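(* The following are equivalent properties of a finitely complete (locally small) category $\mathcal C$: (1) $\mathcal C$ is $\Phi_\vee$-exact; (2) $\mathcal C$ has a strict initial object, and pushouts of pullbacks of pairs of monomorphisms which are stable under pullback; (3) $\mathcal C$ admits finite unions of subobjects which are effective and stable under pullback.
   Context: All categories are ordinary locally small categories ($\mathcal V=\mathbf{Set}$); lex means finite-limit-preserving between finitely complete categories. A class of lex-weights $\Phi$ is a collection of functors $\phi:\mathcal K^{op}\to\mathbf{Set}$ with each $\mathcal K$ small and finitely complete. A $\Phi$-lex-colimit is a weighted colimit $\phi\star D$ with $\phi:\mathcal K^{op}\to\mathbf{Set}$ in $\Phi$ and $D$ a lex functor with domain $\mathcal K$. $\mathcal P\mathcal C$ is the category of small presheaves on $\mathcal C$ (presheaves that are left Kan extensions of their restriction to some small full subcategory); it is finitely complete if $\mathcal C$ is. For finitely complete $\mathcal C$, $\Phi_l\mathcal C$ is the smallest full replete subcategory of $\mathcal P\mathcal C$ containing the representables and closed under finite limits and $\Phi$-lex-colimits, and $W:\mathcal C\to\Phi_l\mathcal C$ is the restricted Yoneda embedding. $\mathcal C$ is $\Phi$-exact if it is finitely complete and $W$ has a finite-limit-preserving left adjoint. $\Phi_\vee$ consists of $\phi_0:\mathcal K_0^{op}\to\mathbf{Set}$, with $\mathcal K_0$ the terminal category and $\phi_0$ the initial object of $[\mathcal K_0^{op},\mathbf{Set}]$, and $\phi_2:\mathcal K_2^{op}\to\mathbf{Set}$, with $\mathcal K_2$ the free category with finite limits generated by a pair of monomorphisms $A\rightarrowtail C\leftarrowtail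 B$ and $\phi_2$ the union in $[\mathcal K_2^{op},\mathbf{Set}]$ of the subobjects $\mathcal K_2(-,A)$ and $\mathcal K_2(-,B)$ of $\mathcal K_2(-,C)$; equivalently $\phi_2$ is the pushout of $\mathcal K_2(-,A)\leftarrowtail\mathcal K_2(-,A\cap B)\rightarrowtail\mathcal K_2(-,B)$. "Pushouts of pullbacks of pairs of monomorphisms" means: for monomorphisms $A\rightarrowtail C\leftarrowtail B$ with pullback $A\cap B$, the pushout of $A\leftarrowtail A\cap B\rightarrowtail B$. Finite unions are effective if, for any $C\in\mathcal C$ and any pair of subobjects $A,B$ of $C$, the pullback square with vertices $A\cap B$, $A$, $B$, $A\cup B$ is also a pushout. An initial object $0$ is strict if every map $X\to 0$ is invertible. *)

theory Defs
  imports "HOL-Library.FuncSet"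
begin

unbundle cardinal_syntax

text \<open>
  The universe of small sets is presented by a type \<open>'u\<close> whose cardinal is uncountable and
  regular: a set is small if its cardinality is less than that of \<open>'u\<close>, and \<^emph>\<open>Set\<close> is the
  category of small subsets of \<open>'u\<close>.  If the cardinal of \<open>'u\<close> is inaccessible, this is, up to
  equivalence, the category of sets in a Grothendieck universe; the strong limit property is not
  needed in what follows and is not required.  The type occurs as an
  argument where it cannot be inferred.
\<close>

definition universe :: "'u itself \<Rightarrow> bool" where
  "universe (U :: 'u itself) \<longleftrightarrow>
     |UNIV :: nat set| <o |UNIV :: 'u set| \<and> regularCard |UNIV :: 'u set|"

definition small :: "'u itself \<Rightarrow> 'x set \<Rightarrow> bool" where
  "small (U :: 'u itself) X \<longleftrightarrow> |X| <o |UNIV :: 'u set|"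


section \<open>Categories\<close>

text \<open>
  Hom-sets are indexed by objects and need not be disjoint, as in enriched category theory, so the
  hom-sets of a locally small category with arbitrarily many objects can literally be objects of
  \<^emph>\<open>Set\<close>.  \<open>Comp C a b c g f\<close> is the composite \<open>g \<circ> f\<close> of \<open>f : a \<rightarrow> b\<close> and \<open>g : b \<rightarrow> c\<close>.  The
  values of \<open>Hom\<close>, \<open>Id\<close> and \<open>Comp\<close> are irrelevant outside the objects and arrows of \<open>C\<close>.
\<close>

record ('o, 'm) cat =
  Obj :: "'o set"
  Hom :: "'o \<Rightarrow> 'o \<Rightarrow> 'm set"
  Id :: "'o \<Rightarrow> 'm"
  Comp :: "'o \<Rightarrow> 'o \<Rightarrow> 'o \<Rightarrow> 'm \<Rightarrow> 'm \<Rightarrow> 'm"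

definition category :: "('o, 'm) cat \<Rightarrow> bool" where
  "category C \<longleftrightarrow>
     (\<forall>a\<in>Obj C. Id C a \<in> Hom C a a) \<and>
     (\<forall>a\<in>Obj C. \<forall>b\<in>Obj C. \<forall>c\<in>Obj C. \<forall>f\<in>Hom C a b. \<forall>g\<in>Hom C b c.
        Comp C a b c g f \<in> Hom C a c) \<and>
     (\<forall>a\<in>Obj C. \<forall>b\<in>Obj C. \<forall>f\<in>Hom C a b.
        Comp C a a b f (Id C a) = f \<and> Comp C a b b (Id C b) f = f) \<and>
     (\<forall>a\<in>Obj C. \<forall>b\<in>Obj C. \<forall>c\<in>Obj C. \<forall>d\<in>Obj C.
        \<forall>f\<in>Hom C a b. \<forall>g\<in>Hom C b c. \<forall>h\<in>Hom C c d.
        Comp C a c d h (Comp C a b c g f) = Comp C a b d (Comp C b c d h g) f)"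

definition locally_small :: "('o, 'u) cat \<Rightarrow> bool" where
  "locally_small C \<longleftrightarrow> category C \<and> (\<forall>a\<in>Obj C. \<forall>b\<in>Obj C. small TYPE('u) (Hom C a b))"

text \<open>Every small category is isomorphic to one whose objects are elements of \<open>'u\<close>.\<close>

definition small_cat :: "('u, 'u) cat \<Rightarrow> bool" where
  "small_cat K \<longleftrightarrow> locally_small K \<and> small TYPE('u) (Obj K)"

definition op :: "('o, 'm) cat \<Rightarrow> ('o, 'm) cat" where
  "op C = \<lparr>Obj = Obj C, Hom = (\<lambda>a b. Hom C b a), Id = Id C,
           Comp = (\<lambda>a b c g f. Comp C c b a f g)\<rparr>"

definition full_subcat :: "('o, 'm) cat \<Rightarrow> 'o set \<Rightarrow> ('o, 'm) cat" where
  "full_subcat C S = C\<lparr>Obj := Obj C \<inter> S\<rparr>"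

definition Set_cat :: "('u set, 'u \<Rightarrow> 'u) cat" where
  "Set_cat = \<lparr>Obj = {X. small TYPE('u) X}, Hom = (\<lambda>X Y. X \<rightarrow>\<^sub>E Y),
              Id = (\<lambda>X. \<lambda>x\<in>X. x), Comp = (\<lambda>X Y Z g f. compose X g f)\<rparr>"

definition is_iso :: "('o, 'm) cat \<Rightarrow> 'o \<Rightarrow> 'o \<Rightarrow> 'm \<Rightarrow> bool" where
  "is_iso C a b f \<longleftrightarrow> f \<in> Hom C a b \<and>
     (\<exists>g\<in>Hom C b a. Comp C a b a g f = Id C a \<and> Comp C b a b f g = Id C b)"

definition is_mono :: "('o, 'm) cat \<Rightarrow> 'o \<Rightarrow> 'o \<Rightarrow> 'm \<Rightarrow> bool" where
  "is_mono C a b f \<longleftrightarrow> f \<in> Hom C a b \<and>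
     (\<forall>x\<in>Obj C. \<forall>g\<in>Hom C x a. \<forall>h\<in>Hom C x a. Comp C x a b f g = Comp C x a b f h \<longrightarrow> g = h)"


section \<open>Functors and natural transformations\<close>

record ('o, 'm, 'p, 'n) func =
  fobj :: "'o \<Rightarrow> 'p"
  farr :: "'o \<Rightarrow> 'o \<Rightarrow> 'm \<Rightarrow> 'n"

definition is_functor :: "('o, 'm) cat \<Rightarrow> ('p, 'n) cat \<Rightarrow> ('o, 'm, 'p, 'n) func \<Rightarrow> bool" where
  "is_functor A B F \<longleftrightarrow>
     (\<forall>a\<in>Obj A. fobj F a \<in> Obj B) \<and>
     (\<forall>a\<in>Obj A. \<forall>b\<in>Obj A. \<forall>f\<in>Hom A a b. farr F a b f \<in> Hom B (fobj F a) (fobj F b)) \<and>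
     (\<forall>a\<in>Obj A. farr F a a (Id A a) = Id B (fobj F a)) \<and>
     (\<forall>a\<in>Obj A. \<forall>b\<in>Obj A. \<forall>c\<in>Obj A. \<forall>f\<in>Hom A a b. \<forall>g\<in>Hom A b c.
        farr F a c (Comp A a b c g f) =
        Comp B (fobj F a) (fobj F b) (fobj F c) (farr F b c g) (farr F a b f))"

definition id_func :: "('o, 'm, 'o, 'm) func" where
  "id_func = \<lparr>fobj = (\<lambda>a. a), farr = (\<lambda>a b f. f)\<rparr>"

definition comp_func ::
  "('p, 'n, 'q, 'l) func \<Rightarrow> ('o, 'm, 'p, 'n) func \<Rightarrow> ('o, 'm, 'q, 'l) func" where
  "comp_func G F = \<lparr>fobj = (\<lambda>a. fobj G (fobj F a)),
                    farr = (\<lambda>a b f. farr G (fobj F a) (fobj F b) (farr F a b f))\<rparr>"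

text \<open>Components are extensional in the object, so that equality is equality of components.\<close>

definition nat_trans :: "('o, 'm) cat \<Rightarrow> ('p, 'n) cat \<Rightarrow> ('o, 'm, 'p, 'n) func \<Rightarrow>
    ('o, 'm, 'p, 'n) func \<Rightarrow> ('o \<Rightarrow> 'n) set" where
  "nat_trans A B F G = {\<tau> \<in> (\<Pi>\<^sub>E a\<in>Obj A. Hom B (fobj F a) (fobj G a)).
     \<forall>a\<in>Obj A. \<forall>b\<in>Obj A. \<forall>f\<in>Hom A a b.
       Comp B (fobj F a) (fobj G a) (fobj G b) (farr G a b f) (\<tau> a) =
       Comp B (fobj F a) (fobj F b) (fobj G b) (\<tau> b) (farr F a b f)}"

definition functor_cat ::
  "('o, 'm) cat \<Rightarrow> ('p, 'n) cat \<Rightarrow> (('o, 'm, 'p, 'n) func, 'o \<Rightarrow> 'n) cat" where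
  "functor_cat A B =
     \<lparr>Obj = {F. is_functor A B F},
      Hom = nat_trans A B,
      Id = (\<lambda>F. \<lambda>a\<in>Obj A. Id B (fobj F a)),
      Comp = (\<lambda>F G H \<sigma> \<tau>. \<lambda>a\<in>Obj A. Comp B (fobj F a) (fobj G a) (fobj H a) (\<sigma> a) (\<tau> a))\<rparr>"

definition adjunction :: "('o, 'm) cat \<Rightarrow> ('p, 'n) cat \<Rightarrow> ('o, 'm, 'p, 'n) func \<Rightarrow>
    ('p, 'n, 'o, 'm) func \<Rightarrow> ('o \<Rightarrow> 'm) \<Rightarrow> ('p \<Rightarrow> 'n) \<Rightarrow> bool" where
  "adjunction A B L R \<eta> \<epsilon> \<longleftrightarrow>
     is_functor A B L \<and> is_functor B A R \<and>
     \<eta> \<in> nat_trans A A id_func (comp_func R L) \<and>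
     \<epsilon> \<in> nat_trans B B (comp_func L R) id_func \<and>
     (\<forall>a\<in>Obj A. let b = fobj L a in
        Comp B b (fobj L (fobj R b)) b (\<epsilon> b) (farr L a (fobj R b) (\<eta> a)) = Id B b) \<and>
     (\<forall>b\<in>Obj B. let a = fobj R b in
        Comp A a (fobj R (fobj L a)) a (farr R (fobj L a) b (\<epsilon> b)) (\<eta> a) = Id A a)"


section \<open>Finite limits\<close>

definition is_cone :: "('j, 'k) cat \<Rightarrow> ('o, 'm) cat \<Rightarrow> ('j, 'k, 'o, 'm) func \<Rightarrow>
    'o \<Rightarrow> ('j \<Rightarrow> 'm) \<Rightarrow> bool" where
  "is_cone J C D v p \<longleftrightarrow> v \<in> Obj C \<and>
     (\<forall>j\<in>Obj J. p j \<in> Hom C v (fobj D j)) \<and>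
     (\<forall>i\<in>Obj J. \<forall>j\<in>Obj J. \<forall>u\<in>Hom J i j.
        Comp C v (fobj D i) (fobj D j) (farr D i j u) (p i) = p j)"

definition is_limit :: "('j, 'k) cat \<Rightarrow> ('o, 'm) cat \<Rightarrow> ('j, 'k, 'o, 'm) func \<Rightarrow>
    'o \<Rightarrow> ('j \<Rightarrow> 'm) \<Rightarrow> bool" where
  "is_limit J C D v p \<longleftrightarrow> is_cone J C D v p \<and>
     (\<forall>w q. is_cone J C D w q \<longrightarrow>
        (\<exists>!h. h \<in> Hom C w v \<and> (\<forall>j\<in>Obj J. Comp C w v (fobj D j) (p j) h = q j)))"

text \<open>Every finite category is isomorphic to one whose objects and arrows are natural numbers.\<close>

definition finite_cat :: "(nat, nat) cat \<Rightarrow> bool" where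
  "finite_cat J \<longleftrightarrow> category J \<and> finite (Obj J) \<and> (\<forall>i\<in>Obj J. \<forall>j\<in>Obj J. finite (Hom J i j))"

definition finitely_complete :: "('o, 'm) cat \<Rightarrow> bool" where
  "finitely_complete C \<longleftrightarrow> category C \<and>
     (\<forall>J D. finite_cat J \<and> is_functor J C D \<longrightarrow> (\<exists>v p. is_limit J C D v p))"

definition preserves_finite_limits ::
  "('o, 'm) cat \<Rightarrow> ('p, 'n) cat \<Rightarrow> ('o, 'm, 'p, 'n) func \<Rightarrow> bool" where
  "preserves_finite_limits A B F \<longleftrightarrow>
     (\<forall>J D v p. finite_cat J \<and> is_functor J A D \<and> is_limit J A D v p \<longrightarrow>
        is_limit J B (comp_func F D) (fobj F v) (\<lambda>j. farr F v (fobj D j) (p j)))"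

text \<open>
  Lex functors are used below only between finitely complete categories; the category of small
  presheaves on a finitely complete category is finitely complete.
\<close>

definition lex_functor :: "('o, 'm) cat \<Rightarrow> ('p, 'n) cat \<Rightarrow> ('o, 'm, 'p, 'n) func \<Rightarrow> bool" where
  "lex_functor A B F \<longleftrightarrow> is_functor A B F \<and> preserves_finite_limits A B F"

definition is_pullback :: "('o, 'm) cat \<Rightarrow> 'o \<Rightarrow> 'o \<Rightarrow> 'o \<Rightarrow> 'o \<Rightarrow> 'm \<Rightarrow> 'm \<Rightarrow> 'm \<Rightarrow> 'm \<Rightarrow> bool" where
  \<comment> \<open>\<open>P\<close>, with \<open>p : P \<rightarrow> A\<close> and \<open>q : P \<rightarrow> B\<close>, is a pullback of \<open>a : A \<rightarrow> c\<close> and \<open>b : B \<rightarrow> c\<close>\<close>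
  "is_pullback C P A B c p q a b \<longleftrightarrow>
     {P, A, B, c} \<subseteq> Obj C \<and> p \<in> Hom C P A \<and> q \<in> Hom C P B \<and> a \<in> Hom C A c \<and> b \<in> Hom C B c \<and>
     Comp C P A c a p = Comp C P B c b q \<and>
     (\<forall>X\<in>Obj C. \<forall>f\<in>Hom C X A. \<forall>g\<in>Hom C X B. Comp C X A c a f = Comp C X B c b g \<longrightarrow>
        (\<exists>!h. h \<in> Hom C X P \<and> Comp C X P A p h = f \<and> Comp C X P B q h = g))"

definition is_pushout :: "('o, 'm) cat \<Rightarrow> 'o \<Rightarrow> 'o \<Rightarrow> 'o \<Rightarrow> 'o \<Rightarrow> 'm \<Rightarrow> 'm \<Rightarrow> 'm \<Rightarrow> 'm \<Rightarrow> bool" where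
  \<comment> \<open>\<open>Q\<close>, with \<open>i : A \<rightarrow> Q\<close> and \<open>j : B \<rightarrow> Q\<close>, is a pushout of \<open>p : P \<rightarrow> A\<close> and \<open>q : P \<rightarrow> B\<close>\<close>
  "is_pushout C P A B Q p q i j \<longleftrightarrow> is_pullback (op C) Q A B P i j p q"


section \<open>Presheaves\<close>

abbreviation presheaves ::
  "('o, 'u) cat \<Rightarrow> (('o, 'u, 'u set, 'u \<Rightarrow> 'u) func, 'o \<Rightarrow> 'u \<Rightarrow> 'u) cat" where
  "presheaves C \<equiv> functor_cat (op C) Set_cat"

definition representable :: "('o, 'u) cat \<Rightarrow> 'o \<Rightarrow> ('o, 'u, 'u set, 'u \<Rightarrow> 'u) func" where
  "representable C c = \<lparr>fobj = (\<lambda>a. Hom C a c),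
                        farr = (\<lambda>b a f. \<lambda>g\<in>Hom C b c. Comp C a b c g f)\<rparr>"

definition yoneda_arr :: "('o, 'u) cat \<Rightarrow> 'o \<Rightarrow> 'o \<Rightarrow> 'u \<Rightarrow> 'o \<Rightarrow> 'u \<Rightarrow> 'u" where
  "yoneda_arr C c d h = (\<lambda>a\<in>Obj C. \<lambda>g\<in>Hom C a c. Comp C a c d h g)"

definition yoneda ::
  "('o, 'u) cat \<Rightarrow> ('o, 'u, ('o, 'u, 'u set, 'u \<Rightarrow> 'u) func, 'o \<Rightarrow> 'u \<Rightarrow> 'u) func" where
  "yoneda C = \<lparr>fobj = representable C, farr = yoneda_arr C\<rparr>"

definition is_left_Kan_extension ::
  "('o, 'm) cat \<Rightarrow> ('p, 'n) cat \<Rightarrow> ('q, 'l) cat \<Rightarrow> ('o, 'm, 'p, 'n) func \<Rightarrow>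
   ('o, 'm, 'q, 'l) func \<Rightarrow> ('p, 'n, 'q, 'l) func \<Rightarrow> ('o \<Rightarrow> 'l) \<Rightarrow> bool" where
  \<comment> \<open>\<open>L : B \<rightarrow> E\<close>, with unit \<open>\<eta> : F \<Rightarrow> L \<circ> J\<close>, is a left Kan extension of \<open>F : A \<rightarrow> E\<close> along
      \<open>J : A \<rightarrow> B\<close>\<close>
  "is_left_Kan_extension A B E J F L \<eta> \<longleftrightarrow>
     is_functor B E L \<and> \<eta> \<in> nat_trans A E F (comp_func L J) \<and>
     (\<forall>G. is_functor B E G \<longrightarrow> (\<forall>\<beta>\<in>nat_trans A E F (comp_func G J).
        \<exists>!\<alpha>. \<alpha> \<in> nat_trans B E L G \<and>
          (\<forall>a\<in>Obj A. Comp E (fobj F a) (fobj L (fobj J a)) (fobj G (fobj J a))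
             (\<alpha> (fobj J a)) (\<eta> a) = \<beta> a)))"

text \<open>
  The inclusion of a full subcategory is \<open>id_func\<close>, and \<open>P\<close> also denotes its own restriction.
\<close>

definition small_presheaf ::
  "('o, 'u) cat \<Rightarrow> ('o, 'u, 'u set, 'u \<Rightarrow> 'u) func \<Rightarrow> bool" where
  "small_presheaf C P \<longleftrightarrow> is_functor (op C) Set_cat P \<and>
     (\<exists>S\<subseteq>Obj C. small TYPE('u) S \<and>
        is_left_Kan_extension (op (full_subcat C S)) (op C) Set_cat id_func P P
          (Id (presheaves (full_subcat C S)) P))"

definition small_presheaves ::
  "('o, 'u) cat \<Rightarrow> (('o, 'u, 'u set, 'u \<Rightarrow> 'u) func, 'o \<Rightarrow> 'u \<Rightarrow> 'u) cat" where
  "small_presheaves C = full_subcat (presheaves C) {P. small_presheaf C P}"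


section \<open>Weighted colimits and exactness\<close>

text \<open>
  A cocone under \<open>D : K \<rightarrow> E\<close> weighted by \<open>\<phi> : K\<^sup>o\<^sup>p \<rightarrow> Set\<close> with vertex \<open>X\<close> is a natural
  transformation \<open>\<phi> \<Rightarrow> E(D -, X)\<close>.  It is written as a family \<open>\<xi> k x : D k \<rightarrow> X\<close>, because \<open>E\<close>
  need not be locally small.
\<close>

definition weighted_cocone :: "('k, 'u) cat \<Rightarrow> ('o, 'm) cat \<Rightarrow>
    ('k, 'u, 'u set, 'u \<Rightarrow> 'u) func \<Rightarrow> ('k, 'u, 'o, 'm) func \<Rightarrow> 'o \<Rightarrow> ('k \<Rightarrow> 'u \<Rightarrow> 'm) \<Rightarrow> bool" where
  "weighted_cocone K E \<phi> D X \<xi> \<longleftrightarrow> X \<in> Obj E \<and>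
     (\<forall>k\<in>Obj K. \<forall>x\<in>fobj \<phi> k. \<xi> k x \<in> Hom E (fobj D k) X) \<and>
     (\<forall>k\<in>Obj K. \<forall>l\<in>Obj K. \<forall>u\<in>Hom K k l. \<forall>x\<in>fobj \<phi> l.
        \<xi> k (farr \<phi> l k u x) = Comp E (fobj D k) (fobj D l) X (\<xi> l x) (farr D k l u))"

definition is_weighted_colimit :: "('k, 'u) cat \<Rightarrow> ('o, 'm) cat \<Rightarrow>
    ('k, 'u, 'u set, 'u \<Rightarrow> 'u) func \<Rightarrow> ('k, 'u, 'o, 'm) func \<Rightarrow> 'o \<Rightarrow> ('k \<Rightarrow> 'u \<Rightarrow> 'm) \<Rightarrow> bool" where
  "is_weighted_colimit K E \<phi> D X \<xi> \<longleftrightarrow> weighted_cocone K E \<phi> D X \<xi> \<and>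
     (\<forall>Y \<zeta>. weighted_cocone K E \<phi> D Y \<zeta> \<longrightarrow>
        (\<exists>!h. h \<in> Hom E X Y \<and>
           (\<forall>k\<in>Obj K. \<forall>x\<in>fobj \<phi> k. Comp E (fobj D k) X Y h (\<xi> k x) = \<zeta> k x)))"

type_synonym 'u weight = "('u, 'u) cat \<times> ('u, 'u, 'u set, 'u \<Rightarrow> 'u) func"

definition lex_weights :: "'u weight set \<Rightarrow> bool" where
  "lex_weights \<Phi> \<longleftrightarrow>
     (\<forall>(K, \<phi>)\<in>\<Phi>. small_cat K \<and> finitely_complete K \<and> is_functor (op K) Set_cat \<phi>)"

definition lex_closed :: "'u weight set \<Rightarrow> ('o, 'u) cat \<Rightarrow>
    ('o, 'u, 'u set, 'u \<Rightarrow> 'u) func set \<Rightarrow> bool" where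
  "lex_closed \<Phi> C S \<longleftrightarrow>
     S \<subseteq> Obj (small_presheaves C) \<and>
     (\<forall>c\<in>Obj C. representable C c \<in> S) \<and>
     (\<forall>P Q \<theta>. P \<in> S \<and> Q \<in> Obj (small_presheaves C) \<and> is_iso (small_presheaves C) P Q \<theta> \<longrightarrow>
        Q \<in> S) \<and>
     (\<forall>J D P p. finite_cat J \<and> is_functor J (small_presheaves C) D \<and> fobj D ` Obj J \<subseteq> S \<and>
        is_limit J (small_presheaves C) D P p \<longrightarrow> P \<in> S) \<and>
     (\<forall>(K, \<phi>)\<in>\<Phi>. \<forall>D P \<xi>. lex_functor K (small_presheaves C) D \<and> fobj D ` Obj K \<subseteq> S \<and>
        is_weighted_colimit K (small_presheaves C) \<phi> D P \<xi> \<longrightarrow> P \<in> S)"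

definition Phi_l :: "'u weight set \<Rightarrow> ('o, 'u) cat \<Rightarrow>
    (('o, 'u, 'u set, 'u \<Rightarrow> 'u) func, 'o \<Rightarrow> 'u \<Rightarrow> 'u) cat" where
  "Phi_l \<Phi> C = full_subcat (small_presheaves C) (\<Inter> {S. lex_closed \<Phi> C S})"

definition lex_exact :: "'u weight set \<Rightarrow> ('o, 'u) cat \<Rightarrow> bool" where
  "lex_exact \<Phi> C \<longleftrightarrow> finitely_complete C \<and>
     (\<exists>L \<eta> \<epsilon>. adjunction (Phi_l \<Phi> C) C L (yoneda C) \<eta> \<epsilon> \<and>
        preserves_finite_limits (Phi_l \<Phi> C) C L)"


section \<open>Initial objects and unions of subobjects\<close>

definition is_initial :: "('o, 'm) cat \<Rightarrow> 'o \<Rightarrow> bool" where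
  "is_initial C z \<longleftrightarrow> z \<in> Obj C \<and> (\<forall>x\<in>Obj C. \<exists>!f. f \<in> Hom C z x)"

definition is_strict_initial :: "('o, 'm) cat \<Rightarrow> 'o \<Rightarrow> bool" where
  "is_strict_initial C z \<longleftrightarrow> is_initial C z \<and> (\<forall>x\<in>Obj C. \<forall>f\<in>Hom C x z. is_iso C x z f)"

definition subobjects :: "('o, 'm) cat \<Rightarrow> 'o \<Rightarrow> ('o \<times> 'm) set" where
  "subobjects C c = {(A, a). A \<in> Obj C \<and> is_mono C A c a}"

definition factors :: "('o, 'm) cat \<Rightarrow> 'o \<Rightarrow> 'o \<times> 'm \<Rightarrow> 'o \<times> 'm \<Rightarrow> bool" where
  "factors C c = (\<lambda>(A, a) (B, b). \<exists>h\<in>Hom C A B. Comp C A B c b h = a)"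

definition is_union :: "('o, 'm) cat \<Rightarrow> 'o \<Rightarrow> ('o \<times> 'm) set \<Rightarrow> 'o \<times> 'm \<Rightarrow> bool" where
  "is_union C c T U \<longleftrightarrow> T \<subseteq> subobjects C c \<and> U \<in> subobjects C c \<and>
     (\<forall>A\<in>T. factors C c A U) \<and>
     (\<forall>V\<in>subobjects C c. (\<forall>A\<in>T. factors C c A V) \<longrightarrow> factors C c U V)"


section \<open>The class of weights for finite unions\<close>

definition is_terminal_cat :: "('o, 'm) cat \<Rightarrow> bool" where
  "is_terminal_cat K \<longleftrightarrow> category K \<and> (\<exists>x. Obj K = {x} \<and> Hom K x x = {Id K x})"

text \<open>
  A cospan is a tuple \<open>(A, B, c, a, b)\<close> with \<open>a : A \<rightarrow> c\<close> and \<open>b : B \<rightarrow> c\<close>; its arrows are natural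
  transformations of diagrams.
\<close>

type_synonym ('o, 'm) cospan = "'o \<times> 'o \<times> 'o \<times> 'm \<times> 'm"

definition mono_cospans :: "('o, 'm) cat \<Rightarrow> (('o, 'm) cospan, 'm \<times> 'm \<times> 'm) cat" where
  "mono_cospans C =
     \<lparr>Obj = {(A, B, c, a, b). {A, B, c} \<subseteq> Obj C \<and> is_mono C A c a \<and> is_mono C B c b},
      Hom = (\<lambda>(A, B, c, a, b) (A', B', c', a', b').
        {(r, s, t). r \<in> Hom C A A' \<and> s \<in> Hom C B B' \<and> t \<in> Hom C c c' \<and>
           Comp C A A' c' a' r = Comp C A c c' t a \<and>
           Comp C B B' c' b' s = Comp C B c c' t b}),
      Id = (\<lambda>(A, B, c, a, b). (Id C A, Id C B, Id C c)),
      Comp = (\<lambda>(A, B, c, a, b) (A', B', c', a', b') (A'', B'', c'', a'', b'')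
                (r', s', t') (r, s, t).
        (Comp C A A' A'' r' r, Comp C B B' B'' s' s, Comp C c c' c'' t' t))\<rparr>"

definition eval_cospan :: "('o, 'm) cospan \<Rightarrow>
    (('o, 'm, 'p, 'n) func, 'o \<Rightarrow> 'n, ('p, 'n) cospan, 'n \<times> 'n \<times> 'n) func" where
  "eval_cospan = (\<lambda>(A, B, c, a, b).
     \<lparr>fobj = (\<lambda>F. (fobj F A, fobj F B, fobj F c, farr F A c a, farr F B c b)),
      farr = (\<lambda>F G \<tau>. (\<tau> A, \<tau> B, \<tau> c))\<rparr>)"

definition is_equivalence :: "('o, 'm) cat \<Rightarrow> ('p, 'n) cat \<Rightarrow> ('o, 'm, 'p, 'n) func \<Rightarrow> bool" where
  "is_equivalence A B F \<longleftrightarrow> is_functor A B F \<and>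
     (\<forall>x\<in>Obj A. \<forall>y\<in>Obj A. bij_betw (farr F x y) (Hom A x y) (Hom B (fobj F x) (fobj F y))) \<and>
     (\<forall>z\<in>Obj B. \<exists>x\<in>Obj A. \<exists>f. is_iso B (fobj F x) z f)"

text \<open>
  The small finitely complete category \<open>K\<close> is free on the pair of monomorphisms \<open>X\<close>: evaluation at
  \<open>X\<close> is an equivalence from lex functors \<open>K \<rightarrow> E\<close> to pairs of monomorphisms in \<open>E\<close>, for
  all small finitely complete \<open>E\<close>.
\<close>

definition is_free_lex_on_monos :: "('u, 'u) cat \<Rightarrow> ('u, 'u) cospan \<Rightarrow> bool" where
  "is_free_lex_on_monos K X \<longleftrightarrow>
     small_cat K \<and> finitely_complete K \<and> X \<in> Obj (mono_cospans K) \<and>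
     (\<forall>E :: ('u, 'u) cat. small_cat E \<and> finitely_complete E \<longrightarrow>
        is_equivalence (full_subcat (functor_cat K E) {F. lex_functor K E F}) (mono_cospans E)
          (eval_cospan X))"

text \<open>
  The indexing categories and the weights are determined up to equivalence only, and all choices are
  admitted; this does not affect the resulting weighted colimits.
\<close>

definition Phi_empty :: "'u weight set" where
  "Phi_empty = {(K, \<phi>). is_terminal_cat K \<and> is_initial (presheaves K) \<phi>}"

definition Phi_binary :: "'u weight set" where
  "Phi_binary = {(K, \<phi>). \<exists>A B c a b \<iota>. is_free_lex_on_monos K (A, B, c, a, b) \<and>
     is_union (presheaves K) (representable K c)
       {(representable K A, yoneda_arr K A c a), (representable K B, yoneda_arr K B c b)} (\<phi>, \<iota>)}"

definition Phi_vee :: "'u weight set" where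
  "Phi_vee = Phi_empty \<union> Phi_binary"

lemma small_singleton:
  assumes "universe (U :: 'u itself)"
  shows "small U {x}"
proof -
  have "|{x}| <o |UNIV :: nat set|"
    by (rule finite_ordLess_infinite) (auto simp: card_of_well_order_on Field_card_of)
  then show ?thesis
    using assms unfolding universe_def small_def by (blast intro: ordLess_transitive)
qed

lemma finitely_complete_terminal_cat:
  assumes "is_terminal_cat K"
  shows "finitely_complete K"
proof -
  obtain x where x: "category K" "Obj K = {x}" "Hom K x x = {Id K x}"
    using assms unfolding is_terminal_cat_def by blast
  then have c: "Comp K x x x (Id K x) (Id K x) = Id K x"
    unfolding category_def by auto
  have "is_limit J K D x (\<lambda>_. Id K x)" if "is_functor J K D" for J :: "(nat, nat) cat" and D
  proof -
    have o: "fobj D j = x" if "j \<in> Obj J" for j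
      using \<open>is_functor J K D\<close> that x unfolding is_functor_def by auto
    have a: "farr D i j u = Id K x" if "i \<in> Obj J" "j \<in> Obj J" "u \<in> Hom J i j" for i j u
    proof -
      have "farr D i j u \<in> Hom K (fobj D i) (fobj D j)"
        using \<open>is_functor J K D\<close> that unfolding is_functor_def by blast
      then show ?thesis using o that x by simp
    qed
    show ?thesis
      using o a x c unfolding is_limit_def is_cone_def by (auto cong: conj_cong)
  qed
  then show ?thesis using x unfolding finitely_complete_def by blast
qed

lemma lex_weights_Phi_vee:
  assumes "universe TYPE('u)"
  shows "lex_weights (Phi_vee :: 'u weight set)"
proof -
  have "small_cat K" if "is_terminal_cat K" for K :: "('u, 'u) cat"
    using that small_singleton[OF assms]
    unfolding is_terminal_cat_def small_cat_def locally_small_def by auto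
  then show ?thesis
    unfolding lex_weights_def Phi_vee_def Phi_empty_def Phi_binary_def
    by (auto simp: finitely_complete_terminal_cat is_initial_def is_union_def subobjects_def
        is_free_lex_on_monos_def functor_cat_def)
qed


section \<open>Stability and effectiveness\<close>

text \<open>
  The pushout square is stable if pulling it back along any \<open>f : X \<rightarrow> Q\<close>, to a square with
  vertices \<open>P'\<close>, \<open>A'\<close>, \<open>B'\<close>, \<open>X\<close>, gives a pushout again.  Here \<open>pP\<close>, \<open>pA\<close>, \<open>pB\<close> are the projections
  to \<open>P\<close>, \<open>A\<close>, \<open>B\<close>, the projections to \<open>X\<close> are \<open>d\<close>, \<open>i'\<close>, \<open>j'\<close>, and \<open>p'\<close>, \<open>q'\<close> are the induced arrows.
\<close>

definition is_stable_pushout ::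
  "('o, 'm) cat \<Rightarrow> 'o \<Rightarrow> 'o \<Rightarrow> 'o \<Rightarrow> 'o \<Rightarrow> 'm \<Rightarrow> 'm \<Rightarrow> 'm \<Rightarrow> 'm \<Rightarrow> bool" where
  "is_stable_pushout C P A B Q p q i j \<longleftrightarrow> is_pushout C P A B Q p q i j \<and>
     (\<forall>X\<in>Obj C. \<forall>f\<in>Hom C X Q. \<forall>P' A' B' pP pA pB d i' j' p' q'.
        is_pullback C A' A X Q pA i' i f \<and>
        is_pullback C B' B X Q pB j' j f \<and>
        is_pullback C P' P X Q pP d (Comp C P A Q i p) f \<and>
        p' \<in> Hom C P' A' \<and> Comp C P' A' A pA p' = Comp C P' P A p pP \<and> Comp C P' A' X i' p' = d \<and>
        q' \<in> Hom C P' B' \<and> Comp C P' B' B pB q' = Comp C P' P B q pP \<and> Comp C P' B' X j' q' = d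
        \<longrightarrow> is_pushout C P' A' B' X p' q' i' j')"

definition has_stable_pushouts_of_pullbacks_of_monos :: "('o, 'm) cat \<Rightarrow> bool" where
  "has_stable_pushouts_of_pullbacks_of_monos C \<longleftrightarrow>
     (\<forall>A\<in>Obj C. \<forall>B\<in>Obj C. \<forall>c\<in>Obj C. \<forall>a b P p q.
        is_mono C A c a \<and> is_mono C B c b \<and> is_pullback C P A B c p q a b \<longrightarrow>
        (\<exists>Q i j. is_stable_pushout C P A B Q p q i j))"

definition has_finite_unions :: "('o, 'm) cat \<Rightarrow> bool" where
  "has_finite_unions C \<longleftrightarrow>
     (\<forall>c\<in>Obj C. \<forall>T. finite T \<and> T \<subseteq> subobjects C c \<longrightarrow> (\<exists>U. is_union C c T U))"

definition finite_unions_effective :: "('o, 'm) cat \<Rightarrow> bool" where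
  "finite_unions_effective C \<longleftrightarrow>
     (\<forall>c\<in>Obj C. \<forall>A a B b U u P p q i j.
        is_union C c {(A, a), (B, b)} (U, u) \<and> is_pullback C P A B c p q a b \<and>
        i \<in> Hom C A U \<and> Comp C A U c u i = a \<and>
        j \<in> Hom C B U \<and> Comp C B U c u j = b \<longrightarrow>
        is_pushout C P A B U p q i j)"

definition is_inverse_image :: "('o, 'm) cat \<Rightarrow> 'o \<Rightarrow> 'o \<Rightarrow> 'm \<Rightarrow> 'o \<times> 'm \<Rightarrow> 'o \<times> 'm \<Rightarrow> bool" where
  \<comment> \<open>\<open>A'\<close> is the inverse image along \<open>f : X \<rightarrow> c\<close> of the subobject \<open>A\<close> of \<open>c\<close>\<close>
  "is_inverse_image C X c f A A' \<longleftrightarrow>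
     (\<exists>h. is_pullback C (fst A') (fst A) X c h (snd A') (snd A) f)"

text \<open>The map \<open>\<rho>\<close> chooses an inverse image of each of the given subobjects.\<close>

definition finite_unions_stable :: "('o, 'm) cat \<Rightarrow> bool" where
  "finite_unions_stable C \<longleftrightarrow>
     (\<forall>c\<in>Obj C. \<forall>X\<in>Obj C. \<forall>f\<in>Hom C X c. \<forall>T U U' \<rho>.
        finite T \<and> is_union C c T U \<and> is_inverse_image C X c f U U' \<and>
        (\<forall>A\<in>T. is_inverse_image C X c f A (\<rho> A)) \<longrightarrow>
        is_union C X (\<rho> ` T) U')"

end

theory Submission
  imports Defs "HOL-Library.Countable"
begin

text \<open>
  If unions are effective and stable, the union of two subobjects is the stable pushout of their
  intersection, and the least subobject of the terminal object is a strict initial object.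
  Conversely a stable pushout of the intersection of two subobjects is a subobject and hence
  their union.

  Suppose that stable pushouts and a strict initial object exist.  The empty coverings of initial
  objects and the coverings given by stable pushouts generate a topology, for which representables
  are sheaves.  The small presheaves with a locally bijective map to a representable contain
  the representables and are closed under finite limits and under \<open>\<Phi>\<^sub>\<or>\<close>-lex-colimits, and the representing
  objects give a left adjoint of the Yoneda embedding that preserves finite limits.

  Suppose conversely that the Yoneda embedding into \<open>\<Phi>\<^sub>l C\<close> has a left adjoint \<open>L\<close> that preserves
  finite limits.  As \<open>\<Phi>\<^sub>l C\<close> contains the empty presheaf and the unions of two representable subobjects,
  \<open>L\<close> sends them to an initial object and to pushouts.  These are stable: \<open>L\<close> inverts the unit at
  such a presheaf, hence also the pullback of the unit along a map of representables, which is
  the inclusion of the empty presheaf or a union again.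
\<close>

section \<open>Categories\<close>

text \<open>\<open>Phi_l\<close> is an intersection of closed classes and is never computed.
  Exactness only needs some closed class on which the reflection exists, and the small presheaves
  whose sheafification is representable are a convenient one. Sheafification itself is never formed,
  which matters because C may be large: representables are sheaves, so a locally bijective map to
  one is already a universal arrow. Coverings are finite at every stage, so an inductive predicate
  replaces the topology, and the sheaf arguments are inductions on it.

  Conversely it is enough that the empty presheaf and the unions of two representable subobjects lie
  in every closed class. This needs an actual weight in \<open>Phi_binary\<close> together with a
  lex diagram that produces the given pair of monomorphisms. Freeness is defined with respect to
  small categories only, whereas the diagram has to come from C. Therefore one free category is
  constructed explicitly, out of finite structures, and its universal property is proved with
  respect to finitely complete categories of any size.\<close>

locale cat =
  fixes C :: "('o, 'm) cat"
  assumes category: "category C"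
begin

lemma id_in [simp]: "a \<in> Obj C \<Longrightarrow> Id C a \<in> Hom C a a"
  using category unfolding category_def by blast

lemma comp_in [simp]:
  "\<lbrakk>f \<in> Hom C a b; g \<in> Hom C b c; a \<in> Obj C; b \<in> Obj C; c \<in> Obj C\<rbrakk> \<Longrightarrow> Comp C a b c g f \<in> Hom C a c"
  using category unfolding category_def by blast

lemma id_right [simp]: "\<lbrakk>f \<in> Hom C a b; a \<in> Obj C; b \<in> Obj C\<rbrakk> \<Longrightarrow> Comp C a a b f (Id C a) = f"
  using category unfolding category_def by blast

lemma id_left [simp]: "\<lbrakk>f \<in> Hom C a b; a \<in> Obj C; b \<in> Obj C\<rbrakk> \<Longrightarrow> Comp C a b b (Id C b) f = f"
  using category unfolding category_def by blast

lemma assoc: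
  "\<lbrakk>f \<in> Hom C a b; g \<in> Hom C b c; h \<in> Hom C c d; a \<in> Obj C; b \<in> Obj C; c \<in> Obj C; d \<in> Obj C\<rbrakk> \<Longrightarrow>
    Comp C a b d (Comp C b c d h g) f = Comp C a c d h (Comp C a b c g f)"
  using category unfolding category_def by metis

text \<open>A commuting square precomposed with \<open>x\<close> and already rebracketed: the form
  in which most diagram chases below use a commutation.\<close>

lemma slide:
  "\<lbrakk>Comp C a b d g f = Comp C a c d k h; x \<in> Hom C w a; f \<in> Hom C a b; g \<in> Hom C b d;
    h \<in> Hom C a c; k \<in> Hom C c d;
    w \<in> Obj C; a \<in> Obj C; b \<in> Obj C; c \<in> Obj C; d \<in> Obj C\<rbrakk> \<Longrightarrow>
    Comp C w b d g (Comp C w a b f x) = Comp C w c d k (Comp C w a c h x)"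
  by (metis assoc)

lemma slide1:
  "\<lbrakk>Comp C a b d g f = k; x \<in> Hom C w a; f \<in> Hom C a b; g \<in> Hom C b d;
    w \<in> Obj C; a \<in> Obj C; b \<in> Obj C; d \<in> Obj C\<rbrakk> \<Longrightarrow>
    Comp C w b d g (Comp C w a b f x) = Comp C w a d k x"
  by (metis assoc)

end

lemma category_op: "category C \<Longrightarrow> category (op C)"
  unfolding category_def op_def by simp

lemma op_simps [simp]:
  "Obj (op C) = Obj C" "Hom (op C) a b = Hom C b a" "Id (op C) = Id C"
  "Comp (op C) a b c g f = Comp C c b a f g"
  by (simp_all add: op_def)

lemma full_subcat_simps [simp]:
  "Obj (full_subcat C S) = Obj C \<inter> S" "Hom (full_subcat C S) = Hom C"
  "Id (full_subcat C S) = Id C" "Comp (full_subcat C S) = Comp C"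
  by (simp_all add: full_subcat_def)

text \<open>Lets \<open>Phi_l\<close>, a full subcategory of the small presheaves, be treated as a
  full subcategory of all presheaves.\<close>

lemma full_subcat_full_subcat: "full_subcat (full_subcat C S) T = full_subcat C (S \<inter> T)"
  by (simp add: full_subcat_def Int_assoc)

lemma category_full_subcat: "category C \<Longrightarrow> category (full_subcat C S)"
  unfolding category_def by simp

section \<open>Monomorphisms and pullback squares\<close>

lemma is_monoD:
  "\<lbrakk>is_mono C a b f; Comp C x a b f g = Comp C x a b f h; g \<in> Hom C x a; h \<in> Hom C x a; x \<in> Obj C\<rbrakk>
    \<Longrightarrow> g = h"
  unfolding is_mono_def by blast

lemma is_mono_in: "is_mono C a b f \<Longrightarrow> f \<in> Hom C a b"
  unfolding is_mono_def by blast

lemma is_pullbackD: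
  assumes "is_pullback C P A B c p q a b"
  shows "P \<in> Obj C" "A \<in> Obj C" "B \<in> Obj C" "c \<in> Obj C" "p \<in> Hom C P A" "q \<in> Hom C P B"
    "a \<in> Hom C A c" "b \<in> Hom C B c" "Comp C P A c a p = Comp C P B c b q"
  using assms unfolding is_pullback_def by auto

lemma is_pullback_lift:
  assumes "is_pullback C P A B c p q a b" "X \<in> Obj C" "f \<in> Hom C X A" "g \<in> Hom C X B"
    "Comp C X A c a f = Comp C X B c b g"
  obtains h where "h \<in> Hom C X P" "Comp C X P A p h = f" "Comp C X P B q h = g"
  using assms unfolding is_pullback_def by blast

lemma is_pullback_sym:
  "is_pullback C P A B c p q a b \<Longrightarrow> is_pullback C P B A c q p b a"
  unfolding is_pullback_def by (safe; simp; metis)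

context cat
begin

lemma is_pullback_unique:
  assumes P: "is_pullback C P A B c p q a b" and X: "X \<in> Obj C" "h \<in> Hom C X P" "k \<in> Hom C X P"
    and e: "Comp C X P A p h = Comp C X P A p k" "Comp C X P B q h = Comp C X P B q k"
  shows "h = k"
proof -
  note [simp] = is_pullbackD(1-8)[OF P]
  have "Comp C X A c a (Comp C X P A p h) = Comp C X B c b (Comp C X P B q h)"
    using X by (intro slide is_pullbackD[OF P])
  then have "\<exists>!k. k \<in> Hom C X P \<and> Comp C X P A p k = Comp C X P A p h \<and> Comp C X P B q k = Comp C X P B q h"
    using P X unfolding is_pullback_def by (metis comp_in insert_subset)
  then show ?thesis using e X by metis
qed

lemma is_pullbackI:
  assumes "{P, A, B, c} \<subseteq> Obj C" "p \<in> Hom C P A" "q \<in> Hom C P B" "a \<in> Hom C A c" "b \<in> Hom C B c"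
    "Comp C P A c a p = Comp C P B c b q"
    and ex: "\<And>X f g. \<lbrakk>X \<in> Obj C; f \<in> Hom C X A; g \<in> Hom C X B; Comp C X A c a f = Comp C X B c b g\<rbrakk> \<Longrightarrow>
       \<exists>h\<in>Hom C X P. Comp C X P A p h = f \<and> Comp C X P B q h = g"
    and un: "\<And>X h k. \<lbrakk>X \<in> Obj C; h \<in> Hom C X P; k \<in> Hom C X P; Comp C X P A p h = Comp C X P A p k;
       Comp C X P B q h = Comp C X P B q k\<rbrakk> \<Longrightarrow> h = k"
  shows "is_pullback C P A B c p q a b"
  unfolding is_pullback_def using assms by (fast intro: ex un)

lemma is_mono_id: "a \<in> Obj C \<Longrightarrow> is_mono C a a (Id C a)"
  unfolding is_mono_def by simp

lemma is_mono_comp: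
  assumes "is_mono C A B f" "is_mono C B D g" "A \<in> Obj C" "B \<in> Obj C" "D \<in> Obj C"
  shows "is_mono C A D (Comp C A B D g f)"
  unfolding is_mono_def
proof (intro conjI ballI impI)
  note [simp] = is_mono_in[OF assms(1)] is_mono_in[OF assms(2)] assms(3-5)
  show "Comp C A B D g f \<in> Hom C A D" by simp
  fix x h k assume h: "x \<in> Obj C" "h \<in> Hom C x A" "k \<in> Hom C x A"
    "Comp C x A D (Comp C A B D g f) h = Comp C x A D (Comp C A B D g f) k"
  then have "Comp C x B D g (Comp C x A B f h) = Comp C x B D g (Comp C x A B f k)"
    by (simp add: assoc)
  then have "Comp C x A B f h = Comp C x A B f k"
    using h by - (rule is_monoD[OF assms(2)], auto)
  then show "h = k" using h by - (rule is_monoD[OF assms(1)], auto)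
qed

lemma is_mono_cancel:
  assumes "is_mono C A D (Comp C A B D g f)" "f \<in> Hom C A B" "g \<in> Hom C B D"
    "A \<in> Obj C" "B \<in> Obj C" "D \<in> Obj C"
  shows "is_mono C A B f"
  unfolding is_mono_def
proof (intro conjI ballI impI)
  fix x h k assume h: "x \<in> Obj C" "h \<in> Hom C x A" "k \<in> Hom C x A"
    "Comp C x A B f h = Comp C x A B f k"
  then have "Comp C x A D (Comp C A B D g f) h = Comp C x A D (Comp C A B D g f) k"
    using assms by (simp add: assoc)
  then show "h = k" using h by - (rule is_monoD[OF assms(1)], auto)
qed (use assms in auto)

lemma is_pullback_mono:
  assumes P: "is_pullback C P A B c p q a b" and a: "is_mono C A c a"
  shows "is_mono C P B q"
  unfolding is_mono_def
proof (intro conjI ballI impI)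
  note [simp] = is_pullbackD(1-8)[OF P]
  fix x h k assume h: "x \<in> Obj C" "h \<in> Hom C x P" "k \<in> Hom C x P" "Comp C x P B q h = Comp C x P B q k"
  have "Comp C x A c a (Comp C x P A p h) = Comp C x B c b (Comp C x P B q h)"
    "Comp C x A c a (Comp C x P A p k) = Comp C x B c b (Comp C x P B q k)"
    using slide[OF is_pullbackD(9)[OF P], of h x] slide[OF is_pullbackD(9)[OF P], of k x] h by simp_all
  then have "Comp C x P A p h = Comp C x P A p k"
    using h by - (rule is_monoD[OF a], auto)
  then show "h = k" using h by - (rule is_pullback_unique[OF P], auto)
qed (use is_pullbackD[OF P] in auto)

lemma is_pullback_id:
  assumes "a \<in> Hom C A c" "A \<in> Obj C" "c \<in> Obj C"
  shows "is_pullback C A A c c (Id C A) a a (Id C c)"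
  using assms by (intro is_pullbackI) auto

text \<open>A cone over \<open>i\<close>, \<open>j\<close> becomes a cone over their composites with
  \<open>u\<close>, so the universal property is inherited once the square commutes already in
  \<open>U\<close>.\<close>

lemma is_pullback_cancel:
  assumes P: "is_pullback C P A B c p q (Comp C A U c u i) (Comp C B U c u j)"
    and U: "U \<in> Obj C" "u \<in> Hom C U c" "i \<in> Hom C A U" "j \<in> Hom C B U"
    and e: "Comp C P A U i p = Comp C P B U j q"
  shows "is_pullback C P A B U p q i j"
proof (rule is_pullbackI)
  note [simp] = is_pullbackD(1-8)[OF P] U
  show "{P, A, B, U} \<subseteq> Obj C" "p \<in> Hom C P A" "q \<in> Hom C P B" "i \<in> Hom C A U" "j \<in> Hom C B U"
    "Comp C P A U i p = Comp C P B U j q" by (simp_all add: e)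
  fix X f g assume X: "X \<in> Obj C" "f \<in> Hom C X A" "g \<in> Hom C X B" "Comp C X A U i f = Comp C X B U j g"
  then have "Comp C X A c (Comp C A U c u i) f = Comp C X B c (Comp C B U c u j) g"
    by (simp add: assoc)
  then show "\<exists>h\<in>Hom C X P. Comp C X P A p h = f \<and> Comp C X P B q h = g"
    using is_pullback_lift[OF P] X by metis
qed (rule is_pullback_unique[OF P])

lemma is_pullback_paste:
  assumes A': "is_pullback C A' A X Q pA i' i f" and A'': "is_pullback C A'' A' X' X qA i'' i' f'"
  shows "is_pullback C A'' A X' Q (Comp C A'' A' A pA qA) i'' i (Comp C X' X Q f f')"
proof (rule is_pullbackI)
  note [simp] = is_pullbackD(1-8)[OF A'] is_pullbackD(1-8)[OF A'']
  show "Comp C A'' A Q i (Comp C A'' A' A pA qA) = Comp C A'' X' Q (Comp C X' X Q f f') i''"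
    using slide[OF is_pullbackD(9)[OF A'], of qA A''] is_pullbackD(9)[OF A''] by (simp add: assoc)
  fix W g h assume W [simp]: "W \<in> Obj C" "g \<in> Hom C W A" "h \<in> Hom C W X'" and e: "Comp C W A Q i g = Comp C W X' Q (Comp C X' X Q f f') h"
  have "Comp C W A Q i g = Comp C W X Q f (Comp C W X' X f' h)" using e by (simp add: assoc)
  then obtain k where k: "k \<in> Hom C W A'" "Comp C W A' A pA k = g" "Comp C W A' X i' k = Comp C W X' X f' h"
    by (rule is_pullback_lift[OF A', rotated 3]) auto
  obtain l where l: "l \<in> Hom C W A''" "Comp C W A'' A' qA l = k" "Comp C W A'' X' i'' l = h"
    by (rule is_pullback_lift[OF A'' W(1) k(1) W(3) k(3)])
  then show "\<exists>l\<in>Hom C W A''. Comp C W A'' A (Comp C A'' A' A pA qA) l = g \<and> Comp C W A'' X' i'' l = h"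
    using k by (intro bexI[of _ l]) (simp_all add: assoc)
next
  note [simp] = is_pullbackD(1-8)[OF A'] is_pullbackD(1-8)[OF A'']
  fix W h k assume W [simp]: "W \<in> Obj C" "h \<in> Hom C W A''" "k \<in> Hom C W A''"
    and e: "Comp C W A'' A (Comp C A'' A' A pA qA) h = Comp C W A'' A (Comp C A'' A' A pA qA) k" "Comp C W A'' X' i'' h = Comp C W A'' X' i'' k"
  have "Comp C W A'' A' qA h = Comp C W A'' A' qA k"
  proof (rule is_pullback_unique[OF A' W(1)])
    show "Comp C W A' A pA (Comp C W A'' A' qA h) = Comp C W A' A pA (Comp C W A'' A' qA k)" using e(1) by (simp add: assoc)
    show "Comp C W A' X i' (Comp C W A'' A' qA h) = Comp C W A' X i' (Comp C W A'' A' qA k)"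
      using slide[OF is_pullbackD(9)[OF A''], of h W] slide[OF is_pullbackD(9)[OF A''], of k W] e(2) by simp
  qed simp_all
  then show "h = k" using is_pullback_unique[OF A'' W _ e(2)] by blast
qed (use is_pullbackD[OF A'] is_pullbackD[OF A''] in auto)

text \<open>Base change preserves pullback squares: arrows to \<open>A'\<close> and
  \<open>B'\<close> that agree in \<open>X\<close> give one to \<open>P\<close> and one to
  \<open>X\<close>, hence one to \<open>P'\<close>. Thus the square that occurs in the definition of
  a stable pushout is again an intersection when the original one is.\<close>

lemma is_pullback_cube:
  assumes P: "is_pullback C P A B Q p q i j"
    and A': "is_pullback C A' A X Q pA i' i f"
    and B': "is_pullback C B' B X Q pB j' j f"
    and P': "is_pullback C P' P X Q pP d (Comp C P A Q i p) f"
    and p': "p' \<in> Hom C P' A'" "Comp C P' A' A pA p' = Comp C P' P A p pP" "Comp C P' A' X i' p' = d"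
    and q': "q' \<in> Hom C P' B'" "Comp C P' B' B pB q' = Comp C P' P B q pP" "Comp C P' B' X j' q' = d"
  shows "is_pullback C P' A' B' X p' q' i' j'"
proof (rule is_pullbackI)
  note [simp] = is_pullbackD(1-8)[OF P] is_pullbackD(1-8)[OF A'] is_pullbackD(1-8)[OF B']
    is_pullbackD(1-8)[OF P'] p'(1) q'(1)
  show "{P', A', B', X} \<subseteq> Obj C" "p' \<in> Hom C P' A'" "q' \<in> Hom C P' B'" "i' \<in> Hom C A' X" "j' \<in> Hom C B' X"
    "Comp C P' A' X i' p' = Comp C P' B' X j' q'" by (simp_all add: p' q')
  fix w s t assume w: "w \<in> Obj C" "s \<in> Hom C w A'" "t \<in> Hom C w B'" "Comp C w A' X i' s = Comp C w B' X j' t"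
  have 1: "Comp C w A Q i (Comp C w A' A pA s) = Comp C w X Q f (Comp C w A' X i' s)"
    by (rule slide[OF is_pullbackD(9)[OF A']]) (use w in auto)
  have 2: "Comp C w B Q j (Comp C w B' B pB t) = Comp C w X Q f (Comp C w B' X j' t)"
    by (rule slide[OF is_pullbackD(9)[OF B']]) (use w in auto)
  have "Comp C w A Q i (Comp C w A' A pA s) = Comp C w B Q j (Comp C w B' B pB t)"
    using 1 2 w(4) by simp
  then obtain h where h: "h \<in> Hom C w P" "Comp C w P A p h = Comp C w A' A pA s" "Comp C w P B q h = Comp C w B' B pB t"
    using is_pullback_lift[OF P] w by (metis comp_in is_pullbackD(1-3)[OF A'] is_pullbackD(1-3)[OF B'] is_pullbackD(5)[OF A'] is_pullbackD(5)[OF B'])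
  have "Comp C w P Q (Comp C P A Q i p) h = Comp C w X Q f (Comp C w A' X i' s)"
    using h w 1 by (simp add: assoc)
  then obtain k where k: "k \<in> Hom C w P'" "Comp C w P' P pP k = h" "Comp C w P' X d k = Comp C w A' X i' s"
    by (rule is_pullback_lift[OF P' w(1) h(1), rotated]) (use w in auto)
  have "Comp C w P' A' p' k = s"
  proof (rule is_pullback_unique[OF A' w(1)])
    show "Comp C w A' A pA (Comp C w P' A' p' k) = Comp C w A' A pA s"
      using slide[OF p'(2), of k w] k h w by simp
    show "Comp C w A' X i' (Comp C w P' A' p' k) = Comp C w A' X i' s"
      using slide1[OF p'(3), of k w] k h w by simp
  qed (use w k in auto)
  moreover have "Comp C w P' B' q' k = t"
  proof (rule is_pullback_unique[OF B' w(1)])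
    show "Comp C w B' B pB (Comp C w P' B' q' k) = Comp C w B' B pB t"
      using slide[OF q'(2), of k w] k h w by simp
    show "Comp C w B' X j' (Comp C w P' B' q' k) = Comp C w B' X j' t"
      using slide1[OF q'(3), of k w] k h w by simp
  qed (use w k in auto)
  ultimately show "\<exists>h\<in>Hom C w P'. Comp C w P' A' p' h = s \<and> Comp C w P' B' q' h = t" using k by blast
next
  note [simp] = is_pullbackD(1-8)[OF P] is_pullbackD(1-8)[OF A'] is_pullbackD(1-8)[OF B']
    is_pullbackD(1-8)[OF P'] p'(1) q'(1)
  fix w h k assume w: "w \<in> Obj C" "h \<in> Hom C w P'" "k \<in> Hom C w P'" and
    e: "Comp C w P' A' p' h = Comp C w P' A' p' k" "Comp C w P' B' q' h = Comp C w P' B' q' k"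
  have "Comp C w P' P pP h = Comp C w P' P pP k"
  proof (rule is_pullback_unique[OF P w(1)])
    show "Comp C w P A p (Comp C w P' P pP h) = Comp C w P A p (Comp C w P' P pP k)"
      using slide[OF p'(2), of h w] slide[OF p'(2), of k w] w e by simp
    show "Comp C w P B q (Comp C w P' P pP h) = Comp C w P B q (Comp C w P' P pP k)"
      using slide[OF q'(2), of h w] slide[OF q'(2), of k w] w e by simp
  qed (use w in auto)
  moreover have "Comp C w P' X d h = Comp C w P' X d k"
    using slide1[OF p'(3), of h w] slide1[OF p'(3), of k w] w e by simp
  ultimately show "h = k" using w by - (rule is_pullback_unique[OF P'], auto)
qed

end

section \<open>Pushouts and stable pushouts\<close>

lemma is_pushout_iff:
  "is_pushout C P A B Q p q i j \<longleftrightarrow>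
     {P, A, B, Q} \<subseteq> Obj C \<and> p \<in> Hom C P A \<and> q \<in> Hom C P B \<and> i \<in> Hom C A Q \<and> j \<in> Hom C B Q \<and>
     Comp C P A Q i p = Comp C P B Q j q \<and>
     (\<forall>X\<in>Obj C. \<forall>f\<in>Hom C A X. \<forall>g\<in>Hom C B X. Comp C P A X f p = Comp C P B X g q \<longrightarrow>
        (\<exists>!h. h \<in> Hom C Q X \<and> Comp C A Q X h i = f \<and> Comp C B Q X h j = g))"
  unfolding is_pushout_def is_pullback_def by auto

lemma is_pushoutD:
  assumes "is_pushout C P A B Q p q i j"
  shows "P \<in> Obj C" "A \<in> Obj C" "B \<in> Obj C" "Q \<in> Obj C" "p \<in> Hom C P A" "q \<in> Hom C P B"
    "i \<in> Hom C A Q" "j \<in> Hom C B Q" "Comp C P A Q i p = Comp C P B Q j q"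
  using assms unfolding is_pushout_iff by auto

lemma is_pushout_lift:
  assumes "is_pushout C P A B Q p q i j" "X \<in> Obj C" "f \<in> Hom C A X" "g \<in> Hom C B X"
    "Comp C P A X f p = Comp C P B X g q"
  obtains h where "h \<in> Hom C Q X" "Comp C A Q X h i = f" "Comp C B Q X h j = g"
  using assms unfolding is_pushout_iff by blast

lemma is_pushout_sym: "is_pushout C P A B Q p q i j \<Longrightarrow> is_pushout C P B A Q q p j i"
  unfolding is_pushout_def by (rule is_pullback_sym)

lemma (in cat) is_pushout_unique:
  assumes "is_pushout C P A B Q p q i j" "X \<in> Obj C" "h \<in> Hom C Q X" "k \<in> Hom C Q X"
    "Comp C A Q X h i = Comp C A Q X k i" "Comp C B Q X h j = Comp C B Q X k j"
  shows "h = k"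
proof -
  interpret op: cat "op C" by unfold_locales (rule category_op[OF category])
  show ?thesis
    using op.is_pullback_unique[OF assms(1)[unfolded is_pushout_def], of X h k] assms by simp
qed

lemma is_stable_pushoutD: "is_stable_pushout C P A B Q p q i j \<Longrightarrow> is_pushout C P A B Q p q i j"
  unfolding is_stable_pushout_def by (rule conjunct1)

lemma is_stable_pushout_pullback:
  assumes "is_stable_pushout C P A B Q p q i j" "X \<in> Obj C" "f \<in> Hom C X Q"
    "is_pullback C A' A X Q pA i' i f" "is_pullback C B' B X Q pB j' j f"
    "is_pullback C P' P X Q pP d (Comp C P A Q i p) f"
    "p' \<in> Hom C P' A'" "Comp C P' A' A pA p' = Comp C P' P A p pP" "Comp C P' A' X i' p' = d"
    "q' \<in> Hom C P' B'" "Comp C P' B' B pB q' = Comp C P' P B q pP" "Comp C P' B' X j' q' = d"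
  shows "is_pushout C P' A' B' X p' q' i' j'"
  using conjunct2[OF assms(1)[unfolded is_stable_pushout_def], rule_format, OF assms(2,3),
      of A' pA i' B' pB j' P' pP d p' q'] assms(4-12)
  by simp

lemma is_stable_pushoutI:
  assumes "is_pushout C P A B Q p q i j"
    and "\<And>X f P' A' B' pP pA pB d i' j' p' q'. \<lbrakk>X \<in> Obj C; f \<in> Hom C X Q;
    is_pullback C A' A X Q pA i' i f; is_pullback C B' B X Q pB j' j f;
    is_pullback C P' P X Q pP d (Comp C P A Q i p) f;
    p' \<in> Hom C P' A'; Comp C P' A' A pA p' = Comp C P' P A p pP; Comp C P' A' X i' p' = d;
    q' \<in> Hom C P' B'; Comp C P' B' B pB q' = Comp C P' P B q pP; Comp C P' B' X j' q' = d\<rbrakk>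
    \<Longrightarrow> is_pushout C P' A' B' X p' q' i' j'"
  shows "is_stable_pushout C P A B Q p q i j"
  unfolding is_stable_pushout_def
  by (intro conjI ballI allI impI; (elim conjE)?; (rule assms(1) | rule assms(2); assumption))

lemma is_stable_pushout_sym:
  assumes "is_stable_pushout C P A B Q p q i j"
  shows "is_stable_pushout C P B A Q q p j i"
proof (rule is_stable_pushoutI)
  note po = is_stable_pushoutD[OF assms]
  show "is_pushout C P B A Q q p j i" by (rule is_pushout_sym[OF po])
  show "is_pushout C P' A' B' X p' q' i' j'"
    if "X \<in> Obj C" "f \<in> Hom C X Q" "is_pullback C A' B X Q pA i' j f" "is_pullback C B' A X Q pB j' i f"
    "is_pullback C P' P X Q pP d (Comp C P B Q j q) f"
    "p' \<in> Hom C P' A'" "Comp C P' A' B pA p' = Comp C P' P B q pP" "Comp C P' A' X i' p' = d"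
    "q' \<in> Hom C P' B'" "Comp C P' B' A pB q' = Comp C P' P A p pP" "Comp C P' B' X j' q' = d"
    for X f P' A' B' pP pA pB d i' j' p' q'
    by (rule is_pushout_sym, rule is_stable_pushout_pullback[OF assms that(1,2)])
      (use that is_pushoutD(9)[OF po] in simp_all)
qed

lemma is_iso_inverse:
  assumes "is_iso C a b f"
  obtains g where "f \<in> Hom C a b" "g \<in> Hom C b a" "Comp C a b a g f = Id C a" "Comp C b a b f g = Id C b"
  using assms unfolding is_iso_def by blast

section \<open>Finite limits\<close>

text \<open>
  For a cospan \<open>A \<rightarrow> c \<leftarrow> B\<close>, the diagram of shape \<open>shape s\<close> has a copy of \<open>c\<close> at \<open>3 k\<close> for each
  \<open>k < length s\<close>, with a copy of \<open>A\<close> over it at \<open>3 k + 1\<close> and a copy of \<open>B\<close> over it at \<open>3 k + 2\<close> if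
  the first and second components of \<open>s ! k\<close> say so.  It covers terminal objects (\<open>s\<close> empty),
  pullbacks (\<open>s = [(True, True)]\<close>), and the finite limits of copies of \<open>A\<close>, \<open>B\<close>, \<open>c\<close> that make up
  the free category with finite limits on a pair of monomorphisms.
\<close>

definition shape :: "(bool \<times> bool) list \<Rightarrow> (nat, nat) cat" where
  "shape s = \<lparr>Obj = {j. j div 3 < length s \<and> (j mod 3 = 1 \<longrightarrow> fst (s ! (j div 3))) \<and>
                       (j mod 3 = 2 \<longrightarrow> snd (s ! (j div 3)))},
              Hom = (\<lambda>i j. {u. u = 0 \<and> (i = j \<or> j = 3 * (i div 3))}),
              Id = (\<lambda>_. 0), Comp = (\<lambda>_ _ _ _ _. 0)\<rparr>"

lemma finite_cat_shape: "finite_cat (shape s)"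
proof -
  have "Obj (shape s) \<subseteq> {..< 3 * length s}"
    by (auto simp: shape_def)
  then have "finite (Obj (shape s))" using finite_subset by blast
  then show ?thesis
    unfolding finite_cat_def category_def by (auto simp: shape_def)
qed

lemma nat_mod3_cases:
  fixes j :: nat
  obtains k where "j = 3 * k" | k where "j = 3 * k + 1" | k where "j = 3 * k + 2"
proof -
  have "j mod 3 = 0 \<or> j mod 3 = 1 \<or> j mod 3 = 2" by linarith
  then show ?thesis using that mult_div_mod_eq[of 3 j] by (metis add_0_right)
qed

lemma Obj_shape_iff [simp]:
  "3 * k \<in> Obj (shape s) \<longleftrightarrow> k < length s"
  "Suc (3 * k) \<in> Obj (shape s) \<longleftrightarrow> k < length s \<and> fst (s ! k)"
  "Suc (Suc (3 * k)) \<in> Obj (shape s) \<longleftrightarrow> k < length s \<and> snd (s ! k)"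
proof -
  have "Suc (3 * k) div 3 = k" "Suc (3 * k) mod 3 = 1" "Suc (Suc (3 * k)) div 3 = k" "Suc (Suc (3 * k)) mod 3 = 2"
    by presburger+
  then show "3 * k \<in> Obj (shape s) \<longleftrightarrow> k < length s"
    "Suc (3 * k) \<in> Obj (shape s) \<longleftrightarrow> k < length s \<and> fst (s ! k)"
    "Suc (Suc (3 * k)) \<in> Obj (shape s) \<longleftrightarrow> k < length s \<and> snd (s ! k)"
    by (simp_all add: shape_def)
qed

lemma Hom_shape_iff:
  "u \<in> Hom (shape s) i j \<longleftrightarrow> u = 0 \<and> (i = j \<or> (\<exists>k. j = 3 * k \<and> (i = 3 * k + 1 \<or> i = 3 * k + 2)))"
proof -
  have "j = 3 * (i div 3) \<longleftrightarrow> i = j \<and> 3 dvd i \<or> (\<exists>k. j = 3 * k \<and> (i = 3 * k + 1 \<or> i = 3 * k + 2))"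
    by (cases i rule: nat_mod3_cases) (auto; presburger)+
  then show ?thesis by (auto simp: shape_def)
qed

lemma Ball_shape_iff:
  "(\<forall>j\<in>Obj (shape s). R j) \<longleftrightarrow>
     (\<forall>k<length s. R (3 * k) \<and> (fst (s ! k) \<longrightarrow> R (3 * k + 1)) \<and> (snd (s ! k) \<longrightarrow> R (3 * k + 2)))"
  (is "?L \<longleftrightarrow> ?R")
proof
  assume ?R
  show ?L
  proof
    fix j assume "j \<in> Obj (shape s)"
    then show "R j" using \<open>?R\<close> by (cases j rule: nat_mod3_cases) auto
  qed
qed auto

lemma Ball_Hom_shape_iff:
  "(\<forall>i\<in>Obj (shape s). \<forall>j\<in>Obj (shape s). \<forall>u\<in>Hom (shape s) i j. R i j u) \<longleftrightarrow>
     (\<forall>j\<in>Obj (shape s). R j j 0) \<and>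
     (\<forall>k<length s. (fst (s ! k) \<longrightarrow> R (3 * k + 1) (3 * k) 0) \<and> (snd (s ! k) \<longrightarrow> R (3 * k + 2) (3 * k) 0))"
  (is "?L \<longleftrightarrow> ?R")
proof
  assume L: ?L
  have "R (3 * k + 1) (3 * k) 0" if "k < length s" "fst (s ! k)" for k
    by (rule L[rule_format]) (use that Hom_shape_iff in auto)
  moreover have "R (3 * k + 2) (3 * k) 0" if "k < length s" "snd (s ! k)" for k
    by (rule L[rule_format]) (use that Hom_shape_iff in auto)
  moreover have "R j j 0" if "j \<in> Obj (shape s)" for j
    by (rule L[rule_format]) (use that Hom_shape_iff in auto)
  ultimately show ?R by blast
next
  assume R: ?R
  show ?L
  proof (intro ballI)
    fix i j u assume "i \<in> Obj (shape s)" "j \<in> Obj (shape s)" "u \<in> Hom (shape s) i j"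
    then show "R i j u"
      using R unfolding Hom_shape_iff by auto
  qed
qed

text \<open>A predicate rather than one functor, since it must also hold of the composite of such a
  diagram with a functor, whose values at pairs of indices without an arrow are different.\<close>

definition cospan_diagram :: "('o, 'm) cat \<Rightarrow> ('o, 'm) cospan \<Rightarrow> (nat, nat, 'o, 'm) func \<Rightarrow> bool" where
  "cospan_diagram C = (\<lambda>(A, B, c, a, b) D.
     (\<forall>k. fobj D (3 * k) = c \<and> fobj D (3 * k + 1) = A \<and> fobj D (3 * k + 2) = B \<and>
       farr D (3 * k + 1) (3 * k) 0 = a \<and> farr D (3 * k + 2) (3 * k) 0 = b) \<and>
     (\<forall>j. farr D j j 0 = Id C (fobj D j)))"

lemma cospan_diagram_comp_func:
  assumes "cospan_diagram C (A, B, c, a, b) D" "is_functor C E F" "A \<in> Obj C" "B \<in> Obj C" "c \<in> Obj C"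
  shows "cospan_diagram E (fobj F A, fobj F B, fobj F c, farr F A c a, farr F B c b) (comp_func F D)"
proof -
  have "fobj D j \<in> Obj C" for j
    using assms unfolding cospan_diagram_def by (cases j rule: nat_mod3_cases) auto
  then show ?thesis
    using assms unfolding cospan_diagram_def comp_func_def is_functor_def by simp
qed

lemma (in cat) is_cone_shape_iff:
  assumes D: "cospan_diagram C (A, B, c, a, b) D" and o: "A \<in> Obj C" "B \<in> Obj C" "c \<in> Obj C"
  shows "is_cone (shape s) C D v p \<longleftrightarrow> v \<in> Obj C \<and>
    (\<forall>k<length s. p (3 * k) \<in> Hom C v c \<and>
      (fst (s ! k) \<longrightarrow> p (3 * k + 1) \<in> Hom C v A \<and> Comp C v A c a (p (3 * k + 1)) = p (3 * k)) \<and>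
      (snd (s ! k) \<longrightarrow> p (3 * k + 2) \<in> Hom C v B \<and> Comp C v B c b (p (3 * k + 2)) = p (3 * k)))"
    (is "_ \<longleftrightarrow> ?R")
proof -
  have D': "\<And>k. fobj D (3 * k) = c" "\<And>k. fobj D (Suc (3 * k)) = A" "\<And>k. fobj D (Suc (Suc (3 * k))) = B"
       "\<And>k. farr D (Suc (3 * k)) (3 * k) 0 = a" "\<And>k. farr D (Suc (Suc (3 * k))) (3 * k) 0 = b"
     "\<And>j. farr D j j 0 = Id C (fobj D j)"
    using D unfolding cospan_diagram_def by auto
  show ?thesis
    unfolding is_cone_def Ball_Hom_shape_iff unfolding Ball_shape_iff using o by (auto simp: D')
qed

definition cospan_func :: "('o, 'm) cat \<Rightarrow> ('o, 'm) cospan \<Rightarrow> (nat, nat, 'o, 'm) func" where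
  "cospan_func C = (\<lambda>(A, B, c, a, b).
     let ob = (\<lambda>j. if j mod 3 = 0 then c else if j mod 3 = 1 then A else B)
     in \<lparr>fobj = ob, farr = (\<lambda>i j u. if i = j then Id C (ob i) else if i mod 3 = 1 then a else b)\<rparr>)"

lemma cospan_diagram_cospan_func: "cospan_diagram C X (cospan_func C X)"
proof -
  obtain A B c a b where X: "X = (A, B, c, a, b)" by (cases X) auto
  have "Suc (3 * k) mod 3 = 1" "Suc (Suc (3 * k)) mod 3 = 2" for k :: nat by presburger+
  then show ?thesis
    unfolding X cospan_diagram_def cospan_func_def Let_def by simp
qed

lemma (in cat) is_functor_cospan_func:
  assumes "a \<in> Hom C A c" "b \<in> Hom C B c" "A \<in> Obj C" "B \<in> Obj C" "c \<in> Obj C"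
  shows "is_functor (shape s) C (cospan_func C (A, B, c, a, b))" (is "is_functor _ _ ?D")
proof -
  have ob: "fobj ?D j \<in> Obj C" for j using assms by (auto simp: cospan_func_def Let_def)
  have mod3: "Suc (3 * k) mod 3 = 1" "Suc (Suc (3 * k)) mod 3 = 2" for k :: nat by presburger+
  have ar: "farr ?D i j u \<in> Hom C (fobj ?D i) (fobj ?D j)" if "u \<in> Hom (shape s) i j" for i j u
    using that assms mod3 unfolding Hom_shape_iff
    by (elim conjE disjE exE) (simp_all add: cospan_func_def Let_def)
  have "farr ?D i k (Comp (shape s) i j k g f) = Comp C (fobj ?D i) (fobj ?D j) (fobj ?D k) (farr ?D j k g) (farr ?D i j f)"
    if f: "f \<in> Hom (shape s) i j" and g: "g \<in> Hom (shape s) j k" for i j k f g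
  proof -
    have [simp]: "f = 0" "g = 0" "\<And>i j k g f. Comp (shape s) i j k g f = 0"
      using f g by (auto simp: shape_def)
    have idD: "farr ?D j j 0 = Id C (fobj ?D j)" for j
      by (simp add: cospan_func_def Let_def)
    \<comment> \<open>Of two composable arrows of the shape one is an identity.\<close>
    have "i = j \<or> j = k" using f g mod3 unfolding Hom_shape_iff by (auto; presburger)
    then show ?thesis
      using ar[OF f] ar[OF g] ob by (auto simp: idD)
  qed
  moreover have "farr ?D j j (Id (shape s) j) = Id C (fobj ?D j)" for j
    by (simp add: cospan_func_def Let_def)
  ultimately show ?thesis using ob ar unfolding is_functor_def by blast
qed

context cat
begin

text \<open>The component of a cone at \<open>0\<close> is the diagonal of the square and is
  determined by the other two, whence the side equation for \<open>p 0\<close>.\<close>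

lemma is_pullback_iff_is_limit:
  assumes D: "cospan_diagram C (A, B, c, a, b) D" and o: "A \<in> Obj C" "B \<in> Obj C" "c \<in> Obj C"
    and ab: "a \<in> Hom C A c" "b \<in> Hom C B c"
  shows "is_limit (shape [(True, True)]) C D v p \<longleftrightarrow>
    is_pullback C v A B c (p 1) (p 2) a b \<and> p 0 = Comp C v A c a (p 1)"
proof -
  have cone: "is_cone (shape [(True, True)]) C D v p \<longleftrightarrow> v \<in> Obj C \<and> p 0 \<in> Hom C v c \<and>
    p 1 \<in> Hom C v A \<and> Comp C v A c a (p 1) = p 0 \<and> p 2 \<in> Hom C v B \<and> Comp C v B c b (p 2) = p 0" for v p
    unfolding is_cone_shape_iff[OF D o] by (auto simp: numeral_2_eq_2)
  have fac: "(\<forall>j\<in>Obj (shape [(True, True)]). Comp C w v (fobj D j) (p j) h = q j) \<longleftrightarrow>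
      Comp C w v c (p 0) h = q 0 \<and> Comp C w v A (p 1) h = q 1 \<and> Comp C w v B (p 2) h = q 2" for w h q
  proof -
    have "fobj D (3 * 0) = c" "fobj D (3 * 0 + 1) = A" "fobj D (3 * 0 + 2) = B"
      using D unfolding cospan_diagram_def by blast+
    then show ?thesis unfolding Ball_shape_iff by (auto simp: numeral_2_eq_2)
  qed
  show ?thesis
  proof
    assume L: "is_limit (shape [(True, True)]) C D v p"
    then have cn: "v \<in> Obj C" "p 0 \<in> Hom C v c" "p 1 \<in> Hom C v A" "Comp C v A c a (p 1) = p 0"
      "p 2 \<in> Hom C v B" "Comp C v B c b (p 2) = p 0"
      unfolding is_limit_def cone by auto
    have "\<exists>!h. h \<in> Hom C X v \<and> Comp C X v A (p 1) h = f \<and> Comp C X v B (p 2) h = g"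
      if X: "X \<in> Obj C" "f \<in> Hom C X A" "g \<in> Hom C X B" "Comp C X A c a f = Comp C X B c b g" for X f g
    proof -
      define q where "q j = (if j = (1::nat) then f else if j = 2 then g else Comp C X A c a f)" for j
      have q: "q 0 = Comp C X A c a f" "q 1 = f" "q 2 = g" by (simp_all add: q_def)
      have "is_cone (shape [(True, True)]) C D X q"
        unfolding cone q using X o ab by simp
      then have "\<exists>!h. h \<in> Hom C X v \<and> Comp C X v c (p 0) h = q 0 \<and> Comp C X v A (p 1) h = q 1 \<and> Comp C X v B (p 2) h = q 2"
        using L unfolding is_limit_def fac by blast
      moreover have "Comp C X v c (p 0) h = q 0" if "h \<in> Hom C X v" "Comp C X v A (p 1) h = q 1" for h
        using slide1[OF cn(4), of h X] that X cn o ab by (simp add: q_def)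
      ultimately show ?thesis unfolding q by metis
    qed
    then show "is_pullback C v A B c (p 1) (p 2) a b \<and> p 0 = Comp C v A c a (p 1)"
      using cn o ab unfolding is_pullback_def by auto
  next
    assume P: "is_pullback C v A B c (p 1) (p 2) a b \<and> p 0 = Comp C v A c a (p 1)"
    note P1 = is_pullbackD[OF conjunct1[OF P]]
    have "\<exists>!h. h \<in> Hom C w v \<and> Comp C w v c (p 0) h = q 0 \<and> Comp C w v A (p 1) h = q 1 \<and> Comp C w v B (p 2) h = q 2"
      if "is_cone (shape [(True, True)]) C D w q" for w q
    proof -
      have q: "w \<in> Obj C" "q 0 \<in> Hom C w c" "q 1 \<in> Hom C w A" "Comp C w A c a (q 1) = q 0"
      "q 2 \<in> Hom C w B" "Comp C w B c b (q 2) = q 0" using that unfolding cone by auto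
      then have "\<exists>!h. h \<in> Hom C w v \<and> Comp C w v A (p 1) h = q 1 \<and> Comp C w v B (p 2) h = q 2"
        using P unfolding is_pullback_def by metis
      moreover have "Comp C w v c (p 0) h = q 0" if "h \<in> Hom C w v" "Comp C w v A (p 1) h = q 1" for h
        using slide1[OF conjunct2[OF P, symmetric], of h w] that q P1 by simp
      ultimately show ?thesis by metis
    qed
    then show "is_limit (shape [(True, True)]) C D v p"
      unfolding is_limit_def fac cone using P P1 by auto
  qed
qed

end

lemma preserves_pullback:
  assumes F: "is_functor A B F" "preserves_finite_limits A B F" and A: "category A" and B: "category B"
    and P: "is_pullback A P X Y c p q a b"
  shows "is_pullback B (fobj F P) (fobj F X) (fobj F Y) (fobj F c) (farr F P X p) (farr F P Y q)
     (farr F X c a) (farr F Y c b)"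
proof -
  interpret A: cat A by unfold_locales fact
  interpret B: cat B by unfold_locales fact
  note P1 = is_pullbackD[OF P]
  let ?D = "cospan_func A (X, Y, c, a, b)"
  define r where "r j = (if j = (1::nat) then p else if j = 2 then q else Comp A P X c a p)" for j
  have r: "r 0 = Comp A P X c a p" "r 1 = p" "r 2 = q" by (simp_all add: r_def)
  have "is_limit (shape [(True, True)]) A ?D P r"
    by (subst A.is_pullback_iff_is_limit[OF cospan_diagram_cospan_func P1(2-4,7,8)]) (simp only: r P simp_thms)
  then have L: "is_limit (shape [(True, True)]) B (comp_func F ?D) (fobj F P) (\<lambda>j. farr F P (fobj ?D j) (r j))"
    using F(2)[unfolded preserves_finite_limits_def, rule_format, of "shape [(True, True)]" ?D P r]
      finite_cat_shape A.is_functor_cospan_func[OF P1(7,8,2,3,4)] by blast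
  have D: "cospan_diagram B (fobj F X, fobj F Y, fobj F c, farr F X c a, farr F Y c b) (comp_func F ?D)"
    using cospan_diagram_comp_func[OF cospan_diagram_cospan_func F(1)] P1 by blast
  have o: "fobj ?D 1 = X" "fobj ?D 2 = Y" by (simp_all add: cospan_func_def)
  have B1: "fobj F X \<in> Obj B" "fobj F Y \<in> Obj B" "fobj F c \<in> Obj B"
    "farr F X c a \<in> Hom B (fobj F X) (fobj F c)" "farr F Y c b \<in> Hom B (fobj F Y) (fobj F c)"
    using P1 F(1) unfolding is_functor_def by auto
  show ?thesis
    using conjunct1[OF iffD1[OF B.is_pullback_iff_is_limit[OF D B1] L]] unfolding o r .
qed

text \<open>The kernel pair description makes being monic a finite-limit property, so that lex
  functors preserve it.\<close>

lemma (in cat) is_mono_iff_is_pullback: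
  assumes "a \<in> Hom C A c" "A \<in> Obj C" "c \<in> Obj C"
  shows "is_mono C A c a \<longleftrightarrow> is_pullback C A A A c (Id C A) (Id C A) a a"
proof
  assume "is_mono C A c a"
  then show "is_pullback C A A A c (Id C A) (Id C A) a a"
    using assms by (intro is_pullbackI) (auto dest: is_monoD)
next
  assume P: "is_pullback C A A A c (Id C A) (Id C A) a a"
  show "is_mono C A c a"
    unfolding is_mono_def
  proof (intro conjI ballI impI assms(1))
    fix x g h assume "x \<in> Obj C" "g \<in> Hom C x A" "h \<in> Hom C x A" "Comp C x A c a g = Comp C x A c a h"
    then show "g = h" using is_pullback_lift[OF P, of x g h] assms by (metis id_left)
  qed
qed

section \<open>Pullbacks, terminal objects and equalizers in a finitely complete category\<close>

locale finlim_cat = cat +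
  assumes finitely_complete: "finitely_complete C"
begin

lemma ex_pullback:
  assumes "a \<in> Hom C A c" "b \<in> Hom C B c" "A \<in> Obj C" "B \<in> Obj C" "c \<in> Obj C"
  obtains P p q where "is_pullback C P A B c p q a b"
proof -
  have "\<exists>v p. is_limit (shape [(True, True)]) C (cospan_func C (A, B, c, a, b)) v p"
    using finitely_complete finite_cat_shape is_functor_cospan_func[OF assms]
    unfolding finitely_complete_def by blast
  then show ?thesis
    using that is_pullback_iff_is_limit[OF cospan_diagram_cospan_func] assms by blast
qed

lemma ex_terminal:
  obtains t where "t \<in> Obj C" "\<And>y. y \<in> Obj C \<Longrightarrow> \<exists>!f. f \<in> Hom C y t"
proof -
  have 1: "Obj (shape []) = {}" by (simp add: shape_def)
  then have "is_functor (shape []) C D" for D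
    unfolding is_functor_def by simp
  then have "\<exists>v p. is_limit (shape []) C D v p" for D
    using finitely_complete finite_cat_shape unfolding finitely_complete_def by blast
  then show ?thesis
    using that 1 unfolding is_limit_def is_cone_def by auto
qed

text \<open>The equalizer is the pullback of \<open>(f, g)\<close> along the diagonal of
  \<open>Y\<close>, the product \<open>Q\<close> being a pullback over a terminal object. It is
  monic because the diagonal is split by \<open>p\<close>.\<close>

lemma ex_equalizer:
  assumes fg: "f \<in> Hom C X Y" "g \<in> Hom C X Y" and o: "X \<in> Obj C" "Y \<in> Obj C"
  obtains E e where "E \<in> Obj C" "is_mono C E X e" "Comp C E X Y f e = Comp C E X Y g e"
    "\<And>w h. \<lbrakk>w \<in> Obj C; h \<in> Hom C w X; Comp C w X Y f h = Comp C w X Y g h\<rbrakk> \<Longrightarrow> \<exists>k\<in>Hom C w E. Comp C w E X e k = h"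
proof -
  obtain t where t: "t \<in> Obj C" "\<And>y. y \<in> Obj C \<Longrightarrow> \<exists>!f. f \<in> Hom C y t"
    using ex_terminal by blast
  then obtain ty where ty: "ty \<in> Hom C Y t" using o by blast
  obtain Q p q where Q: "is_pullback C Q Y Y t p q ty ty"
    by (rule ex_pullback[OF ty ty o(2) o(2) t(1)])
  note Q1 [simp] = is_pullbackD(1-8)[OF Q]
  have un: "u = v" if "u \<in> Hom C y t" "v \<in> Hom C y t" "y \<in> Obj C" for u v y using t that by blast
  have "Comp C X Y t ty f = Comp C X Y t ty g" by (rule un) (use fg o in auto)
  then obtain d where d: "d \<in> Hom C X Q" "Comp C X Q Y p d = f" "Comp C X Q Y q d = g"
    by (rule is_pullback_lift[OF Q o(1) fg])
  obtain dl where dl: "dl \<in> Hom C Y Q" "Comp C Y Q Y p dl = Id C Y" "Comp C Y Q Y q dl = Id C Y"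
    using is_pullback_lift[OF Q o(2), of "Id C Y" "Id C Y"] o by auto
  obtain E e e' where E: "is_pullback C E X Y Q e e' d dl"
    by (rule ex_pullback[OF d(1) dl(1)]) (use o in auto)
  note E1 [simp] = is_pullbackD(1-8)[OF E]
  have dlm: "is_mono C Y Q dl"
    by (rule is_mono_cancel[where g = p and D = Y]) (use dl o is_mono_id in auto)
  have "is_mono C E X e"
    using is_pullback_mono[OF is_pullback_sym[OF E] dlm] .
  moreover have "Comp C E X Y f e = Comp C E X Y g e"
  proof -
    have "Comp C E X Q d e = Comp C E Y Q dl e'" by (rule is_pullbackD[OF E])
    then have "Comp C E Q Y p (Comp C E X Q d e) = Comp C E Q Y q (Comp C E X Q d e)"
      using slide1[OF dl(2), of e' E] slide1[OF dl(3), of e' E] dl o by simp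
    then show ?thesis
      using slide1[OF d(2), of e E] slide1[OF d(3), of e E] d o by simp
  qed
  moreover have "\<exists>k\<in>Hom C w E. Comp C w E X e k = h"
    if h: "w \<in> Obj C" "h \<in> Hom C w X" "Comp C w X Y f h = Comp C w X Y g h" for w h
  proof -
    have "Comp C w X Q d h = Comp C w Y Q dl (Comp C w X Y f h)"
    proof (rule is_pullback_unique[OF Q h(1)])
      show "Comp C w Q Y p (Comp C w X Q d h) = Comp C w Q Y p (Comp C w Y Q dl (Comp C w X Y f h))"
        using slide1[OF d(2), of h w] slide1[OF dl(2), of "Comp C w X Y f h" w] h d fg dl o by simp
      show "Comp C w Q Y q (Comp C w X Q d h) = Comp C w Q Y q (Comp C w Y Q dl (Comp C w X Y f h))"
        using slide1[OF d(3), of h w] slide1[OF dl(3), of "Comp C w X Y f h" w] h d fg dl o by simp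
    qed (use h d fg dl o in auto)
    then show ?thesis
      using is_pullback_lift[OF E, of w h "Comp C w X Y f h"] h fg o by (metis comp_in)
  qed
  ultimately show ?thesis using that E1 by metis
qed

end

section \<open>Unions and stable pushouts\<close>

context cat
begin

text \<open>The whole object bounds every family from above, so a family whose union it is may be
  enlarged.\<close>

lemma is_union_top_mono:
  assumes "is_union C x T (x, Id C x)" "T \<subseteq> T'" "T' \<subseteq> subobjects C x"
  shows "is_union C x T' (x, Id C x)"
proof -
  have "factors C x A (x, Id C x)" if "A \<in> T'" for A
    using that assms unfolding factors_def subobjects_def is_mono_def is_union_def by fastforce
  then show ?thesis using assms unfolding is_union_def by blast
qed

end

lemma subobjectsE:
  assumes "V \<in> subobjects C c"
  obtains W w where "V = (W, w)" "W \<in> Obj C" "is_mono C W c w" "w \<in> Hom C W c"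
  using assms unfolding subobjects_def by (auto dest: is_mono_in)

lemma factorsD:
  assumes "factors C c (A, a) (B, b)"
  obtains h where "h \<in> Hom C A B" "Comp C A B c b h = a"
  using assms unfolding factors_def by auto

lemma factorsI: "\<lbrakk>h \<in> Hom C A B; Comp C A B c b h = a\<rbrakk> \<Longrightarrow> factors C c (A, a) (B, b)"
  unfolding factors_def by auto

section \<open>From effective stable unions to a strict initial object and stable pushouts\<close>

context finlim_cat
begin

text \<open>
  Every object over the least subobject \<open>Z\<close> of the terminal object has, by stability, only one
  subobject; so parallel arrows out of it are equal, and it is isomorphic to \<open>Z\<close>.
\<close>

lemma unions_imp_strict_initial:
  assumes "has_finite_unions C" and st: "finite_unions_stable C"
  shows "\<exists>z. is_strict_initial C z"
proof -
  obtain t where t: "t \<in> Obj C" "\<And>y. y \<in> Obj C \<Longrightarrow> \<exists>!f. f \<in> Hom C y t"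
    using ex_terminal by blast
  obtain Z z where U: "is_union C t {} (Z, z)"
    using assms(1) t(1) unfolding has_finite_unions_def by fastforce
  then have Z: "Z \<in> Obj C" "is_mono C Z t z" "z \<in> Hom C Z t"
    unfolding is_union_def subobjects_def is_mono_def by auto
  have un: "u = v" if "u \<in> Hom C y t" "v \<in> Hom C y t" "y \<in> Obj C" for u v y using t that by blast
  have eq: "f = g" if X: "X \<in> Obj C" "y \<in> Hom C X Z" and fg: "d \<in> Obj C" "f \<in> Hom C X d" "g \<in> Hom C X d" for X y d f g
  proof -
    have "is_pullback C X Z X t y (Id C X) z (Comp C X Z t z y)"
    proof (rule is_pullbackI)
      fix W f g assume W: "W \<in> Obj C" "f \<in> Hom C W Z" "g \<in> Hom C W X"
        "Comp C W Z t z f = Comp C W X t (Comp C X Z t z y) g"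
      have "Comp C W X Z y g = f"
        by (rule is_monoD[OF Z(2), of W]) (use W X Z t in \<open>simp_all add: assoc\<close>)
      then show "\<exists>h\<in>Hom C W X. Comp C W X Z y h = f \<and> Comp C W X X (Id C X) h = g"
        using W X by auto
    qed (use X Z t in auto)
    then have "is_inverse_image C X t (Comp C X Z t z y) (Z, z) (X, Id C X)"
      unfolding is_inverse_image_def by auto
    \<comment> \<open>Stability of the empty union: the inverse image of \<open>Z\<close> is all of
      \<open>X\<close>, so \<open>X\<close> is its own least subobject. The choice function is
      applied to no subobject and is left arbitrary.\<close>
    then have "is_union C X (undefined ` {}) (X, Id C X)"
      using st[unfolded finite_unions_stable_def, rule_format, of t X "Comp C X Z t z y" "{}" "(Z, z)" "(X, Id C X)"]
        U X Z t by auto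
    then have least: "factors C X (X, Id C X) V" if "V \<in> subobjects C X" for V
      using that unfolding is_union_def by auto
    obtain E e where E: "E \<in> Obj C" "is_mono C E X e" "Comp C E X d f e = Comp C E X d g e"
      by (rule ex_equalizer[OF fg(2,3) X(1) fg(1)])
    have "factors C X (X, Id C X) (E, e)" using least[of "(E, e)"] E by (simp add: subobjects_def)
    then obtain h where h: "h \<in> Hom C X E" "Comp C X E X e h = Id C X" by (rule factorsD)
    show ?thesis
      using slide[OF E(3) h(1)] h E fg X is_mono_in[OF E(2)] by simp
  qed
  have iso: "is_iso C X Z y" if X: "X \<in> Obj C" "y \<in> Hom C X Z" for X y
  proof -
    have "is_mono C X t (Comp C X Z t z y)"
      unfolding is_mono_def
    proof (intro conjI ballI impI)
      fix x g h assume "x \<in> Obj C" "g \<in> Hom C x X" "h \<in> Hom C x X"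
      then show "g = h" using eq[of x "Comp C x X Z y g" X g h] X Z by auto
    qed (use X Z t in auto)
    then have "factors C t (Z, z) (X, Comp C X Z t z y)"
      using U X unfolding is_union_def subobjects_def by auto
    then obtain h where h: "h \<in> Hom C Z X" by (rule factorsD)
    have "Comp C X Z X h y = Id C X" by (rule eq[OF X X(1)]) (use X h Z in auto)
    moreover have "Comp C Z X Z y h = Id C Z" by (rule eq[OF Z(1) id_in[OF Z(1)] Z(1)]) (use X h Z in auto)
    ultimately show ?thesis using X h unfolding is_iso_def by blast
  qed
  have "is_initial C Z"
    unfolding is_initial_def
  proof (intro conjI ballI Z(1))
    fix x assume x: "x \<in> Obj C"
    \<comment> \<open>The arrow from \<open>Z\<close> to \<open>x\<close> passes through the
      pullback of \<open>z\<close> along \<open>k\<close>: its projection to \<open>Z\<close> is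
      invertible, as is every arrow into \<open>Z\<close>.\<close>
    obtain k where k: "k \<in> Hom C x t" using t x by blast
    obtain Q p q where Q: "is_pullback C Q Z x t p q z k"
      using ex_pullback[OF Z(3) k Z(1) x t(1)] .
    note Q1 = is_pullbackD[OF Q]
    obtain g where "g \<in> Hom C Z Q"
      using iso[OF Q1(1,5)] by (rule is_iso_inverse)
    then have "Comp C Z Q x q g \<in> Hom C Z x" using Q1 by auto
    then show "\<exists>!f. f \<in> Hom C Z x" using eq[OF Z(1) id_in[OF Z(1)] x] by blast
  qed
  then show ?thesis using iso Z unfolding is_strict_initial_def by blast
qed

text \<open>Effectiveness makes the union \<open>U\<close> a pushout. For its stability the union is
  viewed inside \<open>U\<close> itself, where it is the top subobject: its inverse image along an
  arrow \<open>X -> U\<close> is the top of \<open>X\<close>, which is therefore the union of the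
  inverse images, and effectiveness over \<open>X\<close> applies.\<close>

lemma unions_imp_stable_pushouts:
  assumes un: "has_finite_unions C" and ef: "finite_unions_effective C" and st: "finite_unions_stable C"
  shows "has_stable_pushouts_of_pullbacks_of_monos C"
  unfolding has_stable_pushouts_of_pullbacks_of_monos_def
proof (intro ballI allI impI, elim conjE)
  fix A B c a b P p q
  assume a: "is_mono C A c a" and b: "is_mono C B c b" and P: "is_pullback C P A B c p q a b"
  note P1 [simp] = is_pullbackD(1-8)[OF P]
  have "{(A, a), (B, b)} \<subseteq> subobjects C c" using a b by (simp add: subobjects_def)
  then obtain U u where U: "is_union C c {(A, a), (B, b)} (U, u)"
    using un unfolding has_finite_unions_def by (metis P1(4) finite.simps surj_pair)
  then have u: "U \<in> Obj C" "is_mono C U c u" "u \<in> Hom C U c"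
    unfolding is_union_def subobjects_def is_mono_def by auto
  have f: "factors C c (A, a) (U, u)" "factors C c (B, b) (U, u)"
    using U unfolding is_union_def by auto
  obtain i where i: "i \<in> Hom C A U" "Comp C A U c u i = a" using f(1) by (rule factorsD)
  obtain j where j: "j \<in> Hom C B U" "Comp C B U c u j = b" using f(2) by (rule factorsD)
  have ij: "is_mono C A U i" "is_mono C B U j"
    using is_mono_cancel[of A c U u i] is_mono_cancel[of B c U u j] i j a b u by auto
  have po: "is_pushout C P A B U p q i j"
    using ef[unfolded finite_unions_effective_def] U P i j P1(4) by blast
  have P': "is_pullback C P A B U p q i j"
    by (rule is_pullback_cancel[where c = c and u = u]) (use P u i j is_pushoutD(9)[OF po] in auto)
  \<comment> \<open>A subobject of \<open>U\<close> that contains \<open>A\<close> and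
    \<open>B\<close> is, by composition with \<open>u\<close>, a subobject of \<open>c\<close>,
    where \<open>U\<close> is least; this gives a section of \<open>w\<close>.\<close>
  have V: "factors C U (U, Id C U) V" if VV: "V \<in> subobjects C U" "factors C U (A, i) V" "factors C U (B, j) V" for V
  proof -
    from VV(1) obtain W w where W: "V = (W, w)" "W \<in> Obj C" "is_mono C W U w" "w \<in> Hom C W U"
      by (rule subobjectsE)
    have "is_mono C W c (Comp C W U c u w)" using is_mono_comp[OF W(3) u(2)] W u by simp
    then have s: "(W, Comp C W U c u w) \<in> subobjects C c" using W by (simp add: subobjects_def)
    obtain r where r: "r \<in> Hom C A W" "Comp C A W U w r = i" using VV(2) unfolding W by (rule factorsD)
    obtain s where s: "s \<in> Hom C B W" "Comp C B W U w s = j" using VV(3) unfolding W by (rule factorsD)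
    have "factors C c (A, a) (W, Comp C W U c u w)" "factors C c (B, b) (W, Comp C W U c u w)"
      using W u i j r s by (auto intro!: factorsI[OF r(1)] factorsI[OF s(1)] simp: assoc)
    then have "factors C c (U, u) (W, Comp C W U c u w)"
      using U \<open>(W, Comp C W U c u w) \<in> subobjects C c\<close> unfolding is_union_def by auto
    then obtain h where h: "h \<in> Hom C U W" "Comp C U W c (Comp C W U c u w) h = u" by (rule factorsD)
    have "Comp C U W U w h = Id C U"
      by (rule is_monoD[OF u(2), of U]) (use h W u in \<open>simp_all add: assoc\<close>)
    then show ?thesis unfolding W using h(1) by (intro factorsI)
  qed
  have UU: "is_union C U {(A, i), (B, j)} (U, Id C U)"
    unfolding is_union_def
    using ij u is_mono_id V i j by (auto simp: subobjects_def intro: factorsI)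
  have "is_stable_pushout C P A B U p q i j"
  proof (rule is_stable_pushoutI[OF po])
    fix X f P' A' B' pP pA pB d i' j' p' q'
    assume X: "X \<in> Obj C" "f \<in> Hom C X U" and A': "is_pullback C A' A X U pA i' i f"
      and B': "is_pullback C B' B X U pB j' j f" and pb: "is_pullback C P' P X U pP d (Comp C P A U i p) f"
      "p' \<in> Hom C P' A'" "Comp C P' A' A pA p' = Comp C P' P A p pP" "Comp C P' A' X i' p' = d"
      "q' \<in> Hom C P' B'" "Comp C P' B' B pB q' = Comp C P' P B q pP" "Comp C P' B' X j' q' = d"
    note A'1 [simp] = is_pullbackD(1-8)[OF A'] and B'1 [simp] = is_pullbackD(1-8)[OF B']
    have P'': "is_pullback C P' A' B' X p' q' i' j'"
      using is_pullback_cube[OF P' A' B' pb] .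
    \<comment> \<open>If the two subobjects coincide, \<open>\<rho>\<close> yields the first inverse
      image only; the family is then enlarged by \<open>is_union_top_mono\<close>.\<close>
    define \<rho> where "\<rho> t = (if t = (A, i) then (A', i') else (B', j'))" for t
    have ij': "is_mono C A' X i'" "is_mono C B' X j'"
      using is_pullback_mono[OF A' ij(1)] is_pullback_mono[OF B' ij(2)] .
    have "is_inverse_image C X U f (U, Id C U) (X, Id C X)"
      unfolding is_inverse_image_def using is_pullback_sym[OF is_pullback_id[OF X(2,1) u(1)]] by auto
    moreover have "is_inverse_image C X U f t (\<rho> t)" if "t \<in> {(A, i), (B, j)}" for t
      unfolding is_inverse_image_def \<rho>_def using A' B' that by auto
    ultimately have "is_union C X (\<rho> ` {(A, i), (B, j)}) (X, Id C X)"
      using st[unfolded finite_unions_stable_def, rule_format, OF u(1) X, of "{(A, i), (B, j)}" "(U, Id C U)" "(X, Id C X)" \<rho>] UU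
      by auto
    then have "is_union C X {(A', i'), (B', j')} (X, Id C X)"
      by (rule is_union_top_mono) (auto simp: \<rho>_def subobjects_def ij')
    then show "is_pushout C P' A' B' X p' q' i' j'"
      using ef[unfolded finite_unions_effective_def, rule_format, OF X(1), of A' i' B' j' X "Id C X" P' p' q' i' j'] P'' X
      by simp
  qed
  then show "\<exists>Q i j. is_stable_pushout C P A B Q p q i j" by blast
qed

section \<open>Pullbacks of stable pushouts and the comparison with the ambient object\<close>

text \<open>By pasting, an inverse image of an inverse image is one of the original pushout. Hence
  the pulled back square is not merely a pushout but stable again, which inductions over iterated
  coverings need.\<close>

lemma stable_pushout_pullback':
  assumes Q: "is_stable_pushout C P A B Q p q i j" and X: "X \<in> Obj C" "f \<in> Hom C X Q"
    and A': "is_pullback C A' A X Q pA i' i f" and B': "is_pullback C B' B X Q pB j' j f"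
  obtains P' p' q' where "is_stable_pushout C P' A' B' X p' q' i' j'"
proof -
  note Q1 [simp] = is_pushoutD(1-8)[OF is_stable_pushoutD[OF Q]]
  note Q9 = is_pushoutD(9)[OF is_stable_pushoutD[OF Q]]
  obtain P' pP d where P': "is_pullback C P' P X Q pP d (Comp C P A Q i p) f"
    by (rule ex_pullback[of "Comp C P A Q i p" P Q f X]) (use X in auto)
  note A'1 [simp] = is_pullbackD(1-8)[OF A'] and B'1 [simp] = is_pullbackD(1-8)[OF B']
    and P'1 [simp] = is_pullbackD(1-8)[OF P']
  have "Comp C P' A Q i (Comp C P' P A p pP) = Comp C P' X Q f d"
    using is_pullbackD(9)[OF P'] by (simp add: assoc)
  then obtain p' where p': "p' \<in> Hom C P' A'" "Comp C P' A' A pA p' = Comp C P' P A p pP" "Comp C P' A' X i' p' = d"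
    by (rule is_pullback_lift[OF A', rotated 3]) auto
  have "Comp C P' B Q j (Comp C P' P B q pP) = Comp C P' X Q f d"
    using is_pullbackD(9)[OF P'] unfolding Q9 by (simp add: assoc)
  then obtain q' where q': "q' \<in> Hom C P' B'" "Comp C P' B' B pB q' = Comp C P' P B q pP" "Comp C P' B' X j' q' = d"
    by (rule is_pullback_lift[OF B', rotated 3]) auto
  note [simp] = p'(1) q'(1)
  have "is_stable_pushout C P' A' B' X p' q' i' j'"
  proof (rule is_stable_pushoutI[OF is_stable_pushout_pullback[OF Q X A' B' P' p' q']])
    fix X' f' P'' A'' B'' pP' pA' pB' d' i'' j'' p'' q''
    assume X' [simp]: "X' \<in> Obj C" "f' \<in> Hom C X' X" and A'': "is_pullback C A'' A' X' X pA' i'' i' f'"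
      and B'': "is_pullback C B'' B' X' X pB' j'' j' f'" and P'': "is_pullback C P'' P' X' X pP' d' (Comp C P' A' X i' p') f'"
      and p'': "p'' \<in> Hom C P'' A''" "Comp C P'' A'' A' pA' p'' = Comp C P'' P' A' p' pP'" "Comp C P'' A'' X' i'' p'' = d'"
      and q'': "q'' \<in> Hom C P'' B''" "Comp C P'' B'' B' pB' q'' = Comp C P'' P' B' q' pP'" "Comp C P'' B'' X' j'' q'' = d'"
    note [simp] = is_pullbackD(1-6)[OF A''] is_pullbackD(1-6)[OF B''] is_pullbackD(1,5)[OF P''] p''(1) q''(1)
    show "is_pushout C P'' A'' B'' X' p'' q'' i'' j''"
    proof (rule is_stable_pushout_pullback[OF Q X'(1) _ is_pullback_paste[OF A' A''] is_pullback_paste[OF B' B'']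
          is_pullback_paste[OF P' P''[unfolded p'(3)]] p''(1) _ p''(3) q''(1) _ q''(3)])
      show "Comp C P'' A'' A (Comp C A'' A' A pA pA') p'' = Comp C P'' P A p (Comp C P'' P' P pP pP')"
        using slide[OF p'(2), of pP' P''] p''(2) by (simp add: assoc)
      show "Comp C P'' B'' B (Comp C B'' B' B pB pB') q'' = Comp C P'' P B q (Comp C P'' P' P pP pP')"
        using slide[OF q'(2), of pP' P''] q''(2) by (simp add: assoc)
    qed (use X in simp)
  qed
  then show ?thesis by (rule that)
qed

lemma stable_pushout_pullback:
  assumes Q: "is_stable_pushout C P A B Q p q i j" and X: "X \<in> Obj C" "f \<in> Hom C X Q"
  obtains A' pA i' B' pB j' P' p' q' where "is_pullback C A' A X Q pA i' i f" "is_pullback C B' B X Q pB j' j f"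
    "is_stable_pushout C P' A' B' X p' q' i' j'"
proof -
  note Q1 [simp] = is_pushoutD(1-8)[OF is_stable_pushoutD[OF Q]]
  obtain A' pA i' where A': "is_pullback C A' A X Q pA i' i f"
    by (rule ex_pullback[of i A Q f X]) (use X in auto)
  obtain B' pB j' where B': "is_pullback C B' B X Q pB j' j f"
    by (rule ex_pullback[of j B Q f X]) (use X in auto)
  show ?thesis
    using that[OF A' B'] stable_pushout_pullback'[OF Q X A' B'] by metis
qed

text \<open>The equation is tested on the two pieces into which pulling back along \<open>g\<close>
  cuts \<open>Y\<close>. On \<open>A'\<close> it holds because \<open>a\<close> is monic. On
  \<open>B'\<close> the arrow \<open>s\<close> lands in the intersection \<open>P\<close>, where
  \<open>i p = j q\<close>.\<close>

lemma stable_pushout_comparison_aux: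
  assumes Q: "is_stable_pushout C P A B Q p q i j"
    and P: "is_pullback C P A B c p q a b" and a: "is_mono C A c a"
    and m: "m \<in> Hom C Q c" "Comp C A Q c m i = a" "Comp C B Q c m j = b"
    and s: "Y \<in> Obj C" "s \<in> Hom C Y A" "g \<in> Hom C Y Q" "Comp C Y A c a s = Comp C Y Q c m g"
  shows "Comp C Y A Q i s = g"
proof -
  note [simp] = is_pushoutD(1-8)[OF is_stable_pushoutD[OF Q]] is_pullbackD(1-8)[OF P] m(1) s(1-3)
  obtain A' pA i' B' pB j' P' p' q' where A': "is_pullback C A' A Y Q pA i' i g" and B': "is_pullback C B' B Y Q pB j' j g"
    and po: "is_stable_pushout C P' A' B' Y p' q' i' j'"
    by (rule stable_pushout_pullback[OF Q s(1,3)])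
  note A'1 [simp] = is_pullbackD(1-8)[OF A'] and B'1 [simp] = is_pullbackD(1-8)[OF B']
  note A'9 = is_pullbackD(9)[OF A'] and B'9 = is_pullbackD(9)[OF B']
  show ?thesis
  proof (rule is_pushout_unique[OF is_stable_pushoutD[OF po]])
    have "Comp C A' Y c (Comp C Y A c a s) i' = Comp C A' A c a pA"
      unfolding s(4) using A'9 slide1[OF m(2), of pA A'] by (simp add: assoc)
    then have "Comp C A' A c a (Comp C A' Y A s i') = Comp C A' A c a pA" by (simp add: assoc)
    then have "Comp C A' Y A s i' = pA" by (rule is_monoD[OF a]) auto
    then show "Comp C A' Y Q (Comp C Y A Q i s) i' = Comp C A' Y Q g i'"
      using A'9 by (simp add: assoc)
    have "Comp C B' Y c (Comp C Y A c a s) j' = Comp C B' B c b pB"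
      unfolding s(4) using B'9 slide1[OF m(3), of pB B'] by (simp add: assoc)
    then have "Comp C B' A c a (Comp C B' Y A s j') = Comp C B' B c b pB" by (simp add: assoc)
    then obtain h where h: "h \<in> Hom C B' P" "Comp C B' P A p h = Comp C B' Y A s j'" "Comp C B' P B q h = pB"
      by (rule is_pullback_lift[OF P, rotated 3]) auto
    have "Comp C B' A Q i (Comp C B' P A p h) = Comp C B' B Q j (Comp C B' P B q h)"
      by (rule slide[OF is_pushoutD(9)[OF is_stable_pushoutD[OF Q]]]) (use h in auto)
    then show "Comp C B' Y Q (Comp C Y A Q i s) j' = Comp C B' Y Q g j'"
      using B'9 h by (simp add: assoc)
  qed auto
qed

text \<open>The arrow \<open>f\<close> cuts \<open>X\<close> into a piece over \<open>A\<close> and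
  one over \<open>B\<close>. On each piece \<open>f\<close> factors through a leg, and the previous
  lemma, applied once to each leg, identifies \<open>g\<close> with it.\<close>

lemma stable_pushout_mono:
  assumes Q: "is_stable_pushout C P A B Q p q i j"
    and P: "is_pullback C P A B c p q a b" and a: "is_mono C A c a" "is_mono C B c b"
    and m: "m \<in> Hom C Q c" "Comp C A Q c m i = a" "Comp C B Q c m j = b"
  shows "is_mono C Q c m"
  unfolding is_mono_def
proof (intro conjI ballI impI m(1))
  note [simp] = is_pushoutD(1-8)[OF is_stable_pushoutD[OF Q]] is_pullbackD(1-8)[OF P] m(1)
  fix X f g assume X: "X \<in> Obj C" "f \<in> Hom C X Q" "g \<in> Hom C X Q" "Comp C X Q c m f = Comp C X Q c m g"
  obtain A' pA i' B' pB j' P' p' q' where A': "is_pullback C A' A X Q pA i' i f" and B': "is_pullback C B' B X Q pB j' j f"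
    and po: "is_stable_pushout C P' A' B' X p' q' i' j'"
    by (rule stable_pushout_pullback[OF Q X(1,2)])
  note [simp] = is_pullbackD(1-8)[OF A'] is_pullbackD(1-8)[OF B'] X(1-3)
  note A'9 = is_pullbackD(9)[OF A'] and B'9 = is_pullbackD(9)[OF B']
  show "f = g"
  proof (rule is_pushout_unique[OF is_stable_pushoutD[OF po]])
    have "Comp C A' A c a pA = Comp C A' Q c m (Comp C A' X Q g i')"
      using slide1[OF m(2), of pA A'] A'9 slide[OF X(4), of i' A'] by simp
    then show "Comp C A' X Q f i' = Comp C A' X Q g i'"
      using stable_pushout_comparison_aux[OF Q P a(1) m, of A' pA "Comp C A' X Q g i'"] A'9 by simp
    have "Comp C B' B c b pB = Comp C B' Q c m (Comp C B' X Q g j')"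
      using slide1[OF m(3), of pB B'] B'9 slide[OF X(4), of j' B'] by simp
    then show "Comp C B' X Q f j' = Comp C B' X Q g j'"
      using stable_pushout_comparison_aux[OF is_stable_pushout_sym[OF Q] is_pullback_sym[OF P] a(2) m(1,3,2), of B' pB "Comp C B' X Q g j'"] B'9 by simp
  qed auto
qed

text \<open>The two factorizations through a subobject \<open>w\<close> agree on \<open>P\<close>
  because \<open>w\<close> is monic, so they induce an arrow out of the pushout.\<close>

lemma pushout_is_union:
  assumes Q: "is_pushout C P A B Q p q i j"
    and m: "is_mono C Q c m" "c \<in> Obj C" and a: "is_mono C A c a" "is_mono C B c b"
    and e: "Comp C A Q c m i = a" "Comp C B Q c m j = b"
  shows "is_union C c {(A, a), (B, b)} (Q, m)"
  unfolding is_union_def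
proof (intro conjI ballI impI)
  note [simp] = is_pushoutD(1-8)[OF Q] m(2) is_mono_in[OF m(1)]
  show "{(A, a), (B, b)} \<subseteq> subobjects C c" "(Q, m) \<in> subobjects C c"
    using a m by (auto simp: subobjects_def)
  show "factors C c X (Q, m)" if "X \<in> {(A, a), (B, b)}" for X
    using that e by (auto intro: factorsI[of i] factorsI[of j])
  fix V assume V: "V \<in> subobjects C c" "\<forall>X\<in>{(A, a), (B, b)}. factors C c X V"
  then obtain W w where W: "V = (W, w)" "W \<in> Obj C" "is_mono C W c w" "w \<in> Hom C W c"
    by (metis subobjectsE)
  note [simp] = W(2,4)
  have VA: "factors C c (A, a) (W, w)" "factors C c (B, b) (W, w)" using V(2) unfolding W by auto
  obtain r where r: "r \<in> Hom C A W" "Comp C A W c w r = a" using VA(1) by (rule factorsD)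
  obtain s where s: "s \<in> Hom C B W" "Comp C B W c w s = b" using VA(2) by (rule factorsD)
  note [simp] = r(1) s(1)
  have "Comp C P A W r p = Comp C P B W s q"
  proof (rule is_monoD[OF W(3)])
    show "Comp C P W c w (Comp C P A W r p) = Comp C P W c w (Comp C P B W s q)"
      using slide1[OF r(2), of p P] slide1[OF s(2), of q P] slide1[OF e(1), of p P] slide1[OF e(2), of q P]
        is_pushoutD(9)[OF Q] by simp
  qed auto
  then obtain h where h: "h \<in> Hom C Q W" "Comp C A Q W h i = r" "Comp C B Q W h j = s"
    by (rule is_pushout_lift[OF Q, rotated 3]) auto
  have "Comp C Q W c w h = m"
    by (rule is_pushout_unique[OF Q m(2)]) (use h r s e in \<open>simp_all add: assoc\<close>)
  then show "factors C c (Q, m) V" unfolding W using h(1) by (intro factorsI)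
qed

end

section \<open>Reduction of finite unions to binary and empty ones\<close>

context cat
begin

lemma factors_trans:
  assumes AB: "factors C c A B" and BD: "factors C c B D"
    and sub: "A \<in> subobjects C c" "B \<in> subobjects C c" "D \<in> subobjects C c" and c: "c \<in> Obj C"
  shows "factors C c A D"
proof -
  obtain A0 a where A: "A = (A0, a)" "A0 \<in> Obj C" using sub(1) by (rule subobjectsE)
  obtain B0 b where B: "B = (B0, b)" "B0 \<in> Obj C" using sub(2) by (rule subobjectsE)
  obtain D0 d where D: "D = (D0, d)" "D0 \<in> Obj C" "d \<in> Hom C D0 c" using sub(3) by (rule subobjectsE)
  obtain h where h: "h \<in> Hom C A0 B0" "Comp C A0 B0 c b h = a" using AB unfolding A B by (rule factorsD)
  obtain k where k: "k \<in> Hom C B0 D0" "Comp C B0 D0 c d k = b" using BD unfolding B D by (rule factorsD)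
  show ?thesis
    unfolding A D by (rule factorsI[of "Comp C A0 B0 D0 k h"]) (use A B D c h k slide1[OF k(2), of h A0] in auto)
qed

text \<open>The upper bounds of \<open>T\<close> are the subobjects above its union
  \<open>V\<close>, so inserting \<open>A\<close> amounts to a binary union. This is the induction
  step for finite families.\<close>

lemma is_union_insert_iff:
  assumes T: "is_union C c T V" and A: "A \<in> subobjects C c" and c: "c \<in> Obj C"
  shows "is_union C c (insert A T) U \<longleftrightarrow> is_union C c {A, V} U"
proof -
  have V: "V \<in> subobjects C c" "T \<subseteq> subobjects C c" using T unfolding is_union_def by auto
  have "(\<forall>B\<in>T. factors C c B W) \<longleftrightarrow> factors C c V W" if W: "W \<in> subobjects C c" for W
  proof
    assume "\<forall>B\<in>T. factors C c B W"
    then show "factors C c V W" using T W unfolding is_union_def by blast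
  next
    assume VW: "factors C c V W"
    show "\<forall>B\<in>T. factors C c B W"
    proof
      fix B assume B: "B \<in> T"
      then have "factors C c B V" "B \<in> subobjects C c" using T V unfolding is_union_def by auto
      then show "factors C c B W"
        using factors_trans[OF _ VW] V W c by blast
    qed
  qed
  then show ?thesis
    using V A unfolding is_union_def by (simp cong: conj_cong)
qed

lemma is_pushout_iso:
  assumes Q: "is_pushout C P A B Q p q i j" and k: "is_iso C Q U k" and U: "U \<in> Obj C"
  shows "is_pushout C P A B U p q (Comp C A Q U k i) (Comp C B Q U k j)"
proof -
  obtain h where h [simp]: "k \<in> Hom C Q U" "h \<in> Hom C U Q" and e: "Comp C Q U Q h k = Id C Q" "Comp C U Q U k h = Id C U"
    using k by (rule is_iso_inverse)
  note [simp] = is_pushoutD(1-8)[OF Q] U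
  have "\<exists>!r. r \<in> Hom C U X \<and> Comp C A U X r (Comp C A Q U k i) = f \<and> Comp C B U X r (Comp C B Q U k j) = g"
    if X [simp]: "X \<in> Obj C" "f \<in> Hom C A X" "g \<in> Hom C B X" and fg: "Comp C P A X f p = Comp C P B X g q" for X f g
  proof -
    obtain r where r: "r \<in> Hom C Q X" "Comp C A Q X r i = f" "Comp C B Q X r j = g"
      using is_pushout_lift[OF Q X fg] .
    note [simp] = r(1)
    let ?r = "Comp C U Q X r h"
    have 1: "Comp C A U X ?r (Comp C A Q U k i) = f" "Comp C B U X ?r (Comp C B Q U k j) = g"
      using slide1[OF e(1), of i A] slide1[OF e(1), of j B] r by (simp_all add: assoc)
    have 2: "s = ?r" if s [simp]: "s \<in> Hom C U X" and se: "Comp C A U X s (Comp C A Q U k i) = f" "Comp C B U X s (Comp C B Q U k j) = g" for s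
    proof -
      have "Comp C Q U X s k = r"
        by (rule is_pushout_unique[OF Q X(1)]) (use se r in \<open>simp_all add: assoc\<close>)
      then have "Comp C U U X s (Comp C U Q U k h) = ?r"
        by (simp flip: assoc)
      then show ?thesis by (simp add: e)
    qed
    show ?thesis
      by (rule ex1I[of _ ?r]) (use 1 2 in auto)
  qed
  moreover have "Comp C P A U (Comp C A Q U k i) p = Comp C P B U (Comp C B Q U k j) q"
    using is_pushoutD(9)[OF Q] by (simp add: assoc)
  ultimately show ?thesis unfolding is_pushout_iff by auto
qed

lemma is_initial_hom_eq: "\<lbrakk>is_initial C x; f \<in> Hom C x y; g \<in> Hom C x y; y \<in> Obj C\<rbrakk> \<Longrightarrow> f = g"
  unfolding is_initial_def by blast

lemma strict_initial_over:
  assumes z: "is_strict_initial C z" and f: "f \<in> Hom C x z" "x \<in> Obj C"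
  shows "is_initial C x"
  unfolding is_initial_def
proof (intro conjI ballI f)
  fix y assume y: "y \<in> Obj C"
  have z': "is_initial C z" "z \<in> Obj C" using z unfolding is_strict_initial_def is_initial_def by auto
  obtain h where h: "h \<in> Hom C z y" using z' y unfolding is_initial_def by blast
  have "is_iso C x z f" using z f unfolding is_strict_initial_def by blast
  then obtain g where g: "f \<in> Hom C x z" "g \<in> Hom C z x" "Comp C x z x g f = Id C x" by (rule is_iso_inverse)
  have "k = k'" if k: "k \<in> Hom C x y" "k' \<in> Hom C x y" for k k'
  proof -
    have "Comp C z x y k g = Comp C z x y k' g"
      by (rule is_initial_hom_eq[OF z'(1)]) (use g k y z' f in auto)
    from slide[OF this f(1)] show ?thesis using g k y z' f by simp
  qed
  moreover have "Comp C x z y h f \<in> Hom C x y" using h f y z' by simp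
  ultimately show "\<exists>!f. f \<in> Hom C x y" by blast
qed

text \<open>As \<open>w\<close> maps to \<open>z\<close>, every object over \<open>w\<close> is
  initial by strictness. Hence any two arrows into \<open>w\<close> with a common source agree, and
  \<open>m\<close> is monic.\<close>

lemma strict_initial_bottom:
  assumes z: "is_strict_initial C z" and c: "c \<in> Obj C" and m: "m \<in> Hom C w c" and w: "is_initial C w"
  shows "is_union C c {} (w, m)"
proof -
  have z': "is_initial C z" "z \<in> Obj C" using z unfolding is_strict_initial_def is_initial_def by auto
  have w': "w \<in> Obj C" using w unfolding is_initial_def by blast
  obtain u where u: "u \<in> Hom C w z" using w z' unfolding is_initial_def by blast
  have "is_mono C w c m"
    unfolding is_mono_def
  proof (intro conjI ballI impI m)
    fix x g h assume x: "x \<in> Obj C" "g \<in> Hom C x w" "h \<in> Hom C x w"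
    then have "Comp C x w z u g \<in> Hom C x z" using u w' z' by simp
    from strict_initial_over[OF z this x(1)] show "g = h"
      using x w' by - (rule is_initial_hom_eq[where y = w], auto)
  qed
  moreover have "factors C c (w, m) V" if V: "V \<in> subobjects C c" for V
  proof -
    from V obtain D d where D: "V = (D, d)" "D \<in> Obj C" "d \<in> Hom C D c" by (metis subobjectsE)
    obtain h where h: "h \<in> Hom C w D" using w D unfolding is_initial_def by blast
    have "Comp C w D c d h = m"
      by (rule is_initial_hom_eq[OF w, where y = c]) (use h D c m w' in auto)
    then show ?thesis using h D by (auto intro: factorsI)
  qed
  ultimately show ?thesis unfolding is_union_def using w' by (auto simp: subobjects_def)
qed

text \<open>Cancellation in the pasting law: \<open>A'\<close> is the inverse image of
  \<open>A\<close> along the restriction \<open>s\<close> of \<open>f\<close> to the inverse image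
  of \<open>Q\<close>.\<close>

lemma is_pullback_left:
  assumes A': "is_pullback C A' A X c pA a' (Comp C A Q c m i) f" and U: "is_pullback C U' Q X c s u' m f"
    and i: "i \<in> Hom C A Q"
  obtains i' where "i' \<in> Hom C A' U'" "Comp C A' U' X u' i' = a'" "is_pullback C A' A U' Q pA i' i s"
proof -
  note [simp] = is_pullbackD(1-8)[OF A'] is_pullbackD(1-8)[OF U] i
  have "Comp C A' Q c m (Comp C A' A Q i pA) = Comp C A' X c f a'"
    using is_pullbackD(9)[OF A'] by (simp add: assoc)
  then obtain i' where i': "i' \<in> Hom C A' U'" "Comp C A' U' Q s i' = Comp C A' A Q i pA" "Comp C A' U' X u' i' = a'"
    by (rule is_pullback_lift[OF U, rotated 3]) auto
  note [simp] = i'(1)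
  have "is_pullback C A' A U' Q pA i' i s"
  proof (rule is_pullbackI)
    fix W g h assume W [simp]: "W \<in> Obj C" "g \<in> Hom C W A" "h \<in> Hom C W U'" and e: "Comp C W A Q i g = Comp C W U' Q s h"
    have "Comp C W A c (Comp C A Q c m i) g = Comp C W X c f (Comp C W U' X u' h)"
      using slide[OF is_pullbackD(9)[OF U], of h W] e by (simp add: assoc)
    then obtain k where k: "k \<in> Hom C W A'" "Comp C W A' A pA k = g" "Comp C W A' X a' k = Comp C W U' X u' h"
      by (rule is_pullback_lift[OF A', rotated 3]) auto
    note [simp] = k(1)
    have "Comp C W A' U' i' k = h"
      by (rule is_pullback_unique[OF U]) (use slide[OF i'(2), of k W] slide1[OF i'(3), of k W] k e in simp_all)
    then show "\<exists>h'\<in>Hom C W A'. Comp C W A' A pA h' = g \<and> Comp C W A' U' i' h' = h" using k by blast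
  next
    fix W h k assume W [simp]: "W \<in> Obj C" "h \<in> Hom C W A'" "k \<in> Hom C W A'" and
      e: "Comp C W A' A pA h = Comp C W A' A pA k" "Comp C W A' U' i' h = Comp C W A' U' i' k"
    have "Comp C W U' X u' (Comp C W A' U' i' k) = Comp C W A' X a' k"
      "Comp C W U' X u' (Comp C W A' U' i' h) = Comp C W A' X a' h"
      by (simp_all add: slide1[OF i'(3)])
    then have "Comp C W A' X a' h = Comp C W A' X a' k" using e(2) by metis
    then show "h = k"
      using is_pullback_unique[OF A' W e(1)] by blast
  qed (use i' in auto)
  then show ?thesis using that i' by blast
qed

lemma is_pullback_iso:
  assumes U: "is_pullback C U' U X c s u' u f" and h: "h \<in> Hom C U Q" "Comp C U Q c m h = u"
    and k: "k \<in> Hom C Q U" "Comp C Q U c u k = m" and u: "is_mono C U c u" and m: "is_mono C Q c m" and Q: "Q \<in> Obj C"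
  shows "is_pullback C U' Q X c (Comp C U' U Q h s) u' m f"
proof (rule is_pullbackI)
  note [simp] = is_pullbackD(1-8)[OF U] Q h(1) k(1) is_mono_in[OF m]
  show "Comp C U' Q c m (Comp C U' U Q h s) = Comp C U' X c f u'"
    using slide1[OF h(2), of s U'] is_pullbackD(9)[OF U] by simp
  fix W g r assume W [simp]: "W \<in> Obj C" "g \<in> Hom C W Q" "r \<in> Hom C W X" and e: "Comp C W Q c m g = Comp C W X c f r"
  have "Comp C W U c u (Comp C W Q U k g) = Comp C W X c f r"
    using slide1[OF k(2), of g W] e by simp
  then obtain l where l: "l \<in> Hom C W U'" "Comp C W U' U s l = Comp C W Q U k g" "Comp C W U' X u' l = r"
    by (rule is_pullback_lift[OF U, rotated 3]) auto
  note [simp] = l(1)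
  have "Comp C W U' Q (Comp C U' U Q h s) l = g"
    by (rule is_monoD[OF m]) (use l(2) slide1[OF h(2), of "Comp C W Q U k g" W] slide1[OF k(2), of g W] in \<open>auto simp: assoc\<close>)
  then show "\<exists>l\<in>Hom C W U'. Comp C W U' Q (Comp C U' U Q h s) l = g \<and> Comp C W U' X u' l = r" using l by blast
next
  note [simp] = is_pullbackD(1-8)[OF U] Q h(1) k(1) is_mono_in[OF m]
  fix W l l' assume W [simp]: "W \<in> Obj C" "l \<in> Hom C W U'" "l' \<in> Hom C W U'" and e: "Comp C W U' X u' l = Comp C W U' X u' l'"
  show "l = l'"
    by (rule is_pullback_unique[OF U]) (use is_monoD[OF u, of W "Comp C W U' U s l" "Comp C W U' U s l'"]
      slide[OF is_pullbackD(9)[OF U], of l W] slide[OF is_pullbackD(9)[OF U], of l' W] e in simp_all)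
qed (use is_pullbackD[OF U] Q h k is_mono_in[OF m] in auto)

end

section \<open>From stable pushouts to effective stable unions\<close>

locale stable_pushouts = finlim_cat +
  assumes strict_initial: "\<exists>z. is_strict_initial C z"
    and stable_pushouts: "has_stable_pushouts_of_pullbacks_of_monos C"
begin

lemma ex_stable_pushout:
  assumes P: "is_pullback C P A B c p q a b" and a: "is_mono C A c a" "is_mono C B c b"
  obtains Q i j m where "is_stable_pushout C P A B Q p q i j" "m \<in> Hom C Q c" "Comp C A Q c m i = a" "Comp C B Q c m j = b"
    "is_mono C Q c m" "is_union C c {(A, a), (B, b)} (Q, m)"
proof -
  note P1 = is_pullbackD[OF P]
  have "\<exists>Q i j. is_stable_pushout C P A B Q p q i j"
    using stable_pushouts P1(2-4) a P unfolding has_stable_pushouts_of_pullbacks_of_monos_def by blast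
  then obtain Q i j where Q: "is_stable_pushout C P A B Q p q i j" by blast
  note po = is_stable_pushoutD[OF Q]
  obtain m where m: "m \<in> Hom C Q c" "Comp C A Q c m i = a" "Comp C B Q c m j = b"
    using is_pushout_lift[OF po P1(4,7,8,9)] by blast
  have mm: "is_mono C Q c m" by (rule stable_pushout_mono[OF Q P a m])
  show ?thesis using that[OF Q m mm] pushout_is_union[OF po mm P1(4) a m(2,3)] .
qed

lemma finite_unions: "has_finite_unions C"
  unfolding has_finite_unions_def
proof (intro ballI allI impI, elim conjE)
  fix c T assume c: "c \<in> Obj C" and T: "finite T" "T \<subseteq> subobjects C c"
  from T show "\<exists>U. is_union C c T U"
  proof (induction T rule: finite_induct)
    case empty
    obtain z where z: "is_strict_initial C z" using strict_initial by blast
    then have z': "is_initial C z" unfolding is_strict_initial_def by blast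
    then obtain m where "m \<in> Hom C z c" using c unfolding is_initial_def by blast
    then show ?case using strict_initial_bottom[OF z c _ z'] by blast
  next
    case (insert A T)
    then obtain V where V: "is_union C c T V" by auto
    have A: "A \<in> subobjects C c" using insert by auto
    obtain A0 a where A0: "A = (A0, a)" "A0 \<in> Obj C" "is_mono C A0 c a" "a \<in> Hom C A0 c" using A by (rule subobjectsE)
    have "V \<in> subobjects C c" using V unfolding is_union_def by auto
    then obtain V0 v where V0: "V = (V0, v)" "V0 \<in> Obj C" "is_mono C V0 c v" "v \<in> Hom C V0 c" by (rule subobjectsE)
    obtain P p q where P: "is_pullback C P A0 V0 c p q a v"
      by (rule ex_pullback[OF A0(4) V0(4) A0(2) V0(2) c])
    show ?case
      using ex_stable_pushout[OF P A0(3) V0(3)] is_union_insert_iff[OF V A c] unfolding A0 V0 by metis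
  qed
qed

text \<open>Unions are determined up to isomorphism and the stable pushout over the intersection is
  one, so every union of two subobjects arises in this way; \<open>h\<close> and \<open>k\<close>
  are the mutually inverse comparisons.\<close>

lemma is_union_stable_pushout:
  assumes U: "is_union C c {(A, a), (B, b)} (U, u)" and P: "is_pullback C P A B c p q a b"
  obtains Q i j m h k where "is_stable_pushout C P A B Q p q i j" "m \<in> Hom C Q c" "Comp C A Q c m i = a" "Comp C B Q c m j = b"
    "is_mono C Q c m" "is_mono C U c u" "U \<in> Obj C" "h \<in> Hom C U Q" "Comp C U Q c m h = u"
    "k \<in> Hom C Q U" "Comp C Q U c u k = m" "is_iso C Q U k"
proof -
  have ab: "is_mono C A c a" "is_mono C B c b" and u: "is_mono C U c u" "U \<in> Obj C" "(U, u) \<in> subobjects C c"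
    using U unfolding is_union_def subobjects_def by auto
  obtain Q i j m where Q: "is_stable_pushout C P A B Q p q i j" "m \<in> Hom C Q c" "Comp C A Q c m i = a" "Comp C B Q c m j = b"
    "is_mono C Q c m" and un: "is_union C c {(A, a), (B, b)} (Q, m)"
    by (rule ex_stable_pushout[OF P ab])
  note [simp] = is_pushoutD(1-8)[OF is_stable_pushoutD[OF Q(1)]] Q(2) u(2) is_mono_in[OF u(1)] is_pullbackD(4)[OF P]
  have "factors C c (U, u) (Q, m)" "factors C c (Q, m) (U, u)"
    using U un unfolding is_union_def by auto
  then obtain h k where h: "h \<in> Hom C U Q" "Comp C U Q c m h = u" and k: "k \<in> Hom C Q U" "Comp C Q U c u k = m"
    by (metis factorsD)
  note [simp] = h(1) k(1)
  have "Comp C Q U Q h k = Id C Q"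
    by (rule is_monoD[OF Q(5), of Q]) (use slide1[OF h(2), of k Q] k in simp_all)
  moreover have "Comp C U Q U k h = Id C U"
    by (rule is_monoD[OF u(1), of U]) (use slide1[OF k(2), of h U] h in simp_all)
  ultimately have "is_iso C Q U k" unfolding is_iso_def by auto
  then show ?thesis using that[OF Q u(1,2) h k] by blast
qed

lemma unions_effective: "finite_unions_effective C"
  unfolding finite_unions_effective_def
proof (intro ballI allI impI, elim conjE)
  fix c A a B b U u P p q i j
  assume U: "is_union C c {(A, a), (B, b)} (U, u)" and P: "is_pullback C P A B c p q a b"
    and i: "i \<in> Hom C A U" "Comp C A U c u i = a" and j: "j \<in> Hom C B U" "Comp C B U c u j = b"
  obtain Q i' j' m h k where Q: "is_stable_pushout C P A B Q p q i' j'" "m \<in> Hom C Q c" "Comp C A Q c m i' = a" "Comp C B Q c m j' = b"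
    "is_mono C Q c m" "is_mono C U c u" "U \<in> Obj C" "h \<in> Hom C U Q" "Comp C U Q c m h = u"
    "k \<in> Hom C Q U" "Comp C Q U c u k = m" "is_iso C Q U k"
    by (rule is_union_stable_pushout[OF U P])
  note po = is_stable_pushoutD[OF Q(1)]
  note [simp] = is_pushoutD(1-8)[OF po] Q(2,7,8,10) is_mono_in[OF Q(6)] is_pullbackD(4)[OF P]
  have "Comp C A Q U k i' = i"
    by (rule is_monoD[OF Q(6)]) (use slide1[OF Q(11), of i' A] Q(3) i in auto)
  moreover have "Comp C B Q U k j' = j"
    by (rule is_monoD[OF Q(6)]) (use slide1[OF Q(11), of j' B] Q(4) j in auto)
  ultimately show "is_pushout C P A B U p q i j"
    using is_pushout_iso[OF po Q(12,7)] by simp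
qed

text \<open>The union is replaced by the pushout \<open>Q\<close>. Then \<open>f\<close> restricts
  to an arrow \<open>U' -> Q\<close>, along which the pushout is pulled back to one with vertex
  \<open>U'\<close>, and a pushout of this kind is a union.\<close>

lemma binary_union_stable:
  assumes U: "is_union C c {(A, a), (B, b)} (U, u)" and f: "f \<in> Hom C X c" "X \<in> Obj C" "c \<in> Obj C"
    and A': "is_pullback C A' A X c pA a' a f" and B': "is_pullback C B' B X c pB b' b f"
    and U': "is_pullback C U' U X c pU u' u f"
  shows "is_union C X {(A', a'), (B', b')} (U', u')"
proof -
  note A1 = is_pullbackD[OF A'] and B1 = is_pullbackD[OF B'] and U1 = is_pullbackD[OF U']
  have ab: "is_mono C A c a" "is_mono C B c b" "is_mono C U c u" using U unfolding is_union_def subobjects_def by auto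
  obtain P p q where P: "is_pullback C P A B c p q a b"
    by (rule ex_pullback[OF A1(7) B1(7) A1(2) B1(2) f(3)])
  obtain Q i j m h k where Q: "is_stable_pushout C P A B Q p q i j" "m \<in> Hom C Q c" "Comp C A Q c m i = a" "Comp C B Q c m j = b"
    "is_mono C Q c m" "is_mono C U c u" "U \<in> Obj C" "h \<in> Hom C U Q" "Comp C U Q c m h = u"
    "k \<in> Hom C Q U" "Comp C Q U c u k = m" "is_iso C Q U k"
    by (rule is_union_stable_pushout[OF U P])
  note Q1 = is_pushoutD[OF is_stable_pushoutD[OF Q(1)]]
  have UQ: "is_pullback C U' Q X c (Comp C U' U Q h pU) u' m f"
    by (rule is_pullback_iso[OF U' Q(8-11,6,5) Q1(4)])
  obtain i' where i': "i' \<in> Hom C A' U'" "Comp C A' U' X u' i' = a'" "is_pullback C A' A U' Q pA i' i (Comp C U' U Q h pU)"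
    by (rule is_pullback_left[OF A'[folded Q(3)] UQ Q1(7)])
  obtain j' where j': "j' \<in> Hom C B' U'" "Comp C B' U' X u' j' = b'" "is_pullback C B' B U' Q pB j' j (Comp C U' U Q h pU)"
    by (rule is_pullback_left[OF B'[folded Q(4)] UQ Q1(8)])
  have s: "Comp C U' U Q h pU \<in> Hom C U' Q" using Q U1 Q1 by simp
  obtain P' p' q' where "is_stable_pushout C P' A' B' U' p' q' i' j'"
    by (rule stable_pushout_pullback'[OF Q(1) U1(1) s i'(3) j'(3)])
  from is_stable_pushoutD[OF this] show ?thesis
    by (rule pushout_is_union) (use i' j' f is_pullback_mono[OF A' ab(1)] is_pullback_mono[OF B' ab(2)] is_pullback_mono[OF U' ab(3)] in auto)
qed

text \<open>Induction on the family, generalized over the union since the step needs a new subobject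
  \<open>V\<close> for the smaller family. For the empty family, the bottom subobject maps to a
  strict initial object, hence so does its inverse image, which is therefore initial and again a
  bottom.\<close>

lemma unions_stable: "finite_unions_stable C"
  unfolding finite_unions_stable_def
proof (intro ballI allI impI, elim conjE)
  fix c X f T U U' \<rho>
  assume c: "c \<in> Obj C" and X: "X \<in> Obj C" "f \<in> Hom C X c" and T: "finite T" "is_union C c T U"
    "is_inverse_image C X c f U U'" "\<forall>A\<in>T. is_inverse_image C X c f A (\<rho> A)"
  from T show "is_union C X (\<rho> ` T) U'"
  proof (induction T arbitrary: U U' rule: finite_induct)
    case empty
    obtain U0 u where U: "U = (U0, u)" by (cases U)
    obtain W w where W: "U' = (W, w)" by (cases U')
    obtain h where P: "is_pullback C W U0 X c h w u f" using empty unfolding U W is_inverse_image_def by auto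
    note P1 = is_pullbackD[OF P]
    obtain z where z: "is_strict_initial C z" using strict_initial by blast
    then have z': "is_initial C z" "z \<in> Obj C" unfolding is_strict_initial_def is_initial_def by auto
    then obtain m where m: "m \<in> Hom C z c" using c unfolding is_initial_def by blast
    have "(z, m) \<in> subobjects C c" using strict_initial_bottom[OF z c m z'(1)] unfolding is_union_def by blast
    then have "factors C c (U0, u) (z, m)" using empty unfolding U is_union_def by auto
    then obtain g where "g \<in> Hom C U0 z" by (rule factorsD)
    then have "Comp C W U0 z g h \<in> Hom C W z" using P1 z' by auto
    then have "is_initial C W" using strict_initial_over[OF z] P1 by blast
    then show ?case unfolding W using strict_initial_bottom[OF z X(1) P1(6)] by simp
  next
    case (insert A T)
    have sub: "A \<in> subobjects C c" "T \<subseteq> subobjects C c" using insert.prems(1) unfolding is_union_def by auto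
    obtain V where V: "is_union C c T V" using finite_unions insert(1) sub c unfolding has_finite_unions_def by blast
    have un: "is_union C c {A, V} U" using insert is_union_insert_iff[OF V sub(1) c] by blast
    obtain A0 a where A0: "A = (A0, a)" "A0 \<in> Obj C" "is_mono C A0 c a" "a \<in> Hom C A0 c" using sub(1) by (rule subobjectsE)
    have "V \<in> subobjects C c" using V unfolding is_union_def by auto
    then obtain V0 v where V0: "V = (V0, v)" "V0 \<in> Obj C" "is_mono C V0 c v" "v \<in> Hom C V0 c" by (rule subobjectsE)
    obtain V' pV v' where V': "is_pullback C V' V0 X c pV v' v f"
      by (rule ex_pullback[OF V0(4) X(2) V0(2) X(1) c])
    then have "is_inverse_image C X c f V (V', v')" unfolding V0 is_inverse_image_def by auto
    then have IH: "is_union C X (\<rho> ` T) (V', v')"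
      using insert.IH[OF V] insert.prems(3) by blast
    obtain U0 u where U: "U = (U0, u)" by (cases U)
    obtain W w where W: "U' = (W, w)" by (cases U')
    obtain A' a' where A': "\<rho> A = (A', a')" by (cases "\<rho> A")
    obtain pA where pA: "is_pullback C A' A0 X c pA a' a f" using insert A' A0 unfolding is_inverse_image_def by auto
    obtain pU where pU: "is_pullback C W U0 X c pU w u f" using insert unfolding U W is_inverse_image_def by auto
    have "is_union C X {(A', a'), (V', v')} (W, w)"
      by (rule binary_union_stable[OF un[unfolded A0 V0 U] X(2,1) c pA V' pU])
    moreover have "(A', a') \<in> subobjects C X"
      using is_pullback_mono[OF pA A0(3)] is_pullbackD[OF pA] by (simp add: subobjects_def)
    ultimately show ?case
      using is_union_insert_iff[OF IH _ X(1)] A' W by auto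
  qed
qed

end

theorem (in finlim_cat) stable_pushouts_iff_unions:
  "(\<exists>z. is_strict_initial C z) \<and> has_stable_pushouts_of_pullbacks_of_monos C \<longleftrightarrow>
     has_finite_unions C \<and> finite_unions_effective C \<and> finite_unions_stable C"
proof
  assume "(\<exists>z. is_strict_initial C z) \<and> has_stable_pushouts_of_pullbacks_of_monos C"
  then interpret stable_pushouts C by unfold_locales auto
  show "has_finite_unions C \<and> finite_unions_effective C \<and> finite_unions_stable C"
    using finite_unions unions_effective unions_stable by blast
next
  assume "has_finite_unions C \<and> finite_unions_effective C \<and> finite_unions_stable C"
  then show "(\<exists>z. is_strict_initial C z) \<and> has_stable_pushouts_of_pullbacks_of_monos C"
    using unions_imp_strict_initial unions_imp_stable_pushouts by blast
qed

section \<open>Presheaves\<close>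

lemma small_subset: "\<lbrakk>small U X; Y \<subseteq> X\<rbrakk> \<Longrightarrow> small U Y"
  unfolding small_def using card_of_mono1 ordLeq_ordLess_trans by blast

lemma small_empty: "small U (X :: 'x set) \<Longrightarrow> small U ({} :: 'x set)"
  by (rule small_subset[of U X]) auto

section \<open>Presheaves and their transformations in terms of elements\<close>

abbreviation presheaf :: "('o, 'u) cat \<Rightarrow> ('o, 'u, 'u set, 'u \<Rightarrow> 'u) func \<Rightarrow> bool" where
  "presheaf C P \<equiv> is_functor (op C) Set_cat P"

abbreviation pnat :: "('o, 'u) cat \<Rightarrow> ('o, 'u, 'u set, 'u \<Rightarrow> 'u) func \<Rightarrow>
    ('o, 'u, 'u set, 'u \<Rightarrow> 'u) func \<Rightarrow> ('o \<Rightarrow> 'u \<Rightarrow> 'u) set" where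
  "pnat C \<equiv> nat_trans (op C) Set_cat"

lemma Set_cat_simps [simp]:
  "Obj Set_cat = {X. small TYPE('u) (X :: 'u set)}" "Hom Set_cat X Y = (X \<rightarrow>\<^sub>E Y)"
  "Id Set_cat X = (\<lambda>x\<in>X. x)" "Comp Set_cat X Y Z g f = compose X g f"
  by (simp_all add: Set_cat_def)

lemma presheafI:
  fixes C :: "('o, 'u) cat"
  assumes "\<And>a. a \<in> Obj C \<Longrightarrow> small TYPE('u) (fobj P a)"
    and "\<And>a b f x. \<lbrakk>a \<in> Obj C; b \<in> Obj C; f \<in> Hom C b a; x \<in> fobj P a\<rbrakk> \<Longrightarrow> farr P a b f x \<in> fobj P b"
    and "\<And>a b f x. \<lbrakk>a \<in> Obj C; b \<in> Obj C; f \<in> Hom C b a; x \<notin> fobj P a\<rbrakk> \<Longrightarrow> farr P a b f x = undefined"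
    and "\<And>a x. \<lbrakk>a \<in> Obj C; x \<in> fobj P a\<rbrakk> \<Longrightarrow> farr P a a (Id C a) x = x"
    and "\<And>a b c f g x. \<lbrakk>a \<in> Obj C; b \<in> Obj C; c \<in> Obj C; f \<in> Hom C b a; g \<in> Hom C c b; x \<in> fobj P a\<rbrakk> \<Longrightarrow>
      farr P a c (Comp C c b a f g) x = farr P b c g (farr P a b f x)"
    and "category C"
  shows "presheaf C P"
proof -
  interpret cat C by unfold_locales fact
  show ?thesis
    unfolding is_functor_def
  proof (intro conjI ballI)
    fix a assume a: "a \<in> Obj (op C)"
    then show "fobj P a \<in> Obj Set_cat" using assms(1) by simp
    show "farr P a a (Id (op C) a) = Id Set_cat (fobj P a)"
      using assms(3,4) a by (auto simp: fun_eq_iff)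
    fix b assume b: "b \<in> Obj (op C)"
    { fix f assume "f \<in> Hom (op C) a b"
      then show "farr P a b f \<in> Hom Set_cat (fobj P a) (fobj P b)" using assms(2,3) a b by (auto intro!: PiE_I)
    }
    fix c f g assume c: "c \<in> Obj (op C)" and f: "f \<in> Hom (op C) a b" and g: "g \<in> Hom (op C) b c"
    show "farr P a c (Comp (op C) a b c g f) = Comp Set_cat (fobj P a) (fobj P b) (fobj P c) (farr P b c g) (farr P a b f)"
    proof
      fix x show "farr P a c (Comp (op C) a b c g f) x = Comp Set_cat (fobj P a) (fobj P b) (fobj P c) (farr P b c g) (farr P a b f) x"
        using a b c f g assms(3)[of a c _ x] assms(5) by (cases "x \<in> fobj P a") (auto simp: compose_def)
    qed
  qed
qed

context
  fixes C :: "('o, 'u) cat" and P :: "('o, 'u, 'u set, 'u \<Rightarrow> 'u) func"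
  assumes P: "presheaf C P"
begin

lemma presheaf_small: "a \<in> Obj C \<Longrightarrow> small TYPE('u) (fobj P a)"
  using P unfolding is_functor_def by simp

lemma presheaf_PiE: "\<lbrakk>f \<in> Hom C b a; a \<in> Obj C; b \<in> Obj C\<rbrakk> \<Longrightarrow> farr P a b f \<in> fobj P a \<rightarrow>\<^sub>E fobj P b"
  using P unfolding is_functor_def by (metis op_simps(1,2) Set_cat_simps(2))

lemma presheaf_in:
  "\<lbrakk>x \<in> fobj P a; f \<in> Hom C b a; a \<in> Obj C; b \<in> Obj C\<rbrakk> \<Longrightarrow> farr P a b f x \<in> fobj P b"
  using presheaf_PiE by blast

lemma presheaf_id: "\<lbrakk>x \<in> fobj P a; a \<in> Obj C\<rbrakk> \<Longrightarrow> farr P a a (Id C a) x = x"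
  using P unfolding is_functor_def by simp

lemma presheaf_comp:
  assumes "x \<in> fobj P a" "f \<in> Hom C b a" "g \<in> Hom C c b" "a \<in> Obj C" "b \<in> Obj C" "c \<in> Obj C"
  shows "farr P a c (Comp C c b a f g) x = farr P b c g (farr P a b f x)"
proof -
  have "farr P a c (Comp C c b a f g) = compose (fobj P a) (farr P b c g) (farr P a b f)"
    using P assms(2-) unfolding is_functor_def by (metis op_simps(1,2,4) Set_cat_simps(4))
  then show ?thesis using assms(1) by (simp add: compose_def)
qed

end

lemma pnat_in: "\<lbrakk>\<theta> \<in> pnat C P Q; x \<in> fobj P a; a \<in> Obj C\<rbrakk> \<Longrightarrow> \<theta> a x \<in> fobj Q a"
  unfolding nat_trans_def by (auto dest: PiE_mem)

lemma pnat_natural: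
  assumes "\<theta> \<in> pnat C P Q" "x \<in> fobj P a" "f \<in> Hom C b a" "a \<in> Obj C" "b \<in> Obj C"
  shows "farr Q a b f (\<theta> a x) = \<theta> b (farr P a b f x)"
proof -
  have "compose (fobj P a) (farr Q a b f) (\<theta> a) = compose (fobj P a) (\<theta> b) (farr P a b f)"
    using assms unfolding nat_trans_def by simp
  then show ?thesis using assms(2) by (simp add: compose_def fun_eq_iff) metis
qed

lemma pnat_ext:
  assumes "\<theta> \<in> pnat C P Q" "\<theta>' \<in> pnat C P Q'"
    and "\<And>a x. \<lbrakk>a \<in> Obj C; x \<in> fobj P a\<rbrakk> \<Longrightarrow> \<theta> a x = \<theta>' a x"
  shows "\<theta> = \<theta>'"
proof
  fix a
  show "\<theta> a = \<theta>' a"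
  proof (cases "a \<in> Obj C")
    case True
    then have "\<theta> a \<in> fobj P a \<rightarrow>\<^sub>E fobj Q a" "\<theta>' a \<in> fobj P a \<rightarrow>\<^sub>E fobj Q' a"
      using assms(1,2) unfolding nat_trans_def by auto
    then show ?thesis using assms(3) True by (metis PiE_E ext)
  next
    case False
    then show ?thesis using assms(1,2) unfolding nat_trans_def by (simp add: PiE_iff extensional_def)
  qed
qed

lemma pnatI:
  assumes "\<And>a x. \<lbrakk>a \<in> Obj C; x \<in> fobj P a\<rbrakk> \<Longrightarrow> t a x \<in> fobj Q a"
    and "\<And>a b f x. \<lbrakk>a \<in> Obj C; b \<in> Obj C; f \<in> Hom C b a; x \<in> fobj P a\<rbrakk> \<Longrightarrow> farr Q a b f (t a x) = t b (farr P a b f x)"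
    and "presheaf C P"
  shows "(\<lambda>a\<in>Obj C. \<lambda>x\<in>fobj P a. t a x) \<in> pnat C P Q"
  unfolding nat_trans_def
  using assms(1,2) presheaf_in[OF assms(3)] by (auto simp: compose_def fun_eq_iff restrict_def)

lemma functor_cat_simps [simp]:
  "Obj (functor_cat A B) = {F. is_functor A B F}" "Hom (functor_cat A B) = nat_trans A B"
  by (simp_all add: functor_cat_def)

lemma presheaves_comp_apply [simp]:
  "\<lbrakk>a \<in> Obj C; x \<in> fobj P a\<rbrakk> \<Longrightarrow> Comp (presheaves C) P Q R \<sigma> \<tau> a x = \<sigma> a (\<tau> a x)"
  by (simp add: functor_cat_def compose_def)

lemma presheaves_id_apply [simp]:
  "\<lbrakk>a \<in> Obj C; x \<in> fobj P a\<rbrakk> \<Longrightarrow> Id (presheaves C) P a x = x"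
  by (simp add: functor_cat_def)

lemma presheaves_comp_in:
  assumes "\<tau> \<in> pnat C P Q" "\<sigma> \<in> pnat C Q R" "presheaf C P"
  shows "Comp (presheaves C) P Q R \<sigma> \<tau> \<in> pnat C P R"
proof -
  have "(\<lambda>a\<in>Obj C. \<lambda>x\<in>fobj P a. \<sigma> a (\<tau> a x)) \<in> pnat C P R"
    using assms by (intro pnatI) (simp_all add: pnat_in pnat_natural)
  then show ?thesis by (simp add: functor_cat_def compose_def)
qed

lemma presheaves_id_in: "presheaf C P \<Longrightarrow> Id (presheaves C) P \<in> pnat C P P"
proof -
  assume "presheaf C P"
  then have "(\<lambda>a\<in>Obj C. \<lambda>x\<in>fobj P a. x) \<in> pnat C P P"
    by (intro pnatI) simp_all
  then show ?thesis by (simp add: functor_cat_def)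
qed

lemma category_presheaves: "category (presheaves C)"
  unfolding category_def
proof (intro conjI ballI)
  fix P Q f assume P: "P \<in> Obj (presheaves C)" "Q \<in> Obj (presheaves C)" "f \<in> Hom (presheaves C) P Q"
  show "Comp (presheaves C) P P Q f (Id (presheaves C) P) = f"
    by (rule pnat_ext[of _ C P Q _ Q]) (use P in \<open>simp_all add: presheaves_comp_in presheaves_id_in\<close>)
  show "Comp (presheaves C) P Q Q (Id (presheaves C) Q) f = f"
    by (rule pnat_ext[of _ C P Q _ Q]) (use P in \<open>simp_all add: presheaves_comp_in presheaves_id_in pnat_in\<close>)
next
  fix P Q R S f g h assume P: "P \<in> Obj (presheaves C)" "Q \<in> Obj (presheaves C)" "R \<in> Obj (presheaves C)" "S \<in> Obj (presheaves C)"
    "f \<in> Hom (presheaves C) P Q" "g \<in> Hom (presheaves C) Q R" "h \<in> Hom (presheaves C) R S"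
  show "Comp (presheaves C) P R S h (Comp (presheaves C) P Q R g f) = Comp (presheaves C) P Q S (Comp (presheaves C) Q R S h g) f"
    by (rule pnat_ext[of _ C P S _ S]) (use P in \<open>simp_all add: presheaves_comp_in pnat_in\<close>)
qed (simp_all add: presheaves_comp_in presheaves_id_in)

definition subpresheaf :: "('o, 'u, 'u set, 'u \<Rightarrow> 'u) func \<Rightarrow> ('o \<Rightarrow> 'u set) \<Rightarrow> ('o, 'u, 'u set, 'u \<Rightarrow> 'u) func" where
  "subpresheaf R V = \<lparr>fobj = V, farr = (\<lambda>a b f. \<lambda>x\<in>V a. farr R a b f x)\<rparr>"

definition incl :: "('o, 'u) cat \<Rightarrow> ('o \<Rightarrow> 'u set) \<Rightarrow> 'o \<Rightarrow> 'u \<Rightarrow> 'u" where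
  "incl C V = (\<lambda>a\<in>Obj C. \<lambda>x\<in>V a. x)"

lemma fobj_subpresheaf [simp]: "fobj (subpresheaf R V) = V"
  by (simp add: subpresheaf_def)

lemma farr_subpresheaf [simp]: "x \<in> V a \<Longrightarrow> farr (subpresheaf R V) a b f x = farr R a b f x"
  by (simp add: subpresheaf_def)

lemma incl_apply [simp]: "\<lbrakk>a \<in> Obj C; x \<in> V a\<rbrakk> \<Longrightarrow> incl C V a x = x"
  by (simp add: incl_def)

locale locally_small_cat = cat C for C :: "('o, 'u) cat" +
  assumes locally_small: "locally_small C"
begin

lemma presheaf_subpresheaf:
  assumes R: "presheaf C R" and V: "\<And>a. a \<in> Obj C \<Longrightarrow> V a \<subseteq> fobj R a"
    and cl: "\<And>a b f x. \<lbrakk>a \<in> Obj C; b \<in> Obj C; f \<in> Hom C b a; x \<in> V a\<rbrakk> \<Longrightarrow> farr R a b f x \<in> V b"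
  shows "presheaf C (subpresheaf R V)"
proof (rule presheafI)
  fix a b c f g x assume "a \<in> Obj C" "b \<in> Obj C" "c \<in> Obj C" "f \<in> Hom C b a" "g \<in> Hom C c b" "x \<in> fobj (subpresheaf R V) a"
  then show "farr (subpresheaf R V) a c (Comp C c b a f g) x = farr (subpresheaf R V) b c g (farr (subpresheaf R V) a b f x)"
    using V presheaf_comp[OF R] cl by (simp add: subset_iff)
qed (use V cl presheaf_id[OF R] small_subset[OF presheaf_small[OF R]] category in \<open>auto simp: subset_iff subpresheaf_def\<close>)

lemma incl_in:
  assumes "presheaf C (subpresheaf R V)" and V: "\<And>a. a \<in> Obj C \<Longrightarrow> V a \<subseteq> fobj R a"
  shows "incl C V \<in> pnat C (subpresheaf R V) R"
proof -
  have "(\<lambda>a\<in>Obj C. \<lambda>x\<in>fobj (subpresheaf R V) a. x) \<in> pnat C (subpresheaf R V) R"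
    using assms by (intro pnatI) auto
  then show ?thesis by (simp add: incl_def)
qed

lemma pnat_corestrict:
  assumes "\<theta> \<in> pnat C P R" "presheaf C P" "\<And>a x. \<lbrakk>a \<in> Obj C; x \<in> fobj P a\<rbrakk> \<Longrightarrow> \<theta> a x \<in> V a"
  shows "\<theta> \<in> pnat C P (subpresheaf R V)"
proof -
  have "(\<lambda>a\<in>Obj C. \<lambda>x\<in>fobj P a. \<theta> a x) \<in> pnat C P (subpresheaf R V)"
    using assms by (intro pnatI) (simp_all add: pnat_natural)
  moreover have "(\<lambda>a\<in>Obj C. \<lambda>x\<in>fobj P a. \<theta> a x) \<in> pnat C P R"
    using assms by (intro pnatI) (simp_all add: pnat_in pnat_natural)
  then have "\<theta> = (\<lambda>a\<in>Obj C. \<lambda>x\<in>fobj P a. \<theta> a x)"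
    using assms(1) by - (rule pnat_ext, auto)
  ultimately show ?thesis by simp
qed

subsection \<open>The Yoneda lemma\<close>

lemma fobj_representable [simp]: "fobj (representable C c) a = Hom C a c"
  by (simp add: representable_def)

lemma farr_representable [simp]: "g \<in> Hom C b c \<Longrightarrow> farr (representable C c) b a f g = Comp C a b c g f"
  by (simp add: representable_def)

lemma presheaf_representable:
  assumes "c \<in> Obj C" shows "presheaf C (representable C c)"
  using assms locally_small category unfolding locally_small_def
  by (intro presheafI) (auto simp: assoc, auto simp: representable_def)

text \<open>The transformation that corresponds to the element \<open>x\<close> under the Yoneda
  lemma.\<close>

definition yo :: "('o, 'u, 'u set, 'u \<Rightarrow> 'u) func \<Rightarrow> 'o \<Rightarrow> 'u \<Rightarrow> 'o \<Rightarrow> 'u \<Rightarrow> 'u" where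
  "yo P c x = (\<lambda>a\<in>Obj C. \<lambda>f\<in>Hom C a c. farr P c a f x)"

lemma yo_apply [simp]: "\<lbrakk>a \<in> Obj C; f \<in> Hom C a c\<rbrakk> \<Longrightarrow> yo P c x a f = farr P c a f x"
  by (simp add: yo_def)

lemma yo_in:
  assumes P: "presheaf C P" and c: "c \<in> Obj C" "x \<in> fobj P c"
  shows "yo P c x \<in> pnat C (representable C c) P"
proof -
  have "(\<lambda>a\<in>Obj C. \<lambda>f\<in>fobj (representable C c) a. farr P c a f x) \<in> pnat C (representable C c) P"
    using c presheaf_in[OF P] presheaf_comp[OF P] presheaf_representable by (intro pnatI) auto
  then show ?thesis by (simp add: yo_def)
qed

lemma yo_id: "\<lbrakk>presheaf C P; c \<in> Obj C; x \<in> fobj P c\<rbrakk> \<Longrightarrow> yo P c x c (Id C c) = x"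
  by (simp add: presheaf_id)

lemma pnat_representable_apply:
  assumes "\<theta> \<in> pnat C (representable C c) P" "c \<in> Obj C" "a \<in> Obj C" "f \<in> Hom C a c"
  shows "\<theta> a f = farr P c a f (\<theta> c (Id C c))"
  using assms pnat_natural[OF assms(1), of "Id C c" c f a] by simp

lemma pnat_representable_eqI:
  assumes "\<theta> \<in> pnat C (representable C c) P" "\<theta>' \<in> pnat C (representable C c) P" "c \<in> Obj C"
    and "\<theta> c (Id C c) = \<theta>' c (Id C c)"
  shows "\<theta> = \<theta>'"
proof (rule pnat_ext[OF assms(1,2)])
  fix a f assume a: "a \<in> Obj C" "f \<in> fobj (representable C c) a"
  then have f: "f \<in> Hom C a c" by simp
  show "\<theta> a f = \<theta>' a f"
    using pnat_representable_apply[OF assms(1,3) a(1) f] pnat_representable_apply[OF assms(2,3) a(1) f] assms(4)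
    by metis
qed

lemma yoneda_arr_apply [simp]: "\<lbrakk>a \<in> Obj C; g \<in> Hom C a c\<rbrakk> \<Longrightarrow> yoneda_arr C c d h a g = Comp C a c d h g"
  by (simp add: yoneda_arr_def)

lemma yoneda_arr_in:
  assumes "h \<in> Hom C c d" "c \<in> Obj C" "d \<in> Obj C"
  shows "yoneda_arr C c d h \<in> pnat C (representable C c) (representable C d)"
proof -
  have "(\<lambda>a\<in>Obj C. \<lambda>g\<in>fobj (representable C c) a. Comp C a c d h g) \<in> pnat C (representable C c) (representable C d)"
    using assms presheaf_representable by (intro pnatI) (auto simp: assoc)
  then show ?thesis by (simp add: yoneda_arr_def)
qed

lemma yoneda_simps [simp]: "fobj (yoneda C) = representable C" "farr (yoneda C) = yoneda_arr C"
  by (simp_all add: yoneda_def)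

end

subsection \<open>Full subcategories of presheaves that contain the representables\<close>

text \<open>Used with all presheaves, with the small ones, with those locally isomorphic to a
  representable, and with the objects of \<open>Phi_l\<close>. That representables are present is
  what makes limits, pullbacks and monomorphisms pointwise in each of them.\<close>

locale presheaf_subcat = locally_small_cat C for C :: "('o, 'u) cat" +
  fixes S :: "('o, 'u, 'u set, 'u \<Rightarrow> 'u) func set"
  assumes representable_S: "c \<in> Obj C \<Longrightarrow> representable C c \<in> S"
begin

abbreviation A where "A \<equiv> full_subcat (presheaves C) S"

lemma category_A: "category A"
  by (rule category_full_subcat[OF category_presheaves])

sublocale A: cat A
  by unfold_locales (rule category_A)

lemma Obj_A [simp]: "P \<in> Obj A \<longleftrightarrow> presheaf C P \<and> P \<in> S"
  by simp

lemma representable_A: "c \<in> Obj C \<Longrightarrow> representable C c \<in> Obj A"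
  using presheaf_representable representable_S by simp

lemma A_comp_in: "\<lbrakk>\<tau> \<in> pnat C P Q; \<sigma> \<in> pnat C Q R; presheaf C P\<rbrakk> \<Longrightarrow> Comp A P Q R \<sigma> \<tau> \<in> pnat C P R"
  using presheaves_comp_in by simp

text \<open>By the Yoneda lemma, limits in such a category are computed pointwise.\<close>

definition pointwise_limit where
  "pointwise_limit J D v p \<longleftrightarrow>
     (\<forall>j\<in>Obj J. p j \<in> pnat C v (fobj D j)) \<and>
     (\<forall>i\<in>Obj J. \<forall>j\<in>Obj J. \<forall>u\<in>Hom J i j. \<forall>a\<in>Obj C. \<forall>x\<in>fobj v a. farr D i j u a (p i a x) = p j a x) \<and>
     (\<forall>a\<in>Obj C. \<forall>y. (\<forall>j\<in>Obj J. y j \<in> fobj (fobj D j) a) \<and>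
        (\<forall>i\<in>Obj J. \<forall>j\<in>Obj J. \<forall>u\<in>Hom J i j. farr D i j u a (y i) = y j) \<longrightarrow>
        (\<exists>!x. x \<in> fobj v a \<and> (\<forall>j\<in>Obj J. p j a x = y j)))"

lemma is_cone_A_iff:
  assumes D: "is_functor J A D"
  shows "is_cone J A D v p \<longleftrightarrow> v \<in> Obj A \<and> (\<forall>j\<in>Obj J. p j \<in> pnat C v (fobj D j)) \<and>
     (\<forall>i\<in>Obj J. \<forall>j\<in>Obj J. \<forall>u\<in>Hom J i j. \<forall>a\<in>Obj C. \<forall>x\<in>fobj v a. farr D i j u a (p i a x) = p j a x)"
    (is "_ \<longleftrightarrow> _ \<and> ?N \<and> ?R")
proof -
  have ob: "fobj D j \<in> Obj A" if "j \<in> Obj J" for j using D that unfolding is_functor_def by blast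
  have ar: "farr D i j u \<in> pnat C (fobj D i) (fobj D j)" if "i \<in> Obj J" "j \<in> Obj J" "u \<in> Hom J i j" for i j u
    using D that unfolding is_functor_def by (metis full_subcat_simps(2) functor_cat_simps(2))
  have "(\<forall>i\<in>Obj J. \<forall>j\<in>Obj J. \<forall>u\<in>Hom J i j. Comp A v (fobj D i) (fobj D j) (farr D i j u) (p i) = p j) \<longleftrightarrow> ?R"
    if v: "v \<in> Obj A" and p: ?N
  proof (intro ball_cong refl iffI ballI)
    fix i j u a x assume "i \<in> Obj J" "j \<in> Obj J" "u \<in> Hom J i j" "a \<in> Obj C" "x \<in> fobj v a"
      and "Comp A v (fobj D i) (fobj D j) (farr D i j u) (p i) = p j"
    then show "farr D i j u a (p i a x) = p j a x"
      by (metis presheaves_comp_apply full_subcat_simps(4))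
  next
    fix i j u assume i: "i \<in> Obj J" "j \<in> Obj J" "u \<in> Hom J i j"
      and e: "\<forall>a\<in>Obj C. \<forall>x\<in>fobj v a. farr D i j u a (p i a x) = p j a x"
    show "Comp A v (fobj D i) (fobj D j) (farr D i j u) (p i) = p j"
      by (rule pnat_ext[OF A_comp_in]) (use i e v ar p in auto)
  qed
  then show ?thesis unfolding is_cone_def by auto
qed

lemma is_limit_A_iff:
  assumes D: "is_functor J A D"
  shows "is_limit J A D v p \<longleftrightarrow> v \<in> Obj A \<and> pointwise_limit J D v p"
proof -
  have "fobj D j \<in> Obj A" if "j \<in> Obj J" for j using D that unfolding is_functor_def by blast
  then have ob: "presheaf C (fobj D j)" "fobj D j \<in> S" if "j \<in> Obj J" for j using that by simp_all
  have ar: "farr D i j u \<in> pnat C (fobj D i) (fobj D j)" if "i \<in> Obj J" "j \<in> Obj J" "u \<in> Hom J i j" for i j u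
    using D that unfolding is_functor_def by (metis full_subcat_simps(2) functor_cat_simps(2))
  show ?thesis
  proof
    assume L: "is_limit J A D v p"
    then have cone: "is_cone J A D v p" unfolding is_limit_def by blast
    note c = cone[unfolded is_cone_A_iff[OF D]]
    have pj: "p j \<in> pnat C v (fobj D j)" if "j \<in> Obj J" for j using c that by blast
    have v: "presheaf C v" using c by simp
    have un: "\<exists>!x. x \<in> fobj v a \<and> (\<forall>j\<in>Obj J. p j a x = y j)"
      if a: "a \<in> Obj C" and y: "\<And>j. j \<in> Obj J \<Longrightarrow> y j \<in> fobj (fobj D j) a"
        "\<And>i j u. \<lbrakk>i \<in> Obj J; j \<in> Obj J; u \<in> Hom J i j\<rbrakk> \<Longrightarrow> farr D i j u a (y i) = y j" for a y
    proof -
      \<comment> \<open>A compatible family of elements at \<open>a\<close> is a cone whose vertex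
        is the representable of \<open>a\<close>; this vertex is available since it lies in
        \<open>S\<close>.\<close>
      define q where "q j = yo (fobj D j) a (y j)" for j
      have q: "q j \<in> pnat C (representable C a) (fobj D j)" if "j \<in> Obj J" for j
        unfolding q_def using yo_in ob a y that by blast
      have "is_cone J A D (representable C a) q"
        unfolding is_cone_A_iff[OF D]
      proof (intro conjI ballI representable_A[OF a] q)
        fix i j u b f assume i: "i \<in> Obj J" "j \<in> Obj J" "u \<in> Hom J i j" and b: "b \<in> Obj C" "f \<in> fobj (representable C a) b"
        then show "farr D i j u b (q i b f) = q j b f"
          using pnat_natural[OF ar[OF i] y(1)[OF i(1)], of f b] a y by (simp add: q_def)
      qed
      then have ex: "\<exists>!h. h \<in> Hom A (representable C a) v \<and> (\<forall>j\<in>Obj J. Comp A (representable C a) v (fobj D j) (p j) h = q j)"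
        using L unfolding is_limit_def by blast
      then obtain h where h: "h \<in> pnat C (representable C a) v" "\<And>j. j \<in> Obj J \<Longrightarrow> Comp A (representable C a) v (fobj D j) (p j) h = q j"
        by auto
      have "p j a (h a (Id C a)) = y j" if "j \<in> Obj J" for j
        using h(2)[OF that, THEN fun_cong, of a, THEN fun_cong, of "Id C a"] a y that ob
        by (simp add: q_def presheaf_id)
      moreover have "h a (Id C a) \<in> fobj v a" using pnat_in[OF h(1)] a by simp
      moreover have "x = h a (Id C a)" if x: "x \<in> fobj v a" "\<forall>j\<in>Obj J. p j a x = y j" for x
      proof -
        have "Comp A (representable C a) v (fobj D j) (p j) (yo v a x) = q j" if j: "j \<in> Obj J" for j
        proof (rule pnat_representable_eqI[OF _ q[OF j] a])
          show "Comp A (representable C a) v (fobj D j) (p j) (yo v a x) \<in> pnat C (representable C a) (fobj D j)"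
            by (rule A_comp_in[OF yo_in[OF v a x(1)] pj[OF j] presheaf_representable[OF a]])
          show "Comp A (representable C a) v (fobj D j) (p j) (yo v a x) a (Id C a) = q j a (Id C a)"
            using x j a y(1)[OF j] by (simp add: q_def presheaf_id[OF v] presheaf_id[OF ob(1)])
        qed
        moreover have "yo v a x \<in> Hom A (representable C a) v" "h \<in> Hom A (representable C a) v"
          using yo_in[OF v a x(1)] h(1) by simp_all
        ultimately have "yo v a x = h" using ex h(2) by blast
        then show ?thesis using yo_id[OF v a x(1)] by simp
      qed
      ultimately show ?thesis by metis
    qed
    show "v \<in> Obj A \<and> pointwise_limit J D v p"
      unfolding pointwise_limit_def
    proof (intro conjI[OF conjunct1[OF c]] conjI ballI allI impI)
      show "\<exists>!x. x \<in> fobj v a \<and> (\<forall>j\<in>Obj J. p j a x = y j)"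
        if "a \<in> Obj C" "(\<forall>j\<in>Obj J. y j \<in> fobj (fobj D j) a) \<and>
          (\<forall>i\<in>Obj J. \<forall>j\<in>Obj J. \<forall>u\<in>Hom J i j. farr D i j u a (y i) = y j)" for a y
        by (rule un) (use that in auto)
    qed (use c in blast)+
  next
    assume v: "v \<in> Obj A \<and> pointwise_limit J D v p"
    then have cone: "is_cone J A D v p" unfolding is_cone_A_iff[OF D] pointwise_limit_def by blast
    have pj: "p j \<in> pnat C v (fobj D j)" if "j \<in> Obj J" for j using v that unfolding pointwise_limit_def by blast
    have un: "\<exists>!x. x \<in> fobj v a \<and> (\<forall>j\<in>Obj J. p j a x = y j)"
      if "a \<in> Obj C" "\<And>j. j \<in> Obj J \<Longrightarrow> y j \<in> fobj (fobj D j) a"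
        "\<And>i j u. \<lbrakk>i \<in> Obj J; j \<in> Obj J; u \<in> Hom J i j\<rbrakk> \<Longrightarrow> farr D i j u a (y i) = y j" for a y
      using v that unfolding pointwise_limit_def by blast
    have vP: "presheaf C v" using v by simp
    have "\<exists>!h. h \<in> Hom A w v \<and> (\<forall>j\<in>Obj J. Comp A w v (fobj D j) (p j) h = q j)"
      if "is_cone J A D w q" for w q
    proof -
      note q = that[unfolded is_cone_A_iff[OF D]]
      have qj: "q j \<in> pnat C w (fobj D j)" if "j \<in> Obj J" for j using q that by blast
      have w: "presheaf C w" using q by simp
      define t where "t a x = (THE z. z \<in> fobj v a \<and> (\<forall>j\<in>Obj J. p j a z = q j a x))" for a x
      have ex: "\<exists>!z. z \<in> fobj v a \<and> (\<forall>j\<in>Obj J. p j a z = q j a x)" if "a \<in> Obj C" "x \<in> fobj w a" for a x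
        by (rule un) (use that q pnat_in[OF qj] in auto)
      have t: "t a x \<in> fobj v a" "\<And>j. j \<in> Obj J \<Longrightarrow> p j a (t a x) = q j a x" if "a \<in> Obj C" "x \<in> fobj w a" for a x
        using theI'[OF ex[OF that]] unfolding t_def by auto
      have teq: "z = t a x" if "a \<in> Obj C" "x \<in> fobj w a" "z \<in> fobj v a" "\<And>j. j \<in> Obj J \<Longrightarrow> p j a z = q j a x" for a x z
        using ex[OF that(1,2)] that t by blast
      have h: "(\<lambda>a\<in>Obj C. \<lambda>x\<in>fobj w a. t a x) \<in> pnat C w v" (is "?h \<in> _")
      proof (rule pnatI)
        fix a b f x assume a: "a \<in> Obj C" "b \<in> Obj C" "f \<in> Hom C b a" "x \<in> fobj w a"
        show "farr v a b f (t a x) = t b (farr w a b f x)"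
        proof (rule teq)
          show "p j b (farr v a b f (t a x)) = q j b (farr w a b f x)" if "j \<in> Obj J" for j
            using pnat_natural[OF pj[OF that] t(1)[OF a(1,4)] a(3,1,2)] pnat_natural[OF qj[OF that] a(4,3,1,2)] t(2)[OF a(1,4) that]
            by simp
        qed (use a t presheaf_in[OF vP] presheaf_in[OF w] in auto)
      qed (use t w in auto)
      have h1: "Comp A w v (fobj D j) (p j) ?h = q j" if "j \<in> Obj J" for j
        by (rule pnat_ext[OF A_comp_in[OF h pj[OF that] w] qj[OF that]]) (use t that in auto)
      have h2: "k = ?h" if k: "k \<in> pnat C w v" "\<forall>j\<in>Obj J. Comp A w v (fobj D j) (p j) k = q j" for k
      proof (rule pnat_ext[OF k(1) h])
        fix a x assume a: "a \<in> Obj C" "x \<in> fobj w a"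
        have "k a x = t a x"
        proof (rule teq[OF a pnat_in[OF k(1) a(2,1)]])
          show "p j a (k a x) = q j a x" if "j \<in> Obj J" for j
            using k(2)[rule_format, OF that, THEN fun_cong, of a, THEN fun_cong, of x] a by simp
        qed
        then show "k a x = ?h a x" using a by simp
      qed
      show ?thesis
      proof (rule ex1I[of _ ?h])
        show "?h \<in> Hom A w v \<and> (\<forall>j\<in>Obj J. Comp A w v (fobj D j) (p j) ?h = q j)"
          using h h1 unfolding full_subcat_simps(2) functor_cat_simps(2) by blast
        show "k = ?h" if "k \<in> Hom A w v \<and> (\<forall>j\<in>Obj J. Comp A w v (fobj D j) (p j) k = q j)" for k
          using h2 that unfolding full_subcat_simps(2) functor_cat_simps(2) by blast
      qed
    qed
    then show "is_limit J A D v p" unfolding is_limit_def using cone by blast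
  qed
qed

lemma is_functor_yoneda: "is_functor C A (yoneda C)"
  unfolding is_functor_def
proof (intro conjI ballI)
  fix a assume a: "a \<in> Obj C"
  then show "fobj (yoneda C) a \<in> Obj A" using representable_A by simp
  show "farr (yoneda C) a a (Id C a) = Id A (fobj (yoneda C) a)"
    by (rule pnat_ext[of _ C "representable C a" "representable C a" _ "representable C a"])
      (use a yoneda_arr_in[OF id_in[OF a] a a] presheaves_id_in[OF presheaf_representable[OF a]] in auto)
  fix b assume b: "b \<in> Obj C"
  { fix f assume f: "f \<in> Hom C a b"
    then show "farr (yoneda C) a b f \<in> Hom A (fobj (yoneda C) a) (fobj (yoneda C) b)"
      using a b yoneda_arr_in by simp }
  fix c f g assume c: "c \<in> Obj C" and f: "f \<in> Hom C a b" and g: "g \<in> Hom C b c"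
  show "farr (yoneda C) a c (Comp C a b c g f) =
    Comp A (fobj (yoneda C) a) (fobj (yoneda C) b) (fobj (yoneda C) c) (farr (yoneda C) b c g) (farr (yoneda C) a b f)"
    unfolding yoneda_simps
    by (rule pnat_ext[OF yoneda_arr_in[OF comp_in[OF f g a b c] a c]
          A_comp_in[OF yoneda_arr_in[OF f a b] yoneda_arr_in[OF g b c] presheaf_representable[OF a]]])
      (use a b c f g in \<open>simp add: assoc\<close>)
qed

text \<open>At an object \<open>a\<close>, a compatible family of elements of the representables is
  just a cone over \<open>D\<close> with vertex \<open>a\<close>.\<close>

lemma is_limit_yoneda:
  assumes D: "is_functor J C D" and L: "is_limit J C D v p"
  shows "is_limit J A (comp_func (yoneda C) D) (fobj (yoneda C) v) (\<lambda>j. farr (yoneda C) v (fobj D j) (p j))"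
proof -
  have ob: "fobj D j \<in> Obj C" if "j \<in> Obj J" for j using D that unfolding is_functor_def by blast
  have ar: "farr D i j u \<in> Hom C (fobj D i) (fobj D j)" if "i \<in> Obj J" "j \<in> Obj J" "u \<in> Hom J i j" for i j u
    using D that unfolding is_functor_def by blast
  have v: "v \<in> Obj C" and p: "\<And>j. j \<in> Obj J \<Longrightarrow> p j \<in> Hom C v (fobj D j)"
    and pc: "\<And>i j u. \<lbrakk>i \<in> Obj J; j \<in> Obj J; u \<in> Hom J i j\<rbrakk> \<Longrightarrow> Comp C v (fobj D i) (fobj D j) (farr D i j u) (p i) = p j"
    using L unfolding is_limit_def is_cone_def by auto
  have un: "\<exists>!h. h \<in> Hom C w v \<and> (\<forall>j\<in>Obj J. Comp C w v (fobj D j) (p j) h = q j)" if "is_cone J C D w q" for w q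
    using L that unfolding is_limit_def by blast
  have D': "is_functor J A (comp_func (yoneda C) D)"
    using D is_functor_yoneda unfolding is_functor_def comp_func_def by simp
  show ?thesis
    unfolding is_limit_A_iff[OF D'] pointwise_limit_def
  proof (intro conjI ballI allI impI, goal_cases)
    case 1 then show ?case using representable_A[OF v] by simp
  next
    case (2 j) then show ?case using yoneda_arr_in p ob v by (simp add: comp_func_def)
  next
    case (3 i j u a x)
    then show ?case using slide1[OF pc[OF 3(1-3)], of x a] p[OF 3(1)] ar[OF 3(1-3)] ob v by (simp add: comp_func_def)
  next
    case (4 a y)
    have "is_cone J C D a y"
      unfolding is_cone_def using 4 ar by (auto simp: comp_func_def)
    then show ?case
      using un 4(1) by (simp add: comp_func_def cong: conj_cong)
  qed
qed

lemma preserves_finite_limits_yoneda: "preserves_finite_limits C A (yoneda C)"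
  unfolding preserves_finite_limits_def using is_limit_yoneda by blast

text \<open>Elements at \<open>a\<close> are arrows from the representable of \<open>a\<close>, so a
  monomorphism can be cancelled on them.\<close>

lemma mono_pointwise:
  assumes m: "is_mono A X Y m" and X: "X \<in> Obj A" and a: "a \<in> Obj C" "x \<in> fobj X a" "x' \<in> fobj X a" "m a x = m a x'"
  shows "x = x'"
proof -
  have m': "m \<in> pnat C X Y" using is_mono_in[OF m] by simp
  have X': "presheaf C X" using X by simp
  note yo = yo_in[OF X' a(1,2)] yo_in[OF X' a(1,3)]
  have "Comp A (representable C a) X Y m (yo X a x) = Comp A (representable C a) X Y m (yo X a x')"
    by (rule pnat_representable_eqI[OF A_comp_in A_comp_in])
      (use a m' yo X' presheaf_representable in \<open>auto simp: presheaf_id\<close>)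
  then have "yo X a x = yo X a x'"
    by (rule is_monoD[OF m]) (use yo representable_A[OF a(1)] in simp_all)
  then show ?thesis using yo_id[OF X' a(1,2)] yo_id[OF X' a(1,3)] by metis
qed

lemma is_mono_AI:
  assumes m: "m \<in> pnat C X Y" and inj: "\<And>a x x'. \<lbrakk>a \<in> Obj C; x \<in> fobj X a; x' \<in> fobj X a; m a x = m a x'\<rbrakk> \<Longrightarrow> x = x'"
  shows "is_mono A X Y m"
  unfolding is_mono_def
proof (intro conjI ballI impI)
  show "m \<in> Hom A X Y" using m by simp
  fix W g h assume W: "W \<in> Obj A" "g \<in> Hom A W X" "h \<in> Hom A W X" "Comp A W X Y m g = Comp A W X Y m h"
  show "g = h"
  proof (rule pnat_ext)
    show "g \<in> pnat C W X" "h \<in> pnat C W X" using W by simp_all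
    fix a x assume a: "a \<in> Obj C" "x \<in> fobj W a"
    then have "m a (g a x) = m a (h a x)"
      using W(4)[THEN fun_cong, of a, THEN fun_cong, of x] by simp
    then show "g a x = h a x" using inj W a pnat_in by (metis full_subcat_simps(2) functor_cat_simps(2))
  qed
qed

lemma pullback_pointwise:
  assumes P: "is_pullback A P X Y Z p q f g" and a: "a \<in> Obj C" "x \<in> fobj X a" "y \<in> fobj Y a" "f a x = g a y"
  obtains z where "z \<in> fobj P a" "p a z = x" "q a z = y"
proof -
  note P1 = is_pullbackD[OF P]
  have X: "presheaf C X" "presheaf C Y" "presheaf C P" using P1 by simp_all
  have fg: "f \<in> pnat C X Z" "g \<in> pnat C Y Z" using P1 by simp_all
  note yo = yo_in[OF X(1) a(1,2)] yo_in[OF X(2) a(1,3)]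
  have "Comp A (representable C a) X Z f (yo X a x) = Comp A (representable C a) Y Z g (yo Y a y)"
    by (rule pnat_representable_eqI[OF A_comp_in A_comp_in])
      (use a fg yo X presheaf_representable in \<open>auto simp: presheaf_id\<close>)
  then obtain h where h: "h \<in> Hom A (representable C a) P" "Comp A (representable C a) P X p h = yo X a x"
    "Comp A (representable C a) P Y q h = yo Y a y"
    by (rule is_pullback_lift[OF P, rotated 3]) (use yo representable_A a in auto)
  have "p a (h a (Id C a)) = x" "q a (h a (Id C a)) = y"
    using h(2)[THEN fun_cong, of a, THEN fun_cong, of "Id C a"] h(3)[THEN fun_cong, of a, THEN fun_cong, of "Id C a"] a X
    by (simp_all add: presheaf_id)
  moreover have "h a (Id C a) \<in> fobj P a" using h(1) a by (simp add: pnat_in)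
  ultimately show ?thesis using that by blast
qed

lemma pullback_pointwise_commutes:
  assumes P: "is_pullback A P X Y Z p q f g" and a: "a \<in> Obj C" "z \<in> fobj P a"
  shows "f a (p a z) = g a (q a z)"
  using is_pullbackD(9)[OF P, THEN fun_cong, of a, THEN fun_cong, of z] a by simp

lemma is_pullback_AI:
  assumes o: "{P, X, Y, Z} \<subseteq> Obj A" and n: "p \<in> pnat C P X" "q \<in> pnat C P Y" "f \<in> pnat C X Z" "g \<in> pnat C Y Z"
    and e: "\<And>a z. \<lbrakk>a \<in> Obj C; z \<in> fobj P a\<rbrakk> \<Longrightarrow> f a (p a z) = g a (q a z)"
    and ex: "\<And>a x y. \<lbrakk>a \<in> Obj C; x \<in> fobj X a; y \<in> fobj Y a; f a x = g a y\<rbrakk> \<Longrightarrow> \<exists>z\<in>fobj P a. p a z = x \<and> q a z = y"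
    and inj: "\<And>a z z'. \<lbrakk>a \<in> Obj C; z \<in> fobj P a; z' \<in> fobj P a; p a z = p a z'; q a z = q a z'\<rbrakk> \<Longrightarrow> z = z'"
  shows "is_pullback A P X Y Z p q f g"
proof (rule A.is_pullbackI)
  have P: "presheaf C P" "presheaf C X" "presheaf C Y" using o by auto
  show "Comp A P X Z f p = Comp A P Y Z g q"
    by (rule pnat_ext[OF A_comp_in A_comp_in]) (use n e P in auto)
  fix W h k assume W: "W \<in> Obj A" "h \<in> Hom A W X" "k \<in> Hom A W Y" "Comp A W X Z f h = Comp A W Y Z g k"
  then have h: "h \<in> pnat C W X" "k \<in> pnat C W Y" "presheaf C W" by simp_all
  have "\<exists>z. z \<in> fobj P a \<and> p a z = h a x \<and> q a z = k a x" if "a \<in> Obj C" "x \<in> fobj W a" for a x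
    using ex[OF that(1) pnat_in[OF h(1) that(2,1)] pnat_in[OF h(2) that(2,1)]]
      W(4)[THEN fun_cong, of a, THEN fun_cong, of x] that by auto
  then obtain t where t: "\<And>a x. \<lbrakk>a \<in> Obj C; x \<in> fobj W a\<rbrakk> \<Longrightarrow> t a x \<in> fobj P a \<and> p a (t a x) = h a x \<and> q a (t a x) = k a x"
    by metis
  \<comment> \<open>The pointwise choices are natural because \<open>p\<close> and \<open>q\<close>
    are jointly injective.\<close>
  have tn: "(\<lambda>a\<in>Obj C. \<lambda>x\<in>fobj W a. t a x) \<in> pnat C W P" (is "?t \<in> _")
  proof (rule pnatI)
    fix a b u x assume a: "a \<in> Obj C" "b \<in> Obj C" "u \<in> Hom C b a" "x \<in> fobj W a"
    note x' = presheaf_in[OF h(3) a(4,3,1,2)]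
    show "farr P a b u (t a x) = t b (farr W a b u x)"
    proof (rule inj[OF a(2)])
      show "p b (farr P a b u (t a x)) = p b (t b (farr W a b u x))"
        using pnat_natural[OF n(1) _ a(3,1,2), of "t a x"] pnat_natural[OF h(1) a(4,3,1,2)] t[OF a(1,4)] t[OF a(2) x'] by simp
      show "q b (farr P a b u (t a x)) = q b (t b (farr W a b u x))"
        using pnat_natural[OF n(2) _ a(3,1,2), of "t a x"] pnat_natural[OF h(2) a(4,3,1,2)] t[OF a(1,4)] t[OF a(2) x'] by simp
    qed (use t a x' presheaf_in[OF P(1)] in auto)
  qed (use t h in auto)
  have "Comp A W P X p ?t = h"
    by (rule pnat_ext[OF A_comp_in[OF tn n(1) h(3)] h(1)]) (use t in auto)
  moreover have "Comp A W P Y q ?t = k"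
    by (rule pnat_ext[OF A_comp_in[OF tn n(2) h(3)] h(2)]) (use t in auto)
  ultimately show "\<exists>l\<in>Hom A W P. Comp A W P X p l = h \<and> Comp A W P Y q l = k" using tn by auto
next
  fix W h k assume W: "W \<in> Obj A" "h \<in> Hom A W P" "k \<in> Hom A W P" "Comp A W P X p h = Comp A W P X p k" "Comp A W P Y q h = Comp A W P Y q k"
  then have h: "h \<in> pnat C W P" "k \<in> pnat C W P" by simp_all
  show "h = k"
  proof (rule pnat_ext[OF h])
    fix a x assume a: "a \<in> Obj C" "x \<in> fobj W a"
    then show "h a x = k a x"
      using inj[OF a(1) pnat_in[OF h(1) a(2,1)] pnat_in[OF h(2) a(2,1)]] W(4)[THEN fun_cong, of a, THEN fun_cong, of x]
       W(5)[THEN fun_cong, of a, THEN fun_cong, of x] by simp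
  qed
qed (use o n in simp_all)

end

subsection \<open>Small presheaves\<close>

context locally_small_cat
begin

text \<open>\<open>P\<close> is the left Kan extension of its restriction to \<open>T\<close>, with
  identity unit; the Kan extension condition in \<open>small_presheaf\<close> reduces to this
  form.\<close>

definition lan :: "('o, 'u, 'u set, 'u \<Rightarrow> 'u) func \<Rightarrow> 'o set \<Rightarrow> bool" where
  "lan P T \<longleftrightarrow> presheaf C P \<and> T \<subseteq> Obj C \<and>
     (\<forall>G. presheaf C G \<longrightarrow> (\<forall>\<beta>\<in>pnat (full_subcat C T) P G.
        \<exists>!\<alpha>. \<alpha> \<in> pnat C P G \<and> (\<forall>a\<in>T. \<forall>x\<in>fobj P a. \<alpha> a x = \<beta> a x)))"

lemma presheaf_full_subcat: "presheaf C P \<Longrightarrow> presheaf (full_subcat C T) P"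
  unfolding is_functor_def by simp

lemma small_presheaf_iff: "small_presheaf C P \<longleftrightarrow> (\<exists>T. small TYPE('u) T \<and> lan P T)"
proof -
  have cid: "comp_func G id_func = G" for G :: "('o, 'u, 'u set, 'u \<Rightarrow> 'u) func"
    by (simp add: comp_func_def id_func_def)
  have "is_left_Kan_extension (op (full_subcat C T)) (op C) Set_cat id_func P P (Id (presheaves (full_subcat C T)) P)
      \<longleftrightarrow> lan P T" if P: "presheaf C P" and T: "T \<subseteq> Obj C" for T
  proof -
    have ob: "Obj (op (full_subcat C T)) = T" using T by auto
    have eq: "Comp Set_cat (fobj P a) (fobj P (fobj id_func a)) (fobj G (fobj id_func a)) (\<alpha> (fobj id_func a)) (Id (presheaves (full_subcat C T)) P a) = \<beta> a
        \<longleftrightarrow> (\<forall>x\<in>fobj P a. \<alpha> a x = \<beta> a x)"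
      if \<beta>: "\<beta> \<in> pnat (full_subcat C T) P G" and a: "a \<in> T" for G \<alpha> \<beta> a
    proof -
      have "\<beta> a \<in> extensional (fobj P a)"
        using \<beta> a ob unfolding nat_trans_def by (auto simp: PiE_iff)
      then show ?thesis
        using a T by (auto simp: id_func_def compose_def fun_eq_iff extensional_def functor_cat_def)
    qed
    have eq': "(\<exists>!\<alpha>. \<alpha> \<in> pnat C P G \<and> (\<forall>a\<in>T. Comp Set_cat (fobj P a) (fobj P (fobj id_func a)) (fobj G (fobj id_func a))
          (\<alpha> (fobj id_func a)) (Id (presheaves (full_subcat C T)) P a) = \<beta> a)) \<longleftrightarrow>
        (\<exists>!\<alpha>. \<alpha> \<in> pnat C P G \<and> (\<forall>a\<in>T. \<forall>x\<in>fobj P a. \<alpha> a x = \<beta> a x))"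
      if "\<beta> \<in> pnat (full_subcat C T) P G" for G \<beta>
      by (intro arg_cong[where f = Ex1] ext) (use eq[OF that] in blast)
    have P': "Id (presheaves (full_subcat C T)) P \<in> pnat (full_subcat C T) P P"
      by (rule presheaves_id_in[OF presheaf_full_subcat[OF P]])
    show ?thesis
      unfolding is_left_Kan_extension_def lan_def cid ob
      by (simp only: P T P' simp_thms eq' cong: ball_cong)
  qed
  then show ?thesis
    unfolding small_presheaf_def by (metis lan_def)
qed

lemma pnat_restrict:
  assumes "\<alpha> \<in> pnat C P G" "presheaf C P" "T \<subseteq> Obj C"
  shows "(\<lambda>a\<in>T. \<lambda>x\<in>fobj P a. \<alpha> a x) \<in> pnat (full_subcat C T) P G"
proof -
  have T: "Obj (full_subcat C T) = T" using assms(3) by auto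
  have "(\<lambda>a\<in>Obj (full_subcat C T). \<lambda>x\<in>fobj P a. \<alpha> a x) \<in> pnat (full_subcat C T) P G"
    by (rule pnatI) (use assms pnat_in[OF assms(1)] pnat_natural[OF assms(1)] presheaf_full_subcat in auto)
  then show ?thesis unfolding T .
qed

lemma lan_unique:
  assumes "lan P T" "presheaf C G" "\<alpha> \<in> pnat C P G" "\<alpha>' \<in> pnat C P G"
    and "\<And>a x. \<lbrakk>a \<in> T; x \<in> fobj P a\<rbrakk> \<Longrightarrow> \<alpha> a x = \<alpha>' a x"
  shows "\<alpha> = \<alpha>'"
proof -
  let ?\<beta> = "\<lambda>a\<in>T. \<lambda>x\<in>fobj P a. \<alpha> a x"
  have "?\<beta> \<in> pnat (full_subcat C T) P G"
    using assms by (intro pnat_restrict) (auto simp: lan_def)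
  then have "\<exists>!\<alpha>. \<alpha> \<in> pnat C P G \<and> (\<forall>a\<in>T. \<forall>x\<in>fobj P a. \<alpha> a x = ?\<beta> a x)"
    using assms(1,2) unfolding lan_def by blast
  moreover have "\<forall>a\<in>T. \<forall>x\<in>fobj P a. \<alpha> a x = ?\<beta> a x" "\<forall>a\<in>T. \<forall>x\<in>fobj P a. \<alpha>' a x = ?\<beta> a x"
    using assms(5) by auto
  ultimately show ?thesis using assms(3,4) by blast
qed

lemma lan_extend:
  assumes L: "lan P T" and G: "presheaf C G"
    and b: "\<And>a x. \<lbrakk>a \<in> T; x \<in> fobj P a\<rbrakk> \<Longrightarrow> b a x \<in> fobj G a"
    and n: "\<And>a c f x. \<lbrakk>a \<in> T; c \<in> T; f \<in> Hom C c a; x \<in> fobj P a\<rbrakk> \<Longrightarrow> farr G a c f (b a x) = b c (farr P a c f x)"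
  shows "\<exists>\<alpha>\<in>pnat C P G. \<forall>a\<in>T. \<forall>x\<in>fobj P a. \<alpha> a x = b a x"
proof -
  let ?\<beta> = "\<lambda>a\<in>Obj (full_subcat C T). \<lambda>x\<in>fobj P a. b a x"
  have T: "T \<subseteq> Obj C" and P: "presheaf C P" using L unfolding lan_def by auto
  have "?\<beta> \<in> pnat (full_subcat C T) P G"
    by (rule pnatI[OF _ _ presheaf_full_subcat[OF P]]) (use b n in simp_all)
  then have "\<exists>!\<alpha>. \<alpha> \<in> pnat C P G \<and> (\<forall>a\<in>T. \<forall>x\<in>fobj P a. \<alpha> a x = ?\<beta> a x)"
    using L G unfolding lan_def by blast
  then obtain \<alpha> where \<alpha>: "\<alpha> \<in> pnat C P G" "\<forall>a\<in>T. \<forall>x\<in>fobj P a. \<alpha> a x = ?\<beta> a x" by blast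
  show ?thesis
    by (rule bexI[OF _ \<alpha>(1)]) (use \<alpha>(2) T in \<open>simp add: subset_iff\<close>)
qed

text \<open>The elements that are restrictions of elements over \<open>T\<close> form a subpresheaf
  \<open>V\<close>, which is all of \<open>P\<close> over \<open>T\<close>. The identity over
  \<open>T\<close> extends to \<open>P -> V\<close>, and its composite with the inclusion is the
  identity of \<open>P\<close> by uniqueness; so \<open>V\<close> is all of
  \<open>P\<close>.\<close>

lemma lan_generates:
  assumes L: "lan P T" and a: "a \<in> Obj C" "x \<in> fobj P a"
  obtains t f y where "t \<in> T" "f \<in> Hom C a t" "y \<in> fobj P t" "x = farr P t a f y"
proof -
  have P: "presheaf C P" "T \<subseteq> Obj C" using L unfolding lan_def by auto
  define V where "V a = {x \<in> fobj P a. \<exists>t\<in>T. \<exists>f\<in>Hom C a t. \<exists>y\<in>fobj P t. x = farr P t a f y}" for a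
  have V: "V a \<subseteq> fobj P a" for a unfolding V_def by auto
  have V': "presheaf C (subpresheaf P V)"
  proof (rule presheaf_subpresheaf[OF P(1) V])
    fix a b f x assume a: "a \<in> Obj C" "b \<in> Obj C" "f \<in> Hom C b a" "x \<in> V a"
    then obtain t g y where t: "t \<in> T" "g \<in> Hom C a t" "y \<in> fobj P t" "x = farr P t a g y" unfolding V_def by auto
    then have "farr P a b f x = farr P t b (Comp C b a t g f) y"
      using presheaf_comp[OF P(1) t(3,2) a(3)] a P(2) by auto
    moreover have "Comp C b a t g f \<in> Hom C b t" using t a P(2) by auto
    moreover have "farr P a b f x \<in> fobj P b" using presheaf_in[OF P(1) _ a(3,1,2), of x] a V[of a] by auto
    ultimately show "farr P a b f x \<in> V b" unfolding V_def using t by blast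
  qed
  have VT: "V t = fobj P t" if "t \<in> T" for t
  proof
    show "fobj P t \<subseteq> V t"
    proof
      fix x assume x: "x \<in> fobj P t"
      then have "x = farr P t t (Id C t) x" using presheaf_id[OF P(1)] that P(2) by auto
      moreover have "Id C t \<in> Hom C t t" using that P(2) by auto
      ultimately show "x \<in> V t" unfolding V_def using x that by blast
    qed
  qed (rule V)
  have "\<exists>\<alpha>\<in>pnat C P (subpresheaf P V). \<forall>a\<in>T. \<forall>x\<in>fobj P a. \<alpha> a x = x"
  proof (rule lan_extend[OF L V'])
    show "x \<in> fobj (subpresheaf P V) a" if "a \<in> T" "x \<in> fobj P a" for a x using VT that by simp
    show "farr (subpresheaf P V) a c f x = farr P a c f x" if "a \<in> T" "x \<in> fobj P a" for a c f x
      using VT that by simp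
  qed
  then obtain \<alpha> where \<alpha>: "\<alpha> \<in> pnat C P (subpresheaf P V)" "\<And>a x. \<lbrakk>a \<in> T; x \<in> fobj P a\<rbrakk> \<Longrightarrow> \<alpha> a x = x"
    by blast
  have i: "incl C V \<in> pnat C (subpresheaf P V) P" by (rule incl_in[OF V' V])
  have "Comp (presheaves C) P (subpresheaf P V) P (incl C V) \<alpha> = Id (presheaves C) P"
  proof (rule lan_unique[OF L P(1) presheaves_comp_in[OF \<alpha>(1) i P(1)] presheaves_id_in[OF P(1)]])
    fix a x assume "a \<in> T" "x \<in> fobj P a"
    then show "Comp (presheaves C) P (subpresheaf P V) P (incl C V) \<alpha> a x = Id (presheaves C) P a x"
      using P(2) \<alpha>(2) VT by (auto simp: subset_iff)
  qed
  from this[THEN fun_cong, of a, THEN fun_cong, of x] have "\<alpha> a x = x"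
    using a pnat_in[OF \<alpha>(1)] by simp
  then have "x \<in> V a" using pnat_in[OF \<alpha>(1) a(2,1)] by simp
  then show ?thesis using that unfolding V_def by blast
qed

text \<open>The transformation extended from \<open>T\<close> also agrees with
  \<open>\<beta>\<close> over \<open>T'\<close>, since by \<open>lan_generates\<close> every element
  there is a restriction of one over \<open>T\<close>. This allows several presheaves to be brought
  to a common index set.\<close>

lemma lan_mono:
  assumes L: "lan P T" and T': "T \<subseteq> T'" "T' \<subseteq> Obj C"
  shows "lan P T'"
proof -
  have P: "presheaf C P" "T \<subseteq> Obj C" using L unfolding lan_def by auto
  have T'o: "Obj (full_subcat C T') = T'" using T' by auto
  have To: "Obj (full_subcat C T) = T" using P by auto
  have "\<exists>!\<alpha>. \<alpha> \<in> pnat C P G \<and> (\<forall>a\<in>T'. \<forall>x\<in>fobj P a. \<alpha> a x = \<beta> a x)"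
    if G: "presheaf C G" and \<beta>: "\<beta> \<in> pnat (full_subcat C T') P G" for G \<beta>
  proof -
    have nat: "farr G a b f (\<beta> a x) = \<beta> b (farr P a b f x)"
      if "x \<in> fobj P a" "f \<in> Hom C b a" "a \<in> T'" "b \<in> T'" for a b f x
      using pnat_natural[OF \<beta> that(1), of f b] that T'(2) by (simp add: subset_iff)
    have "\<exists>\<alpha>\<in>pnat C P G. \<forall>a\<in>T. \<forall>x\<in>fobj P a. \<alpha> a x = \<beta> a x"
    proof (rule lan_extend[OF L G, of \<beta>])
      show "\<beta> a x \<in> fobj G a" if "a \<in> T" "x \<in> fobj P a" for a x
        using pnat_in[OF \<beta> that(2)] that T' T'o by auto
      show "farr G a c f (\<beta> a x) = \<beta> c (farr P a c f x)"
        if "a \<in> T" "c \<in> T" "f \<in> Hom C c a" "x \<in> fobj P a" for a c f x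
        using nat[OF that(4), of f c] that T' by auto
    qed
    then obtain \<alpha> where \<alpha>: "\<alpha> \<in> pnat C P G" "\<And>a x. \<lbrakk>a \<in> T; x \<in> fobj P a\<rbrakk> \<Longrightarrow> \<alpha> a x = \<beta> a x"
      by blast
    have agree: "\<alpha> a x = \<beta> a x" if a: "a \<in> T'" and x: "x \<in> fobj P a" for a x
    proof -
      have a': "a \<in> Obj C" using a T' by auto
      obtain t f y where t: "t \<in> T" "f \<in> Hom C a t" "y \<in> fobj P t" "x = farr P t a f y"
        by (rule lan_generates[OF L a' x])
      have t': "t \<in> Obj C" "t \<in> T'" using t P(2) T' by auto
      show ?thesis
        using pnat_natural[OF \<alpha>(1) t(3,2) t'(1) a'] nat[OF t(3,2) t'(2) a] \<alpha>(2)[OF t(1,3)] t(4) by simp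
    qed
    show ?thesis
    proof (rule ex1I[of _ \<alpha>])
      show "\<alpha> \<in> pnat C P G \<and> (\<forall>a\<in>T'. \<forall>x\<in>fobj P a. \<alpha> a x = \<beta> a x)" using \<alpha>(1) agree by blast
      fix \<alpha>' assume \<alpha>': "\<alpha>' \<in> pnat C P G \<and> (\<forall>a\<in>T'. \<forall>x\<in>fobj P a. \<alpha>' a x = \<beta> a x)"
      show "\<alpha>' = \<alpha>"
        by (rule lan_unique[OF L G _ \<alpha>(1)]) (use \<alpha>' \<alpha>(2) T'(1) in auto)
    qed
  qed
  then show ?thesis unfolding lan_def using P T' by blast
qed

lemma lan_representable:
  assumes c: "c \<in> Obj C"
  shows "lan (representable C c) {c}"
proof -
  have "\<exists>!\<alpha>. \<alpha> \<in> pnat C (representable C c) G \<and> (\<forall>a\<in>{c}. \<forall>x\<in>fobj (representable C c) a. \<alpha> a x = \<beta> a x)"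
    if G: "presheaf C G" and \<beta>: "\<beta> \<in> pnat (full_subcat C {c}) (representable C c) G" for G \<beta>
  proof (rule ex1I[of _ "yo G c (\<beta> c (Id C c))"])
    have b: "\<beta> c (Id C c) \<in> fobj G c" using pnat_in[OF \<beta>, of "Id C c" c] c by simp
    show "yo G c (\<beta> c (Id C c)) \<in> pnat C (representable C c) G \<and>
      (\<forall>a\<in>{c}. \<forall>x\<in>fobj (representable C c) a. yo G c (\<beta> c (Id C c)) a x = \<beta> a x)"
      using yo_in[OF G c b] pnat_natural[OF \<beta>, of "Id C c" c] c by auto
    show "\<alpha> = yo G c (\<beta> c (Id C c))"
      if "\<alpha> \<in> pnat C (representable C c) G \<and> (\<forall>a\<in>{c}. \<forall>x\<in>fobj (representable C c) a. \<alpha> a x = \<beta> a x)" for \<alpha>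
      by (rule pnat_representable_eqI[OF _ yo_in[OF G c b] c]) (use that c b presheaf_id[OF G] in auto)
  qed
  then show ?thesis unfolding lan_def using c presheaf_representable by blast
qed

subsection \<open>Unions of two subobjects\<close>

end

definition union_sets :: "('o, 'u, 'u set, 'u \<Rightarrow> 'u) func \<Rightarrow> ('o, 'u, 'u set, 'u \<Rightarrow> 'u) func \<Rightarrow>
    ('o \<Rightarrow> 'u \<Rightarrow> 'u) \<Rightarrow> ('o \<Rightarrow> 'u \<Rightarrow> 'u) \<Rightarrow> 'o \<Rightarrow> 'u set" where
  "union_sets P1 P2 \<theta>1 \<theta>2 a = \<theta>1 a ` fobj P1 a \<union> \<theta>2 a ` fobj P2 a"

definition union_psh where
  "union_psh R P1 P2 \<theta>1 \<theta>2 = subpresheaf R (union_sets P1 P2 \<theta>1 \<theta>2)"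

locale mono_pair = locally_small_cat C for C :: "('o, 'u) cat" +
  fixes R P1 P2 :: "('o, 'u, 'u set, 'u \<Rightarrow> 'u) func" and \<theta>1 \<theta>2 :: "'o \<Rightarrow> 'u \<Rightarrow> 'u"
  assumes R: "presheaf C R" and P1: "presheaf C P1" and P2: "presheaf C P2"
    and \<theta>1: "\<theta>1 \<in> pnat C P1 R" and \<theta>2: "\<theta>2 \<in> pnat C P2 R"
    and inj1: "\<lbrakk>a \<in> Obj C; x \<in> fobj P1 a; x' \<in> fobj P1 a; \<theta>1 a x = \<theta>1 a x'\<rbrakk> \<Longrightarrow> x = x'"
    and inj2: "\<lbrakk>a \<in> Obj C; y \<in> fobj P2 a; y' \<in> fobj P2 a; \<theta>2 a y = \<theta>2 a y'\<rbrakk> \<Longrightarrow> y = y'"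
begin

abbreviation U where "U \<equiv> union_psh R P1 P2 \<theta>1 \<theta>2"

lemma fobj_U: "fobj U a = union_sets P1 P2 \<theta>1 \<theta>2 a"
  by (simp add: union_psh_def)

lemma U_cases:
  assumes "x \<in> fobj U a"
  obtains y where "y \<in> fobj P1 a" "x = \<theta>1 a y" | y where "y \<in> fobj P2 a" "x = \<theta>2 a y"
  using assms unfolding fobj_U union_sets_def by blast

lemma U_I1: "x \<in> fobj P1 a \<Longrightarrow> \<theta>1 a x \<in> fobj U a"
  unfolding fobj_U union_sets_def by blast

lemma U_I2: "x \<in> fobj P2 a \<Longrightarrow> \<theta>2 a x \<in> fobj U a"
  unfolding fobj_U union_sets_def by blast

lemma farr_U: "x \<in> fobj U a \<Longrightarrow> farr U a b f x = farr R a b f x"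
  by (simp add: union_psh_def)

lemma U_sub: "a \<in> Obj C \<Longrightarrow> union_sets P1 P2 \<theta>1 \<theta>2 a \<subseteq> fobj R a"
  unfolding union_sets_def using pnat_in[OF \<theta>1] pnat_in[OF \<theta>2] by blast

lemma presheaf_U: "presheaf C U"
  unfolding union_psh_def
proof (rule presheaf_subpresheaf[OF R U_sub])
  fix a b f x assume a: "a \<in> Obj C" "b \<in> Obj C" "f \<in> Hom C b a" "x \<in> union_sets P1 P2 \<theta>1 \<theta>2 a"
  then have "x \<in> fobj U a" by (simp add: fobj_U)
  then show "farr R a b f x \<in> union_sets P1 P2 \<theta>1 \<theta>2 b"
  proof (cases rule: U_cases)
    case (1 y)
    then show ?thesis
      using pnat_natural[OF \<theta>1 1(1) a(3,1,2)] presheaf_in[OF P1 1(1) a(3,1,2)] by (auto simp: union_sets_def)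
  next
    case (2 y)
    then show ?thesis
      using pnat_natural[OF \<theta>2 2(1) a(3,1,2)] presheaf_in[OF P2 2(1) a(3,1,2)] by (auto simp: union_sets_def)
  qed
qed

lemma incl_U: "incl C (fobj U) \<in> pnat C U R"
  using incl_in[OF presheaf_U[unfolded union_psh_def] U_sub] by (simp add: union_psh_def)

lemma \<theta>1_U: "\<theta>1 \<in> pnat C P1 U"
  unfolding union_psh_def by (rule pnat_corestrict[OF \<theta>1 P1]) (simp add: union_sets_def)

lemma \<theta>2_U: "\<theta>2 \<in> pnat C P2 U"
  unfolding union_psh_def by (rule pnat_corestrict[OF \<theta>2 P2]) (simp add: union_sets_def)

lemma U_ext:
  assumes "\<gamma> \<in> pnat C U G" "\<gamma>' \<in> pnat C U G"
    "\<And>a x. \<lbrakk>a \<in> Obj C; x \<in> fobj P1 a\<rbrakk> \<Longrightarrow> \<gamma> a (\<theta>1 a x) = \<gamma>' a (\<theta>1 a x)"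
    "\<And>a y. \<lbrakk>a \<in> Obj C; y \<in> fobj P2 a\<rbrakk> \<Longrightarrow> \<gamma> a (\<theta>2 a y) = \<gamma>' a (\<theta>2 a y)"
  shows "\<gamma> = \<gamma>'"
  by (rule pnat_ext[OF assms(1,2)]) (use assms(3,4) in \<open>auto elim: U_cases\<close>)

text \<open>Pointwise, \<open>U\<close> is the pushout of \<open>P1\<close> and \<open>P2\<close>
  over their intersection. By injectivity an element of \<open>U\<close> has at most one preimage on
  each side, and where it has both, the hypothesis \<open>c\<close> makes the two prescriptions
  agree.\<close>

lemma U_glue:
  assumes \<alpha>1: "\<alpha>1 \<in> pnat C P1 G" and \<alpha>2: "\<alpha>2 \<in> pnat C P2 G"
    and c: "\<And>a x y. \<lbrakk>a \<in> Obj C; x \<in> fobj P1 a; y \<in> fobj P2 a; \<theta>1 a x = \<theta>2 a y\<rbrakk> \<Longrightarrow> \<alpha>1 a x = \<alpha>2 a y"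
  shows "\<exists>\<gamma>\<in>pnat C U G. (\<forall>a\<in>Obj C. \<forall>x\<in>fobj P1 a. \<gamma> a (\<theta>1 a x) = \<alpha>1 a x) \<and>
    (\<forall>a\<in>Obj C. \<forall>y\<in>fobj P2 a. \<gamma> a (\<theta>2 a y) = \<alpha>2 a y)"
proof -
  define t where "t a z = (if \<exists>x\<in>fobj P1 a. z = \<theta>1 a x then \<alpha>1 a (THE x. x \<in> fobj P1 a \<and> z = \<theta>1 a x)
     else \<alpha>2 a (THE y. y \<in> fobj P2 a \<and> z = \<theta>2 a y))" for a z
  have t1: "t a (\<theta>1 a x) = \<alpha>1 a x" if "a \<in> Obj C" "x \<in> fobj P1 a" for a x
  proof -
    have "(THE x'. x' \<in> fobj P1 a \<and> \<theta>1 a x = \<theta>1 a x') = x" using that inj1 by blast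
    then show ?thesis using that unfolding t_def by auto
  qed
  have t2: "t a (\<theta>2 a y) = \<alpha>2 a y" if a: "a \<in> Obj C" "y \<in> fobj P2 a" for a y
  proof (cases "\<exists>x\<in>fobj P1 a. \<theta>2 a y = \<theta>1 a x")
    case True
    then obtain x where "x \<in> fobj P1 a" "\<theta>2 a y = \<theta>1 a x" by blast
    then show ?thesis using t1[OF a(1)] c a by metis
  next
    case False
    have "(THE y'. y' \<in> fobj P2 a \<and> \<theta>2 a y = \<theta>2 a y') = y" using that inj2 by blast
    then show ?thesis using False unfolding t_def by auto
  qed
  have n: "(\<lambda>a\<in>Obj C. \<lambda>x\<in>fobj U a. t a x) \<in> pnat C U G"
  proof (rule pnatI[OF _ _ presheaf_U])
    fix a x assume a: "a \<in> Obj C" and x: "x \<in> fobj U a"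
    from x show "t a x \<in> fobj G a"
      by (cases rule: U_cases) (use a t1 t2 pnat_in[OF \<alpha>1] pnat_in[OF \<alpha>2] in auto)
    fix b f assume b: "b \<in> Obj C" and f: "f \<in> Hom C b a"
    from x show "farr G a b f (t a x) = t b (farr U a b f x)"
    proof (cases rule: U_cases)
      case (1 y)
      then show ?thesis
        using farr_U[OF x] pnat_natural[OF \<theta>1 1(1) f a b] pnat_natural[OF \<alpha>1 1(1) f a b] t1 a b
          presheaf_in[OF P1 1(1) f a b] by simp
    next
      case (2 y)
      then show ?thesis
        using farr_U[OF x] pnat_natural[OF \<theta>2 2(1) f a b] pnat_natural[OF \<alpha>2 2(1) f a b] t2 a b
          presheaf_in[OF P2 2(1) f a b] by simp
    qed
  qed
  show ?thesis by (rule bexI[OF _ n]) (use t1 t2 U_I1 U_I2 in auto)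
qed

text \<open>A colimit of presheaves that are Kan extended from \<open>T\<close> is Kan extended from
  \<open>T\<close>. \<open>P12\<close> is the intersection of \<open>P1\<close> and
  \<open>P2\<close>: the extensions of \<open>\<beta>\<close> to \<open>P1\<close> and
  \<open>P2\<close> coincide on it because they do so over \<open>T\<close>, and hence they
  glue.\<close>

lemma lan_U:
  assumes L: "lan P1 T" "lan P2 T" "lan P12 T" and p: "p \<in> pnat C P12 P1" and q: "q \<in> pnat C P12 P2"
    and e: "\<And>a z. \<lbrakk>a \<in> Obj C; z \<in> fobj P12 a\<rbrakk> \<Longrightarrow> \<theta>1 a (p a z) = \<theta>2 a (q a z)"
    and ex: "\<And>a x y. \<lbrakk>a \<in> Obj C; x \<in> fobj P1 a; y \<in> fobj P2 a; \<theta>1 a x = \<theta>2 a y\<rbrakk> \<Longrightarrow> \<exists>z\<in>fobj P12 a. p a z = x \<and> q a z = y"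
  shows "lan U T"
proof -
  have T: "T \<subseteq> Obj C" and P12: "presheaf C P12" using L unfolding lan_def by auto
  have To: "Obj (full_subcat C T) = T" using T by auto
  have "\<exists>!\<alpha>. \<alpha> \<in> pnat C U G \<and> (\<forall>a\<in>T. \<forall>x\<in>fobj U a. \<alpha> a x = \<beta> a x)"
    if G: "presheaf C G" and \<beta>: "\<beta> \<in> pnat (full_subcat C T) U G" for G \<beta>
  proof -
    have ex1: "\<exists>\<alpha>. \<alpha> \<in> pnat C P G \<and> (\<forall>a\<in>T. \<forall>x\<in>fobj P a. \<alpha> a x = \<beta> a (\<theta> a x))"
      if L: "lan P T" and \<theta>: "\<theta> \<in> pnat C P U" for P \<theta>
    proof -
      have "\<exists>\<alpha>\<in>pnat C P G. \<forall>a\<in>T. \<forall>x\<in>fobj P a. \<alpha> a x = \<beta> a (\<theta> a x)"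
      proof (rule lan_extend[OF L G, of "\<lambda>a x. \<beta> a (\<theta> a x)"])
        fix a x assume a: "a \<in> T" "x \<in> fobj P a"
        then have a': "a \<in> Obj C" using T by blast
        note \<theta>x = pnat_in[OF \<theta> a(2) a']
        show "\<beta> a (\<theta> a x) \<in> fobj G a" using pnat_in[OF \<beta> \<theta>x] a a' by simp
        fix c f assume c: "c \<in> T" "f \<in> Hom C c a"
        then have c': "c \<in> Obj C" using T by blast
        show "farr G a c f (\<beta> a (\<theta> a x)) = \<beta> c (\<theta> c (farr P a c f x))"
          using pnat_natural[OF \<beta> \<theta>x, of f c] pnat_natural[OF \<theta> a(2) c(2) a' c'] a c a' c' by simp
      qed
      then show ?thesis by blast
    qed
    obtain \<alpha>1 where \<alpha>1: "\<alpha>1 \<in> pnat C P1 G" "\<And>a x. \<lbrakk>a \<in> T; x \<in> fobj P1 a\<rbrakk> \<Longrightarrow> \<alpha>1 a x = \<beta> a (\<theta>1 a x)"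
      using ex1[OF L(1) \<theta>1_U] by blast
    obtain \<alpha>2 where \<alpha>2: "\<alpha>2 \<in> pnat C P2 G" "\<And>a x. \<lbrakk>a \<in> T; x \<in> fobj P2 a\<rbrakk> \<Longrightarrow> \<alpha>2 a x = \<beta> a (\<theta>2 a x)"
      using ex1[OF L(2) \<theta>2_U] by blast
    have pq: "Comp (presheaves C) P12 P1 G \<alpha>1 p = Comp (presheaves C) P12 P2 G \<alpha>2 q"
    proof (rule lan_unique[OF L(3) G presheaves_comp_in[OF p \<alpha>1(1) P12] presheaves_comp_in[OF q \<alpha>2(1) P12]])
      fix a x assume a: "a \<in> T" "x \<in> fobj P12 a"
      then have "a \<in> Obj C" using T by auto
      then show "Comp (presheaves C) P12 P1 G \<alpha>1 p a x = Comp (presheaves C) P12 P2 G \<alpha>2 q a x"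
        using a e \<alpha>1(2)[OF a(1)] \<alpha>2(2)[OF a(1)] pnat_in[OF p] pnat_in[OF q] by simp
    qed
    have "\<exists>\<gamma>\<in>pnat C U G. (\<forall>a\<in>Obj C. \<forall>x\<in>fobj P1 a. \<gamma> a (\<theta>1 a x) = \<alpha>1 a x) \<and>
      (\<forall>a\<in>Obj C. \<forall>y\<in>fobj P2 a. \<gamma> a (\<theta>2 a y) = \<alpha>2 a y)"
    proof (rule U_glue[OF \<alpha>1(1) \<alpha>2(1)])
      fix a x y assume a: "a \<in> Obj C" "x \<in> fobj P1 a" "y \<in> fobj P2 a" "\<theta>1 a x = \<theta>2 a y"
      then obtain z where "z \<in> fobj P12 a" "p a z = x" "q a z = y" using ex by blast
      then show "\<alpha>1 a x = \<alpha>2 a y" using pq[THEN fun_cong, of a, THEN fun_cong, of z] a by simp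
    qed
    then obtain \<gamma> where \<gamma>: "\<gamma> \<in> pnat C U G" "\<And>a x. \<lbrakk>a \<in> Obj C; x \<in> fobj P1 a\<rbrakk> \<Longrightarrow> \<gamma> a (\<theta>1 a x) = \<alpha>1 a x"
      "\<And>a y. \<lbrakk>a \<in> Obj C; y \<in> fobj P2 a\<rbrakk> \<Longrightarrow> \<gamma> a (\<theta>2 a y) = \<alpha>2 a y" by blast
    have agree: "\<gamma> a x = \<beta> a x" if "a \<in> T" "x \<in> fobj U a" for a x
      using that(2) by (cases rule: U_cases) (use that(1) T \<gamma> \<alpha>1 \<alpha>2 in auto)
    have un: "\<gamma>' = \<gamma>''" if g: "\<gamma>' \<in> pnat C U G" "\<gamma>'' \<in> pnat C U G" "\<And>a x. \<lbrakk>a \<in> T; x \<in> fobj U a\<rbrakk> \<Longrightarrow> \<gamma>' a x = \<gamma>'' a x" for \<gamma>' \<gamma>''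
    proof (rule U_ext[OF g(1,2)])
      fix a x assume a: "a \<in> Obj C"
      { assume x: "x \<in> fobj P1 a"
        obtain t f y where t: "t \<in> T" "f \<in> Hom C a t" "y \<in> fobj P1 t" "x = farr P1 t a f y" by (rule lan_generates[OF L(1) a x])
        then have t': "t \<in> Obj C" using T by auto
        show "\<gamma>' a (\<theta>1 a x) = \<gamma>'' a (\<theta>1 a x)"
          using pnat_natural[OF g(1) U_I1[OF t(3)] t(2) t' a] pnat_natural[OF g(2) U_I1[OF t(3)] t(2) t' a]
            g(3)[OF t(1) U_I1[OF t(3)]] pnat_natural[OF \<theta>1_U t(3,2) t' a] t(4) by simp }
      { assume x: "x \<in> fobj P2 a"
        obtain t f y where t: "t \<in> T" "f \<in> Hom C a t" "y \<in> fobj P2 t" "x = farr P2 t a f y" by (rule lan_generates[OF L(2) a x])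
        then have t': "t \<in> Obj C" using T by auto
        show "\<gamma>' a (\<theta>2 a x) = \<gamma>'' a (\<theta>2 a x)"
          using pnat_natural[OF g(1) U_I2[OF t(3)] t(2) t' a] pnat_natural[OF g(2) U_I2[OF t(3)] t(2) t' a]
            g(3)[OF t(1) U_I2[OF t(3)]] pnat_natural[OF \<theta>2_U t(3,2) t' a] t(4) by simp }
    qed
    show ?thesis
    proof (rule ex1I[of _ \<gamma>])
      show "\<gamma> \<in> pnat C U G \<and> (\<forall>a\<in>T. \<forall>x\<in>fobj U a. \<gamma> a x = \<beta> a x)" using \<gamma>(1) agree by blast
      fix \<gamma>' assume \<gamma>': "\<gamma>' \<in> pnat C U G \<and> (\<forall>a\<in>T. \<forall>x\<in>fobj U a. \<gamma>' a x = \<beta> a x)"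
      show "\<gamma>' = \<gamma>" by (rule un[OF _ \<gamma>(1)]) (use \<gamma>' agree in auto)
    qed
  qed
  then show ?thesis unfolding lan_def using presheaf_U T by blast
qed

end

lemma full_subcat_UNIV: "full_subcat C UNIV = C"
  by (simp add: full_subcat_def)

subsection \<open>The colimit weighted by a union of two representable subobjects\<close>

context locally_small_cat
begin

lemma presheaf_subcat_UNIV: "presheaf_subcat C UNIV"
  by unfold_locales simp

lemma presheaves_is_monoD:
  assumes "is_mono (presheaves C) X Y m" "presheaf C X" "a \<in> Obj C" "x \<in> fobj X a" "x' \<in> fobj X a" "m a x = m a x'"
  shows "x = x'"
proof -
  interpret presheaf_subcat C UNIV by (rule presheaf_subcat_UNIV)
  show ?thesis using mono_pointwise[of X Y m a x x'] assms unfolding full_subcat_UNIV by simp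
qed

lemma mono_pair_representable:
  assumes a: "is_mono C A c a" "is_mono C B c b" and o: "A \<in> Obj C" "B \<in> Obj C" "c \<in> Obj C"
  shows "mono_pair C (representable C c) (representable C A) (representable C B) (yoneda_arr C A c a) (yoneda_arr C B c b)"
proof unfold_locales
  show "presheaf C (representable C c)" "presheaf C (representable C A)" "presheaf C (representable C B)"
    using o presheaf_representable by blast+
  show "yoneda_arr C A c a \<in> pnat C (representable C A) (representable C c)"
    "yoneda_arr C B c b \<in> pnat C (representable C B) (representable C c)"
    using yoneda_arr_in is_mono_in[OF a(1)] is_mono_in[OF a(2)] o by blast+
  show "x = x'" if "d \<in> Obj C" "x \<in> fobj (representable C A) d" "x' \<in> fobj (representable C A) d"
    "yoneda_arr C A c a d x = yoneda_arr C A c a d x'" for d x x'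
    using is_monoD[OF a(1), of d x x'] that by simp
  show "x = x'" if "d \<in> Obj C" "x \<in> fobj (representable C B) d" "x' \<in> fobj (representable C B) d"
    "yoneda_arr C B c b d x = yoneda_arr C B c b d x'" for d x x'
    using is_monoD[OF a(2), of d x x'] that by simp
qed

abbreviation union_rep where
  "union_rep A B c a b \<equiv> union_psh (representable C c) (representable C A) (representable C B) (yoneda_arr C A c a) (yoneda_arr C B c b)"

abbreviation rep_pair where
  "rep_pair A B c a b \<equiv> {(representable C A, yoneda_arr C A c a), (representable C B, yoneda_arr C B c b)}"

text \<open>Leastness comes from \<open>U_glue\<close>: the factorizations of the two representables
  through a subobject \<open>w\<close> agree on the overlap, as \<open>w\<close> is
  injective.\<close>

lemma is_union_representables:
  assumes a: "is_mono C A c a" "is_mono C B c b" and o: "A \<in> Obj C" "B \<in> Obj C" "c \<in> Obj C"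
  shows "is_union (presheaves C) (representable C c) (rep_pair A B c a b)
    (union_rep A B c a b, incl C (fobj (union_rep A B c a b)))"
proof -
  interpret M: mono_pair C "representable C c" "representable C A" "representable C B" "yoneda_arr C A c a" "yoneda_arr C B c b"
    by (rule mono_pair_representable[OF a o])
  interpret PP: presheaf_subcat C UNIV by (rule presheaf_subcat_UNIV)
  note PA = full_subcat_UNIV
  have mono: "is_mono (presheaves C) (representable C A) (representable C c) (yoneda_arr C A c a)"
    "is_mono (presheaves C) (representable C B) (representable C c) (yoneda_arr C B c b)"
    "is_mono (presheaves C) M.U (representable C c) (incl C (fobj M.U))"
    using PP.is_mono_AI[OF M.\<theta>1 M.inj1] PP.is_mono_AI[OF M.\<theta>2 M.inj2] PP.is_mono_AI[OF M.incl_U] unfolding PA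
    by simp_all
  have sub: "rep_pair A B c a b \<subseteq> subobjects (presheaves C) (representable C c)"
    "(M.U, incl C (fobj M.U)) \<in> subobjects (presheaves C) (representable C c)"
    using mono M.P1 M.P2 M.presheaf_U by (simp_all add: subobjects_def)
  have "Comp (presheaves C) (representable C A) M.U (representable C c) (incl C (fobj M.U)) (yoneda_arr C A c a) = yoneda_arr C A c a"
  proof (rule pnat_ext[OF presheaves_comp_in[OF M.\<theta>1_U M.incl_U M.P1] M.\<theta>1])
    fix d x assume d: "d \<in> Obj C" "x \<in> fobj (representable C A) d"
    show "Comp (presheaves C) (representable C A) M.U (representable C c) (incl C (fobj M.U)) (yoneda_arr C A c a) d x = yoneda_arr C A c a d x"
      unfolding presheaves_comp_apply[OF d] by (rule incl_apply[where V = "fobj M.U", OF d(1) M.U_I1[OF d(2)]])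
  qed
  moreover have "Comp (presheaves C) (representable C B) M.U (representable C c) (incl C (fobj M.U)) (yoneda_arr C B c b) = yoneda_arr C B c b"
  proof (rule pnat_ext[OF presheaves_comp_in[OF M.\<theta>2_U M.incl_U M.P2] M.\<theta>2])
    fix d x assume d: "d \<in> Obj C" "x \<in> fobj (representable C B) d"
    show "Comp (presheaves C) (representable C B) M.U (representable C c) (incl C (fobj M.U)) (yoneda_arr C B c b) d x = yoneda_arr C B c b d x"
      unfolding presheaves_comp_apply[OF d] by (rule incl_apply[where V = "fobj M.U", OF d(1) M.U_I2[OF d(2)]])
  qed
  ultimately have fac: "factors (presheaves C) (representable C c) X (M.U, incl C (fobj M.U))" if "X \<in> rep_pair A B c a b" for X
    using that M.\<theta>1_U M.\<theta>2_U by (auto intro!: factorsI)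
  have least: "factors (presheaves C) (representable C c) (M.U, incl C (fobj M.U)) V"
    if V: "V \<in> subobjects (presheaves C) (representable C c)"
      "\<forall>X\<in>rep_pair A B c a b. factors (presheaves C) (representable C c) X V" for V
  proof -
    from V(1) obtain W w where W: "V = (W, w)" "W \<in> Obj (presheaves C)" "is_mono (presheaves C) W (representable C c) w"
      "w \<in> Hom (presheaves C) W (representable C c)" by (rule subobjectsE)
    have W': "presheaf C W" "w \<in> pnat C W (representable C c)" using W by simp_all
    have VV: "factors (presheaves C) (representable C c) (representable C A, yoneda_arr C A c a) (W, w)"
      "factors (presheaves C) (representable C c) (representable C B, yoneda_arr C B c b) (W, w)" using V(2) W by auto
    obtain \<alpha>1 where \<alpha>1: "\<alpha>1 \<in> Hom (presheaves C) (representable C A) W"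
      "Comp (presheaves C) (representable C A) W (representable C c) w \<alpha>1 = yoneda_arr C A c a" using VV(1) by (rule factorsD)
    obtain \<alpha>2 where \<alpha>2: "\<alpha>2 \<in> Hom (presheaves C) (representable C B) W"
      "Comp (presheaves C) (representable C B) W (representable C c) w \<alpha>2 = yoneda_arr C B c b" using VV(2) by (rule factorsD)
    have \<alpha>: "\<alpha>1 \<in> pnat C (representable C A) W" "\<alpha>2 \<in> pnat C (representable C B) W" using \<alpha>1 \<alpha>2 by simp_all
    have e1: "w d (\<alpha>1 d x) = yoneda_arr C A c a d x" if "d \<in> Obj C" "x \<in> fobj (representable C A) d" for d x
      using \<alpha>1(2)[THEN fun_cong, of d, THEN fun_cong, of x] that by simp
    have e2: "w d (\<alpha>2 d x) = yoneda_arr C B c b d x" if "d \<in> Obj C" "x \<in> fobj (representable C B) d" for d x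
      using \<alpha>2(2)[THEN fun_cong, of d, THEN fun_cong, of x] that by simp
    have "\<exists>\<gamma>\<in>pnat C M.U W. (\<forall>d\<in>Obj C. \<forall>x\<in>fobj (representable C A) d. \<gamma> d (yoneda_arr C A c a d x) = \<alpha>1 d x) \<and>
      (\<forall>d\<in>Obj C. \<forall>y\<in>fobj (representable C B) d. \<gamma> d (yoneda_arr C B c b d y) = \<alpha>2 d y)"
    proof (rule M.U_glue[OF \<alpha>])
      fix d x y assume d: "d \<in> Obj C" "x \<in> fobj (representable C A) d" "y \<in> fobj (representable C B) d"
        "yoneda_arr C A c a d x = yoneda_arr C B c b d y"
      show "\<alpha>1 d x = \<alpha>2 d y"
        by (rule presheaves_is_monoD[OF W(3) W'(1) d(1) pnat_in[OF \<alpha>(1) d(2,1)] pnat_in[OF \<alpha>(2) d(3,1)]])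
          (use e1[OF d(1,2)] e2[OF d(1,3)] d(4) in simp)
    qed
    then obtain \<gamma> where \<gamma>: "\<gamma> \<in> pnat C M.U W" "\<forall>d\<in>Obj C. \<forall>x\<in>fobj (representable C A) d. \<gamma> d (yoneda_arr C A c a d x) = \<alpha>1 d x"
      "\<forall>d\<in>Obj C. \<forall>y\<in>fobj (representable C B) d. \<gamma> d (yoneda_arr C B c b d y) = \<alpha>2 d y" by blast
    have "Comp (presheaves C) M.U W (representable C c) w \<gamma> = incl C (fobj M.U)"
    proof (rule M.U_ext[OF presheaves_comp_in[OF \<gamma>(1) W'(2) M.presheaf_U] M.incl_U])
      fix d x assume d: "d \<in> Obj C"
      { assume x: "x \<in> fobj (representable C A) d"
        show "Comp (presheaves C) M.U W (representable C c) w \<gamma> d (yoneda_arr C A c a d x) = incl C (fobj M.U) d (yoneda_arr C A c a d x)"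
          using d x M.U_I1[OF x] \<gamma>(2)[rule_format, OF d x] e1[OF d x] presheaves_comp_apply[OF d M.U_I1[OF x]] incl_apply[where V = "fobj M.U", OF d M.U_I1[OF x]] by metis }
      { assume x: "x \<in> fobj (representable C B) d"
        show "Comp (presheaves C) M.U W (representable C c) w \<gamma> d (yoneda_arr C B c b d x) = incl C (fobj M.U) d (yoneda_arr C B c b d x)"
          using d x M.U_I2[OF x] \<gamma>(3)[rule_format, OF d x] e2[OF d x] presheaves_comp_apply[OF d M.U_I2[OF x]] incl_apply[where V = "fobj M.U", OF d M.U_I2[OF x]] by metis }
    qed
    then show ?thesis unfolding W(1) using \<gamma>(1) by (intro factorsI[of \<gamma>]) simp_all
  qed
  show ?thesis unfolding is_union_def using sub fac least by blast
qed

text \<open>A weight is given only as some union in the presheaf category. Comparison with the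
  concrete union \<open>union_rep\<close> yields the elementwise facts about it on which the
  computation of the weighted colimit rests.\<close>

lemma is_union_representablesD:
  assumes a: "is_mono C A c a" "is_mono C B c b" and o: "A \<in> Obj C" "B \<in> Obj C" "c \<in> Obj C"
    and un: "is_union (presheaves C) (representable C c) (rep_pair A B c a b) (\<phi>, \<iota>)"
  shows "presheaf C \<phi>" "\<iota> \<in> pnat C \<phi> (representable C c)"
    "\<And>d x x'. \<lbrakk>d \<in> Obj C; x \<in> fobj \<phi> d; x' \<in> fobj \<phi> d; \<iota> d x = \<iota> d x'\<rbrakk> \<Longrightarrow> x = x'"
    "\<And>d x. \<lbrakk>d \<in> Obj C; x \<in> fobj \<phi> d\<rbrakk> \<Longrightarrow> (\<exists>u\<in>Hom C d A. \<iota> d x = Comp C d A c a u) \<or> (\<exists>u\<in>Hom C d B. \<iota> d x = Comp C d B c b u)"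
    "\<exists>x\<in>fobj \<phi> A. \<iota> A x = a" "\<exists>x\<in>fobj \<phi> B. \<iota> B x = b"
proof -
  interpret M: mono_pair C "representable C c" "representable C A" "representable C B" "yoneda_arr C A c a" "yoneda_arr C B c b"
    by (rule mono_pair_representable[OF a o])
  have s: "(\<phi>, \<iota>) \<in> subobjects (presheaves C) (representable C c)" using un unfolding is_union_def by blast
  then have m: "is_mono (presheaves C) \<phi> (representable C c) \<iota>" and \<phi>: "presheaf C \<phi>" unfolding subobjects_def by auto
  then have \<iota>: "\<iota> \<in> pnat C \<phi> (representable C c)" using is_mono_in[OF m] by simp
  show "presheaf C \<phi>" "\<iota> \<in> pnat C \<phi> (representable C c)" by fact+
  show "x = x'" if "d \<in> Obj C" "x \<in> fobj \<phi> d" "x' \<in> fobj \<phi> d" "\<iota> d x = \<iota> d x'" for d x x'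
    using presheaves_is_monoD[OF m \<phi> that] .
  have "factors (presheaves C) (representable C c) (\<phi>, \<iota>) (M.U, incl C (fobj M.U))"
    using un is_union_representables[OF a o] unfolding is_union_def by blast
  then obtain h where h: "h \<in> Hom (presheaves C) \<phi> M.U" "Comp (presheaves C) \<phi> M.U (representable C c) (incl C (fobj M.U)) h = \<iota>"
    by (rule factorsD)
  have h': "h \<in> pnat C \<phi> M.U" using h by simp
  show "(\<exists>u\<in>Hom C d A. \<iota> d x = Comp C d A c a u) \<or> (\<exists>u\<in>Hom C d B. \<iota> d x = Comp C d B c b u)"
    if d: "d \<in> Obj C" "x \<in> fobj \<phi> d" for d x
  proof -
    have "\<iota> d x \<in> fobj M.U d"
      using h(2)[THEN fun_cong, of d, THEN fun_cong, of x] d pnat_in[OF h' d(2,1)] by simp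
    then show ?thesis by (cases rule: M.U_cases) (use d in auto)
  qed
  have "factors (presheaves C) (representable C c) (representable C A, yoneda_arr C A c a) (\<phi>, \<iota>)"
    using un unfolding is_union_def by blast
  then obtain r where r: "r \<in> Hom (presheaves C) (representable C A) \<phi>" "Comp (presheaves C) (representable C A) \<phi> (representable C c) \<iota> r = yoneda_arr C A c a"
    by (rule factorsD)
  have r': "r \<in> pnat C (representable C A) \<phi>" using r by simp
  show "\<exists>x\<in>fobj \<phi> A. \<iota> A x = a"
    using r(2)[THEN fun_cong, of A, THEN fun_cong, of "Id C A"] o is_mono_in[OF a(1)] pnat_in[OF r', of "Id C A" A] by auto
  have "factors (presheaves C) (representable C c) (representable C B, yoneda_arr C B c b) (\<phi>, \<iota>)"
    using un unfolding is_union_def by blast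
  then obtain r where r: "r \<in> Hom (presheaves C) (representable C B) \<phi>" "Comp (presheaves C) (representable C B) \<phi> (representable C c) \<iota> r = yoneda_arr C B c b"
    by (rule factorsD)
  have r': "r \<in> pnat C (representable C B) \<phi>" using r by simp
  show "\<exists>x\<in>fobj \<phi> B. \<iota> B x = b"
    using r(2)[THEN fun_cong, of B, THEN fun_cong, of "Id C B"] o is_mono_in[OF a(2)] pnat_in[OF r', of "Id C B" B] by auto
qed

end

text \<open>The weight is the union of the representables of \<open>A0\<close> and
  \<open>B0\<close>, which meet in that of \<open>M\<close>. So a cocone is a pair of arrows out of
  \<open>D A0\<close> and \<open>D B0\<close> that agree on \<open>D M\<close>. By
  \<open>ex\<close>, \<open>D M\<close> covers the intersection of the two subpresheaves of
  \<open>D c0\<close>, so such a pair is an arrow out of their union.\<close>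

lemma (in presheaf_subcat) union_weighted_colimit:
  fixes K :: "('u, 'u) cat"
  assumes K: "locally_small K" and a: "is_mono K A0 c0 a0" "is_mono K B0 c0 b0"
    and P: "is_pullback K M A0 B0 c0 p q a0 b0"
    and un: "is_union (presheaves K) (representable K c0)
       {(representable K A0, yoneda_arr K A0 c0 a0), (representable K B0, yoneda_arr K B0 c0 b0)} (\<phi>, \<iota>)"
    and D: "is_functor K A D"
    and mp: "mono_pair C (fobj D c0) (fobj D A0) (fobj D B0) (farr D A0 c0 a0) (farr D B0 c0 b0)"
    and ex: "\<And>d x y. \<lbrakk>d \<in> Obj C; x \<in> fobj (fobj D A0) d; y \<in> fobj (fobj D B0) d; farr D A0 c0 a0 d x = farr D B0 c0 b0 d y\<rbrakk> \<Longrightarrow>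
      \<exists>z\<in>fobj (fobj D M) d. farr D M A0 p d z = x \<and> farr D M B0 q d z = y"
    and U: "union_psh (fobj D c0) (fobj D A0) (fobj D B0) (farr D A0 c0 a0) (farr D B0 c0 b0) \<in> S"
  shows "is_weighted_colimit K A \<phi> D (union_psh (fobj D c0) (fobj D A0) (fobj D B0) (farr D A0 c0 a0) (farr D B0 c0 b0))
    (\<lambda>k x. farr D k c0 (\<iota> k x))"
proof -
  interpret K: locally_small_cat K using K by unfold_locales (simp_all add: locally_small_def)
  interpret M: mono_pair C "fobj D c0" "fobj D A0" "fobj D B0" "farr D A0 c0 a0" "farr D B0 c0 b0" by (rule mp)
  note P1 = is_pullbackD[OF P]
  note o = P1(2-4)
  note \<phi> = K.is_union_representablesD[OF a o un]
  have Dob: "fobj D k \<in> Obj A" if "k \<in> Obj K" for k using D that unfolding is_functor_def by blast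
  then have Dps: "presheaf C (fobj D k)" if "k \<in> Obj K" for k using that by simp
  have Dar: "farr D k l u \<in> pnat C (fobj D k) (fobj D l)" if "u \<in> Hom K k l" "k \<in> Obj K" "l \<in> Obj K" for k l u
    using D that unfolding is_functor_def by (metis full_subcat_simps(2) functor_cat_simps(2))
  have Dcomp: "farr D k m (Comp K k l m v u) d z = farr D l m v d (farr D k l u d z)"
    if "u \<in> Hom K k l" "v \<in> Hom K l m" "k \<in> Obj K" "l \<in> Obj K" "m \<in> Obj K" "d \<in> Obj C" "z \<in> fobj (fobj D k) d" for k l m u v d z
  proof -
    have "farr D k m (Comp K k l m v u) = Comp A (fobj D k) (fobj D l) (fobj D m) (farr D l m v) (farr D k l u)"
      using D that unfolding is_functor_def by blast
    then show ?thesis using that by simp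
  qed
  have \<iota>in: "\<iota> k x \<in> Hom K k c0" if "k \<in> Obj K" "x \<in> fobj \<phi> k" for k x
    using pnat_in[OF \<phi>(2) that(2,1)] by simp
  have \<iota>nat: "\<iota> k (farr \<phi> l k u x) = Comp K k l c0 (\<iota> l x) u" if "k \<in> Obj K" "l \<in> Obj K" "u \<in> Hom K k l" "x \<in> fobj \<phi> l" for k l u x
    using pnat_natural[OF \<phi>(2) that(4,3,2,1)] \<iota>in that by simp
  \<comment> \<open>\<open>xA\<close> and \<open>xB\<close> are the generic elements of the weight;
    a cocone is determined by its values at them.\<close>
  obtain xA where xA: "xA \<in> fobj \<phi> A0" "\<iota> A0 xA = a0" using \<phi>(5) by blast
  obtain xB where xB: "xB \<in> fobj \<phi> B0" "\<iota> B0 xB = b0" using \<phi>(6) by blast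
  have Ain: "a0 \<in> Hom K A0 c0" "b0 \<in> Hom K B0 c0" using P1 by simp_all
  have \<xi>: "farr D k c0 (\<iota> k x) \<in> pnat C (fobj D k) M.U" if k: "k \<in> Obj K" and x: "x \<in> fobj \<phi> k" for k x
    unfolding union_psh_def
  proof (rule pnat_corestrict[OF Dar[OF \<iota>in[OF k x] k o(3)] Dps[OF k]])
    fix d z assume d: "d \<in> Obj C" "z \<in> fobj (fobj D k) d"
    from \<phi>(4)[OF k x] show "farr D k c0 (\<iota> k x) d z \<in> union_sets (fobj D A0) (fobj D B0) (farr D A0 c0 a0) (farr D B0 c0 b0) d"
    proof (elim disjE bexE)
      fix u assume u: "u \<in> Hom K k A0" "\<iota> k x = Comp K k A0 c0 a0 u"
      then show ?thesis
        using Dcomp[OF u(1) Ain(1) k o(1,3) d] pnat_in[OF Dar[OF u(1) k o(1)] d(2,1)] unfolding union_sets_def by auto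
    next
      fix u assume u: "u \<in> Hom K k B0" "\<iota> k x = Comp K k B0 c0 b0 u"
      then show ?thesis
        using Dcomp[OF u(1) Ain(2) k o(2,3) d] pnat_in[OF Dar[OF u(1) k o(2)] d(2,1)] unfolding union_sets_def by auto
    qed
  qed
  have UA: "M.U \<in> Obj A" using M.presheaf_U U by simp
  have cocone: "weighted_cocone K A \<phi> D M.U (\<lambda>k x. farr D k c0 (\<iota> k x))"
    unfolding weighted_cocone_def
  proof (intro conjI ballI UA)
    show "farr D k c0 (\<iota> k x) \<in> Hom A (fobj D k) M.U" if "k \<in> Obj K" "x \<in> fobj \<phi> k" for k x using \<xi>[OF that] by simp
    fix k l u x assume k: "k \<in> Obj K" "l \<in> Obj K" "u \<in> Hom K k l" "x \<in> fobj \<phi> l"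
    have x': "farr \<phi> l k u x \<in> fobj \<phi> k" using presheaf_in[OF \<phi>(1) k(4,3,2,1)] .
    show "farr D k c0 (\<iota> k (farr \<phi> l k u x)) = Comp A (fobj D k) (fobj D l) M.U (farr D l c0 (\<iota> l x)) (farr D k l u)"
      by (rule pnat_ext[OF \<xi>[OF k(1) x'] A_comp_in[OF Dar[OF k(3,1,2)] \<xi>[OF k(2,4)] Dps[OF k(1)]]])
        (use Dcomp[OF k(3) \<iota>in[OF k(2,4)] k(1,2) o(3)] \<iota>nat[OF k] in simp)
  qed
  have "\<exists>!h. h \<in> Hom A M.U Y \<and> (\<forall>k\<in>Obj K. \<forall>x\<in>fobj \<phi> k. Comp A (fobj D k) M.U Y h (farr D k c0 (\<iota> k x)) = \<zeta> k x)"
    if \<zeta>: "weighted_cocone K A \<phi> D Y \<zeta>" for Y \<zeta>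
  proof -
    have \<zeta>in: "\<zeta> k x \<in> pnat C (fobj D k) Y" if "k \<in> Obj K" "x \<in> fobj \<phi> k" for k x
      using \<zeta> that unfolding weighted_cocone_def by simp
    have \<zeta>nat: "\<zeta> k (farr \<phi> l k u x) d z = \<zeta> l x d (farr D k l u d z)"
      if "k \<in> Obj K" "l \<in> Obj K" "u \<in> Hom K k l" "x \<in> fobj \<phi> l" "d \<in> Obj C" "z \<in> fobj (fobj D k) d" for k l u x d z
    proof -
      have "\<zeta> k (farr \<phi> l k u x) = Comp A (fobj D k) (fobj D l) Y (\<zeta> l x) (farr D k l u)"
        using \<zeta> that unfolding weighted_cocone_def by blast
      then show ?thesis using that by simp
    qed
    have "\<exists>\<gamma>\<in>pnat C M.U Y. (\<forall>d\<in>Obj C. \<forall>x\<in>fobj (fobj D A0) d. \<gamma> d (farr D A0 c0 a0 d x) = \<zeta> A0 xA d x) \<and>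
        (\<forall>d\<in>Obj C. \<forall>y\<in>fobj (fobj D B0) d. \<gamma> d (farr D B0 c0 b0 d y) = \<zeta> B0 xB d y)"
    proof (rule M.U_glue[OF \<zeta>in[OF o(1) xA(1)] \<zeta>in[OF o(2) xB(1)]])
      fix d x y assume d: "d \<in> Obj C" "x \<in> fobj (fobj D A0) d" "y \<in> fobj (fobj D B0) d" "farr D A0 c0 a0 d x = farr D B0 c0 b0 d y"
      obtain z where z: "z \<in> fobj (fobj D M) d" "farr D M A0 p d z = x" "farr D M B0 q d z = y" using ex[OF d] by blast
      \<comment> \<open>The restrictions of \<open>xA\<close> and \<open>xB\<close> to
        \<open>M\<close> both name the diagonal \<open>M -> c0\<close>, and \<open>\<iota>\<close>
        is injective; so the cocone takes a single value on the intersection.\<close>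
      have "\<iota> M (farr \<phi> A0 M p xA) = \<iota> M (farr \<phi> B0 M q xB)"
        using \<iota>nat[OF P1(1) o(1) P1(5) xA(1)] \<iota>nat[OF P1(1) o(2) P1(6) xB(1)] xA(2) xB(2) P1(9) by simp
      then have "farr \<phi> A0 M p xA = farr \<phi> B0 M q xB"
        using \<phi>(3)[OF P1(1) presheaf_in[OF \<phi>(1) xA(1) P1(5) o(1) P1(1)] presheaf_in[OF \<phi>(1) xB(1) P1(6) o(2) P1(1)]] by blast
      then show "\<zeta> A0 xA d x = \<zeta> B0 xB d y"
        using \<zeta>nat[OF P1(1) o(1) P1(5) xA(1) d(1) z(1)] \<zeta>nat[OF P1(1) o(2) P1(6) xB(1) d(1) z(1)] z by simp
    qed
    then obtain \<gamma> where \<gamma>: "\<gamma> \<in> pnat C M.U Y" "\<And>d x. \<lbrakk>d \<in> Obj C; x \<in> fobj (fobj D A0) d\<rbrakk> \<Longrightarrow> \<gamma> d (farr D A0 c0 a0 d x) = \<zeta> A0 xA d x"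
        "\<And>d y. \<lbrakk>d \<in> Obj C; y \<in> fobj (fobj D B0) d\<rbrakk> \<Longrightarrow> \<gamma> d (farr D B0 c0 b0 d y) = \<zeta> B0 xB d y" by blast
    have fac: "Comp A (fobj D k) M.U Y \<gamma> (farr D k c0 (\<iota> k x)) = \<zeta> k x" if k: "k \<in> Obj K" and x: "x \<in> fobj \<phi> k" for k x
    proof (rule pnat_ext[OF A_comp_in[OF \<xi>[OF k x] \<gamma>(1) Dps[OF k]] \<zeta>in[OF k x]])
      fix d z assume d: "d \<in> Obj C" "z \<in> fobj (fobj D k) d"
      from \<phi>(4)[OF k x] have "\<gamma> d (farr D k c0 (\<iota> k x) d z) = \<zeta> k x d z"
      proof (elim disjE bexE)
        fix u assume u: "u \<in> Hom K k A0" "\<iota> k x = Comp K k A0 c0 a0 u"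
        have "x = farr \<phi> A0 k u xA"
          using \<phi>(3)[OF k x presheaf_in[OF \<phi>(1) xA(1) u(1) o(1) k]] \<iota>nat[OF k o(1) u(1) xA(1)] u(2) xA(2) by simp
        then show ?thesis
          using Dcomp[OF u(1) Ain(1) k o(1,3) d] \<gamma>(2)[OF d(1) pnat_in[OF Dar[OF u(1) k o(1)] d(2,1)]]
            \<zeta>nat[OF k o(1) u(1) xA(1) d] u(2) by simp
      next
        fix u assume u: "u \<in> Hom K k B0" "\<iota> k x = Comp K k B0 c0 b0 u"
        have "x = farr \<phi> B0 k u xB"
          using \<phi>(3)[OF k x presheaf_in[OF \<phi>(1) xB(1) u(1) o(2) k]] \<iota>nat[OF k o(2) u(1) xB(1)] u(2) xB(2) by simp
        then show ?thesis
          using Dcomp[OF u(1) Ain(2) k o(2,3) d] \<gamma>(3)[OF d(1) pnat_in[OF Dar[OF u(1) k o(2)] d(2,1)]]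
            \<zeta>nat[OF k o(2) u(1) xB(1) d] u(2) by simp
      qed
      then show "Comp A (fobj D k) M.U Y \<gamma> (farr D k c0 (\<iota> k x)) d z = \<zeta> k x d z" using d by simp
    qed
    have un: "h = \<gamma>" if h: "h \<in> pnat C M.U Y" "\<And>k x. \<lbrakk>k \<in> Obj K; x \<in> fobj \<phi> k\<rbrakk> \<Longrightarrow> Comp A (fobj D k) M.U Y h (farr D k c0 (\<iota> k x)) = \<zeta> k x" for h
    proof (rule M.U_ext[OF h(1) \<gamma>(1)])
      show "h d (farr D A0 c0 a0 d x) = \<gamma> d (farr D A0 c0 a0 d x)" if "d \<in> Obj C" "x \<in> fobj (fobj D A0) d" for d x
        using h(2)[OF o(1) xA(1), THEN fun_cong, of d, THEN fun_cong, of x] xA(2) \<gamma>(2)[OF that] that by simp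
      show "h d (farr D B0 c0 b0 d x) = \<gamma> d (farr D B0 c0 b0 d x)" if "d \<in> Obj C" "x \<in> fobj (fobj D B0) d" for d x
        using h(2)[OF o(2) xB(1), THEN fun_cong, of d, THEN fun_cong, of x] xB(2) \<gamma>(3)[OF that] that by simp
    qed
    show ?thesis
    proof (rule ex1I[of _ \<gamma>])
      show "\<gamma> \<in> Hom A M.U Y \<and> (\<forall>k\<in>Obj K. \<forall>x\<in>fobj \<phi> k. Comp A (fobj D k) M.U Y \<gamma> (farr D k c0 (\<iota> k x)) = \<zeta> k x)"
        using \<gamma>(1) fac unfolding full_subcat_simps(2) functor_cat_simps(2) by blast
      show "h = \<gamma>" if "h \<in> Hom A M.U Y \<and> (\<forall>k\<in>Obj K. \<forall>x\<in>fobj \<phi> k. Comp A (fobj D k) M.U Y h (farr D k c0 (\<iota> k x)) = \<zeta> k x)" for h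
        using un that unfolding full_subcat_simps(2) functor_cat_simps(2) by blast
    qed
  qed
  then show ?thesis unfolding is_weighted_colimit_def using cocone by blast
qed

section \<open>The free category with finite limits on a pair of monomorphisms\<close>

text \<open>
  It is the opposite of the category of finite sets with two subsets.  Such a structure is a list
  of pairs of truth values, and an arrow \<open>s \<rightarrow> t\<close> of the opposite category is the list of values of
  a function from the positions of \<open>t\<close> to those of \<open>s\<close>.
\<close>

definition struct_map :: "'x set \<Rightarrow> 'x set \<Rightarrow> 'x set \<Rightarrow> (bool \<times> bool) list \<Rightarrow> (nat \<Rightarrow> 'x) \<Rightarrow> bool" where
  "struct_map X PA PB s y \<longleftrightarrow>
     (\<forall>k<length s. y k \<in> X \<and> (fst (s ! k) \<longrightarrow> y k \<in> PA) \<and> (snd (s ! k) \<longrightarrow> y k \<in> PB))"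

definition struct_hom :: "(bool \<times> bool) list \<Rightarrow> (bool \<times> bool) list \<Rightarrow> nat list set" where
  "struct_hom s t = {f. length f = length t \<and>
     struct_map {..<length s} {i. fst (s ! i)} {i. snd (s ! i)} t ((!) f)}"

lemma struct_homD:
  assumes "f \<in> struct_hom s t"
  shows "length f = length t" "\<And>k. k < length t \<Longrightarrow> f ! k < length s"
    "\<And>k. \<lbrakk>k < length t; fst (t ! k)\<rbrakk> \<Longrightarrow> fst (s ! (f ! k))" "\<And>k. \<lbrakk>k < length t; snd (t ! k)\<rbrakk> \<Longrightarrow> snd (s ! (f ! k))"
  using assms unfolding struct_hom_def struct_map_def by auto

lemma struct_hom_id: "[0..<length s] \<in> struct_hom s s"
  unfolding struct_hom_def struct_map_def by auto

lemma struct_hom_comp: "\<lbrakk>f \<in> struct_hom s t; g \<in> struct_hom t u\<rbrakk> \<Longrightarrow> map ((!) f) g \<in> struct_hom s u"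
  unfolding struct_hom_def struct_map_def by auto

text \<open>The indexing category of a weight has elements of the universe type as objects and
  arrows, so lists are carried there by injections \<open>e1\<close>, \<open>e2\<close> with left
  inverses \<open>d1\<close>, \<open>d2\<close>.\<close>

locale struct_enc =
  fixes e1 :: "(bool \<times> bool) list \<Rightarrow> 'k" and d1 :: "'k \<Rightarrow> (bool \<times> bool) list"
    and e2 :: "nat list \<Rightarrow> 'm" and d2 :: "'m \<Rightarrow> nat list"
  assumes d1 [simp]: "d1 (e1 s) = s" and d2 [simp]: "d2 (e2 f) = f"
begin

definition K :: "('k, 'm) cat" where
  "K = \<lparr>Obj = range e1, Hom = (\<lambda>a b. e2 ` struct_hom (d1 a) (d1 b)), Id = (\<lambda>a. e2 [0..<length (d1 a)]),
        Comp = (\<lambda>a b c g f. e2 (map ((!) (d2 f)) (d2 g)))\<rparr>"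

lemma K_simps:
  "Obj K = range e1" "Hom K a b = e2 ` struct_hom (d1 a) (d1 b)" "Id K a = e2 [0..<length (d1 a)]"
  "Comp K a b c g f = e2 (map ((!) (d2 f)) (d2 g))"
  by (simp_all add: K_def)

lemma e1_in [simp]: "e1 s \<in> Obj K"
  by (simp add: K_simps)

lemma e2_in: "f \<in> struct_hom (d1 a) (d1 b) \<Longrightarrow> e2 f \<in> Hom K a b"
  by (simp add: K_simps)

lemma Hom_KD: "u \<in> Hom K a b \<Longrightarrow> d2 u \<in> struct_hom (d1 a) (d1 b) \<and> e2 (d2 u) = u"
  by (auto simp: K_simps)

lemma category_K: "category K"
  unfolding category_def
proof (intro conjI ballI)
  fix a b c d f g h
  show "Id K a \<in> Hom K a a" by (simp add: K_simps struct_hom_id)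
  assume f: "f \<in> Hom K a b"
  note f' = Hom_KD[OF f]
  show "Comp K a a b f (Id K a) = f"
  proof -
    have "map ((!) [0..<length (d1 a)]) (d2 f) = d2 f"
      by (rule nth_equalityI) (use struct_homD[OF conjunct1[OF f']] in auto)
    then show ?thesis using f' by (simp add: K_simps)
  qed
  show "Comp K a b b (Id K b) f = f"
    using f' struct_homD(1)[OF conjunct1[OF f']] map_nth[of "d2 f"] by (simp add: K_simps)
  assume g: "g \<in> Hom K b c"
  note g' = Hom_KD[OF g]
  show "Comp K a b c g f \<in> Hom K a c"
    using struct_hom_comp[OF conjunct1[OF f'] conjunct1[OF g']] unfolding K_simps by blast
  assume h: "h \<in> Hom K c d"
  note h' = Hom_KD[OF h]
  show "Comp K a c d h (Comp K a b c g f) = Comp K a b d (Comp K b c d h g) f"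
  proof -
    have "map ((!) (map ((!) (d2 f)) (d2 g))) (d2 h) = map ((!) (d2 f) \<circ> (!) (d2 g)) (d2 h)"
      by (rule nth_equalityI) (use struct_homD[OF conjunct1[OF g']] struct_homD[OF conjunct1[OF h']] in auto)
    then show ?thesis unfolding K_simps d2 map_map by (rule arg_cong)
  qed
qed

sublocale K: cat K
  by unfold_locales (rule category_K)

text \<open>One-point structures represent the three sets of a structure: arrows from
  \<open>s\<close> to \<open>gC\<close> are the positions of \<open>s\<close>, those to
  \<open>gA\<close> and \<open>gB\<close> the positions in the first and in the second subset.
  \<open>pt i\<close> is the arrow given by position \<open>i\<close>.\<close>

definition gA where "gA = e1 [(True, False)]"
definition gB where "gB = e1 [(False, True)]"
definition gC where "gC = e1 [(False, False)]"
definition pt where "pt i = e2 [i]"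

lemma d1_gens [simp]: "d1 gA = [(True, False)]" "d1 gB = [(False, True)]" "d1 gC = [(False, False)]"
  by (simp_all add: gA_def gB_def gC_def)

lemma gens_in [simp]: "gA \<in> Obj K" "gB \<in> Obj K" "gC \<in> Obj K"
  by (simp_all add: gA_def gB_def gC_def)

lemma pt_in_C: "i < length (d1 s) \<Longrightarrow> pt i \<in> Hom K s gC"
  unfolding pt_def by (rule e2_in) (simp add: struct_hom_def struct_map_def)

lemma pt_in_A: "\<lbrakk>i < length (d1 s); fst (d1 s ! i)\<rbrakk> \<Longrightarrow> pt i \<in> Hom K s gA"
  unfolding pt_def by (rule e2_in) (simp add: struct_hom_def struct_map_def)

lemma pt_in_B: "\<lbrakk>i < length (d1 s); snd (d1 s ! i)\<rbrakk> \<Longrightarrow> pt i \<in> Hom K s gB"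
  unfolding pt_def by (rule e2_in) (simp add: struct_hom_def struct_map_def)

lemma pt_comp [simp]: "Comp K a b c (pt i) u = pt (d2 u ! i)"
  by (simp add: K_simps pt_def)

lemma d2_pt [simp]: "d2 (pt i) = [i]"
  by (simp add: pt_def)

lemma d2_comp [simp]: "d2 (Comp K a b c g f) = map ((!) (d2 f)) (d2 g)"
  by (simp add: K_simps)

lemma Hom_gen_eq: "\<lbrakk>u \<in> Hom K s t; length (d1 t) = 1\<rbrakk> \<Longrightarrow> u = pt (d2 u ! 0)"
  using Hom_KD[of u s t] struct_homD(1)[of "d2 u" "d1 s" "d1 t"] by (cases "d2 u") (auto simp: pt_def)

lemma Hom_K_eqI:
  assumes "u \<in> Hom K s t" "v \<in> Hom K s t" "\<And>k. k < length (d1 t) \<Longrightarrow> d2 u ! k = d2 v ! k"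
  shows "u = v"
proof -
  have "d2 u = d2 v"
    using Hom_KD[OF assms(1)] Hom_KD[OF assms(2)] struct_homD(1) assms(3) by (metis nth_equalityI)
  then show ?thesis using Hom_KD[OF assms(1)] Hom_KD[OF assms(2)] by metis
qed

lemma pt_in_gens: "pt 0 \<in> Hom K gA gC" "pt 0 \<in> Hom K gB gC"
  by (rule pt_in_C; simp)+

lemma pt0_comp_gen: "\<lbrakk>u \<in> Hom K s t; length (d1 t) = 1\<rbrakk> \<Longrightarrow> Comp K s t c (pt 0) u = u"
  using Hom_gen_eq by simp

lemma is_mono_gens: "is_mono K gA gC (pt 0)" "is_mono K gB gC (pt 0)"
  unfolding is_mono_def using pt_in_gens pt0_comp_gen by (auto simp del: pt_comp)

text \<open>
  Limits in \<open>K\<close> have the dual universal property also with respect to infinite structures, since a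
  finite diagram of finite structures only reaches a finite substructure.
\<close>

lemma finite_substructure:
  assumes "finite X0"
  obtains w :: "(bool \<times> bool) list" and h :: "nat \<Rightarrow> 'x" and g :: "'x \<Rightarrow> nat"
  where "\<And>x. x \<in> X0 \<Longrightarrow> h (g x) = x" "\<And>i. i < length w \<Longrightarrow> h i \<in> X0 \<and> g (h i) = i"
    "\<And>i. i < length w \<Longrightarrow> w ! i = (h i \<in> PA, h i \<in> PB)"
    "\<And>s y. \<lbrakk>struct_map X PA PB s y; y ` {..<length s} \<subseteq> X0\<rbrakk> \<Longrightarrow> map (\<lambda>k. g (y k)) [0..<length s] \<in> struct_hom w s"
    "\<And>s f. \<lbrakk>X0 \<subseteq> X; f \<in> struct_hom w s\<rbrakk> \<Longrightarrow> struct_map X PA PB s (\<lambda>k. h (f ! k))"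
proof -
  obtain h where h: "bij_betw h {0..<card X0} X0" using ex_bij_betw_nat_finite[OF assms] by blast
  define g where "g = inv_into {0..<card X0} h"
  define w where "w = map (\<lambda>i. (h i \<in> PA, h i \<in> PB)) [0..<card X0]"
  have 1: "h (g x) = x" "g x < length w" if "x \<in> X0" for x
    using h that bij_betw_inv_into_right[OF h that] bij_betw_inv_into[OF h] unfolding g_def w_def
    by (auto simp: bij_betw_def)
  have 2: "h i \<in> X0 \<and> g (h i) = i" if "i < length w" for i
    using h that bij_betw_inv_into_left[OF h, of i] unfolding g_def w_def by (auto simp: bij_betw_def)
  have 3: "w ! i = (h i \<in> PA, h i \<in> PB)" if "i < length w" for i
    using that unfolding w_def by simp
  show ?thesis
  proof (rule that[OF 1(1) 2 3])
    fix s y assume y: "struct_map X PA PB s y" "y ` {..<length s} \<subseteq> X0"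
    then have "y k \<in> X0" if "k < length s" for k using that by auto
    then show "map (\<lambda>k. g (y k)) [0..<length s] \<in> struct_hom w s"
      using y(1) 1 3 unfolding struct_hom_def struct_map_def by simp
  next
    fix s f assume X: "X0 \<subseteq> X" "f \<in> struct_hom w s"
    then show "struct_map X PA PB s (\<lambda>k. h (f ! k))"
      using struct_homD[OF X(2)] 2 3 unfolding struct_map_def by (metis fst_conv snd_conv subsetD)
  qed
qed

text \<open>Applied with \<open>X\<close> the set of arrows \<open>w -> c\<close> of a category
  \<open>E\<close>, which may be infinite, this is the existence half of the preservation of the
  limit \<open>v\<close> by the free functor.\<close>

lemma K_limit_ex:
  assumes J: "finite (Obj J)" and D: "is_functor J K D" and L: "is_limit J K D v p"
    and y: "\<And>j. j \<in> Obj J \<Longrightarrow> struct_map X PA PB (d1 (fobj D j)) (y j)"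
    and c: "\<And>i j u k. \<lbrakk>i \<in> Obj J; j \<in> Obj J; u \<in> Hom J i j; k < length (d1 (fobj D j))\<rbrakk> \<Longrightarrow> y j k = y i (d2 (farr D i j u) ! k)"
  shows "\<exists>z. struct_map X PA PB (d1 v) z \<and> (\<forall>j\<in>Obj J. \<forall>k<length (d1 (fobj D j)). z (d2 (p j) ! k) = y j k)"
proof -
  define X0 where "X0 = (\<Union>j\<in>Obj J. y j ` {..<length (d1 (fobj D j))})"
  have fin: "finite X0" and sub: "X0 \<subseteq> X" using J y unfolding X0_def struct_map_def by auto
  obtain w h g where h: "\<And>x. x \<in> X0 \<Longrightarrow> h (g x) = x"
    and m: "\<And>s y. \<lbrakk>struct_map X PA PB s y; y ` {..<length s} \<subseteq> X0\<rbrakk> \<Longrightarrow> map (\<lambda>k. g (y k)) [0..<length s] \<in> struct_hom w s"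
    and m': "\<And>s f. \<lbrakk>X0 \<subseteq> X; f \<in> struct_hom w s\<rbrakk> \<Longrightarrow> struct_map X PA PB s (\<lambda>k. h (f ! k))"
    by (rule finite_substructure[OF fin, of PA PB X]) blast
  define q where "q j = e2 (map (\<lambda>k. g (y j k)) [0..<length (d1 (fobj D j))])" for j
  have q: "q j \<in> Hom K (e1 w) (fobj D j)" if "j \<in> Obj J" for j
    unfolding q_def by (rule e2_in) (use m[OF y[OF that]] that in \<open>auto simp: X0_def\<close>)
  have Dar: "farr D i j u \<in> Hom K (fobj D i) (fobj D j)" if "i \<in> Obj J" "j \<in> Obj J" "u \<in> Hom J i j" for i j u
    using D that unfolding is_functor_def by blast
  have "is_cone J K D (e1 w) q"
    unfolding is_cone_def
  proof (intro conjI ballI e1_in q)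
    fix i j u assume i: "i \<in> Obj J" "j \<in> Obj J" "u \<in> Hom J i j"
    note u = Hom_KD[OF Dar[OF i]]
    have ob: "fobj D i \<in> Obj K" "fobj D j \<in> Obj K" using D i unfolding is_functor_def by blast+
    show "Comp K (e1 w) (fobj D i) (fobj D j) (farr D i j u) (q i) = q j"
      by (rule Hom_K_eqI[OF _ q[OF i(2)]])
        (use ob Dar[OF i] q[OF i(1)] struct_homD[OF conjunct1[OF u]] c[OF i] in \<open>auto simp: q_def\<close>)
  qed
  then obtain r where r: "r \<in> Hom K (e1 w) v" "\<And>j. j \<in> Obj J \<Longrightarrow> Comp K (e1 w) v (fobj D j) (p j) r = q j"
    using L unfolding is_limit_def by blast
  have r': "d2 r \<in> struct_hom w (d1 v)" using Hom_KD[OF r(1)] by simp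
  have "h (d2 r ! (d2 (p j) ! k)) = y j k" if j: "j \<in> Obj J" and k: "k < length (d1 (fobj D j))" for j k
  proof -
    have "p j \<in> Hom K v (fobj D j)" using L j unfolding is_limit_def is_cone_def by blast
    then have "length (d2 (p j)) = length (d1 (fobj D j))" using Hom_KD struct_homD(1) by blast
    then have "d2 r ! (d2 (p j) ! k) = g (y j k)"
      using arg_cong[OF r(2)[OF j], of "\<lambda>u. d2 u ! k"] k by (simp add: q_def)
    moreover have "y j k \<in> X0" using j k unfolding X0_def by blast
    ultimately show ?thesis using h by simp
  qed
  then show ?thesis using m'[OF sub r'] by blast
qed

text \<open>The ranges of \<open>z\<close> and \<open>z'\<close> span one finite substructure. On it
  both are arrows to \<open>v\<close> in \<open>K\<close>, and they have the same composites with
  the legs.\<close>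

lemma K_limit_unique:
  assumes L: "is_limit J K D v p" and z: "struct_map X PA PB (d1 v) z" "struct_map X PA PB (d1 v) z'"
    and e: "\<And>j k. \<lbrakk>j \<in> Obj J; k < length (d1 (fobj D j))\<rbrakk> \<Longrightarrow> z (d2 (p j) ! k) = z' (d2 (p j) ! k)"
    and D: "is_functor J K D" and k: "k < length (d1 v)"
  shows "z k = z' k"
proof -
  define X0 where "X0 = z ` {..<length (d1 v)} \<union> z' ` {..<length (d1 v)}"
  have fin: "finite X0" unfolding X0_def by simp
  obtain w h g where h: "\<And>x. x \<in> X0 \<Longrightarrow> h (g x) = x"
    and m: "\<And>s y. \<lbrakk>struct_map X PA PB s y; y ` {..<length s} \<subseteq> X0\<rbrakk> \<Longrightarrow> map (\<lambda>k. g (y k)) [0..<length s] \<in> struct_hom w s"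
    by (rule finite_substructure[OF fin, of PA PB X]) blast
  let ?r = "\<lambda>z. e2 (map (\<lambda>k. g (z k)) [0..<length (d1 v)])"
  have r: "?r z \<in> Hom K (e1 w) v" "?r z' \<in> Hom K (e1 w) v"
    by (rule e2_in; use m z X0_def in auto)+
  have v: "v \<in> Obj K" and p: "\<And>j. j \<in> Obj J \<Longrightarrow> p j \<in> Hom K v (fobj D j)"
    and pc: "\<And>i j u. \<lbrakk>i \<in> Obj J; j \<in> Obj J; u \<in> Hom J i j\<rbrakk> \<Longrightarrow> Comp K v (fobj D i) (fobj D j) (farr D i j u) (p i) = p j"
    using L unfolding is_limit_def is_cone_def by auto
  have ob: "fobj D i \<in> Obj K" if "i \<in> Obj J" for i using D that unfolding is_functor_def by blast
  have Dar: "farr D i j u \<in> Hom K (fobj D i) (fobj D j)" if "i \<in> Obj J" "j \<in> Obj J" "u \<in> Hom J i j" for i j u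
    using D that unfolding is_functor_def by blast
  let ?q = "\<lambda>j. Comp K (e1 w) v (fobj D j) (p j) (?r z)"
  have "is_cone J K D (e1 w) ?q"
    unfolding is_cone_def
  proof (intro conjI ballI e1_in)
    show "?q j \<in> Hom K (e1 w) (fobj D j)" if "j \<in> Obj J" for j using p[OF that] r(1) v ob[OF that] by simp
    show "Comp K (e1 w) (fobj D i) (fobj D j) (farr D i j u) (?q i) = ?q j"
      if i: "i \<in> Obj J" "j \<in> Obj J" "u \<in> Hom J i j" for i j u
      using K.slide1[OF pc[OF i] r(1) p[OF i(1)] Dar[OF i]] v ob i by simp
  qed
  moreover have "Comp K (e1 w) v (fobj D j) (p j) (?r z') = ?q j" if j: "j \<in> Obj J" for j
  proof (rule Hom_K_eqI)
    show "Comp K (e1 w) v (fobj D j) (p j) (?r z') \<in> Hom K (e1 w) (fobj D j)" "?q j \<in> Hom K (e1 w) (fobj D j)"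
      using p[OF j] r v ob[OF j] by simp_all
    fix k assume k: "k < length (d1 (fobj D j))"
    have "d2 (p j) \<in> struct_hom (d1 v) (d1 (fobj D j))" using Hom_KD[OF p[OF j]] by blast
    then show "d2 (Comp K (e1 w) v (fobj D j) (p j) (?r z')) ! k = d2 (?q j) ! k"
      using struct_homD[of "d2 (p j)"] k e[OF j k] by simp
  qed
  ultimately have "?r z = ?r z'" using L r unfolding is_limit_def by blast
  from arg_cong[OF this, of "\<lambda>u. d2 u ! k"] have "g (z k) = g (z' k)" using k by simp
  moreover have "z k \<in> X0" "z' k \<in> X0" using k unfolding X0_def by blast+
  ultimately show ?thesis using h[of "z k"] h[of "z' k"] by metis
qed

end

context struct_enc
begin

text \<open>
  Colimits of structures: two elements of the disjoint union are identified if no compatible family of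
  functions to the natural numbers separates them.
\<close>

lemma finitely_complete_K: "finitely_complete K"
  unfolding finitely_complete_def
proof (intro conjI category_K allI impI, elim conjE)
  fix J :: "(nat, nat) cat" and D
  assume J: "finite_cat J" and D: "is_functor J K D"
  have ob: "fobj D i \<in> Obj K" if "i \<in> Obj J" for i using D that unfolding is_functor_def by blast
  have Dar: "farr D i j u \<in> Hom K (fobj D i) (fobj D j)" if "i \<in> Obj J" "j \<in> Obj J" "u \<in> Hom J i j" for i j u
    using D that unfolding is_functor_def by blast
  define len where "len j = length (d1 (fobj D j))" for j
  define E where "E = Sigma (Obj J) (\<lambda>j. {..<len j})"
  have finE: "finite E" unfolding E_def using J unfolding finite_cat_def by auto
  \<comment> \<open>\<open>(j, k)\<close> stands for position \<open>k\<close> of the structure at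
    \<open>j\<close>. Test functions into the natural numbers suffice, since an arrow of
    \<open>K\<close> is itself a list of positions.\<close>
  define inv where "inv \<phi> \<longleftrightarrow> (\<forall>i\<in>Obj J. \<forall>j\<in>Obj J. \<forall>u\<in>Hom J i j. \<forall>k<len j.
      \<phi> (j, k) = \<phi> (i, d2 (farr D i j u) ! k))" for \<phi> :: "nat \<times> nat \<Rightarrow> nat"
  define cls where "cls x = {y. \<forall>\<phi>. inv \<phi> \<longrightarrow> \<phi> x = \<phi> y}" for x
  have cls_inv: "\<phi> x = \<phi> y" if "inv \<phi>" "cls x = cls y" for \<phi> x y
  proof -
    have "y \<in> cls x" using that(2) unfolding cls_def by blast
    then show ?thesis using that(1) unfolding cls_def by blast
  qed
  have cls_u: "cls (j, k) = cls (i, d2 (farr D i j u) ! k)" if i: "i \<in> Obj J" "j \<in> Obj J" "u \<in> Hom J i j" "k < len j" for i j u k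
  proof -
    have *: "\<phi> (j, k) = \<phi> (i, d2 (farr D i j u) ! k)" if "inv \<phi>" for \<phi>
      using \<open>inv \<phi>\<close> i unfolding inv_def by blast
    show ?thesis
      unfolding cls_def by (intro Collect_cong all_cong1 imp_cong refl) (metis *)
  qed
  obtain g where g: "bij_betw g (cls ` E) {0..<card (cls ` E)}"
    using ex_bij_betw_finite_nat[of "cls ` E"] finE by blast
  define n where "n = card (cls ` E)"
  define num where "num x = g (cls x)" for x
  have num_eq: "cls x = cls y" if "num x = num y" "x \<in> E" "y \<in> E" for x y
    using g that unfolding num_def bij_betw_def inj_on_def by blast
  have num_lt: "num x < n" if "x \<in> E" for x using g that unfolding num_def bij_betw_def n_def by auto
  have num_surj: "\<exists>x\<in>E. num x = m" if "m < n" for m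
  proof -
    have "m \<in> g ` (cls ` E)" using g that unfolding bij_betw_def n_def by simp
    then show ?thesis unfolding num_def by blast
  qed
  define rep where "rep m = (SOME x. x \<in> E \<and> num x = m)" for m
  have rep: "rep m \<in> E \<and> num (rep m) = m" if "m < n" for m
    unfolding rep_def by (rule someI_ex) (use num_surj[OF that] in blast)
  define lab where "lab x = d1 (fobj D (fst x)) ! snd x" for x
  \<comment> \<open>A class belongs to a subset as soon as one of its members does: the least
    labelling for which the legs are homomorphisms.\<close>
  define v where "v = map (\<lambda>m. (\<exists>x\<in>E. num x = m \<and> fst (lab x), \<exists>x\<in>E. num x = m \<and> snd (lab x))) [0..<n]"
  define p where "p j = e2 (map (\<lambda>k. num (j, k)) [0..<len j])" for j
  have p: "p j \<in> Hom K (e1 v) (fobj D j)" if "j \<in> Obj J" for j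
    unfolding p_def
  proof (rule e2_in)
    have E: "(j, k) \<in> E" if "k < len j" for k using that \<open>j \<in> Obj J\<close> unfolding E_def by simp
    show "map (\<lambda>k. num (j, k)) [0..<len j] \<in> struct_hom (d1 (e1 v)) (d1 (fobj D j))"
      unfolding struct_hom_def struct_map_def using num_lt[OF E] E
      by (auto simp: len_def[symmetric] v_def lab_def intro!: bexI[of _ "(j, _)"])
  qed
  have cone: "is_cone J K D (e1 v) p"
    unfolding is_cone_def
  proof (intro conjI ballI e1_in p)
    fix i j u assume i: "i \<in> Obj J" "j \<in> Obj J" "u \<in> Hom J i j"
    note u = Hom_KD[OF Dar[OF i]]
    show "Comp K (e1 v) (fobj D i) (fobj D j) (farr D i j u) (p i) = p j"
    proof (rule Hom_K_eqI[OF _ p[OF i(2)]])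
      fix k assume "k < length (d1 (fobj D j))"
      then show "d2 (Comp K (e1 v) (fobj D i) (fobj D j) (farr D i j u) (p i)) ! k = d2 (p j) ! k"
        using struct_homD(1,2)[OF conjunct1[OF u]] cls_u[OF i, of k] by (simp add: p_def len_def num_def)
    qed (use Dar[OF i] p[OF i(1)] ob[OF i(1)] ob[OF i(2)] in simp)
  qed
  have "\<exists>!h. h \<in> Hom K w (e1 v) \<and> (\<forall>j\<in>Obj J. Comp K w (e1 v) (fobj D j) (p j) h = q j)"
    if "is_cone J K D w q" for w q
  proof -
    have w: "w \<in> Obj K" and q: "\<And>j. j \<in> Obj J \<Longrightarrow> q j \<in> Hom K w (fobj D j)"
      and qc: "\<And>i j u. \<lbrakk>i \<in> Obj J; j \<in> Obj J; u \<in> Hom J i j\<rbrakk> \<Longrightarrow> Comp K w (fobj D i) (fobj D j) (farr D i j u) (q i) = q j"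
      using that unfolding is_cone_def by auto
    have q': "d2 (q j) \<in> struct_hom (d1 w) (d1 (fobj D j))" if "j \<in> Obj J" for j using Hom_KD[OF q[OF that]] by blast
    define y where "y x = d2 (q (fst x)) ! snd x" for x
    have "inv y"
      unfolding inv_def
    proof (intro ballI allI impI)
      fix i j u k assume i: "i \<in> Obj J" "j \<in> Obj J" "u \<in> Hom J i j" and k: "k < len j"
      have "length (d2 (farr D i j u)) = len j" using struct_homD(1)[OF conjunct1[OF Hom_KD[OF Dar[OF i]]]] by (simp add: len_def)
      then show "y (j, k) = y (i, d2 (farr D i j u) ! k)"
        using arg_cong[OF qc[OF i], of "\<lambda>u. d2 u ! k"] k by (simp add: y_def)
    qed
    then have y_num: "y x = y x'" if "num x = num x'" "x \<in> E" "x' \<in> E" for x x'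
      using cls_inv num_eq that by blast
    have yE: "y x < length (d1 w)" "fst (lab x) \<Longrightarrow> fst (d1 w ! y x)" "snd (lab x) \<Longrightarrow> snd (d1 w ! y x)" if "x \<in> E" for x
    proof -
      have j: "fst x \<in> Obj J" "snd x < length (d1 (fobj D (fst x)))" using that unfolding E_def len_def by auto
      show "y x < length (d1 w)" "fst (lab x) \<Longrightarrow> fst (d1 w ! y x)" "snd (lab x) \<Longrightarrow> snd (d1 w ! y x)"
        using struct_homD(2-4)[OF q'[OF j(1)] j(2)] unfolding y_def lab_def by blast+
    qed
    define h where "h = e2 (map (\<lambda>m. y (rep m)) [0..<n])"
    have lv: "length v = n" "\<And>m. m < n \<Longrightarrow> v ! m = (\<exists>x\<in>E. num x = m \<and> fst (lab x), \<exists>x\<in>E. num x = m \<and> snd (lab x))"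
      unfolding v_def by simp_all
    have h: "h \<in> Hom K w (e1 v)"
      unfolding h_def
    proof (rule e2_in)
      have "y (rep m) < length (d1 w) \<and> (fst (v ! m) \<longrightarrow> fst (d1 w ! y (rep m))) \<and> (snd (v ! m) \<longrightarrow> snd (d1 w ! y (rep m)))"
        if m: "m < n" for m
      proof -
        have r: "rep m \<in> E" "num (rep m) = m" using rep[OF m] by auto
        have "y x = y (rep m)" if "x \<in> E" "num x = m" for x using y_num[of x "rep m"] that r by simp
        then show ?thesis using yE(1)[OF r(1)] yE(2,3) lv(2)[OF m] by auto metis+
      qed
      then show "map (\<lambda>m. y (rep m)) [0..<n] \<in> struct_hom (d1 w) (d1 (e1 v))"
        unfolding struct_hom_def struct_map_def using lv(1) by simp
    qed
    have eq: "Comp K w (e1 v) (fobj D j) (p j) h = q j" if j: "j \<in> Obj J" for j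
    proof (rule Hom_K_eqI[OF _ q[OF j]])
      fix k assume k: "k < length (d1 (fobj D j))"
      then have E: "(j, k) \<in> E" using j unfolding E_def len_def by simp
      have "y (rep (num (j, k))) = y (j, k)" using y_num[of "rep (num (j, k))" "(j, k)"] rep[OF num_lt[OF E]] E by blast
      then show "d2 (Comp K w (e1 v) (fobj D j) (p j) h) ! k = d2 (q j) ! k"
        using k num_lt[OF E] by (simp add: h_def p_def len_def y_def)
    qed (use h p[OF j] w ob[OF j] in simp)
    have un: "h' = h" if h': "h' \<in> Hom K w (e1 v)" "\<And>j. j \<in> Obj J \<Longrightarrow> Comp K w (e1 v) (fobj D j) (p j) h' = q j" for h'
    proof (rule Hom_K_eqI[OF h'(1) h])
      fix m assume "m < length (d1 (e1 v))"
      then have m: "m < n" using lv by simp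
      obtain j k where r: "rep m = (j, k)" by (cases "rep m")
      have jk: "j \<in> Obj J" "k < len j" "num (j, k) = m" using rep[OF m] unfolding r E_def by auto
      have "d2 h' ! m = y (rep m)"
        using arg_cong[OF h'(2)[OF jk(1)], of "\<lambda>u. d2 u ! k"] jk r by (simp add: p_def y_def)
      then show "d2 h' ! m = d2 h ! m" using m by (simp add: h_def)
    qed
    show ?thesis
    proof (rule ex1I[of _ h])
      show "h \<in> Hom K w (e1 v) \<and> (\<forall>j\<in>Obj J. Comp K w (e1 v) (fobj D j) (p j) h = q j)" using h eq by blast
      show "h' = h" if "h' \<in> Hom K w (e1 v) \<and> (\<forall>j\<in>Obj J. Comp K w (e1 v) (fobj D j) (p j) h' = q j)" for h'
        using un that by blast
    qed
  qed
  then show "\<exists>v p. is_limit J K D v p" unfolding is_limit_def using cone by blast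
qed

end

section \<open>Powers of a cospan by finite structures\<close>

abbreviation fac_set where
  "fac_set E w A c a \<equiv> {x. \<exists>h\<in>Hom E w A. Comp E w A c a h = x}"

text \<open>
  \<open>pow E A B c a b s v \<pi>\<close>: arrows into \<open>v\<close> correspond to homomorphisms from the structure \<open>s\<close> to the
  structure of generalized elements of the cospan.
\<close>

definition pow where
  "pow E A B c a b s v \<pi> \<longleftrightarrow> v \<in> Obj E \<and> struct_map (Hom E v c) (fac_set E v A c a) (fac_set E v B c b) s \<pi> \<and>
     (\<forall>w\<in>Obj E. \<forall>x. struct_map (Hom E w c) (fac_set E w A c a) (fac_set E w B c b) s x \<longrightarrow>
        (\<exists>!h. h \<in> Hom E w v \<and> (\<forall>k<length s. Comp E w v c (\<pi> k) h = x k)))"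

context cat
begin

text \<open>As \<open>a\<close> and \<open>b\<close> are monic, the components of a cone at
  \<open>3 k + 1\<close> and \<open>3 k + 2\<close> are determined by the one at \<open>3 k\<close>;
  all that is left of them is the condition that the latter factors through the subobject.\<close>

lemma limit_shape_pow:
  assumes D: "cospan_diagram C (A, B, c, a, b) D" and o: "A \<in> Obj C" "B \<in> Obj C" "c \<in> Obj C"
    and m: "is_mono C A c a" "is_mono C B c b" and L: "is_limit (shape s) C D v p"
  shows "pow C A B c a b s v (\<lambda>k. p (3 * k))"
proof -
  have D': "\<And>k. fobj D (3 * k) = c" "\<And>k. fobj D (3 * k + 1) = A" "\<And>k. fobj D (3 * k + 2) = B"
    using D unfolding cospan_diagram_def by auto
  note cone = is_cone_shape_iff[OF D o]
  have v: "v \<in> Obj C" and p: "\<And>k. k < length s \<Longrightarrow> p (3 * k) \<in> Hom C v c \<and>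
      (fst (s ! k) \<longrightarrow> p (3 * k + 1) \<in> Hom C v A \<and> Comp C v A c a (p (3 * k + 1)) = p (3 * k)) \<and>
      (snd (s ! k) \<longrightarrow> p (3 * k + 2) \<in> Hom C v B \<and> Comp C v B c b (p (3 * k + 2)) = p (3 * k))"
    using L unfolding is_limit_def cone by blast+
  have str: "struct_map (Hom C v c) (fac_set C v A c a) (fac_set C v B c b) s (\<lambda>k. p (3 * k))"
    unfolding struct_map_def using p by blast
  have "\<exists>!h. h \<in> Hom C w v \<and> (\<forall>k<length s. Comp C w v c (p (3 * k)) h = x k)"
    if w: "w \<in> Obj C" and x: "struct_map (Hom C w c) (fac_set C w A c a) (fac_set C w B c b) s x" for w x
  proof -
    have xA: "\<forall>k. \<exists>h. k < length s \<and> fst (s ! k) \<longrightarrow> h \<in> Hom C w A \<and> Comp C w A c a h = x k"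
      and xB: "\<forall>k. \<exists>h. k < length s \<and> snd (s ! k) \<longrightarrow> h \<in> Hom C w B \<and> Comp C w B c b h = x k"
      and xc: "\<forall>k<length s. x k \<in> Hom C w c"
      using x unfolding struct_map_def by blast+
    obtain yA where yA: "\<And>k. \<lbrakk>k < length s; fst (s ! k)\<rbrakk> \<Longrightarrow> yA k \<in> Hom C w A \<and> Comp C w A c a (yA k) = x k"
      using choice[OF xA] by blast
    obtain yB where yB: "\<And>k. \<lbrakk>k < length s; snd (s ! k)\<rbrakk> \<Longrightarrow> yB k \<in> Hom C w B \<and> Comp C w B c b (yB k) = x k"
      using choice[OF xB] by blast
    define q where "q j = (if j mod 3 = 0 then x (j div 3) else if j mod 3 = 1 then yA (j div 3) else yB (j div 3))" for j
    have q3: "q (3 * k) = x k" "q (3 * k + 1) = yA k" "q (3 * k + 2) = yB k" for k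
    proof -
      have "(3 * k + 1) mod 3 = 1" "(3 * k + 1) div 3 = k" "(3 * k + 2) mod 3 = 2" "(3 * k + 2) div 3 = k" by presburger+
      then show "q (3 * k) = x k" "q (3 * k + 1) = yA k" "q (3 * k + 2) = yB k" unfolding q_def by simp_all
    qed
    have "is_cone (shape s) C D w q"
      unfolding cone q3 using w xc yA yB by blast
    then have "\<exists>!h. h \<in> Hom C w v \<and> (\<forall>j\<in>Obj (shape s). Comp C w v (fobj D j) (p j) h = q j)"
      using L unfolding is_limit_def by blast
    moreover have "(\<forall>j\<in>Obj (shape s). Comp C w v (fobj D j) (p j) h = q j) \<longleftrightarrow> (\<forall>k<length s. Comp C w v c (p (3 * k)) h = x k)"
      if h: "h \<in> Hom C w v" for h
    proof
      assume e: "\<forall>k<length s. Comp C w v c (p (3 * k)) h = x k"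
      show "\<forall>j\<in>Obj (shape s). Comp C w v (fobj D j) (p j) h = q j"
        unfolding Ball_shape_iff D' q3
      proof (intro allI impI conjI)
        fix k assume k: "k < length s"
        show "Comp C w v c (p (3 * k)) h = x k" using e k by blast
        show "Comp C w v A (p (3 * k + 1)) h = yA k" if f: "fst (s ! k)"
        proof (rule is_monoD[OF m(1) _ _ _ w])
          have pk: "p (3 * k + 1) \<in> Hom C v A" "Comp C v A c a (p (3 * k + 1)) = p (3 * k)" using p[OF k] f by blast+
          show "Comp C w A c a (Comp C w v A (p (3 * k + 1)) h) = Comp C w A c a (yA k)"
            using slide1[OF pk(2) h pk(1)] is_mono_in[OF m(1)] w v o e k yA[OF k f] by simp
          show "Comp C w v A (p (3 * k + 1)) h \<in> Hom C w A" "yA k \<in> Hom C w A"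
            using pk(1) h w v o yA[OF k f] by simp_all
        qed
        show "Comp C w v B (p (3 * k + 2)) h = yB k" if f: "snd (s ! k)"
        proof (rule is_monoD[OF m(2) _ _ _ w])
          have pk: "p (3 * k + 2) \<in> Hom C v B" "Comp C v B c b (p (3 * k + 2)) = p (3 * k)" using p[OF k] f by blast+
          show "Comp C w B c b (Comp C w v B (p (3 * k + 2)) h) = Comp C w B c b (yB k)"
            using slide1[OF pk(2) h pk(1)] is_mono_in[OF m(2)] w v o e k yB[OF k f] by simp
          show "Comp C w v B (p (3 * k + 2)) h \<in> Hom C w B" "yB k \<in> Hom C w B"
            using pk(1) h w v o yB[OF k f] by simp_all
        qed
      qed
    next
      assume "\<forall>j\<in>Obj (shape s). Comp C w v (fobj D j) (p j) h = q j"
      then show "\<forall>k<length s. Comp C w v c (p (3 * k)) h = x k" unfolding Ball_shape_iff D' q3 by blast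
    qed
    ultimately show ?thesis by (simp cong: conj_cong)
  qed
  then show ?thesis unfolding pow_def using v str by blast
qed

end

lemma preserves_mono:
  assumes F: "is_functor A B F" "preserves_finite_limits A B F" and A: "category A" and B: "category B"
    and m: "is_mono A x y a" "x \<in> Obj A" "y \<in> Obj A"
  shows "is_mono B (fobj F x) (fobj F y) (farr F x y a)"
proof -
  interpret A: cat A by unfold_locales fact
  interpret B: cat B by unfold_locales fact
  have a: "a \<in> Hom A x y" using is_mono_in[OF m(1)] .
  have "is_pullback A x x x y (Id A x) (Id A x) a a" using A.is_mono_iff_is_pullback[OF a m(2,3)] m(1) by blast
  from preserves_pullback[OF F A B this]
  have "is_pullback B (fobj F x) (fobj F x) (fobj F x) (fobj F y) (Id B (fobj F x)) (Id B (fobj F x)) (farr F x y a) (farr F x y a)"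
    using F(1) m(2) unfolding is_functor_def by simp
  moreover have "farr F x y a \<in> Hom B (fobj F x) (fobj F y)" "fobj F x \<in> Obj B" "fobj F y \<in> Obj B"
    using F(1) m a unfolding is_functor_def by auto
  ultimately show ?thesis using B.is_mono_iff_is_pullback by blast
qed

context struct_enc
begin

text \<open>A structure is glued from its points, each with the subsets to which it belongs. Dually,
  every object of \<open>K\<close> is a finite limit of the three generators, of the shape which the
  object itself prescribes.\<close>

lemma K_shape_limit:
  assumes s: "s \<in> Obj K"
  shows "is_limit (shape (d1 s)) K (cospan_func K (gA, gB, gC, pt 0, pt 0)) s (\<lambda>j. pt (j div 3))"
proof -
  let ?D = "cospan_func K (gA, gB, gC, pt 0, pt 0)"
  note D = cospan_diagram_cospan_func[of K "(gA, gB, gC, pt 0, pt 0)"]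
  have D': "\<And>k. fobj ?D (3 * k) = gC" "\<And>k. fobj ?D (3 * k + 1) = gA" "\<And>k. fobj ?D (3 * k + 2) = gB"
    using D unfolding cospan_diagram_def by auto
  note cone = K.is_cone_shape_iff[OF D gens_in]
  have dv: "(3 * k + 1) div 3 = k" "(3 * k + 2) div 3 = k" "(3 * k) div 3 = k" for k :: nat by presburger+
  have c: "is_cone (shape (d1 s)) K ?D s (\<lambda>j. pt (j div 3))"
    unfolding cone dv using s by (simp add: pt_in_A pt_in_B pt_in_C)
  have "\<exists>!h. h \<in> Hom K w s \<and> (\<forall>j\<in>Obj (shape (d1 s)). Comp K w s (fobj ?D j) (pt (j div 3)) h = q j)"
    if "is_cone (shape (d1 s)) K ?D w q" for w q
  proof -
    have w: "w \<in> Obj K" and q: "\<And>k. k < length (d1 s) \<Longrightarrow> q (3 * k) \<in> Hom K w gC \<and>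
      (fst (d1 s ! k) \<longrightarrow> q (3 * k + 1) \<in> Hom K w gA \<and> Comp K w gA gC (pt 0) (q (3 * k + 1)) = q (3 * k)) \<and>
      (snd (d1 s ! k) \<longrightarrow> q (3 * k + 2) \<in> Hom K w gB \<and> Comp K w gB gC (pt 0) (q (3 * k + 2)) = q (3 * k))"
      using that unfolding cone by blast+
    define m where "m k = d2 (q (3 * k)) ! 0" for k
    have qm: "q (3 * k) = pt (m k)" "m k < length (d1 w)" if "k < length (d1 s)" for k
    proof -
      have h: "q (3 * k) \<in> Hom K w gC" using q[OF that] by blast
      show "q (3 * k) = pt (m k)" unfolding m_def by (rule Hom_gen_eq[OF h]) simp
      show "m k < length (d1 w)" unfolding m_def using struct_homD(2)[OF conjunct1[OF Hom_KD[OF h]], of 0] by simp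
    qed
    have qA: "q (3 * k + 1) = pt (m k)" "fst (d1 w ! m k)" if "k < length (d1 s)" "fst (d1 s ! k)" for k
    proof -
      have h: "q (3 * k + 1) \<in> Hom K w gA" and e: "Comp K w gA gC (pt 0) (q (3 * k + 1)) = q (3 * k)" using q[OF that(1)] that(2) by blast+
      have e': "q (3 * k + 1) = q (3 * k)" using e pt0_comp_gen[OF h] by simp
      show "q (3 * k + 1) = pt (m k)" unfolding e' by (rule qm[OF that(1)])
      show "fst (d1 w ! m k)" unfolding m_def using struct_homD(3)[OF conjunct1[OF Hom_KD[OF h]], of 0] e' by simp
    qed
    have qB: "q (3 * k + 2) = pt (m k)" "snd (d1 w ! m k)" if "k < length (d1 s)" "snd (d1 s ! k)" for k
    proof -
      have h: "q (3 * k + 2) \<in> Hom K w gB" and e: "Comp K w gB gC (pt 0) (q (3 * k + 2)) = q (3 * k)" using q[OF that(1)] that(2) by blast+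
      have e': "q (3 * k + 2) = q (3 * k)" using e pt0_comp_gen[OF h] by simp
      show "q (3 * k + 2) = pt (m k)" unfolding e' by (rule qm[OF that(1)])
      show "snd (d1 w ! m k)" unfolding m_def using struct_homD(4)[OF conjunct1[OF Hom_KD[OF h]], of 0] e' by simp
    qed
    let ?h = "e2 (map m [0..<length (d1 s)])"
    have h: "?h \<in> Hom K w s"
      by (rule e2_in) (use qm qA qB in \<open>simp add: struct_hom_def struct_map_def\<close>)
    have fac: "(\<forall>j\<in>Obj (shape (d1 s)). Comp K w s (fobj ?D j) (pt (j div 3)) h' = q j) \<longleftrightarrow>
        (\<forall>k<length (d1 s). d2 h' ! k = m k)" for h'
      unfolding Ball_shape_iff D' dv pt_comp using qm(1) qA(1) qB(1) d2_pt by (metis list.inject)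
    show ?thesis
      unfolding fac
    proof (rule ex1I[of _ ?h])
      show "h' = ?h" if "h' \<in> Hom K w s \<and> (\<forall>k<length (d1 s). d2 h' ! k = m k)" for h'
        by (rule Hom_K_eqI[OF _ h]) (use that in auto)
    qed (use h in simp)
  qed
  then show ?thesis unfolding is_limit_def using c by blast
qed

text \<open>A lex functor preserves the limit of generators that forms \<open>s\<close>, so its
  value at \<open>s\<close> is determined by its values at the generators.\<close>

lemma lex_pow:
  assumes F: "lex_functor K E F" and E: "category E" and s: "s \<in> Obj K"
  shows "pow E (fobj F gA) (fobj F gB) (fobj F gC) (farr F gA gC (pt 0)) (farr F gB gC (pt 0)) (d1 s) (fobj F s)
    (\<lambda>k. farr F s gC (pt k))"
proof -
  interpret E: cat E by unfold_locales fact
  have F': "is_functor K E F" "preserves_finite_limits K E F" using F unfolding lex_functor_def by auto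
  let ?D = "cospan_func K (gA, gB, gC, pt 0, pt 0)"
  have D: "is_functor (shape (d1 s)) K ?D" by (rule K.is_functor_cospan_func[OF pt_in_gens gens_in])
  have "is_limit (shape (d1 s)) E (comp_func F ?D) (fobj F s) (\<lambda>j. farr F s (fobj ?D j) (pt (j div 3)))"
    using F'(2)[unfolded preserves_finite_limits_def, rule_format, of "shape (d1 s)" ?D s "\<lambda>j. pt (j div 3)"]
      finite_cat_shape D K_shape_limit[OF s] by blast
  from E.limit_shape_pow[OF cospan_diagram_comp_func[OF cospan_diagram_cospan_func F'(1) gens_in] _ _ _ _ _ this]
  have "pow E (fobj F gA) (fobj F gB) (fobj F gC) (farr F gA gC (pt 0)) (farr F gB gC (pt 0)) (d1 s) (fobj F s)
    (\<lambda>k. farr F s (fobj ?D (3 * k)) (pt ((3 * k) div 3)))"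
    using preserves_mono[OF F' category_K E is_mono_gens(1)] preserves_mono[OF F' category_K E is_mono_gens(2)] F'(1)
    unfolding is_functor_def by simp
  moreover have "fobj ?D (3 * k) = gC" for k
    using cospan_diagram_cospan_func[of K "(gA, gB, gC, pt 0, pt 0)"] unfolding cospan_diagram_def by auto
  ultimately show ?thesis by simp
qed

end

lemma struct_map_reindex: "\<lbrakk>struct_map X PA PB s y; f \<in> struct_hom s t\<rbrakk> \<Longrightarrow> struct_map X PA PB t (\<lambda>k. y (f ! k))"
  using struct_homD[of f s t] unfolding struct_map_def by auto

context cat
begin

lemma pow_lift:
  assumes "pow C A B c a b s v \<pi>" "w \<in> Obj C" "struct_map (Hom C w c) (fac_set C w A c a) (fac_set C w B c b) s x"
  obtains h where "h \<in> Hom C w v" "\<And>k. k < length s \<Longrightarrow> Comp C w v c (\<pi> k) h = x k"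
  using assms unfolding pow_def by blast

lemma pow_D:
  assumes "pow C A B c a b s v \<pi>"
  shows "v \<in> Obj C" "struct_map (Hom C v c) (fac_set C v A c a) (fac_set C v B c b) s \<pi>" "\<And>k. k < length s \<Longrightarrow> \<pi> k \<in> Hom C v c"
  using assms unfolding pow_def struct_map_def by blast+

lemma pow_struct_map_comp:
  assumes P: "pow C A B c a b s v \<pi>" and h: "h \<in> Hom C w v" "w \<in> Obj C"
    and o: "A \<in> Obj C" "B \<in> Obj C" "c \<in> Obj C" "a \<in> Hom C A c" "b \<in> Hom C B c"
  shows "struct_map (Hom C w c) (fac_set C w A c a) (fac_set C w B c b) s (\<lambda>k. Comp C w v c (\<pi> k) h)"
  unfolding struct_map_def
proof (intro allI impI conjI)
  fix k assume k: "k < length s"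
  note v = pow_D(1)[OF P] and \<pi> = pow_D(3)[OF P k]
  show "Comp C w v c (\<pi> k) h \<in> Hom C w c" using v \<pi> h o by simp
  { assume "fst (s ! k)"
    then obtain r where r: "r \<in> Hom C v A" "Comp C v A c a r = \<pi> k" using pow_D(2)[OF P] k unfolding struct_map_def by blast
    have "Comp C w v A r h \<in> Hom C w A" using r h v o by simp
    moreover have "Comp C w A c a (Comp C w v A r h) = Comp C w v c (\<pi> k) h"
      by (rule slide1[OF r(2) h(1) r(1)]) (use h v o in auto)
    ultimately show "Comp C w v c (\<pi> k) h \<in> fac_set C w A c a" by blast }
  { assume "snd (s ! k)"
    then obtain r where r: "r \<in> Hom C v B" "Comp C v B c b r = \<pi> k" using pow_D(2)[OF P] k unfolding struct_map_def by blast
    have "Comp C w v B r h \<in> Hom C w B" using r h v o by simp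
    moreover have "Comp C w B c b (Comp C w v B r h) = Comp C w v c (\<pi> k) h"
      by (rule slide1[OF r(2) h(1) r(1)]) (use h v o in auto)
    ultimately show "Comp C w v c (\<pi> k) h \<in> fac_set C w B c b" by blast }
qed

lemma pow_unique:
  assumes P: "pow C A B c a b s v \<pi>" and h: "h \<in> Hom C w v" "h' \<in> Hom C w v" "w \<in> Obj C"
    and o: "A \<in> Obj C" "B \<in> Obj C" "c \<in> Obj C" "a \<in> Hom C A c" "b \<in> Hom C B c"
    and e: "\<And>k. k < length s \<Longrightarrow> Comp C w v c (\<pi> k) h = Comp C w v c (\<pi> k) h'"
  shows "h = h'"
proof -
  have "\<exists>!g. g \<in> Hom C w v \<and> (\<forall>k<length s. Comp C w v c (\<pi> k) g = Comp C w v c (\<pi> k) h)"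
    using P pow_struct_map_comp[OF P h(1,3) o] h(3) unfolding pow_def by blast
  moreover have "\<forall>k<length s. Comp C w v c (\<pi> k) h' = Comp C w v c (\<pi> k) h" using e by simp
  ultimately show ?thesis using h by blast
qed

text \<open>For the generators the given data are powers themselves. Choosing these makes the free
  functor extend the cospan strictly and not only up to isomorphism.\<close>

lemma pow_gens:
  assumes m: "is_mono C A c a" "is_mono C B c b" and o: "A \<in> Obj C" "B \<in> Obj C" "c \<in> Obj C"
  shows "pow C A B c a b [(True, False)] A (\<lambda>_. a)" "pow C A B c a b [(False, True)] B (\<lambda>_. b)"
    "pow C A B c a b [(False, False)] c (\<lambda>_. Id C c)"
proof -
  note ab = is_mono_in[OF m(1)] is_mono_in[OF m(2)]
  have "Id C A \<in> Hom C A A" "Comp C A A c a (Id C A) = a" "Id C B \<in> Hom C B B" "Comp C B B c b (Id C B) = b"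
    using ab o by simp_all
  then show "pow C A B c a b [(True, False)] A (\<lambda>_. a)" "pow C A B c a b [(False, True)] B (\<lambda>_. b)"
    unfolding pow_def struct_map_def using o ab by (auto, (metis is_monoD[OF m(1)] is_monoD[OF m(2)])+)
  show "pow C A B c a b [(False, False)] c (\<lambda>_. Id C c)"
    unfolding pow_def struct_map_def using o by (auto cong: conj_cong)
qed

end

lemma (in finlim_cat) ex_pow:
  assumes m: "is_mono C A c a" "is_mono C B c b" and o: "A \<in> Obj C" "B \<in> Obj C" "c \<in> Obj C"
  shows "\<exists>v \<pi>. pow C A B c a b s v \<pi>"
proof -
  let ?D = "cospan_func C (A, B, c, a, b)"
  have "\<exists>v p. is_limit (shape s) C ?D v p"
    using finitely_complete finite_cat_shape is_functor_cospan_func[OF is_mono_in[OF m(1)] is_mono_in[OF m(2)] o]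
    unfolding finitely_complete_def by blast
  then show ?thesis using limit_shape_pow[OF cospan_diagram_cospan_func o m] by blast
qed

section \<open>Freeness of the category of structures\<close>

context struct_enc
begin

text \<open>The value at a structure \<open>s\<close> is a power of the cospan by \<open>s\<close>,
  and arrows of \<open>K\<close> act by reindexing. Arrows from \<open>w\<close> into such a power
  are the homomorphisms from \<open>s\<close> to the structure formed by the arrows
  \<open>w -> c\<close>, with those through \<open>A\<close> and through \<open>B\<close> as
  subsets. Limits of \<open>K\<close> are universal with respect to that structure too, by
  \<open>K_limit_ex\<close> and \<open>K_limit_unique\<close>, and this is preservation of
  limits.\<close>

lemma ex_free_functor:
  assumes E: "category E" "finitely_complete E" and m: "is_mono E A c a" "is_mono E B c b"
    and o: "A \<in> Obj E" "B \<in> Obj E" "c \<in> Obj E"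
  obtains F where "lex_functor K E F" "fobj F gA = A" "fobj F gB = B" "fobj F gC = c"
    "farr F gA gC (pt 0) = a" "farr F gB gC (pt 0) = b"
proof -
  interpret E: finlim_cat E using E by unfold_locales
  note ab = is_mono_in[OF m(1)] is_mono_in[OF m(2)]
  note oab = o ab
  have "\<forall>s. \<exists>v\<pi>. pow E A B c a b s (fst v\<pi>) (snd v\<pi>) \<and> (s = [(True, False)] \<longrightarrow> v\<pi> = (A, \<lambda>_. a)) \<and>
      (s = [(False, True)] \<longrightarrow> v\<pi> = (B, \<lambda>_. b)) \<and> (s = [(False, False)] \<longrightarrow> v\<pi> = (c, \<lambda>_. Id E c))"
  proof
    fix s
    show "\<exists>v\<pi>. pow E A B c a b s (fst v\<pi>) (snd v\<pi>) \<and> (s = [(True, False)] \<longrightarrow> v\<pi> = (A, \<lambda>_. a)) \<and>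
      (s = [(False, True)] \<longrightarrow> v\<pi> = (B, \<lambda>_. b)) \<and> (s = [(False, False)] \<longrightarrow> v\<pi> = (c, \<lambda>_. Id E c))"
    proof -
      consider "s = [(True, False)]" | "s = [(False, True)]" | "s = [(False, False)]"
        | "s \<noteq> [(True, False)]" "s \<noteq> [(False, True)]" "s \<noteq> [(False, False)]" by blast
      then show ?thesis
      proof cases
        case 1 then show ?thesis using E.pow_gens(1)[OF m o] by (intro exI[of _ "(A, \<lambda>_. a)"]) simp
      next
        case 2 then show ?thesis using E.pow_gens(2)[OF m o] by (intro exI[of _ "(B, \<lambda>_. b)"]) simp
      next
        case 3 then show ?thesis using E.pow_gens(3)[OF m o] by (intro exI[of _ "(c, \<lambda>_. Id E c)"]) simp
      next
        case 4
        obtain v \<pi> where "pow E A B c a b s v \<pi>" using E.ex_pow[OF m o] by blast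
        then show ?thesis using 4 by (intro exI[of _ "(v, \<pi>)"]) simp
      qed
    qed
  qed
  from choice[OF this] obtain V\<pi> where V\<pi>: "\<And>s. pow E A B c a b s (fst (V\<pi> s)) (snd (V\<pi> s))"
      "V\<pi> [(True, False)] = (A, \<lambda>_. a)" "V\<pi> [(False, True)] = (B, \<lambda>_. b)" "V\<pi> [(False, False)] = (c, \<lambda>_. Id E c)"
    by blast
  define V where "V s = fst (V\<pi> s)" for s
  define \<pi> where "\<pi> s = snd (V\<pi> s)" for s
  have pw: "pow E A B c a b s (V s) (\<pi> s)" for s unfolding V_def \<pi>_def by (rule V\<pi>(1))
  have V: "V s \<in> Obj E" for s using E.pow_D(1)[OF pw] .
  have \<pi>: "\<pi> s k \<in> Hom E (V s) c" if "k < length s" for s k using E.pow_D(3)[OF pw that] .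
  define ar where "ar s t f = (THE h. h \<in> Hom E (V s) (V t) \<and> (\<forall>k<length t. Comp E (V s) (V t) c (\<pi> t k) h = \<pi> s (f ! k)))" for s t f
  have ar: "ar s t f \<in> Hom E (V s) (V t)" "\<And>k. k < length t \<Longrightarrow> Comp E (V s) (V t) c (\<pi> t k) (ar s t f) = \<pi> s (f ! k)"
    if f: "f \<in> struct_hom s t" for s t f
  proof -
    have "\<exists>!h. h \<in> Hom E (V s) (V t) \<and> (\<forall>k<length t. Comp E (V s) (V t) c (\<pi> t k) h = \<pi> s (f ! k))"
      using pw[of t] struct_map_reindex[OF E.pow_D(2)[OF pw] f] V[of s] unfolding pow_def by blast
    from theI'[OF this] show "ar s t f \<in> Hom E (V s) (V t)" "\<And>k. k < length t \<Longrightarrow> Comp E (V s) (V t) c (\<pi> t k) (ar s t f) = \<pi> s (f ! k)"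
      unfolding ar_def by blast+
  qed
  have ar_eq: "h = ar s t f" if "f \<in> struct_hom s t" "h \<in> Hom E (V s) (V t)" "\<And>k. k < length t \<Longrightarrow> Comp E (V s) (V t) c (\<pi> t k) h = \<pi> s (f ! k)" for s t f h
    by (rule E.pow_unique[OF pw that(2) ar(1)[OF that(1)] V oab]) (use that(3) ar(2)[OF that(1)] in simp)
  define F where "F = \<lparr>fobj = (\<lambda>k. V (d1 k)), farr = (\<lambda>k l u. ar (d1 k) (d1 l) (d2 u))\<rparr>"
  have F: "fobj F k = V (d1 k)" "farr F k l u = ar (d1 k) (d1 l) (d2 u)" for k l u unfolding F_def by simp_all
  have Ffun: "is_functor K E F"
    unfolding is_functor_def F
  proof (intro conjI ballI V)
    fix x y z u v assume "x \<in> Obj K" "y \<in> Obj K" "z \<in> Obj K"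
    assume u: "u \<in> Hom K x y"
    note u' = conjunct1[OF Hom_KD[OF u]]
    show "ar (d1 x) (d1 y) (d2 u) \<in> Hom E (V (d1 x)) (V (d1 y))" by (rule ar(1)[OF u'])
    assume v: "v \<in> Hom K y z"
    note v' = conjunct1[OF Hom_KD[OF v]]
    show "ar (d1 x) (d1 z) (d2 (Comp K x y z v u)) = Comp E (V (d1 x)) (V (d1 y)) (V (d1 z)) (ar (d1 y) (d1 z) (d2 v)) (ar (d1 x) (d1 y) (d2 u))"
    proof (rule ar_eq[symmetric])
      show "d2 (Comp K x y z v u) \<in> struct_hom (d1 x) (d1 z)" using struct_hom_comp[OF u' v'] by simp
      show "Comp E (V (d1 x)) (V (d1 y)) (V (d1 z)) (ar (d1 y) (d1 z) (d2 v)) (ar (d1 x) (d1 y) (d2 u)) \<in> Hom E (V (d1 x)) (V (d1 z))"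
        using ar(1)[OF u'] ar(1)[OF v'] V by simp
      fix k assume k: "k < length (d1 z)"
      show "Comp E (V (d1 x)) (V (d1 z)) c (\<pi> (d1 z) k) (Comp E (V (d1 x)) (V (d1 y)) (V (d1 z)) (ar (d1 y) (d1 z) (d2 v)) (ar (d1 x) (d1 y) (d2 u)))
        = \<pi> (d1 x) (d2 (Comp K x y z v u) ! k)"
        using E.slide1[OF ar(2)[OF v' k] ar(1)[OF u'] ar(1)[OF v'] \<pi>[OF k] V V V o(3)] ar(2)[OF u' struct_homD(2)[OF v' k]] struct_homD(1)[OF v'] k
        by simp
    qed
  next
    fix x assume "x \<in> Obj K"
    show "ar (d1 x) (d1 x) (d2 (Id K x)) = Id E (V (d1 x))"
      by (rule ar_eq[symmetric]) (use V \<pi> o in \<open>simp_all add: K_simps struct_hom_id\<close>)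
  qed
  have "is_limit J E (comp_func F D) (fobj F v) (\<lambda>j. farr F v (fobj D j) (p j))"
    if J: "finite_cat J" and D: "is_functor J K D" and L: "is_limit J K D v p" for J :: "(nat, nat) cat" and D v p
  proof -
    have finJ: "finite (Obj J)" using J unfolding finite_cat_def by blast
    have v: "v \<in> Obj K" and p: "\<And>j. j \<in> Obj J \<Longrightarrow> p j \<in> Hom K v (fobj D j)"
      and pc: "\<And>i j u. \<lbrakk>i \<in> Obj J; j \<in> Obj J; u \<in> Hom J i j\<rbrakk> \<Longrightarrow> Comp K v (fobj D i) (fobj D j) (farr D i j u) (p i) = p j"
      using L unfolding is_limit_def is_cone_def by auto
    have ob: "fobj D i \<in> Obj K" if "i \<in> Obj J" for i using D that unfolding is_functor_def by blast
    have Dar: "farr D i j u \<in> Hom K (fobj D i) (fobj D j)" if "i \<in> Obj J" "j \<in> Obj J" "u \<in> Hom J i j" for i j u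
      using D that unfolding is_functor_def by blast
    have Du: "d2 (farr D i j u) \<in> struct_hom (d1 (fobj D i)) (d1 (fobj D j))" if "i \<in> Obj J" "j \<in> Obj J" "u \<in> Hom J i j" for i j u
      using Hom_KD[OF Dar[OF that]] by blast
    have p': "d2 (p j) \<in> struct_hom (d1 v) (d1 (fobj D j))" if "j \<in> Obj J" for j using Hom_KD[OF p[OF that]] by blast
    have FD: "fobj (comp_func F D) j = V (d1 (fobj D j))" "farr (comp_func F D) i j u = ar (d1 (fobj D i)) (d1 (fobj D j)) (d2 (farr D i j u))" for i j u
      by (simp_all add: comp_func_def F)
    have cone: "is_cone J E (comp_func F D) (fobj F v) (\<lambda>j. farr F v (fobj D j) (p j))"
      unfolding is_cone_def FD
    proof (intro conjI ballI)
      show "fobj F v \<in> Obj E" using V by (simp add: F)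
      show "farr F v (fobj D j) (p j) \<in> Hom E (fobj F v) (V (d1 (fobj D j)))" if "j \<in> Obj J" for j
        unfolding F by (rule ar(1)[OF p'[OF that]])
      fix i j u assume i: "i \<in> Obj J" "j \<in> Obj J" "u \<in> Hom J i j"
      have "farr F v (fobj D j) (Comp K v (fobj D i) (fobj D j) (farr D i j u) (p i)) =
        Comp E (fobj F v) (fobj F (fobj D i)) (fobj F (fobj D j)) (farr F (fobj D i) (fobj D j) (farr D i j u)) (farr F v (fobj D i) (p i))"
        using Ffun v ob i Dar[OF i] p unfolding is_functor_def by blast
      then show "Comp E (fobj F v) (V (d1 (fobj D i))) (V (d1 (fobj D j))) (ar (d1 (fobj D i)) (d1 (fobj D j)) (d2 (farr D i j u))) (farr F v (fobj D i) (p i)) =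
          farr F v (fobj D j) (p j)"
        unfolding pc[OF i] by (simp add: F)
    qed
    have "\<exists>!h. h \<in> Hom E w (fobj F v) \<and> (\<forall>j\<in>Obj J. Comp E w (fobj F v) (fobj (comp_func F D) j) (farr F v (fobj D j) (p j)) h = q j)"
      if "is_cone J E (comp_func F D) w q" for w q
    proof -
      have w: "w \<in> Obj E" and q: "\<And>j. j \<in> Obj J \<Longrightarrow> q j \<in> Hom E w (V (d1 (fobj D j)))"
        and qc: "\<And>i j u. \<lbrakk>i \<in> Obj J; j \<in> Obj J; u \<in> Hom J i j\<rbrakk> \<Longrightarrow>
          Comp E w (V (d1 (fobj D i))) (V (d1 (fobj D j))) (ar (d1 (fobj D i)) (d1 (fobj D j)) (d2 (farr D i j u))) (q i) = q j"
        using that unfolding is_cone_def FD by auto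
      \<comment> \<open>The leg \<open>q j\<close>, read as a homomorphism from the structure at
        \<open>j\<close> to that of the arrows \<open>w -> c\<close>.\<close>
      define y where "y j k = Comp E w (V (d1 (fobj D j))) c (\<pi> (d1 (fobj D j)) k) (q j)" for j k
      have ys: "struct_map (Hom E w c) (fac_set E w A c a) (fac_set E w B c b) (d1 (fobj D j)) (y j)" if "j \<in> Obj J" for j
        unfolding y_def by (rule E.pow_struct_map_comp[OF pw q[OF that] w oab])
      have yc: "y j k = y i (d2 (farr D i j u) ! k)"
        if i: "i \<in> Obj J" "j \<in> Obj J" "u \<in> Hom J i j" and k: "k < length (d1 (fobj D j))" for i j u k
        using E.slide1[OF ar(2)[OF Du[OF i] k] q[OF i(1)] ar(1)[OF Du[OF i]] \<pi>[OF k] w V V o(3)] qc[OF i] unfolding y_def by simp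
      obtain z where z: "struct_map (Hom E w c) (fac_set E w A c a) (fac_set E w B c b) (d1 v) z"
        "\<And>j k. \<lbrakk>j \<in> Obj J; k < length (d1 (fobj D j))\<rbrakk> \<Longrightarrow> z (d2 (p j) ! k) = y j k"
        using K_limit_ex[OF finJ D L ys yc] by blast
      obtain h where h: "h \<in> Hom E w (V (d1 v))" "\<And>k. k < length (d1 v) \<Longrightarrow> Comp E w (V (d1 v)) c (\<pi> (d1 v) k) h = z k"
        by (rule E.pow_lift[OF pw w z(1)]) blast
      have proj: "Comp E w (V (d1 (fobj D j))) c (\<pi> (d1 (fobj D j)) k) (Comp E w (V (d1 v)) (V (d1 (fobj D j))) (ar (d1 v) (d1 (fobj D j)) (d2 (p j))) h')
          = Comp E w (V (d1 v)) c (\<pi> (d1 v) (d2 (p j) ! k)) h'"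
        if "j \<in> Obj J" "k < length (d1 (fobj D j))" "h' \<in> Hom E w (V (d1 v))" for j k h'
        by (rule E.slide1[OF ar(2)[OF p'[OF that(1)] that(2)] that(3) ar(1)[OF p'[OF that(1)]] \<pi>[OF that(2)] w V V o(3)])
      have e: "Comp E w (V (d1 v)) (V (d1 (fobj D j))) (ar (d1 v) (d1 (fobj D j)) (d2 (p j))) h = q j" if j: "j \<in> Obj J" for j
      proof (rule E.pow_unique[OF pw _ q[OF j] w oab])
        show "Comp E w (V (d1 v)) (V (d1 (fobj D j))) (ar (d1 v) (d1 (fobj D j)) (d2 (p j))) h \<in> Hom E w (V (d1 (fobj D j)))"
          using h(1) ar(1)[OF p'[OF j]] V w by simp
        fix k assume k: "k < length (d1 (fobj D j))"
        show "Comp E w (V (d1 (fobj D j))) c (\<pi> (d1 (fobj D j)) k) (Comp E w (V (d1 v)) (V (d1 (fobj D j))) (ar (d1 v) (d1 (fobj D j)) (d2 (p j))) h)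
          = Comp E w (V (d1 (fobj D j))) c (\<pi> (d1 (fobj D j)) k) (q j)"
          unfolding proj[OF j k h(1)] h(2)[OF struct_homD(2)[OF p'[OF j] k]] z(2)[OF j k] y_def ..
      qed
      have un: "h' = h" if h': "h' \<in> Hom E w (V (d1 v))"
        "\<And>j. j \<in> Obj J \<Longrightarrow> Comp E w (V (d1 v)) (V (d1 (fobj D j))) (ar (d1 v) (d1 (fobj D j)) (d2 (p j))) h' = q j" for h'
      proof (rule E.pow_unique[OF pw h'(1) h(1) w oab])
        fix k assume k: "k < length (d1 v)"
        have "Comp E w (V (d1 v)) c (\<pi> (d1 v) k) h' = z k"
        proof (rule K_limit_unique[OF L E.pow_struct_map_comp[OF pw h'(1) w oab] z(1) _ D k])
          fix j k assume j: "j \<in> Obj J" "k < length (d1 (fobj D j))"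
          show "Comp E w (V (d1 v)) c (\<pi> (d1 v) (d2 (p j) ! k)) h' = z (d2 (p j) ! k)"
            using proj[OF j h'(1)] h'(2)[OF j(1)] z(2)[OF j] unfolding y_def by simp
        qed
        then show "Comp E w (V (d1 v)) c (\<pi> (d1 v) k) h' = Comp E w (V (d1 v)) c (\<pi> (d1 v) k) h" using h(2)[OF k] by simp
      qed
      show ?thesis
        unfolding F FD
      proof (rule ex1I[of _ h])
        show "h \<in> Hom E w (V (d1 v)) \<and> (\<forall>j\<in>Obj J. Comp E w (V (d1 v)) (V (d1 (fobj D j))) (ar (d1 v) (d1 (fobj D j)) (d2 (p j))) h = q j)"
          using h(1) e by blast
        show "h' = h" if "h' \<in> Hom E w (V (d1 v)) \<and> (\<forall>j\<in>Obj J. Comp E w (V (d1 v)) (V (d1 (fobj D j))) (ar (d1 v) (d1 (fobj D j)) (d2 (p j))) h' = q j)" for h'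
          using un that by blast
      qed
    qed
    then show ?thesis unfolding is_limit_def using cone by blast
  qed
  then have lex: "lex_functor K E F" unfolding lex_functor_def preserves_finite_limits_def using Ffun by blast
  have gens: "V [(True, False)] = A" "V [(False, True)] = B" "V [(False, False)] = c"
    "\<pi> [(True, False)] = (\<lambda>_. a)" "\<pi> [(False, True)] = (\<lambda>_. b)" "\<pi> [(False, False)] = (\<lambda>_. Id E c)"
    unfolding V_def \<pi>_def V\<pi> by simp_all
  have "a = ar [(True, False)] [(False, False)] [0]"
    by (rule ar_eq) (use o ab in \<open>simp_all add: gens struct_hom_def struct_map_def\<close>)
  moreover have "b = ar [(False, True)] [(False, False)] [0]"
    by (rule ar_eq) (use o ab in \<open>simp_all add: gens struct_hom_def struct_map_def\<close>)
  ultimately show ?thesis using that[OF lex] by (simp add: F gens)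
qed

end

lemma mono_cospans_simps:
  "X \<in> Obj (mono_cospans E) \<longleftrightarrow> (case X of (A, B, c, a, b) \<Rightarrow> {A, B, c} \<subseteq> Obj E \<and> is_mono E A c a \<and> is_mono E B c b)"
  "(r, s, t) \<in> Hom (mono_cospans E) (A, B, c, a, b) (A', B', c', a', b') \<longleftrightarrow>
     r \<in> Hom E A A' \<and> s \<in> Hom E B B' \<and> t \<in> Hom E c c' \<and>
     Comp E A A' c' a' r = Comp E A c c' t a \<and> Comp E B B' c' b' s = Comp E B c c' t b"
  "Id (mono_cospans E) (A, B, c, a, b) = (Id E A, Id E B, Id E c)"
  "Comp (mono_cospans E) (A, B, c, a, b) (A', B', c', a', b') (A'', B'', c'', a'', b'') (r', s', t') (r, s, t) =
     (Comp E A A' A'' r' r, Comp E B B' B'' s' s, Comp E c c' c'' t' t)"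
  by (auto simp: mono_cospans_def)

context struct_enc
begin

abbreviation gX where "gX \<equiv> (gA, gB, gC, pt 0, pt 0)"

lemma eval_gX:
  "fobj (eval_cospan gX) F = (fobj F gA, fobj F gB, fobj F gC, farr F gA gC (pt 0), farr F gB gC (pt 0))"
  "farr (eval_cospan gX) F G \<tau> = (\<tau> gA, \<tau> gB, \<tau> gC)"
  by (simp_all add: eval_cospan_def)

text \<open>Each value of a lex functor is a power of its values at the generators. Hence a
  transformation is determined by its components there, and any compatible triple of such components
  induces one. Essential surjectivity is \<open>ex_free_functor\<close>, with identities as the
  isomorphism.\<close>

lemma free_equivalence:
  assumes E: "category E" "finitely_complete E"
  shows "is_equivalence (full_subcat (functor_cat K E) {F. lex_functor K E F}) (mono_cospans E) (eval_cospan gX)"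
    (is "is_equivalence ?L _ _")
proof -
  interpret E: cat E by unfold_locales fact
  have lex: "lex_functor K E F" "is_functor K E F" "preserves_finite_limits K E F" if "F \<in> Obj ?L" for F
    using that unfolding lex_functor_def by auto
  have Fob: "fobj F s \<in> Obj E" if "F \<in> Obj ?L" "s \<in> Obj K" for F s
    using lex(2)[OF that(1)] that(2) unfolding is_functor_def by blast
  have Far: "farr F s t u \<in> Hom E (fobj F s) (fobj F t)" if "F \<in> Obj ?L" "u \<in> Hom K s t" "s \<in> Obj K" "t \<in> Obj K" for F s t u
    using lex(2)[OF that(1)] that(2-) unfolding is_functor_def by blast
  have Fcomp: "farr F s z (Comp K s t z v u) = Comp E (fobj F s) (fobj F t) (fobj F z) (farr F t z v) (farr F s t u)"
    if "F \<in> Obj ?L" "u \<in> Hom K s t" "v \<in> Hom K t z" "s \<in> Obj K" "t \<in> Obj K" "z \<in> Obj K" for F s t z u v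
    using lex(2)[OF that(1)] that(2-) unfolding is_functor_def by blast
  have Fmono: "is_mono E (fobj F gA) (fobj F gC) (farr F gA gC (pt 0))" "is_mono E (fobj F gB) (fobj F gC) (farr F gB gC (pt 0))"
    if "F \<in> Obj ?L" for F
    using preserves_mono[OF lex(2,3)[OF that] category_K E(1) is_mono_gens(1)] preserves_mono[OF lex(2,3)[OF that] category_K E(1) is_mono_gens(2)]
    by simp_all
  have pw: "pow E (fobj F gA) (fobj F gB) (fobj F gC) (farr F gA gC (pt 0)) (farr F gB gC (pt 0)) (d1 s) (fobj F s) (\<lambda>k. farr F s gC (pt k))"
    if "F \<in> Obj ?L" "s \<in> Obj K" for F s by (rule lex_pow[OF lex(1)[OF that(1)] E(1) that(2)])
  have \<tau>in: "\<tau> s \<in> Hom E (fobj F s) (fobj G s)" if "\<tau> \<in> nat_trans K E F G" "s \<in> Obj K" for \<tau> F G s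
    using that unfolding nat_trans_def by blast
  have \<tau>nat: "Comp E (fobj F s) (fobj G s) (fobj G t) (farr G s t u) (\<tau> s) = Comp E (fobj F s) (fobj F t) (fobj G t) (\<tau> t) (farr F s t u)"
    if "\<tau> \<in> nat_trans K E F G" "u \<in> Hom K s t" "s \<in> Obj K" "t \<in> Obj K" for \<tau> F G s t u
    using that unfolding nat_trans_def by blast
  have func: "is_functor ?L (mono_cospans E) (eval_cospan gX)"
    unfolding is_functor_def
  proof (intro conjI ballI)
    fix F assume F: "F \<in> Obj ?L"
    show "fobj (eval_cospan gX) F \<in> Obj (mono_cospans E)"
      unfolding eval_gX mono_cospans_simps using Fob[OF F] Fmono[OF F] by simp
    show "farr (eval_cospan gX) F F (Id ?L F) = Id (mono_cospans E) (fobj (eval_cospan gX) F)"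
      unfolding eval_gX mono_cospans_simps by (simp add: functor_cat_def)
    fix G assume G: "G \<in> Obj ?L"
    { fix \<tau> assume "\<tau> \<in> Hom ?L F G"
      then have \<tau>: "\<tau> \<in> nat_trans K E F G" by simp
      show "farr (eval_cospan gX) F G \<tau> \<in> Hom (mono_cospans E) (fobj (eval_cospan gX) F) (fobj (eval_cospan gX) G)"
        unfolding eval_gX mono_cospans_simps using \<tau>in[OF \<tau>] \<tau>nat[OF \<tau> pt_in_gens(1)] \<tau>nat[OF \<tau> pt_in_gens(2)] by simp }
    fix H \<sigma> \<tau> assume "H \<in> Obj ?L"
    show "farr (eval_cospan gX) F H (Comp ?L F G H \<tau> \<sigma>) = Comp (mono_cospans E) (fobj (eval_cospan gX) F) (fobj (eval_cospan gX) G)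
       (fobj (eval_cospan gX) H) (farr (eval_cospan gX) G H \<tau>) (farr (eval_cospan gX) F G \<sigma>)"
      unfolding eval_gX mono_cospans_simps by (simp add: functor_cat_def)
  qed
  have ff: "bij_betw (farr (eval_cospan gX) F G) (Hom ?L F G) (Hom (mono_cospans E) (fobj (eval_cospan gX) F) (fobj (eval_cospan gX) G))"
    if F: "F \<in> Obj ?L" and G: "G \<in> Obj ?L" for F G
  proof (rule bij_betw_imageI)
    note oG = Fob[OF G gens_in(1)] Fob[OF G gens_in(2)] Fob[OF G gens_in(3)] Far[OF G pt_in_gens(1) gens_in(1,3)] Far[OF G pt_in_gens(2) gens_in(2,3)]
    show "inj_on (farr (eval_cospan gX) F G) (Hom ?L F G)"
    proof (rule inj_onI)
      fix \<sigma> \<tau> assume "\<sigma> \<in> Hom ?L F G" "\<tau> \<in> Hom ?L F G" and e: "farr (eval_cospan gX) F G \<sigma> = farr (eval_cospan gX) F G \<tau>"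
      then have \<sigma>: "\<sigma> \<in> nat_trans K E F G" and \<tau>: "\<tau> \<in> nat_trans K E F G" by simp_all
      have "\<sigma> s = \<tau> s" if s: "s \<in> Obj K" for s
      proof (rule E.pow_unique[OF pw[OF G s] \<tau>in[OF \<sigma> s] \<tau>in[OF \<tau> s] Fob[OF F s] oG])
        fix k assume k: "k < length (d1 s)"
        show "Comp E (fobj F s) (fobj G s) (fobj G gC) (farr G s gC (pt k)) (\<sigma> s) = Comp E (fobj F s) (fobj G s) (fobj G gC) (farr G s gC (pt k)) (\<tau> s)"
          using \<tau>nat[OF \<sigma> pt_in_C[OF k] s gens_in(3)] \<tau>nat[OF \<tau> pt_in_C[OF k] s gens_in(3)] e by (simp add: eval_gX)
      qed
      moreover have "\<sigma> s = \<tau> s" if "s \<notin> Obj K" for s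
        using \<sigma> \<tau> that unfolding nat_trans_def by (simp add: PiE_iff extensional_def)
      ultimately show "\<sigma> = \<tau>" by blast
    qed
    show "farr (eval_cospan gX) F G ` Hom ?L F G = Hom (mono_cospans E) (fobj (eval_cospan gX) F) (fobj (eval_cospan gX) G)"
    proof
      show "farr (eval_cospan gX) F G ` Hom ?L F G \<subseteq> Hom (mono_cospans E) (fobj (eval_cospan gX) F) (fobj (eval_cospan gX) G)"
        using func F G unfolding is_functor_def by blast
      show "Hom (mono_cospans E) (fobj (eval_cospan gX) F) (fobj (eval_cospan gX) G) \<subseteq> farr (eval_cospan gX) F G ` Hom ?L F G"
      proof
        fix x assume x: "x \<in> Hom (mono_cospans E) (fobj (eval_cospan gX) F) (fobj (eval_cospan gX) G)"
        obtain rA rB rC where xe: "x = (rA, rB, rC)" by (cases x) auto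
        have r: "rA \<in> Hom E (fobj F gA) (fobj G gA)" "rB \<in> Hom E (fobj F gB) (fobj G gB)" "rC \<in> Hom E (fobj F gC) (fobj G gC)"
          "Comp E (fobj F gA) (fobj G gA) (fobj G gC) (farr G gA gC (pt 0)) rA = Comp E (fobj F gA) (fobj F gC) (fobj G gC) rC (farr F gA gC (pt 0))"
          "Comp E (fobj F gB) (fobj G gB) (fobj G gC) (farr G gB gC (pt 0)) rB = Comp E (fobj F gB) (fobj F gC) (fobj G gC) rC (farr F gB gC (pt 0))"
          using x unfolding xe eval_gX mono_cospans_simps by auto
        \<comment> \<open>The component at \<open>s\<close> is the arrow into the power
          \<open>fobj G s\<close> whose projection at position \<open>k\<close> is \<open>rC\<close>
          after the projection of \<open>fobj F s\<close> at \<open>k\<close>.\<close>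
        have "\<forall>s. \<exists>h. s \<in> Obj K \<longrightarrow> h \<in> Hom E (fobj F s) (fobj G s) \<and> (\<forall>k<length (d1 s).
          Comp E (fobj F s) (fobj G s) (fobj G gC) (farr G s gC (pt k)) h = Comp E (fobj F s) (fobj F gC) (fobj G gC) rC (farr F s gC (pt k)))"
        proof (intro allI)
          fix s
          have str: "struct_map (Hom E (fobj F s) (fobj G gC)) (fac_set E (fobj F s) (fobj G gA) (fobj G gC) (farr G gA gC (pt 0)))
              (fac_set E (fobj F s) (fobj G gB) (fobj G gC) (farr G gB gC (pt 0))) (d1 s)
              (\<lambda>k. Comp E (fobj F s) (fobj F gC) (fobj G gC) rC (farr F s gC (pt k)))" if s: "s \<in> Obj K"
            unfolding struct_map_def
          proof (intro allI impI conjI)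
            fix k assume k: "k < length (d1 s)"
            note Fk = Far[OF F pt_in_C[OF k] s gens_in(3)]
            show "Comp E (fobj F s) (fobj F gC) (fobj G gC) rC (farr F s gC (pt k)) \<in> Hom E (fobj F s) (fobj G gC)"
              using Fk r Fob[OF F s] Fob[OF F] oG by simp
            { assume f: "fst (d1 s ! k)"
              note Fk = Far[OF F pt_in_A[OF k f] s gens_in(1)]
              have "farr F s gC (pt k) = Comp E (fobj F s) (fobj F gA) (fobj F gC) (farr F gA gC (pt 0)) (farr F s gA (pt k))"
                using Fcomp[OF F pt_in_A[OF k f] pt_in_gens(1) s] by simp
              moreover have "Comp E (fobj F s) (fobj G gA) (fobj G gC) (farr G gA gC (pt 0)) (Comp E (fobj F s) (fobj F gA) (fobj G gA) rA (farr F s gA (pt k)))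
                = Comp E (fobj F s) (fobj F gC) (fobj G gC) rC (Comp E (fobj F s) (fobj F gA) (fobj F gC) (farr F gA gC (pt 0)) (farr F s gA (pt k)))"
                by (rule E.slide[OF r(4) Fk]) (use r Fob[OF F s] Fob[OF F] oG Far[OF F pt_in_gens(1)] in simp_all)
              moreover have "Comp E (fobj F s) (fobj F gA) (fobj G gA) rA (farr F s gA (pt k)) \<in> Hom E (fobj F s) (fobj G gA)"
                using r Fk Fob[OF F s] Fob[OF F] oG by simp
              ultimately show "Comp E (fobj F s) (fobj F gC) (fobj G gC) rC (farr F s gC (pt k)) \<in> fac_set E (fobj F s) (fobj G gA) (fobj G gC) (farr G gA gC (pt 0))"
                by auto }
            { assume f: "snd (d1 s ! k)"
              note Fk = Far[OF F pt_in_B[OF k f] s gens_in(2)]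
              have "farr F s gC (pt k) = Comp E (fobj F s) (fobj F gB) (fobj F gC) (farr F gB gC (pt 0)) (farr F s gB (pt k))"
                using Fcomp[OF F pt_in_B[OF k f] pt_in_gens(2) s] by simp
              moreover have "Comp E (fobj F s) (fobj G gB) (fobj G gC) (farr G gB gC (pt 0)) (Comp E (fobj F s) (fobj F gB) (fobj G gB) rB (farr F s gB (pt k)))
                = Comp E (fobj F s) (fobj F gC) (fobj G gC) rC (Comp E (fobj F s) (fobj F gB) (fobj F gC) (farr F gB gC (pt 0)) (farr F s gB (pt k)))"
                by (rule E.slide[OF r(5) Fk]) (use r Fob[OF F s] Fob[OF F] oG Far[OF F pt_in_gens(2)] in simp_all)
              moreover have "Comp E (fobj F s) (fobj F gB) (fobj G gB) rB (farr F s gB (pt k)) \<in> Hom E (fobj F s) (fobj G gB)"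
                using r Fk Fob[OF F s] Fob[OF F] oG by simp
              ultimately show "Comp E (fobj F s) (fobj F gC) (fobj G gC) rC (farr F s gC (pt k)) \<in> fac_set E (fobj F s) (fobj G gB) (fobj G gC) (farr G gB gC (pt 0))"
                by auto }
          qed
          show "\<exists>h. s \<in> Obj K \<longrightarrow> h \<in> Hom E (fobj F s) (fobj G s) \<and> (\<forall>k<length (d1 s).
            Comp E (fobj F s) (fobj G s) (fobj G gC) (farr G s gC (pt k)) h = Comp E (fobj F s) (fobj F gC) (fobj G gC) rC (farr F s gC (pt k)))"
          proof (cases "s \<in> Obj K")
            case True
            show ?thesis by (rule E.pow_lift[OF pw[OF G True] Fob[OF F True] str[OF True]]) blast
          qed simp
        qed
        from choice[OF this] obtain t where t: "\<And>s. s \<in> Obj K \<Longrightarrow> t s \<in> Hom E (fobj F s) (fobj G s)"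
          "\<And>s k. \<lbrakk>s \<in> Obj K; k < length (d1 s)\<rbrakk> \<Longrightarrow> Comp E (fobj F s) (fobj G s) (fobj G gC) (farr G s gC (pt k)) (t s) =
             Comp E (fobj F s) (fobj F gC) (fobj G gC) rC (farr F s gC (pt k))" by blast
        have nat: "Comp E (fobj F s) (fobj G s) (fobj G s') (farr G s s' u) (t s) = Comp E (fobj F s) (fobj F s') (fobj G s') (t s') (farr F s s' u)"
          if s: "s \<in> Obj K" "s' \<in> Obj K" and u: "u \<in> Hom K s s'" for s s' u
        proof (rule E.pow_unique[OF pw[OF G s(2)] _ _ Fob[OF F s(1)] oG])
          note Gu = Far[OF G u s] and Fu = Far[OF F u s]
          show "Comp E (fobj F s) (fobj G s) (fobj G s') (farr G s s' u) (t s) \<in> Hom E (fobj F s) (fobj G s')"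
            using Gu t(1)[OF s(1)] Fob F G s by simp
          show "Comp E (fobj F s) (fobj F s') (fobj G s') (t s') (farr F s s' u) \<in> Hom E (fobj F s) (fobj G s')"
            using Fu t(1)[OF s(2)] Fob F G s by simp
          fix k assume k: "k < length (d1 s')"
          have k': "d2 u ! k < length (d1 s)" using struct_homD(2)[OF conjunct1[OF Hom_KD[OF u]] k] .
          have G1: "Comp E (fobj G s) (fobj G s') (fobj G gC) (farr G s' gC (pt k)) (farr G s s' u) = farr G s gC (pt (d2 u ! k))"
            using Fcomp[OF G u pt_in_C[OF k] s gens_in(3)] by simp
          have F1: "Comp E (fobj F s) (fobj F s') (fobj F gC) (farr F s' gC (pt k)) (farr F s s' u) = farr F s gC (pt (d2 u ! k))"
            using Fcomp[OF F u pt_in_C[OF k] s gens_in(3)] by simp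
          have "Comp E (fobj F s) (fobj G s') (fobj G gC) (farr G s' gC (pt k)) (Comp E (fobj F s) (fobj G s) (fobj G s') (farr G s s' u) (t s))
             = Comp E (fobj F s) (fobj G s) (fobj G gC) (farr G s gC (pt (d2 u ! k))) (t s)"
            by (rule E.slide1[OF G1 t(1)[OF s(1)] Gu Far[OF G pt_in_C[OF k] s(2) gens_in(3)] Fob[OF F s(1)] Fob[OF G s(1)] Fob[OF G s(2)] oG(3)])
          also have "\<dots> = Comp E (fobj F s) (fobj F gC) (fobj G gC) rC (farr F s gC (pt (d2 u ! k)))" by (rule t(2)[OF s(1) k'])
          also have "\<dots> = Comp E (fobj F s) (fobj F gC) (fobj G gC) rC (Comp E (fobj F s) (fobj F s') (fobj F gC) (farr F s' gC (pt k)) (farr F s s' u))"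
            unfolding F1 ..
          also have "\<dots> = Comp E (fobj F s) (fobj G s') (fobj G gC) (farr G s' gC (pt k)) (Comp E (fobj F s) (fobj F s') (fobj G s') (t s') (farr F s s' u))"
            by (rule E.slide[OF t(2)[OF s(2) k] Fu t(1)[OF s(2)] Far[OF G pt_in_C[OF k] s(2) gens_in(3)] Far[OF F pt_in_C[OF k] s(2) gens_in(3)] r(3)
                Fob[OF F s(1)] Fob[OF F s(2)] Fob[OF G s(2)] Fob[OF F gens_in(3)] oG(3), symmetric])
          finally show "Comp E (fobj F s) (fobj G s') (fobj G gC) (farr G s' gC (pt k)) (Comp E (fobj F s) (fobj G s) (fobj G s') (farr G s s' u) (t s))
            = Comp E (fobj F s) (fobj G s') (fobj G gC) (farr G s' gC (pt k)) (Comp E (fobj F s) (fobj F s') (fobj G s') (t s') (farr F s s' u))" .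
        qed
        have "restrict t (Obj K) \<in> Hom ?L F G"
          using t(1) nat by (simp add: nat_trans_def)
        moreover have "t gC = rC"
        proof -
          have I: "pt 0 = Id K gC" by (simp add: K_simps pt_def)
          have "farr F gC gC (pt 0) = Id E (fobj F gC)" "farr G gC gC (pt 0) = Id E (fobj G gC)"
            unfolding I using lex(2)[OF F] lex(2)[OF G] gens_in(3) unfolding is_functor_def by blast+
          then show ?thesis using t(2)[OF gens_in(3), of 0] t(1)[OF gens_in(3)] r(3) Fob[OF F gens_in(3)] oG by simp
        qed
        moreover have "t gA = rA"
          by (rule is_monoD[OF Fmono(1)[OF G] _ t(1)[OF gens_in(1)] r(1) Fob[OF F gens_in(1)]])
            (use t(2)[OF gens_in(1), of 0] r(4) in simp)
        moreover have "t gB = rB"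
          by (rule is_monoD[OF Fmono(2)[OF G] _ t(1)[OF gens_in(2)] r(2) Fob[OF F gens_in(2)]])
            (use t(2)[OF gens_in(2), of 0] r(5) in simp)
        ultimately show "x \<in> farr (eval_cospan gX) F G ` Hom ?L F G"
          unfolding xe by (intro image_eqI[of _ _ "restrict t (Obj K)"]) (simp_all add: eval_gX)
      qed
    qed
  qed
  have es: "\<exists>F\<in>Obj ?L. \<exists>f. is_iso (mono_cospans E) (fobj (eval_cospan gX) F) z f" if z: "z \<in> Obj (mono_cospans E)" for z
  proof -
    obtain A B c a b where ze: "z = (A, B, c, a, b)" by (cases z) auto
    have z': "A \<in> Obj E" "B \<in> Obj E" "c \<in> Obj E" "is_mono E A c a" "is_mono E B c b" using z unfolding ze mono_cospans_simps by auto
    note ab = is_mono_in[OF z'(4)] is_mono_in[OF z'(5)]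
    obtain F where F: "lex_functor K E F" "fobj F gA = A" "fobj F gB = B" "fobj F gC = c"
    "farr F gA gC (pt 0) = a" "farr F gB gC (pt 0) = b"
      by (rule ex_free_functor[OF E z'(4,5,1-3)])
    have "F \<in> Obj ?L" using F(1) unfolding lex_functor_def by simp
    moreover have "is_iso (mono_cospans E) (fobj (eval_cospan gX) F) z (Id E A, Id E B, Id E c)"
      unfolding eval_gX F ze is_iso_def mono_cospans_simps
      by (intro conjI bexI[of _ "(Id E A, Id E B, Id E c)"]) (use z' ab in \<open>simp_all add: mono_cospans_simps\<close>)
    ultimately show ?thesis by blast
  qed
  show ?thesis unfolding is_equivalence_def using func ff es by blast
qed

end

lemma small_countable:
  fixes X :: "'x set"
  assumes U: "universe (U :: 'u itself)" and f: "inj_on (f :: 'x \<Rightarrow> nat) X"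
  shows "small U X"
proof -
  have "|X| \<le>o |UNIV :: nat set|" using f card_of_ordLeq[of X "UNIV :: nat set"] by blast
  then show ?thesis using U ordLeq_ordLess_trans unfolding universe_def small_def by blast
qed

text \<open>The lists in question form countable types, while the universe type has more than
  countably many elements; so they embed in it, and the resulting category is small.\<close>

lemma ex_free_lex_on_monos:
  assumes U: "universe TYPE('u)"
  obtains e1 d1 e2 d2 where "struct_enc (e1 :: _ \<Rightarrow> 'u) d1 (e2 :: _ \<Rightarrow> 'u) d2"
    "is_free_lex_on_monos (struct_enc.K e1 d1 e2 d2) (struct_enc.gX e1 e2)"
proof -
  have "|UNIV :: nat set| \<le>o |UNIV :: 'u set|" using U ordLess_imp_ordLeq unfolding universe_def by blast
  then obtain n :: "nat \<Rightarrow> 'u" where n: "inj n" using card_of_ordLeq[of "UNIV :: nat set" "UNIV :: 'u set"] by blast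
  define e1 :: "(bool \<times> bool) list \<Rightarrow> 'u" where "e1 = n \<circ> to_nat"
  define e2 :: "nat list \<Rightarrow> 'u" where "e2 = n \<circ> to_nat"
  have inj: "inj e1" "inj e2" unfolding e1_def e2_def using n by (auto intro: inj_compose)
  interpret K: struct_enc e1 "inv e1" e2 "inv e2" using inj by unfold_locales simp_all
  have "small TYPE('u) (range e1)"
    by (rule small_countable[OF U, of "to_nat \<circ> inv e1"]) (use inj in \<open>auto simp: inj_on_def\<close>)
  moreover have "small TYPE('u) (e2 ` X)" for X
    by (rule small_countable[OF U, of "to_nat \<circ> inv e2"]) (use inj in \<open>auto simp: inj_on_def\<close>)
  ultimately have "small_cat K.K"
    unfolding small_cat_def locally_small_def using K.category_K by (simp add: K.K_simps)
  then have "is_free_lex_on_monos K.K K.gX"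
    unfolding is_free_lex_on_monos_def
    using K.finitely_complete_K K.free_equivalence K.is_mono_gens K.gens_in
    by (auto simp: mono_cospans_simps small_cat_def locally_small_def)
  then show ?thesis using that K.struct_enc_axioms by blast
qed

section \<open>Finite coverings\<close>

text \<open>
  \<open>locally x S\<close>: the condition \<open>S\<close> on arrows into \<open>x\<close> holds locally for the topology generated by the
  empty coverings of initial objects and by stable pushouts.
\<close>

inductive (in cat) locally :: "'o \<Rightarrow> ('o \<Rightarrow> 'm \<Rightarrow> bool) \<Rightarrow> bool" where
  whole: "\<lbrakk>x \<in> Obj C; \<And>w g. \<lbrakk>w \<in> Obj C; g \<in> Hom C w x\<rbrakk> \<Longrightarrow> S w g\<rbrakk> \<Longrightarrow> locally x S"
| empty: "is_initial C x \<Longrightarrow> locally x S"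
| split: "\<lbrakk>is_stable_pushout C P A B x p q a b; locally A (\<lambda>w g. S w (Comp C w A x a g));
    locally B (\<lambda>w g. S w (Comp C w B x b g))\<rbrakk> \<Longrightarrow> locally x S"

context cat
begin

definition sieve :: "'o \<Rightarrow> ('o \<Rightarrow> 'm \<Rightarrow> bool) \<Rightarrow> bool" where
  "sieve x S \<longleftrightarrow> (\<forall>w\<in>Obj C. \<forall>g\<in>Hom C w x. S w g \<longrightarrow> (\<forall>v\<in>Obj C. \<forall>h\<in>Hom C v w. S v (Comp C v w x g h)))"

lemma locally_mono:
  assumes "locally x S" "\<And>w g. \<lbrakk>w \<in> Obj C; g \<in> Hom C w x; S w g\<rbrakk> \<Longrightarrow> R w g"
  shows "locally x R"
  using assms
proof (induction arbitrary: R rule: locally.induct)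
  case (whole x S)
  then show ?case by (intro locally.whole) blast+
next
  case (empty x S)
  then show ?case by (intro locally.empty)
next
  case (split P A B x p q a b S)
  note Q = is_pushoutD[OF is_stable_pushoutD[OF split(1)]]
  show ?case
    by (rule locally.split[OF split(1)]; rule split.IH; rule split.prems) (use Q in auto)
qed

end

section \<open>Grothendieck topology axioms and the sheaf property of representables\<close>

context stable_pushouts
begin

lemma initial_over:
  assumes "is_initial C x" "f \<in> Hom C y x" "y \<in> Obj C"
  shows "is_initial C y"
proof -
  obtain z where z: "is_strict_initial C z" using strict_initial by blast
  then have "z \<in> Obj C" unfolding is_strict_initial_def is_initial_def by blast
  then obtain g where "g \<in> Hom C x z" "x \<in> Obj C" using assms(1) unfolding is_initial_def by blast
  then have "Comp C y x z g f \<in> Hom C y z" using assms \<open>z \<in> Obj C\<close> by simp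
  then show ?thesis using strict_initial_over[OF z] assms(3) by blast
qed

text \<open>The generating coverings are stable: an object over an initial object is initial, and
  stable pushouts pull back to stable pushouts.\<close>

lemma locally_pullback:
  assumes "locally x S" "f \<in> Hom C y x" "y \<in> Obj C"
  shows "locally y (\<lambda>w g. S w (Comp C w y x f g))"
  using assms
proof (induction arbitrary: y f rule: locally.induct)
  case (whole x S)
  then show ?case by (intro locally.whole) auto
next
  case (empty x S)
  show ?case by (rule locally.empty[OF initial_over[OF empty.hyps empty.prems]])
next
  case (split P A B x p q a b S)
  note Q [simp] = is_pushoutD(1-8)[OF is_stable_pushoutD[OF split(1)]]
  obtain A' pA i' B' pB j' P' p' q' where A': "is_pullback C A' A y x pA i' a f" and B': "is_pullback C B' B y x pB j' b f"
    and st: "is_stable_pushout C P' A' B' y p' q' i' j'"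
    by (rule stable_pushout_pullback[OF split(1) split.prems(2,1)])
  note [simp] = is_pullbackD(1-8)[OF A'] is_pullbackD(1-8)[OF B']
  show ?case
  proof (rule locally.split[OF st])
    show "locally A' (\<lambda>w g. S w (Comp C w y x f (Comp C w A' y i' g)))"
      by (rule locally_mono[OF split.IH(1)[of pA A']]) (use slide[OF is_pullbackD(9)[OF A']] in simp_all)
    show "locally B' (\<lambda>w g. S w (Comp C w y x f (Comp C w B' y j' g)))"
      by (rule locally_mono[OF split.IH(2)[of pB B']]) (use slide[OF is_pullbackD(9)[OF B']] in simp_all)
  qed
qed

text \<open>Transitivity of the topology: at each leaf \<open>whole\<close> of the first covering, a
  covering for \<open>R\<close> is inserted.\<close>

lemma locally_trans:
  assumes "locally x S" "\<And>w g. \<lbrakk>w \<in> Obj C; g \<in> Hom C w x; S w g\<rbrakk> \<Longrightarrow> locally w (\<lambda>v h. R v (Comp C v w x g h))"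
  shows "locally x R"
  using assms
proof (induction arbitrary: R rule: locally.induct)
  case (whole x S)
  have "locally x (\<lambda>v h. R v (Comp C v x x (Id C x) h))" by (rule whole.prems) (use whole.hyps in auto)
  then show ?case by (rule locally_mono) (use whole.hyps(1) in simp)
next
  case (empty x S)
  then show ?case by (intro locally.empty)
next
  case (split P A B x p q a b S)
  note Q [simp] = is_pushoutD(1-8)[OF is_stable_pushoutD[OF split(1)]]
  show ?case
  proof (rule locally.split[OF split(1)])
    show "locally A (\<lambda>w g. R w (Comp C w A x a g))"
    proof (rule split.IH(1))
      fix w g assume w: "w \<in> Obj C" "g \<in> Hom C w A" "S w (Comp C w A x a g)"
      have "locally w (\<lambda>v h. R v (Comp C v w x (Comp C w A x a g) h))" by (rule split.prems) (use w in auto)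
      then show "locally w (\<lambda>v h. R v (Comp C v A x a (Comp C v w A g h)))" by (rule locally_mono) (use w in \<open>simp add: assoc\<close>)
    qed
    show "locally B (\<lambda>w g. R w (Comp C w B x b g))"
    proof (rule split.IH(2))
      fix w g assume w: "w \<in> Obj C" "g \<in> Hom C w B" "S w (Comp C w B x b g)"
      have "locally w (\<lambda>v h. R v (Comp C v w x (Comp C w B x b g) h))" by (rule split.prems) (use w in auto)
      then show "locally w (\<lambda>v h. R v (Comp C v B x b (Comp C v w B g h)))" by (rule locally_mono) (use w in \<open>simp add: assoc\<close>)
    qed
  qed
qed

text \<open>Finitely many coverings have a common refinement, obtained by pulling back one along the
  arrows of another. The conditions must be sieves in order to survive the further
  restriction.\<close>

lemma locally_ball:
  assumes "finite I" "x \<in> Obj C" "\<And>i. i \<in> I \<Longrightarrow> locally x (S i)" "\<And>i. i \<in> I \<Longrightarrow> sieve x (S i)"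
  shows "locally x (\<lambda>w g. \<forall>i\<in>I. S i w g)"
  using assms
proof (induction I rule: finite_induct)
  case empty
  then show ?case by (intro locally.whole) auto
next
  case (insert i I)
  have IH: "locally x (\<lambda>w g. \<forall>i\<in>I. S i w g)" using insert by auto
  have i: "locally x (S i)" "sieve x (S i)" using insert by auto
  show ?case
  proof (rule locally_trans[OF i(1)])
    fix w g assume w: "w \<in> Obj C" "g \<in> Hom C w x" "S i w g"
    show "locally w (\<lambda>v h. \<forall>i\<in>insert i I. S i v (Comp C v w x g h))"
      by (rule locally_mono[OF locally_pullback[OF IH w(2,1)]]) (use w i(2) in \<open>auto simp: sieve_def\<close>)
  qed
qed

text \<open>Representables are separated: parallel arrows out of an initial object agree, and arrows
  out of a pushout are determined by their restrictions to the legs.\<close>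

lemma locally_unique:
  assumes "locally x S" "d \<in> Obj C" "f \<in> Hom C x d" "f' \<in> Hom C x d"
    and "\<And>w g. \<lbrakk>w \<in> Obj C; g \<in> Hom C w x; S w g\<rbrakk> \<Longrightarrow> Comp C w x d f g = Comp C w x d f' g"
  shows "f = f'"
  using assms
proof (induction arbitrary: f f' rule: locally.induct)
  case (whole x S)
  then show ?case using whole.prems(4)[of x "Id C x"] by simp
next
  case (empty x S)
  then show ?case using is_initial_hom_eq by blast
next
  case (split P A B x p q a b S)
  note po = is_stable_pushoutD[OF split(1)]
  note Q [simp] = is_pushoutD(1-8)[OF po]
  show ?case
  proof (rule is_pushout_unique[OF po split.prems(1-3)])
    show "Comp C A x d f a = Comp C A x d f' a"
    proof (rule split.IH(1)[OF split.prems(1)])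
      fix w g assume w: "w \<in> Obj C" "g \<in> Hom C w A" "S w (Comp C w A x a g)"
      show "Comp C w A d (Comp C A x d f a) g = Comp C w A d (Comp C A x d f' a) g"
        using split.prems(4)[of w "Comp C w A x a g"] w split.prems(1-3) by (simp add: assoc)
    qed (use split.prems in auto)
    show "Comp C B x d f b = Comp C B x d f' b"
    proof (rule split.IH(2)[OF split.prems(1)])
      fix w g assume w: "w \<in> Obj C" "g \<in> Hom C w B" "S w (Comp C w B x b g)"
      show "Comp C w B d (Comp C B x d f b) g = Comp C w B d (Comp C B x d f' b) g"
        using split.prems(4)[of w "Comp C w B x b g"] w split.prems(1-3) by (simp add: assoc)
    qed (use split.prems in auto)
  qed
qed

text \<open>Representables are sheaves, \<open>fam\<close> being a matching family on the covering
  sieve \<open>S\<close>. For a pushout, the families restricted to the two legs are glued first,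
  and the results are then joined by the pushout property.\<close>

lemma locally_glue:
  assumes "locally x S" "sieve x S" "d \<in> Obj C"
    and "\<And>w g. \<lbrakk>w \<in> Obj C; g \<in> Hom C w x; S w g\<rbrakk> \<Longrightarrow> fam w g \<in> Hom C w d"
    and "\<And>w g v h. \<lbrakk>w \<in> Obj C; g \<in> Hom C w x; S w g; v \<in> Obj C; h \<in> Hom C v w\<rbrakk> \<Longrightarrow>
      fam v (Comp C v w x g h) = Comp C v w d (fam w g) h"
  shows "\<exists>f\<in>Hom C x d. \<forall>w\<in>Obj C. \<forall>g\<in>Hom C w x. S w g \<longrightarrow> Comp C w x d f g = fam w g"
  using assms
proof (induction arbitrary: fam rule: locally.induct)
  case (whole x S)
  have "Comp C w x d (fam x (Id C x)) g = fam w g" if "w \<in> Obj C" "g \<in> Hom C w x" for w g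
    using whole.prems(4)[of x "Id C x" w g] whole.hyps that by simp
  moreover have "fam x (Id C x) \<in> Hom C x d" using whole by simp
  ultimately show ?case by blast
next
  case (empty x S)
  then obtain f where f: "f \<in> Hom C x d" "x \<in> Obj C" unfolding is_initial_def by blast
  have "Comp C w x d f g = fam w g" if "w \<in> Obj C" "g \<in> Hom C w x" "S w g" for w g
    by (rule is_initial_hom_eq[OF initial_over[OF empty.hyps that(2,1)], where y = d]) (use f that empty.prems in auto)
  then show ?case using f by blast
next
  case (split P A B x p q a b S)
  note po = is_stable_pushoutD[OF split(1)]
  note Q [simp] = is_pushoutD(1-8)[OF po]
  note d [simp] = split.prems(2)
  have sv: "S v (Comp C v w x g h)" if "w \<in> Obj C" "g \<in> Hom C w x" "S w g" "v \<in> Obj C" "h \<in> Hom C v w" for w g v h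
    using split.prems(1) that unfolding sieve_def by blast
  have "\<exists>f\<in>Hom C A d. \<forall>w\<in>Obj C. \<forall>g\<in>Hom C w A. S w (Comp C w A x a g) \<longrightarrow> Comp C w A d f g = fam w (Comp C w A x a g)"
  proof (rule split.IH(1)[OF _ d])
    show "sieve A (\<lambda>w g. S w (Comp C w A x a g))"
      unfolding sieve_def using sv by (simp flip: assoc)
    show "fam v (Comp C v A x a (Comp C v w A g h)) = Comp C v w d (fam w (Comp C w A x a g)) h"
      if "w \<in> Obj C" "g \<in> Hom C w A" "S w (Comp C w A x a g)" "v \<in> Obj C" "h \<in> Hom C v w" for w g v h
      using split.prems(4)[of w "Comp C w A x a g" v h] that by (simp add: assoc)
  qed (use split.prems(3) in simp)
  then obtain fA where fA [simp]: "fA \<in> Hom C A d"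
    and fA': "\<And>w g. \<lbrakk>w \<in> Obj C; g \<in> Hom C w A; S w (Comp C w A x a g)\<rbrakk> \<Longrightarrow> Comp C w A d fA g = fam w (Comp C w A x a g)" by blast
  have "\<exists>f\<in>Hom C B d. \<forall>w\<in>Obj C. \<forall>g\<in>Hom C w B. S w (Comp C w B x b g) \<longrightarrow> Comp C w B d f g = fam w (Comp C w B x b g)"
  proof (rule split.IH(2)[OF _ d])
    show "sieve B (\<lambda>w g. S w (Comp C w B x b g))"
      unfolding sieve_def using sv by (simp flip: assoc)
    show "fam v (Comp C v B x b (Comp C v w B g h)) = Comp C v w d (fam w (Comp C w B x b g)) h"
      if "w \<in> Obj C" "g \<in> Hom C w B" "S w (Comp C w B x b g)" "v \<in> Obj C" "h \<in> Hom C v w" for w g v h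
      using split.prems(4)[of w "Comp C w B x b g" v h] that by (simp add: assoc)
  qed (use split.prems(3) in simp)
  then obtain fB where fB [simp]: "fB \<in> Hom C B d"
    and fB': "\<And>w g. \<lbrakk>w \<in> Obj C; g \<in> Hom C w B; S w (Comp C w B x b g)\<rbrakk> \<Longrightarrow> Comp C w B d fB g = fam w (Comp C w B x b g)" by blast
  \<comment> \<open>Agreement on \<open>P\<close> is a local question: on the covering pulled back
    along \<open>p\<close>, both sides are values of the one family \<open>fam\<close>.\<close>
  have "Comp C P A d fA p = Comp C P B d fB q"
  proof (rule locally_unique[OF locally_pullback[OF split.hyps(2), of p P] d])
    fix w g assume w [simp]: "w \<in> Obj C" "g \<in> Hom C w P" and Sg: "S w (Comp C w A x a (Comp C w P A p g))"
    have e: "Comp C w A x a (Comp C w P A p g) = Comp C w B x b (Comp C w P B q g)"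
      by (rule slide[OF is_pushoutD(9)[OF po]]) simp_all
    show "Comp C w P d (Comp C P A d fA p) g = Comp C w P d (Comp C P B d fB q) g"
      using fA'[of w "Comp C w P A p g"] fB'[of w "Comp C w P B q g"] Sg e by (simp add: assoc)
  qed simp_all
  then obtain f where f [simp]: "f \<in> Hom C x d" and fa: "Comp C A x d f a = fA" and fb: "Comp C B x d f b = fB"
    by (rule is_pushout_lift[OF po, rotated 3]) auto
  have "Comp C w x d f g = fam w g" if w [simp]: "w \<in> Obj C" "g \<in> Hom C w x" and Sg: "S w g" for w g
  proof -
    \<comment> \<open>An arrow \<open>g\<close> of the sieve need not factor through either leg, so
      the equation is tested on the pushout pulled back along \<open>g\<close>.\<close>
    obtain A' pA i' B' pB j' P' p' q' where A': "is_pullback C A' A w x pA i' a g" and B': "is_pullback C B' B w x pB j' b g"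
      and po': "is_stable_pushout C P' A' B' w p' q' i' j'"
      by (rule stable_pushout_pullback[OF split(1) w])
    note [simp] = is_pullbackD(1-8)[OF A'] is_pullbackD(1-8)[OF B']
    note A'9 = is_pullbackD(9)[OF A'] and B'9 = is_pullbackD(9)[OF B']
    show ?thesis
    proof (rule is_pushout_unique[OF is_stable_pushoutD[OF po'] d])
      have "Comp C A' w d (fam w g) i' = fam A' (Comp C A' w x g i')" using split.prems(4)[OF w Sg, of A' i'] by simp
      also have "\<dots> = Comp C A' A d fA pA" using fA'[of A' pA] sv[OF w Sg, of A' i'] A'9 by simp
      also have "\<dots> = Comp C A' w d (Comp C w x d f g) i'" using slide1[OF fa, of pA A'] A'9 by (simp add: assoc)
      finally show "Comp C A' w d (Comp C w x d f g) i' = Comp C A' w d (fam w g) i'" ..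
      have "Comp C B' w d (fam w g) j' = fam B' (Comp C B' w x g j')" using split.prems(4)[OF w Sg, of B' j'] by simp
      also have "\<dots> = Comp C B' B d fB pB" using fB'[of B' pB] sv[OF w Sg, of B' j'] B'9 by simp
      also have "\<dots> = Comp C B' w d (Comp C w x d f g) j'" using slide1[OF fb, of pB B'] B'9 by (simp add: assoc)
      finally show "Comp C B' w d (Comp C w x d f g) j' = Comp C B' w d (fam w g) j'" ..
    qed (use split.prems(3)[OF w Sg] in simp_all)
  qed
  then show ?case using f by blast
qed

end

section \<open>Reflections onto representables\<close>

context presheaf_subcat
begin

text \<open>A universal arrow from \<open>P\<close> to the Yoneda embedding. The notion depends on
  \<open>C\<close> alone and is therefore common to all the subcategories of presheaves
  considered.\<close>

definition reflection where
  "reflection P c \<eta> \<longleftrightarrow> c \<in> Obj C \<and> \<eta> \<in> pnat C P (representable C c) \<and>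
     (\<forall>d\<in>Obj C. \<forall>\<theta>\<in>pnat C P (representable C d).
        \<exists>!k. k \<in> Hom C c d \<and> (\<forall>x\<in>Obj C. \<forall>p\<in>fobj P x. Comp C x c d k (\<eta> x p) = \<theta> x p))"

definition mediator where
  "mediator P c \<eta> d \<theta> = (THE k. k \<in> Hom C c d \<and> (\<forall>x\<in>Obj C. \<forall>p\<in>fobj P x. Comp C x c d k (\<eta> x p) = \<theta> x p))"

lemma reflectionD:
  assumes "reflection P c \<eta>"
  shows "c \<in> Obj C" "\<eta> \<in> pnat C P (representable C c)"
    "\<And>x p. \<lbrakk>x \<in> Obj C; p \<in> fobj P x\<rbrakk> \<Longrightarrow> \<eta> x p \<in> Hom C x c"
  using assms pnat_in[of \<eta> C P "representable C c"] unfolding reflection_def by auto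

lemma mediator:
  assumes "reflection P c \<eta>" "d \<in> Obj C" "\<theta> \<in> pnat C P (representable C d)"
  shows "mediator P c \<eta> d \<theta> \<in> Hom C c d"
    "\<And>x p. \<lbrakk>x \<in> Obj C; p \<in> fobj P x\<rbrakk> \<Longrightarrow> Comp C x c d (mediator P c \<eta> d \<theta>) (\<eta> x p) = \<theta> x p"
proof -
  have "\<exists>!k. k \<in> Hom C c d \<and> (\<forall>x\<in>Obj C. \<forall>p\<in>fobj P x. Comp C x c d k (\<eta> x p) = \<theta> x p)"
    using assms unfolding reflection_def by blast
  from theI'[OF this] show "mediator P c \<eta> d \<theta> \<in> Hom C c d"
    "\<And>x p. \<lbrakk>x \<in> Obj C; p \<in> fobj P x\<rbrakk> \<Longrightarrow> Comp C x c d (mediator P c \<eta> d \<theta>) (\<eta> x p) = \<theta> x p"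
    unfolding mediator_def by blast+
qed

lemma reflection_ext:
  assumes r: "reflection P c \<eta>" and d: "d \<in> Obj C" "k \<in> Hom C c d" "k' \<in> Hom C c d" and P: "presheaf C P"
    and e: "\<And>x p. \<lbrakk>x \<in> Obj C; p \<in> fobj P x\<rbrakk> \<Longrightarrow> Comp C x c d k (\<eta> x p) = Comp C x c d k' (\<eta> x p)"
  shows "k = k'"
proof -
  note c = reflectionD[OF r]
  have "Comp (presheaves C) P (representable C c) (representable C d) (yoneda_arr C c d k) \<eta> \<in> pnat C P (representable C d)" (is "?\<theta> \<in> _")
    by (rule presheaves_comp_in[OF c(2) yoneda_arr_in[OF d(2) c(1) d(1)] P])
  then have "\<exists>!k. k \<in> Hom C c d \<and> (\<forall>x\<in>Obj C. \<forall>p\<in>fobj P x. Comp C x c d k (\<eta> x p) = ?\<theta> x p)"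
    using r d(1) unfolding reflection_def by blast
  moreover have "?\<theta> x p = Comp C x c d k (\<eta> x p)" if "x \<in> Obj C" "p \<in> fobj P x" for x p
    using that c(3)[OF that] by simp
  ultimately show ?thesis using d e by auto
qed

context
  fixes c :: "('o, 'u, 'u set, 'u \<Rightarrow> 'u) func \<Rightarrow> 'o" and \<eta>
  assumes refl: "\<And>P. P \<in> Obj A \<Longrightarrow> reflection P (c P) (\<eta> P)"
begin

definition refl_func where
  "refl_func = \<lparr>fobj = c, farr = (\<lambda>P Q \<theta>. mediator P (c P) (\<eta> P) (c Q) (Comp A P Q (representable C (c Q)) (\<eta> Q) \<theta>))\<rparr>"

lemma fobj_refl_func [simp]: "fobj refl_func = c"
  by (simp add: refl_func_def)

lemma farr_refl_func:
  assumes P: "P \<in> Obj A" and Q: "Q \<in> Obj A" and \<theta>: "\<theta> \<in> pnat C P Q"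
  shows "farr refl_func P Q \<theta> \<in> Hom C (c P) (c Q)"
    "\<And>x p. \<lbrakk>x \<in> Obj C; p \<in> fobj P x\<rbrakk> \<Longrightarrow> Comp C x (c P) (c Q) (farr refl_func P Q \<theta>) (\<eta> P x p) = \<eta> Q x (\<theta> x p)"
proof -
  have n: "Comp A P Q (representable C (c Q)) (\<eta> Q) \<theta> \<in> pnat C P (representable C (c Q))"
    using A_comp_in[OF \<theta> reflectionD(2)[OF refl[OF Q]]] P by simp
  show "farr refl_func P Q \<theta> \<in> Hom C (c P) (c Q)"
    using mediator(1)[OF refl[OF P] reflectionD(1)[OF refl[OF Q]] n] by (simp add: refl_func_def)
  show "Comp C x (c P) (c Q) (farr refl_func P Q \<theta>) (\<eta> P x p) = \<eta> Q x (\<theta> x p)" if "x \<in> Obj C" "p \<in> fobj P x" for x p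
    using mediator(2)[OF refl[OF P] reflectionD(1)[OF refl[OF Q]] n that] that by (simp add: refl_func_def)
qed

lemma is_functor_refl_func: "is_functor A C refl_func"
  unfolding is_functor_def fobj_refl_func
proof (intro conjI ballI)
  fix P assume P: "P \<in> Obj A"
  note rP = refl[OF P] note cP = reflectionD[OF rP]
  have P': "presheaf C P" using P by simp
  show "c P \<in> Obj C" by (rule cP)
  have I: "Id A P \<in> pnat C P P" using presheaves_id_in[OF P'] by simp
  show "farr refl_func P P (Id A P) = Id C (c P)"
    by (rule reflection_ext[OF rP cP(1) farr_refl_func(1)[OF P P I] id_in[OF cP(1)] P'])
      (use farr_refl_func(2)[OF P P I] cP in simp)
  fix Q assume Q: "Q \<in> Obj A"
  note rQ = refl[OF Q] note cQ = reflectionD[OF rQ]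
  { fix \<theta> assume "\<theta> \<in> Hom A P Q"
    then show "farr refl_func P Q \<theta> \<in> Hom C (c P) (c Q)" using farr_refl_func(1)[OF P Q] by simp }
  fix R \<theta> \<sigma> assume R: "R \<in> Obj A" and "\<theta> \<in> Hom A P Q" "\<sigma> \<in> Hom A Q R"
  then have \<theta>: "\<theta> \<in> pnat C P Q" and \<sigma>: "\<sigma> \<in> pnat C Q R" by simp_all
  note rR = refl[OF R] note cR = reflectionD[OF rR]
  have \<sigma>\<theta>: "Comp A P Q R \<sigma> \<theta> \<in> pnat C P R" by (rule A_comp_in[OF \<theta> \<sigma> P'])
  note f\<theta> = farr_refl_func[OF P Q \<theta>] note f\<sigma> = farr_refl_func[OF Q R \<sigma>]
  show "farr refl_func P R (Comp A P Q R \<sigma> \<theta>) = Comp C (c P) (c Q) (c R) (farr refl_func Q R \<sigma>) (farr refl_func P Q \<theta>)"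
  proof (rule reflection_ext[OF rP cR(1) farr_refl_func(1)[OF P R \<sigma>\<theta>] _ P'])
    show "Comp C (c P) (c Q) (c R) (farr refl_func Q R \<sigma>) (farr refl_func P Q \<theta>) \<in> Hom C (c P) (c R)"
      using f\<theta>(1) f\<sigma>(1) cP cQ cR by simp
    fix x p assume x: "x \<in> Obj C" "p \<in> fobj P x"
    show "Comp C x (c P) (c R) (farr refl_func P R (Comp A P Q R \<sigma> \<theta>)) (\<eta> P x p) =
      Comp C x (c P) (c R) (Comp C (c P) (c Q) (c R) (farr refl_func Q R \<sigma>) (farr refl_func P Q \<theta>)) (\<eta> P x p)"
      using farr_refl_func(2)[OF P R \<sigma>\<theta> x] f\<theta>(2)[OF x] f\<sigma>(2)[OF x(1) pnat_in[OF \<theta> x(2,1)]] cP(3)[OF x]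
        assoc[OF cP(3)[OF x] f\<theta>(1) f\<sigma>(1) x(1) cP(1) cQ(1) cR(1)] x by simp
  qed
qed

text \<open>Universal arrows at all objects assemble to a left adjoint; the counit at
  \<open>b\<close> is the mediator of the identity of the representable of \<open>b\<close>.\<close>

lemma refl_adjunction:
  "\<exists>\<epsilon>. adjunction A C refl_func (yoneda C) (restrict \<eta> (Obj A)) \<epsilon>"
proof -
  define \<epsilon> where "\<epsilon> = (\<lambda>b\<in>Obj C. mediator (representable C b) (c (representable C b)) (\<eta> (representable C b)) b (Id A (representable C b)))"
  have Y: "representable C b \<in> Obj A" "presheaf C (representable C b)" if "b \<in> Obj C" for b
    using representable_A[OF that] presheaf_representable[OF that] by simp_all
  have I: "Id A (representable C b) \<in> pnat C (representable C b) (representable C b)" if "b \<in> Obj C" for b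
    using presheaves_id_in[OF Y(2)[OF that]] by simp
  have \<epsilon>: "\<epsilon> b \<in> Hom C (c (representable C b)) b"
    "\<And>x g. \<lbrakk>x \<in> Obj C; g \<in> Hom C x b\<rbrakk> \<Longrightarrow> Comp C x (c (representable C b)) b (\<epsilon> b) (\<eta> (representable C b) x g) = g"
    if b: "b \<in> Obj C" for b
    using mediator[OF refl[OF Y(1)[OF b]] b I[OF b]] b unfolding \<epsilon>_def by simp_all
  have \<eta>nat: "restrict \<eta> (Obj A) \<in> nat_trans A A id_func (comp_func (yoneda C) refl_func)"
    unfolding nat_trans_def
  proof (intro CollectI conjI PiE_I ballI)
    fix P assume P: "P \<in> Obj A"
    then have P': "presheaf C P" by simp
    note cP = reflectionD[OF refl[OF P]]
    show "restrict \<eta> (Obj A) P \<in> Hom A (fobj id_func P) (fobj (comp_func (yoneda C) refl_func) P)"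
      using cP P by (simp add: id_func_def comp_func_def)
    fix Q \<theta> assume Q: "Q \<in> Obj A" and "\<theta> \<in> Hom A P Q"
    then have \<theta>: "\<theta> \<in> pnat C P Q" by simp
    note cQ = reflectionD[OF refl[OF Q]] note f = farr_refl_func[OF P Q \<theta>]
    have "Comp A P (representable C (c P)) (representable C (c Q)) (yoneda_arr C (c P) (c Q) (farr refl_func P Q \<theta>)) (\<eta> P)
        = Comp A P Q (representable C (c Q)) (\<eta> Q) \<theta>"
      by (rule pnat_ext[OF A_comp_in[OF cP(2) yoneda_arr_in[OF f(1) cP(1) cQ(1)] P'] A_comp_in[OF \<theta> cQ(2) P']])
        (use f(2) cP(3) in simp)
    then show "Comp A (fobj id_func P) (fobj (comp_func (yoneda C) refl_func) P) (fobj (comp_func (yoneda C) refl_func) Q)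
        (farr (comp_func (yoneda C) refl_func) P Q \<theta>) (restrict \<eta> (Obj A) P) =
      Comp A (fobj id_func P) (fobj id_func Q) (fobj (comp_func (yoneda C) refl_func) Q) (restrict \<eta> (Obj A) Q) (farr id_func P Q \<theta>)"
      using P Q by (simp add: id_func_def comp_func_def)
  qed (metis restrict_apply)
  have \<epsilon>nat: "\<epsilon> \<in> nat_trans C C (comp_func refl_func (yoneda C)) id_func"
    unfolding nat_trans_def
  proof (intro CollectI conjI PiE_I ballI)
    fix b assume b: "b \<in> Obj C"
    show "\<epsilon> b \<in> Hom C (fobj (comp_func refl_func (yoneda C)) b) (fobj id_func b)"
      using \<epsilon>(1)[OF b] by (simp add: comp_func_def id_func_def)
    fix b' f assume b': "b' \<in> Obj C" and f: "f \<in> Hom C b b'"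
    let ?Yb = "representable C b" and ?Yb' = "representable C b'"
    note cb = reflectionD[OF refl[OF Y(1)[OF b]]] note cb' = reflectionD[OF refl[OF Y(1)[OF b']]]
    note Yf = yoneda_arr_in[OF f b b']
    note Lf = farr_refl_func[OF Y(1)[OF b] Y(1)[OF b'] Yf]
    have "Comp C (c ?Yb) b b' f (\<epsilon> b) = Comp C (c ?Yb) (c ?Yb') b' (\<epsilon> b') (farr refl_func ?Yb ?Yb' (yoneda_arr C b b' f))"
    proof (rule reflection_ext[OF refl[OF Y(1)[OF b]] b' _ _ Y(2)[OF b]])
      show "Comp C (c ?Yb) b b' f (\<epsilon> b) \<in> Hom C (c ?Yb) b'"
        "Comp C (c ?Yb) (c ?Yb') b' (\<epsilon> b') (farr refl_func ?Yb ?Yb' (yoneda_arr C b b' f)) \<in> Hom C (c ?Yb) b'"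
        using f \<epsilon>(1)[OF b] \<epsilon>(1)[OF b'] cb cb' Lf(1) b b' by simp_all
      fix x g assume x: "x \<in> Obj C" "g \<in> fobj ?Yb x"
      then have g: "g \<in> Hom C x b" by simp
      have fg: "Comp C x b b' f g \<in> Hom C x b'" using f g x b b' by simp
      show "Comp C x (c ?Yb) b' (Comp C (c ?Yb) b b' f (\<epsilon> b)) (\<eta> ?Yb x g) =
        Comp C x (c ?Yb) b' (Comp C (c ?Yb) (c ?Yb') b' (\<epsilon> b') (farr refl_func ?Yb ?Yb' (yoneda_arr C b b' f))) (\<eta> ?Yb x g)"
        using assoc[OF cb(3)[OF x] \<epsilon>(1)[OF b] f x(1) cb(1) b b'] assoc[OF cb(3)[OF x] Lf(1) \<epsilon>(1)[OF b'] x(1) cb(1) cb'(1) b']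
          \<epsilon>(2)[OF b x(1) g] Lf(2)[OF x] \<epsilon>(2)[OF b' x(1) fg] x(1) g by simp
    qed
    then show "Comp C (fobj (comp_func refl_func (yoneda C)) b) (fobj id_func b) (fobj id_func b') (farr id_func b b' f) (\<epsilon> b) =
      Comp C (fobj (comp_func refl_func (yoneda C)) b) (fobj (comp_func refl_func (yoneda C)) b') (fobj id_func b') (\<epsilon> b')
       (farr (comp_func refl_func (yoneda C)) b b' f)"
      by (simp add: comp_func_def id_func_def)
  qed (simp add: \<epsilon>_def)
  have t1: "Comp C (c P) (c (representable C (c P))) (c P) (\<epsilon> (c P)) (farr refl_func P (representable C (c P)) (\<eta> P)) = Id C (c P)"
    if P: "P \<in> Obj A" for P
  proof -
    have P': "presheaf C P" using P by simp
    note cP = reflectionD[OF refl[OF P]] let ?Y = "representable C (c P)"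
    note cY = reflectionD[OF refl[OF Y(1)[OF cP(1)]]]
    note L = farr_refl_func[OF P Y(1)[OF cP(1)] cP(2)]
    show ?thesis
    proof (rule reflection_ext[OF refl[OF P] cP(1) _ id_in[OF cP(1)] P'])
      show "Comp C (c P) (c ?Y) (c P) (\<epsilon> (c P)) (farr refl_func P ?Y (\<eta> P)) \<in> Hom C (c P) (c P)"
        using L(1) \<epsilon>(1)[OF cP(1)] cP cY by simp
      fix x p assume x: "x \<in> Obj C" "p \<in> fobj P x"
      show "Comp C x (c P) (c P) (Comp C (c P) (c ?Y) (c P) (\<epsilon> (c P)) (farr refl_func P ?Y (\<eta> P))) (\<eta> P x p) = Comp C x (c P) (c P) (Id C (c P)) (\<eta> P x p)"
        using assoc[OF cP(3)[OF x] L(1) \<epsilon>(1)[OF cP(1)] x(1) cP(1) cY(1) cP(1)] L(2)[OF x] \<epsilon>(2)[OF cP(1) x(1) cP(3)[OF x]] cP x by simp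
    qed
  qed
  have t2: "Comp A (representable C b) (representable C (c (representable C b))) (representable C b)
      (yoneda_arr C (c (representable C b)) b (\<epsilon> b)) (\<eta> (representable C b)) = Id A (representable C b)"
    if b: "b \<in> Obj C" for b
  proof -
    note cb = reflectionD[OF refl[OF Y(1)[OF b]]]
    show ?thesis
      by (rule pnat_ext[OF A_comp_in[OF cb(2) yoneda_arr_in[OF \<epsilon>(1)[OF b] cb(1) b] Y(2)[OF b]] I[OF b]])
        (use \<epsilon>(2)[OF b] cb(3) in simp)
  qed
  show ?thesis
    unfolding adjunction_def Let_def
    using is_functor_refl_func is_functor_yoneda \<eta>nat \<epsilon>nat t1 t2 representable_A by (intro exI[of _ \<epsilon>]) simp
qed

end

end

section \<open>Presheaves locally isomorphic to a representable\<close>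

locale stable_presheaf_subcat = presheaf_subcat C S + stable_pushouts C for C :: "('o, 'u) cat" and S
begin

text \<open>\<open>\<eta>\<close> is inverted by sheafification.\<close>

definition local_iso where
  "local_iso P c \<eta> \<longleftrightarrow> presheaf C P \<and> c \<in> Obj C \<and> \<eta> \<in> pnat C P (representable C c) \<and>
     (\<forall>x\<in>Obj C. \<forall>g\<in>Hom C x c. locally x (\<lambda>w h. \<exists>p\<in>fobj P w. \<eta> w p = Comp C w x c g h)) \<and>
     (\<forall>x\<in>Obj C. \<forall>p\<in>fobj P x. \<forall>q\<in>fobj P x. \<eta> x p = \<eta> x q \<longrightarrow> locally x (\<lambda>w h. farr P x w h p = farr P x w h q))"

lemma local_isoD:
  assumes "local_iso P c \<eta>"
  shows "presheaf C P" "c \<in> Obj C" "\<eta> \<in> pnat C P (representable C c)"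
    "\<And>x p. \<lbrakk>x \<in> Obj C; p \<in> fobj P x\<rbrakk> \<Longrightarrow> \<eta> x p \<in> Hom C x c"
    "\<And>x g. \<lbrakk>x \<in> Obj C; g \<in> Hom C x c\<rbrakk> \<Longrightarrow> locally x (\<lambda>w h. \<exists>p\<in>fobj P w. \<eta> w p = Comp C w x c g h)"
    "\<And>x p q. \<lbrakk>x \<in> Obj C; p \<in> fobj P x; q \<in> fobj P x; \<eta> x p = \<eta> x q\<rbrakk> \<Longrightarrow> locally x (\<lambda>w h. farr P x w h p = farr P x w h q)"
    "\<And>x w h p. \<lbrakk>x \<in> Obj C; w \<in> Obj C; h \<in> Hom C w x; p \<in> fobj P x\<rbrakk> \<Longrightarrow> \<eta> w (farr P x w h p) = Comp C w x c (\<eta> x p) h"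
proof -
  show 1: "presheaf C P" "c \<in> Obj C" "\<eta> \<in> pnat C P (representable C c)"
    "\<And>x g. \<lbrakk>x \<in> Obj C; g \<in> Hom C x c\<rbrakk> \<Longrightarrow> locally x (\<lambda>w h. \<exists>p\<in>fobj P w. \<eta> w p = Comp C w x c g h)"
    "\<And>x p q. \<lbrakk>x \<in> Obj C; p \<in> fobj P x; q \<in> fobj P x; \<eta> x p = \<eta> x q\<rbrakk> \<Longrightarrow> locally x (\<lambda>w h. farr P x w h p = farr P x w h q)"
    using assms unfolding local_iso_def by blast+
  show 2: "\<eta> x p \<in> Hom C x c" if "x \<in> Obj C" "p \<in> fobj P x" for x p using pnat_in[OF 1(3) that(2,1)] by simp
  show "\<eta> w (farr P x w h p) = Comp C w x c (\<eta> x p) h" if "x \<in> Obj C" "w \<in> Obj C" "h \<in> Hom C w x" "p \<in> fobj P x" for x w h p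
    using pnat_natural[OF 1(3) that(4,3,1,2)] 2[OF that(1,4)] by simp
qed

text \<open>A transformation \<open>\<theta>\<close> to a representable gives a family of arrows on
  the image of \<open>\<eta>\<close>: it is well defined because \<open>\<eta>\<close> is locally
  injective and representables are separated. The image is a covering sieve by local surjectivity,
  so the family glues to the required arrow \<open>c -> d\<close>.\<close>

lemma local_iso_reflection:
  assumes L: "local_iso P c \<eta>"
  shows "reflection P c \<eta>"
  unfolding reflection_def
proof (intro conjI ballI)
  note l = local_isoD[OF L]
  show "c \<in> Obj C" "\<eta> \<in> pnat C P (representable C c)" by (rule l)+
  fix d \<theta> assume d: "d \<in> Obj C" and \<theta>: "\<theta> \<in> pnat C P (representable C d)"
  have \<theta>in: "\<theta> x p \<in> Hom C x d" if "x \<in> Obj C" "p \<in> fobj P x" for x p using pnat_in[OF \<theta> that(2,1)] by simp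
  have \<theta>nat: "\<theta> w (farr P x w h p) = Comp C w x d (\<theta> x p) h" if "x \<in> Obj C" "w \<in> Obj C" "h \<in> Hom C w x" "p \<in> fobj P x" for x w h p
    using pnat_natural[OF \<theta> that(4,3,1,2)] \<theta>in[OF that(1,4)] by simp
  have wd: "\<theta> x p = \<theta> x q" if x: "x \<in> Obj C" "p \<in> fobj P x" "q \<in> fobj P x" "\<eta> x p = \<eta> x q" for x p q
  proof (rule locally_unique[OF l(6)[OF x] d \<theta>in[OF x(1,2)] \<theta>in[OF x(1,3)]])
    show "Comp C w x d (\<theta> x p) g = Comp C w x d (\<theta> x q) g" if "w \<in> Obj C" "g \<in> Hom C w x" "farr P x w g p = farr P x w g q" for w g
      using \<theta>nat[OF x(1) that(1,2) x(2)] \<theta>nat[OF x(1) that(1,2) x(3)] that(3) by simp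
  qed
  define S where "S w h \<longleftrightarrow> (\<exists>p\<in>fobj P w. \<eta> w p = h)" for w h
  have S: "locally c S" by (rule locally_mono[OF l(5)[OF l(2) id_in[OF l(2)]]]) (use l(2) in \<open>auto simp: S_def\<close>)
  \<comment> \<open>The choice of the preimage is immaterial by \<open>wd\<close>.\<close>
  define fam where "fam w h = \<theta> w (SOME p. p \<in> fobj P w \<and> \<eta> w p = h)" for w h
  have fam: "fam w (\<eta> w p) = \<theta> w p" if "w \<in> Obj C" "p \<in> fobj P w" for w p
  proof -
    have "(SOME q. q \<in> fobj P w \<and> \<eta> w q = \<eta> w p) \<in> fobj P w \<and> \<eta> w (SOME q. q \<in> fobj P w \<and> \<eta> w q = \<eta> w p) = \<eta> w p"
      by (rule someI[where x = p]) (use that in simp)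
    then show ?thesis using wd that unfolding fam_def by blast
  qed
  have "\<exists>k\<in>Hom C c d. \<forall>w\<in>Obj C. \<forall>g\<in>Hom C w c. S w g \<longrightarrow> Comp C w c d k g = fam w g"
  proof (rule locally_glue[OF S _ d])
    show "sieve c S"
      unfolding sieve_def S_def
    proof (intro ballI impI, elim bexE)
      fix w g v h p assume w: "w \<in> Obj C" "v \<in> Obj C" "h \<in> Hom C v w" "p \<in> fobj P w" "\<eta> w p = g"
      then show "\<exists>p\<in>fobj P v. \<eta> v p = Comp C v w c g h"
        using l(7)[OF w(1-4)] presheaf_in[OF l(1) w(4,3,1,2)] by blast
    qed
    show "fam w g \<in> Hom C w d" if "w \<in> Obj C" "g \<in> Hom C w c" "S w g" for w g
      using that fam[OF that(1)] \<theta>in[OF that(1)] unfolding S_def by auto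
    fix w g v h assume w: "w \<in> Obj C" "g \<in> Hom C w c" "S w g" "v \<in> Obj C" "h \<in> Hom C v w"
    then obtain p where p: "p \<in> fobj P w" "\<eta> w p = g" unfolding S_def by blast
    have "fam v (\<eta> v (farr P w v h p)) = \<theta> v (farr P w v h p)" by (rule fam[OF w(4) presheaf_in[OF l(1) p(1) w(5,1,4)]])
    then show "fam v (Comp C v w c g h) = Comp C v w d (fam w g) h"
      using l(7)[OF w(1,4,5) p(1)] \<theta>nat[OF w(1,4,5) p(1)] fam[OF w(1) p(1)] p(2) by simp
  qed
  then obtain k where k: "k \<in> Hom C c d" "\<And>w g. \<lbrakk>w \<in> Obj C; g \<in> Hom C w c; S w g\<rbrakk> \<Longrightarrow> Comp C w c d k g = fam w g" by blast
  show "\<exists>!k. k \<in> Hom C c d \<and> (\<forall>x\<in>Obj C. \<forall>p\<in>fobj P x. Comp C x c d k (\<eta> x p) = \<theta> x p)"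
  proof (rule ex1I[of _ k])
    show "k \<in> Hom C c d \<and> (\<forall>x\<in>Obj C. \<forall>p\<in>fobj P x. Comp C x c d k (\<eta> x p) = \<theta> x p)"
    proof (intro conjI ballI k(1))
      fix x p assume x: "x \<in> Obj C" "p \<in> fobj P x"
      then have "S x (\<eta> x p)" unfolding S_def by blast
      then show "Comp C x c d k (\<eta> x p) = \<theta> x p" using k(2)[OF x(1) l(4)[OF x]] fam[OF x] by simp
    qed
    fix k' assume k': "k' \<in> Hom C c d \<and> (\<forall>x\<in>Obj C. \<forall>p\<in>fobj P x. Comp C x c d k' (\<eta> x p) = \<theta> x p)"
    show "k' = k"
    proof (rule locally_unique[OF S d])
      fix w g assume w: "w \<in> Obj C" "g \<in> Hom C w c" "S w g"
      then obtain p where "p \<in> fobj P w" "\<eta> w p = g" unfolding S_def by blast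
      then show "Comp C w c d k' g = Comp C w c d k g" using k' k(2)[OF w] fam[OF w(1)] w(1) by auto
    qed (use k k' in auto)
  qed
qed

text \<open>The counterpart of the fact that sheafification preserves finite limits. A generalized
  element of \<open>v'\<close> has components that lift locally to elements of the
  \<open>fobj D j\<close>. As \<open>J\<close> is finite, one covering serves for all components,
  and a refinement of it makes the lifted elements compatible. Local injectivity likewise needs only
  finitely many coverings.\<close>

lemma local_iso_limit:
  assumes J: "finite_cat J" and D: "\<And>j. j \<in> Obj J \<Longrightarrow> local_iso (fobj D j) (fobj cD j) (\<eta> j)"
    and Dar: "\<And>i j u. \<lbrakk>i \<in> Obj J; j \<in> Obj J; u \<in> Hom J i j\<rbrakk> \<Longrightarrow> farr D i j u \<in> pnat C (fobj D i) (fobj D j)"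
    and cD: "is_functor J C cD"
    and cDar: "\<And>i j u x p. \<lbrakk>i \<in> Obj J; j \<in> Obj J; u \<in> Hom J i j; x \<in> Obj C; p \<in> fobj (fobj D i) x\<rbrakk> \<Longrightarrow>
       Comp C x (fobj cD i) (fobj cD j) (farr cD i j u) (\<eta> i x p) = \<eta> j x (farr D i j u x p)"
    and v: "presheaf C v" "pointwise_limit J D v p" and v': "is_limit J C cD v' p'"
  shows "\<exists>\<eta>v. local_iso v v' \<eta>v \<and> (\<forall>j\<in>Obj J. \<forall>x\<in>Obj C. \<forall>z\<in>fobj v x. Comp C x v' (fobj cD j) (p' j) (\<eta>v x z) = \<eta> j x (p j x z))"
proof -
  have finJ: "finite (Obj J)" using J unfolding finite_cat_def by blast
  have pj: "p j \<in> pnat C v (fobj D j)" if "j \<in> Obj J" for j using v(2) that unfolding pointwise_limit_def by blast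
  have pc: "farr D i j u x (p i x z) = p j x z" if "i \<in> Obj J" "j \<in> Obj J" "u \<in> Hom J i j" "x \<in> Obj C" "z \<in> fobj v x" for i j u x z
    using v(2) that unfolding pointwise_limit_def by blast
  have vex: "\<exists>!z. z \<in> fobj v x \<and> (\<forall>j\<in>Obj J. p j x z = y j)"
    if "x \<in> Obj C" "\<And>j. j \<in> Obj J \<Longrightarrow> y j \<in> fobj (fobj D j) x"
      "\<And>i j u. \<lbrakk>i \<in> Obj J; j \<in> Obj J; u \<in> Hom J i j\<rbrakk> \<Longrightarrow> farr D i j u x (y i) = y j" for x y
    using v(2) that unfolding pointwise_limit_def by blast
  have v'1: "v' \<in> Obj C" "\<And>j. j \<in> Obj J \<Longrightarrow> p' j \<in> Hom C v' (fobj cD j)"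
    and p'c: "\<And>i j u. \<lbrakk>i \<in> Obj J; j \<in> Obj J; u \<in> Hom J i j\<rbrakk> \<Longrightarrow> Comp C v' (fobj cD i) (fobj cD j) (farr cD i j u) (p' i) = p' j"
    and v'ex: "\<And>w q. is_cone J C cD w q \<Longrightarrow> \<exists>!h. h \<in> Hom C w v' \<and> (\<forall>j\<in>Obj J. Comp C w v' (fobj cD j) (p' j) h = q j)"
    using v' unfolding is_limit_def is_cone_def by auto
  have cob: "fobj cD j \<in> Obj C" if "j \<in> Obj J" for j using cD that unfolding is_functor_def by blast
  have car: "farr cD i j u \<in> Hom C (fobj cD i) (fobj cD j)" if "i \<in> Obj J" "j \<in> Obj J" "u \<in> Hom J i j" for i j u
    using cD that unfolding is_functor_def by blast
  have v'un: "h = h'" if "x \<in> Obj C" "h \<in> Hom C x v'" "h' \<in> Hom C x v'"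
      "\<And>j. j \<in> Obj J \<Longrightarrow> Comp C x v' (fobj cD j) (p' j) h = Comp C x v' (fobj cD j) (p' j) h'" for x h h'
  proof -
    let ?q = "\<lambda>j. Comp C x v' (fobj cD j) (p' j) h"
    have "is_cone J C cD x ?q"
      unfolding is_cone_def
    proof (intro conjI ballI that(1))
      show "?q j \<in> Hom C x (fobj cD j)" if "j \<in> Obj J" for j using v'1 cob that \<open>x \<in> Obj C\<close> \<open>h \<in> Hom C x v'\<close> by simp
      show "Comp C x (fobj cD i) (fobj cD j) (farr cD i j u) (?q i) = ?q j" if i: "i \<in> Obj J" "j \<in> Obj J" "u \<in> Hom J i j" for i j u
        by (rule slide1[OF p'c[OF i] \<open>h \<in> Hom C x v'\<close> v'1(2)[OF i(1)] car[OF i] \<open>x \<in> Obj C\<close> v'1(1) cob[OF i(1)] cob[OF i(2)]])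
    qed
    from v'ex[OF this] show ?thesis using that(2-4) by (metis (no_types, lifting))
  qed
  have vun: "z = z'" if "x \<in> Obj C" "z \<in> fobj v x" "z' \<in> fobj v x" "\<And>j. j \<in> Obj J \<Longrightarrow> p j x z = p j x z'" for x z z'
  proof -
    have "\<exists>!y. y \<in> fobj v x \<and> (\<forall>j\<in>Obj J. p j x y = p j x z)"
      by (rule vex) (use that pnat_in[OF pj] pc in auto)
    moreover have "\<forall>j\<in>Obj J. p j x z' = p j x z" using that(4) by simp
    ultimately show ?thesis using that(2,3) by blast
  qed
  note l = local_isoD[OF D]
  have "\<forall>x z. \<exists>h. x \<in> Obj C \<and> z \<in> fobj v x \<longrightarrow> h \<in> Hom C x v' \<and> (\<forall>j\<in>Obj J. Comp C x v' (fobj cD j) (p' j) h = \<eta> j x (p j x z))"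
  proof (intro allI)
    fix x z
    have "\<exists>h. h \<in> Hom C x v' \<and> (\<forall>j\<in>Obj J. Comp C x v' (fobj cD j) (p' j) h = \<eta> j x (p j x z))" if x: "x \<in> Obj C" "z \<in> fobj v x"
    proof -
      have "is_cone J C cD x (\<lambda>j. \<eta> j x (p j x z))"
        unfolding is_cone_def using x l(4) pnat_in[OF pj x(2,1)] cDar pc by simp
      from v'ex[OF this] show ?thesis by blast
    qed
    then show "\<exists>h. x \<in> Obj C \<and> z \<in> fobj v x \<longrightarrow> h \<in> Hom C x v' \<and> (\<forall>j\<in>Obj J. Comp C x v' (fobj cD j) (p' j) h = \<eta> j x (p j x z))" by blast
  qed
  then obtain t where t: "\<And>x z. \<lbrakk>x \<in> Obj C; z \<in> fobj v x\<rbrakk> \<Longrightarrow> t x z \<in> Hom C x v'"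
    "\<And>x z j. \<lbrakk>x \<in> Obj C; z \<in> fobj v x; j \<in> Obj J\<rbrakk> \<Longrightarrow> Comp C x v' (fobj cD j) (p' j) (t x z) = \<eta> j x (p j x z)"
    by (metis (no_types, lifting))
  define \<eta>v where "\<eta>v = (\<lambda>x\<in>Obj C. \<lambda>z\<in>fobj v x. t x z)"
  have pnatl: "p j y (farr v x y f z) = farr (fobj D j) x y f (p j x z)" if "j \<in> Obj J" "x \<in> Obj C" "y \<in> Obj C" "f \<in> Hom C y x" "z \<in> fobj v x" for j x y f z
    using pnat_natural[OF pj[OF that(1)] that(5,4,2,3)] by simp
  have \<eta>v: "\<eta>v \<in> pnat C v (representable C v')"
    unfolding \<eta>v_def
  proof (rule pnatI[OF _ _ v(1)])
    show "t x z \<in> fobj (representable C v') x" if "x \<in> Obj C" "z \<in> fobj v x" for x z using t(1)[OF that] by simp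
    fix x y f z assume x: "x \<in> Obj C" "y \<in> Obj C" "f \<in> Hom C y x" "z \<in> fobj v x"
    note z' = presheaf_in[OF v(1) x(4,3,1,2)]
    have "Comp C y x v' (t x z) f = t y (farr v x y f z)"
    proof (rule v'un[OF x(2) _ t(1)[OF x(2) z']])
      show "Comp C y x v' (t x z) f \<in> Hom C y v'" using t(1)[OF x(1,4)] x v'1 by simp
      fix j assume j: "j \<in> Obj J"
      have "Comp C y v' (fobj cD j) (p' j) (Comp C y x v' (t x z) f) = Comp C y x (fobj cD j) (\<eta> j x (p j x z)) f"
        by (rule slide1[OF t(2)[OF x(1,4) j] x(3) t(1)[OF x(1,4)] v'1(2)[OF j] x(2,1) v'1(1) cob[OF j]])
      also have "\<dots> = \<eta> j y (farr (fobj D j) x y f (p j x z))"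
        using l(7)[OF j x(1,2,3) pnat_in[OF pj[OF j] x(4,1)]] by simp
      also have "\<dots> = Comp C y v' (fobj cD j) (p' j) (t y (farr v x y f z))"
        using t(2)[OF x(2) z' j] pnatl[OF j x] by simp
      finally show "Comp C y v' (fobj cD j) (p' j) (Comp C y x v' (t x z) f) = Comp C y v' (fobj cD j) (p' j) (t y (farr v x y f z))" .
    qed
    then show "farr (representable C v') x y f (t x z) = t y (farr v x y f z)" using t(1)[OF x(1,4)] by simp
  qed
  have surj: "locally x (\<lambda>w h. \<exists>z\<in>fobj v w. \<eta>v w z = Comp C w x v' g h)" if x: "x \<in> Obj C" "g \<in> Hom C x v'" for x g
  proof -
    define gj where "gj j = Comp C x v' (fobj cD j) (p' j) g" for j
    have gj: "gj j \<in> Hom C x (fobj cD j)" if "j \<in> Obj J" for j unfolding gj_def using v'1 cob x that by simp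
    let ?S = "\<lambda>j w h. \<exists>q\<in>fobj (fobj D j) w. \<eta> j w q = Comp C w x (fobj cD j) (gj j) h"
    have "locally x (\<lambda>w h. \<forall>j\<in>Obj J. ?S j w h)"
    proof (rule locally_ball[OF finJ x(1)])
      show "locally x (?S j)" if "j \<in> Obj J" for j by (rule l(5)[OF that x(1) gj[OF that]])
      show "sieve x (?S j)" if j: "j \<in> Obj J" for j
        unfolding sieve_def
      proof (intro ballI impI, elim bexE)
        fix w h u k q assume w: "w \<in> Obj C" "h \<in> Hom C w x" "u \<in> Obj C" "k \<in> Hom C u w" "q \<in> fobj (fobj D j) w" "\<eta> j w q = Comp C w x (fobj cD j) (gj j) h"
        then show "\<exists>q\<in>fobj (fobj D j) u. \<eta> j u q = Comp C u x (fobj cD j) (gj j) (Comp C u w x h k)"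
          using l(7)[OF j w(1,3,4,5)] presheaf_in[OF l(1)[OF j] w(5,4,1,3)] assoc[OF w(4,2) gj[OF j] w(3,1) x(1) cob[OF j]]
          by (intro bexI[of _ "farr (fobj D j) w u k q"]) simp_all
      qed
    qed
    then show ?thesis
    proof (rule locally_trans)
      fix w h assume w: "w \<in> Obj C" "h \<in> Hom C w x" "\<forall>j\<in>Obj J. ?S j w h"
      have "\<forall>j\<in>Obj J. \<exists>q. q \<in> fobj (fobj D j) w \<and> \<eta> j w q = Comp C w x (fobj cD j) (gj j) h" using w(3) by blast
      from bchoice[OF this] obtain q where q: "\<And>j. j \<in> Obj J \<Longrightarrow> q j \<in> fobj (fobj D j) w"
        "\<And>j. j \<in> Obj J \<Longrightarrow> \<eta> j w (q j) = Comp C w x (fobj cD j) (gj j) h" by blast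
      \<comment> \<open>The lifts \<open>q j\<close> were chosen independently. Along each arrow of
        \<open>J\<close> they are compatible after applying \<open>\<eta>\<close>, so by local
        injectivity they are so on a covering; \<open>?I\<close> collects the finitely many arrows
        to be treated.\<close>
      let ?I = "Sigma (Obj J) (\<lambda>i. Sigma (Obj J) (\<lambda>j. Hom J i j))"
      let ?T = "\<lambda>(i, j, u) y k. farr (fobj D j) w y k (farr D i j u w (q i)) = farr (fobj D j) w y k (q j)"
      have "locally w (\<lambda>y k. \<forall>iju\<in>?I. ?T iju y k)"
      proof (rule locally_ball[OF _ w(1)])
        show "finite ?I" using J unfolding finite_cat_def by auto
        fix iju assume "iju \<in> ?I"
        then obtain i j u where i: "iju = (i, j, u)" "i \<in> Obj J" "j \<in> Obj J" "u \<in> Hom J i j" by auto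
        have Dq: "farr D i j u w (q i) \<in> fobj (fobj D j) w" using pnat_in[OF Dar[OF i(2-4)] q(1)[OF i(2)] w(1)] .
        have "\<eta> j w (farr D i j u w (q i)) = Comp C w (fobj cD i) (fobj cD j) (farr cD i j u) (Comp C w x (fobj cD i) (gj i) h)"
          using cDar[OF i(2-4) w(1) q(1)[OF i(2)]] q(2)[OF i(2)] by simp
        also have "\<dots> = Comp C w x (fobj cD j) (Comp C x (fobj cD i) (fobj cD j) (farr cD i j u) (gj i)) h"
          using assoc[OF w(2) gj[OF i(2)] car[OF i(2-4)] w(1) x(1) cob[OF i(2)] cob[OF i(3)]] by simp
        also have "Comp C x (fobj cD i) (fobj cD j) (farr cD i j u) (gj i) = gj j"
          unfolding gj_def by (rule slide1[OF p'c[OF i(2-4)] x(2) v'1(2)[OF i(2)] car[OF i(2-4)] x(1) v'1(1) cob[OF i(2)] cob[OF i(3)]])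
        finally have "\<eta> j w (farr D i j u w (q i)) = \<eta> j w (q j)" using q(2)[OF i(3)] by simp
        from l(6)[OF i(3) w(1) Dq q(1)[OF i(3)] this] show "locally w (?T iju)" unfolding i(1) by simp
        show "sieve w (?T iju)"
          unfolding sieve_def i(1) using presheaf_comp[OF l(1)[OF i(3)] Dq] presheaf_comp[OF l(1)[OF i(3)] q(1)[OF i(3)]] w(1) by simp
      qed
      then show "locally w (\<lambda>y k. \<exists>z\<in>fobj v y. \<eta>v y z = Comp C y x v' g (Comp C y w x h k))"
      proof (rule locally_mono)
        fix y k assume y: "y \<in> Obj C" "k \<in> Hom C y w" "\<forall>iju\<in>?I. ?T iju y k"
        have q': "farr (fobj D j) w y k (q j) \<in> fobj (fobj D j) y" if "j \<in> Obj J" for j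
          by (rule presheaf_in[OF l(1)[OF that] q(1)[OF that] y(2) w(1) y(1)])
        have "\<exists>!z. z \<in> fobj v y \<and> (\<forall>j\<in>Obj J. p j y z = farr (fobj D j) w y k (q j))"
        proof (rule vex[OF y(1) q'])
          fix i j u assume i: "i \<in> Obj J" "j \<in> Obj J" "u \<in> Hom J i j"
          then have "?T (i, j, u) y k" using y(3) by blast
          then show "farr D i j u y (farr (fobj D i) w y k (q i)) = farr (fobj D j) w y k (q j)"
            using pnat_natural[OF Dar[OF i] q(1)[OF i(1)] y(2) w(1) y(1)] by simp
        qed
        then obtain z where z: "z \<in> fobj v y" "\<And>j. j \<in> Obj J \<Longrightarrow> p j y z = farr (fobj D j) w y k (q j)" by blast
        have hk: "Comp C y w x h k \<in> Hom C y x" using y w x by simp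
        have "\<eta>v y z = Comp C y x v' g (Comp C y w x h k)"
        proof (rule v'un[OF y(1)])
          show "\<eta>v y z \<in> Hom C y v'" using t(1)[OF y(1) z(1)] y z by (simp add: \<eta>v_def)
          show "Comp C y x v' g (Comp C y w x h k) \<in> Hom C y v'" using hk x y v'1 by simp
          fix j assume j: "j \<in> Obj J"
          have "Comp C y v' (fobj cD j) (p' j) (\<eta>v y z) = \<eta> j y (farr (fobj D j) w y k (q j))"
            using t(2)[OF y(1) z(1) j] z y(1) j by (simp add: \<eta>v_def)
          also have "\<dots> = Comp C y w (fobj cD j) (Comp C w x (fobj cD j) (gj j) h) k"
            using l(7)[OF j w(1) y(1,2) q(1)[OF j]] q(2)[OF j] by simp
          also have "\<dots> = Comp C y x (fobj cD j) (gj j) (Comp C y w x h k)"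
            by (rule assoc[OF y(2) w(2) gj[OF j] y(1) w(1) x(1) cob[OF j]])
          also have "\<dots> = Comp C y v' (fobj cD j) (p' j) (Comp C y x v' g (Comp C y w x h k))"
            unfolding gj_def by (rule assoc[OF hk x(2) v'1(2)[OF j] y(1) x(1) v'1(1) cob[OF j]])
          finally show "Comp C y v' (fobj cD j) (p' j) (\<eta>v y z) = Comp C y v' (fobj cD j) (p' j) (Comp C y x v' g (Comp C y w x h k))" .
        qed
        then show "\<exists>z\<in>fobj v y. \<eta>v y z = Comp C y x v' g (Comp C y w x h k)" using z(1) by blast
      qed
    qed
  qed
  have inj: "locally x (\<lambda>w h. farr v x w h z = farr v x w h z')" if x: "x \<in> Obj C" "z \<in> fobj v x" "z' \<in> fobj v x" "\<eta>v x z = \<eta>v x z'" for x z z'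
  proof -
    have e: "t x z = t x z'" using x by (simp add: \<eta>v_def)
    let ?T = "\<lambda>j w h. farr (fobj D j) x w h (p j x z) = farr (fobj D j) x w h (p j x z')"
    have "locally x (\<lambda>w h. \<forall>j\<in>Obj J. ?T j w h)"
    proof (rule locally_ball[OF finJ x(1)])
      fix j assume j: "j \<in> Obj J"
      note pz = pnat_in[OF pj[OF j] x(2,1)] pnat_in[OF pj[OF j] x(3,1)]
      have "\<eta> j x (p j x z) = \<eta> j x (p j x z')" using t(2)[OF x(1,2) j] t(2)[OF x(1,3) j] e by simp
      then show "locally x (?T j)" by (rule l(6)[OF j x(1) pz])
      show "sieve x (?T j)"
        unfolding sieve_def using presheaf_comp[OF l(1)[OF j] pz(1)] presheaf_comp[OF l(1)[OF j] pz(2)] x(1) by simp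
    qed
    then show ?thesis
    proof (rule locally_mono)
      fix w h assume w: "w \<in> Obj C" "h \<in> Hom C w x" "\<forall>j\<in>Obj J. ?T j w h"
      show "farr v x w h z = farr v x w h z'"
        by (rule vun[OF w(1) presheaf_in[OF v(1) x(2) w(2) x(1) w(1)] presheaf_in[OF v(1) x(3) w(2) x(1) w(1)]])
          (use w pnatl[OF _ x(1) w(1,2) x(2)] pnatl[OF _ x(1) w(1,2) x(3)] in simp)
    qed
  qed
  have "local_iso v v' \<eta>v" unfolding local_iso_def using v(1) v'1(1) \<eta>v surj inj by blast
  moreover have "\<forall>j\<in>Obj J. \<forall>x\<in>Obj C. \<forall>z\<in>fobj v x. Comp C x v' (fobj cD j) (p' j) (\<eta>v x z) = \<eta> j x (p j x z)"
    using t(2) by (simp add: \<eta>v_def)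
  ultimately show ?thesis by blast
qed

end

context stable_presheaf_subcat
begin

lemma local_iso_representable:
  assumes c: "c \<in> Obj C"
  shows "local_iso (representable C c) c (Id (presheaves C) (representable C c))"
  unfolding local_iso_def
proof (intro conjI ballI impI)
  note P = presheaf_representable[OF c]
  show "presheaf C (representable C c)" "c \<in> Obj C" by fact+
  show "Id (presheaves C) (representable C c) \<in> pnat C (representable C c) (representable C c)"
    by (rule presheaves_id_in[OF P])
  show "locally x (\<lambda>w h. \<exists>p\<in>fobj (representable C c) w. Id (presheaves C) (representable C c) w p = Comp C w x c g h)"
    if "x \<in> Obj C" "g \<in> Hom C x c" for x g
    by (rule locally.whole) (use that c in auto)
  show "locally x (\<lambda>w h. farr (representable C c) x w h p = farr (representable C c) x w h q)"
    if "x \<in> Obj C" "p \<in> fobj (representable C c) x" "q \<in> fobj (representable C c) x"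
      "Id (presheaves C) (representable C c) x p = Id (presheaves C) (representable C c) x q" for x p q
    by (rule locally.whole) (use that in auto)
qed

lemma local_iso_iso:
  assumes L: "local_iso P c \<eta>" and Q: "presheaf C Q" and \<theta>: "\<theta> \<in> pnat C Q P" "\<theta>' \<in> pnat C P Q"
    and e: "\<And>x q. \<lbrakk>x \<in> Obj C; q \<in> fobj Q x\<rbrakk> \<Longrightarrow> \<theta>' x (\<theta> x q) = q" "\<And>x p. \<lbrakk>x \<in> Obj C; p \<in> fobj P x\<rbrakk> \<Longrightarrow> \<theta> x (\<theta>' x p) = p"
  shows "local_iso Q c (Comp (presheaves C) Q P (representable C c) \<eta> \<theta>)"
  unfolding local_iso_def
proof (intro conjI ballI impI)
  note l = local_isoD[OF L]
  show "presheaf C Q" "c \<in> Obj C" by fact+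
  show "Comp (presheaves C) Q P (representable C c) \<eta> \<theta> \<in> pnat C Q (representable C c)"
    by (rule presheaves_comp_in[OF \<theta>(1) l(3) Q])
  show "locally x (\<lambda>w h. \<exists>q\<in>fobj Q w. Comp (presheaves C) Q P (representable C c) \<eta> \<theta> w q = Comp C w x c g h)"
    if x: "x \<in> Obj C" "g \<in> Hom C x c" for x g
  proof (rule locally_mono[OF l(5)[OF x]])
    fix w h assume w: "w \<in> Obj C" "\<exists>p\<in>fobj P w. \<eta> w p = Comp C w x c g h"
    then obtain p where p: "p \<in> fobj P w" "\<eta> w p = Comp C w x c g h" by blast
    have q: "\<theta>' w p \<in> fobj Q w" by (rule pnat_in[OF \<theta>(2) p(1) w(1)])
    show "\<exists>q\<in>fobj Q w. Comp (presheaves C) Q P (representable C c) \<eta> \<theta> w q = Comp C w x c g h"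
      by (rule bexI[OF _ q]) (use w(1) q p e(2)[OF w(1) p(1)] in simp)
  qed
  fix x p q assume x: "x \<in> Obj C" "p \<in> fobj Q x" "q \<in> fobj Q x"
    and "Comp (presheaves C) Q P (representable C c) \<eta> \<theta> x p = Comp (presheaves C) Q P (representable C c) \<eta> \<theta> x q"
  then have e': "\<eta> x (\<theta> x p) = \<eta> x (\<theta> x q)" by simp
  show "locally x (\<lambda>w h. farr Q x w h p = farr Q x w h q)"
  proof (rule locally_mono[OF l(6)[OF x(1) pnat_in[OF \<theta>(1) x(2,1)] pnat_in[OF \<theta>(1) x(3,1)] e']])
    fix w h assume w: "w \<in> Obj C" "h \<in> Hom C w x" "farr P x w h (\<theta> x p) = farr P x w h (\<theta> x q)"
    then have "\<theta> w (farr Q x w h p) = \<theta> w (farr Q x w h q)"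
      using pnat_natural[OF \<theta>(1) x(2) w(2) x(1) w(1)] pnat_natural[OF \<theta>(1) x(3) w(2) x(1) w(1)] by simp
    then show "farr Q x w h p = farr Q x w h q"
      using e(1)[OF w(1) presheaf_in[OF Q x(2) w(2) x(1) w(1)]] e(1)[OF w(1) presheaf_in[OF Q x(3) w(2) x(1) w(1)]] by metis
  qed
qed

text \<open>Two arrows with equal composites with \<open>la\<close> are lifted locally to elements
  of \<open>P1\<close>. The images of these in \<open>R\<close> agree after \<open>\<eta>R\<close>,
  hence agree on a further covering, where injectivity of \<open>\<theta>\<close> identifies the
  elements. The three nested coverings are removed by separatedness.\<close>

lemma local_iso_mono:
  assumes L1: "local_iso P1 l1 \<eta>1" and LR: "local_iso R lR \<eta>R" and \<theta>: "\<theta> \<in> pnat C P1 R"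
    and inj: "\<And>x p q. \<lbrakk>x \<in> Obj C; p \<in> fobj P1 x; q \<in> fobj P1 x; \<theta> x p = \<theta> x q\<rbrakk> \<Longrightarrow> p = q"
    and la: "la \<in> Hom C l1 lR" "\<And>x p. \<lbrakk>x \<in> Obj C; p \<in> fobj P1 x\<rbrakk> \<Longrightarrow> Comp C x l1 lR la (\<eta>1 x p) = \<eta>R x (\<theta> x p)"
  shows "is_mono C l1 lR la"
  unfolding is_mono_def
proof (intro conjI ballI impI la(1))
  note l = local_isoD[OF L1] note r = local_isoD[OF LR]
  note o [simp] = l(2) r(2) la(1)
  fix x f g assume x [simp]: "x \<in> Obj C" "f \<in> Hom C x l1" "g \<in> Hom C x l1" and e: "Comp C x l1 lR la f = Comp C x l1 lR la g"
  show "f = g"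
  proof (rule locally_unique[OF l(5)[OF x(1,2)] l(2) x(2,3)])
    fix w h assume w [simp]: "w \<in> Obj C" "h \<in> Hom C w x" and "\<exists>p\<in>fobj P1 w. \<eta>1 w p = Comp C w x l1 f h"
    then obtain p where p: "p \<in> fobj P1 w" "\<eta>1 w p = Comp C w x l1 f h" by blast
    have gh: "Comp C w x l1 g h \<in> Hom C w l1" by simp
    show "Comp C w x l1 f h = Comp C w x l1 g h"
    proof (rule locally_unique[OF l(5)[OF w(1) gh] l(2) _ gh])
      fix v k assume v [simp]: "v \<in> Obj C" "k \<in> Hom C v w" and "\<exists>q\<in>fobj P1 v. \<eta>1 v q = Comp C v w l1 (Comp C w x l1 g h) k"
      then obtain q where q: "q \<in> fobj P1 v" "\<eta>1 v q = Comp C v w l1 (Comp C w x l1 g h) k" by blast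
      let ?p = "farr P1 w v k p"
      have p': "?p \<in> fobj P1 v" by (rule presheaf_in[OF l(1) p(1) v(2) w(1) v(1)])
      have fp: "\<eta>1 v ?p = Comp C v w l1 (Comp C w x l1 f h) k" using l(7)[OF w(1) v p(1)] p(2) by simp
      have "Comp C v l1 lR la (\<eta>1 v ?p) = Comp C v l1 lR la (\<eta>1 v q)"
        unfolding fp q(2) using slide[OF e, of "Comp C v w x h k" v] by (simp add: assoc)
      then have e': "\<eta>R v (\<theta> v ?p) = \<eta>R v (\<theta> v q)" using la(2)[OF v(1) p'] la(2)[OF v(1) q(1)] by simp
      note loc' = r(6)[OF v(1) pnat_in[OF \<theta> p' v(1)] pnat_in[OF \<theta> q(1) v(1)] e']
      show "Comp C v w l1 (Comp C w x l1 f h) k = Comp C v w l1 (Comp C w x l1 g h) k"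
      proof (rule locally_unique[OF loc' l(2)])
        fix u m assume u: "u \<in> Obj C" "m \<in> Hom C u v" "farr R v u m (\<theta> v ?p) = farr R v u m (\<theta> v q)"
        have "\<theta> u (farr P1 v u m ?p) = \<theta> u (farr P1 v u m q)"
          using pnat_natural[OF \<theta> p' u(2) v(1) u(1)] pnat_natural[OF \<theta> q(1) u(2) v(1) u(1)] u(3) by simp
        then have "farr P1 v u m ?p = farr P1 v u m q"
          by (rule inj[OF u(1) presheaf_in[OF l(1) p' u(2) v(1) u(1)] presheaf_in[OF l(1) q(1) u(2) v(1) u(1)]])
        then have "Comp C u v l1 (\<eta>1 v ?p) m = Comp C u v l1 (\<eta>1 v q) m"
          using l(7)[OF v(1) u(1,2) p'] l(7)[OF v(1) u(1,2) q(1)] by simp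
        then show "Comp C u v l1 (Comp C v w l1 (Comp C w x l1 f h) k) m = Comp C u v l1 (Comp C v w l1 (Comp C w x l1 g h) k) m"
          unfolding fp q(2) .
      qed simp_all
    qed simp_all
  qed
qed

text \<open>The union is reflected to the stable pushout \<open>Q\<close> of the reflections of
  \<open>P1\<close> and \<open>P2\<close> over their intersection in \<open>lR\<close>. The map
  \<open>\<gamma>\<close> to \<open>Q\<close> is locally surjective because the legs of
  \<open>Q\<close> cover it. It is locally injective because \<open>m\<close> after
  \<open>\<gamma>\<close> is the restriction of \<open>\<eta>R\<close> to the union.\<close>

lemma union_local_iso:
  assumes mp: "mono_pair C R P1 P2 \<theta>1 \<theta>2" and L: "local_iso R lR \<eta>R" "local_iso P1 l1 \<eta>1" "local_iso P2 l2 \<eta>2"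
  shows "\<exists>Q \<eta>. local_iso (union_psh R P1 P2 \<theta>1 \<theta>2) Q \<eta>"
proof -
  interpret M: mono_pair C R P1 P2 \<theta>1 \<theta>2 by (rule mp)
  note r = local_isoD[OF L(1)] note l1 = local_isoD[OF L(2)] note l2 = local_isoD[OF L(3)]
  define la where "la = mediator P1 l1 \<eta>1 lR (Comp (presheaves C) P1 R (representable C lR) \<eta>R \<theta>1)"
  define lb where "lb = mediator P2 l2 \<eta>2 lR (Comp (presheaves C) P2 R (representable C lR) \<eta>R \<theta>2)"
  have la: "la \<in> Hom C l1 lR" "\<And>x p. \<lbrakk>x \<in> Obj C; p \<in> fobj P1 x\<rbrakk> \<Longrightarrow> Comp C x l1 lR la (\<eta>1 x p) = \<eta>R x (\<theta>1 x p)"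
    using mediator[OF local_iso_reflection[OF L(2)] r(2) presheaves_comp_in[OF M.\<theta>1 r(3) M.P1]] unfolding la_def by simp_all
  have lb: "lb \<in> Hom C l2 lR" "\<And>x p. \<lbrakk>x \<in> Obj C; p \<in> fobj P2 x\<rbrakk> \<Longrightarrow> Comp C x l2 lR lb (\<eta>2 x p) = \<eta>R x (\<theta>2 x p)"
    using mediator[OF local_iso_reflection[OF L(3)] r(2) presheaves_comp_in[OF M.\<theta>2 r(3) M.P2]] unfolding lb_def by simp_all
  have ma: "is_mono C l1 lR la" by (rule local_iso_mono[OF L(2,1) M.\<theta>1 M.inj1 la])
  have mb: "is_mono C l2 lR lb" by (rule local_iso_mono[OF L(3,1) M.\<theta>2 M.inj2 lb])
  obtain N p q where N: "is_pullback C N l1 l2 lR p q la lb" by (rule ex_pullback[OF la(1) lb(1) l1(2) l2(2) r(2)])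
  obtain Q i j m where Q: "is_stable_pushout C N l1 l2 Q p q i j" and m: "m \<in> Hom C Q lR" "Comp C l1 Q lR m i = la" "Comp C l2 Q lR m j = lb"
    and "is_mono C Q lR m" and "is_union C lR {(l1, la), (l2, lb)} (Q, m)"
    by (rule ex_stable_pushout[OF N ma mb])
  note po = is_stable_pushoutD[OF Q]
  note Q1 = is_pushoutD[OF po] note N1 = is_pullbackD[OF N]
  have i\<eta>: "Comp (presheaves C) P1 (representable C l1) (representable C Q) (yoneda_arr C l1 Q i) \<eta>1 \<in> pnat C P1 (representable C Q)"
    by (rule presheaves_comp_in[OF l1(3) yoneda_arr_in[OF Q1(7,2,4)] M.P1])
  have j\<eta>: "Comp (presheaves C) P2 (representable C l2) (representable C Q) (yoneda_arr C l2 Q j) \<eta>2 \<in> pnat C P2 (representable C Q)"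
    by (rule presheaves_comp_in[OF l2(3) yoneda_arr_in[OF Q1(8,3,4)] M.P2])
  have i\<eta>': "Comp (presheaves C) P1 (representable C l1) (representable C Q) (yoneda_arr C l1 Q i) \<eta>1 x y = Comp C x l1 Q i (\<eta>1 x y)"
    if "x \<in> Obj C" "y \<in> fobj P1 x" for x y using that l1(4)[OF that] by simp
  have j\<eta>': "Comp (presheaves C) P2 (representable C l2) (representable C Q) (yoneda_arr C l2 Q j) \<eta>2 x y = Comp C x l2 Q j (\<eta>2 x y)"
    if "x \<in> Obj C" "y \<in> fobj P2 x" for x y using that l2(4)[OF that] by simp
  have "\<exists>\<gamma>\<in>pnat C M.U (representable C Q).
    (\<forall>x\<in>Obj C. \<forall>y\<in>fobj P1 x. \<gamma> x (\<theta>1 x y) = Comp (presheaves C) P1 (representable C l1) (representable C Q) (yoneda_arr C l1 Q i) \<eta>1 x y) \<and>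
    (\<forall>x\<in>Obj C. \<forall>y\<in>fobj P2 x. \<gamma> x (\<theta>2 x y) = Comp (presheaves C) P2 (representable C l2) (representable C Q) (yoneda_arr C l2 Q j) \<eta>2 x y)"
  proof (rule M.U_glue[OF i\<eta> j\<eta>])
    fix x y z assume x: "x \<in> Obj C" "y \<in> fobj P1 x" "z \<in> fobj P2 x" "\<theta>1 x y = \<theta>2 x z"
    have "Comp C x l1 lR la (\<eta>1 x y) = Comp C x l2 lR lb (\<eta>2 x z)" using la(2)[OF x(1,2)] lb(2)[OF x(1,3)] x(4) by simp
    then obtain h where h: "h \<in> Hom C x N" "Comp C x N l1 p h = \<eta>1 x y" "Comp C x N l2 q h = \<eta>2 x z"
      by (rule is_pullback_lift[OF N x(1) l1(4)[OF x(1,2)] l2(4)[OF x(1,3)]])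
    have "Comp C x l1 Q i (Comp C x N l1 p h) = Comp C x l2 Q j (Comp C x N l2 q h)"
      by (rule slide[OF Q1(9) h(1) Q1(5,7,6,8) x(1) Q1(1,2,3,4)])
    then show "Comp (presheaves C) P1 (representable C l1) (representable C Q) (yoneda_arr C l1 Q i) \<eta>1 x y =
        Comp (presheaves C) P2 (representable C l2) (representable C Q) (yoneda_arr C l2 Q j) \<eta>2 x z"
      unfolding i\<eta>'[OF x(1,2)] j\<eta>'[OF x(1,3)] h(2,3) .
  qed
  then obtain \<gamma> where \<gamma>: "\<gamma> \<in> pnat C M.U (representable C Q)"
    "\<And>x y. \<lbrakk>x \<in> Obj C; y \<in> fobj P1 x\<rbrakk> \<Longrightarrow> \<gamma> x (\<theta>1 x y) = Comp C x l1 Q i (\<eta>1 x y)"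
    "\<And>x y. \<lbrakk>x \<in> Obj C; y \<in> fobj P2 x\<rbrakk> \<Longrightarrow> \<gamma> x (\<theta>2 x y) = Comp C x l2 Q j (\<eta>2 x y)"
    using i\<eta>' j\<eta>' by auto
  have m\<gamma>: "Comp C x Q lR m (\<gamma> x u) = \<eta>R x u" if x: "x \<in> Obj C" and u: "u \<in> fobj M.U x" for x u
    using u
  proof (cases rule: M.U_cases)
    case (1 y)
    then show ?thesis
      using \<gamma>(2)[OF x 1(1)] slide1[OF m(2) l1(4)[OF x 1(1)] Q1(7) m(1) x l1(2) Q1(4) r(2)] la(2)[OF x 1(1)] by simp
  next
    case (2 y)
    then show ?thesis
      using \<gamma>(3)[OF x 2(1)] slide1[OF m(3) l2(4)[OF x 2(1)] Q1(8) m(1) x l2(2) Q1(4) r(2)] lb(2)[OF x 2(1)] by simp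
  qed
  have surj: "locally x (\<lambda>w h. \<exists>u\<in>fobj M.U w. \<gamma> w u = Comp C w x Q g h)" if x: "x \<in> Obj C" "g \<in> Hom C x Q" for x g
  proof -
    obtain A' pA i' B' pB j' P' p' q' where A': "is_pullback C A' l1 x Q pA i' i g" and B': "is_pullback C B' l2 x Q pB j' j g"
      and st: "is_stable_pushout C P' A' B' x p' q' i' j'"
      by (rule stable_pushout_pullback[OF Q x])
    note A1 = is_pullbackD[OF A'] note B1 = is_pullbackD[OF B']
    show ?thesis
    proof (rule locally.split[OF st])
      show "locally A' (\<lambda>w h. \<exists>u\<in>fobj M.U w. \<gamma> w u = Comp C w x Q g (Comp C w A' x i' h))"
      proof (rule locally_mono[OF l1(5)[OF A1(1,5)]])
        fix w h assume w: "w \<in> Obj C" "h \<in> Hom C w A'" and "\<exists>y\<in>fobj P1 w. \<eta>1 w y = Comp C w A' l1 pA h"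
        then obtain y where y: "y \<in> fobj P1 w" "\<eta>1 w y = Comp C w A' l1 pA h" by blast
        have "\<gamma> w (\<theta>1 w y) = Comp C w x Q g (Comp C w A' x i' h)"
          using \<gamma>(2)[OF w(1) y(1)] y(2) slide[OF A1(9) w(2) A1(5) Q1(7) A1(6) x(2) w(1) A1(1-4)] by simp
        then show "\<exists>u\<in>fobj M.U w. \<gamma> w u = Comp C w x Q g (Comp C w A' x i' h)" using M.U_I1[OF y(1)] by blast
      qed
      show "locally B' (\<lambda>w h. \<exists>u\<in>fobj M.U w. \<gamma> w u = Comp C w x Q g (Comp C w B' x j' h))"
      proof (rule locally_mono[OF l2(5)[OF B1(1,5)]])
        fix w h assume w: "w \<in> Obj C" "h \<in> Hom C w B'" and "\<exists>y\<in>fobj P2 w. \<eta>2 w y = Comp C w B' l2 pB h"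
        then obtain y where y: "y \<in> fobj P2 w" "\<eta>2 w y = Comp C w B' l2 pB h" by blast
        have "\<gamma> w (\<theta>2 w y) = Comp C w x Q g (Comp C w B' x j' h)"
          using \<gamma>(3)[OF w(1) y(1)] y(2) slide[OF B1(9) w(2) B1(5) Q1(8) B1(6) x(2) w(1) B1(1-4)] by simp
        then show "\<exists>u\<in>fobj M.U w. \<gamma> w u = Comp C w x Q g (Comp C w B' x j' h)" using M.U_I2[OF y(1)] by blast
      qed
    qed
  qed
  have inj: "locally x (\<lambda>w h. farr M.U x w h u = farr M.U x w h u')" if x: "x \<in> Obj C" "u \<in> fobj M.U x" "u' \<in> fobj M.U x" "\<gamma> x u = \<gamma> x u'" for x u u'
  proof -
    have "u \<in> fobj R x" "u' \<in> fobj R x" using M.U_sub[OF x(1)] x(2,3) unfolding M.fobj_U by blast+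
    moreover have "\<eta>R x u = \<eta>R x u'" using m\<gamma>[OF x(1,2)] m\<gamma>[OF x(1,3)] x(4) by simp
    ultimately have "locally x (\<lambda>w h. farr R x w h u = farr R x w h u')" by (rule r(6)[OF x(1)])
    then show ?thesis using M.farr_U[OF x(2)] M.farr_U[OF x(3)] by simp
  qed
  have "local_iso M.U Q \<gamma>" unfolding local_iso_def using M.presheaf_U Q1(4) \<gamma>(1) surj inj by blast
  then show ?thesis by blast
qed

end

lemma (in cat) is_limit_iso:
  assumes L: "is_limit J C D v' p'" and k: "is_iso C v v' k" and D: "is_functor J C D" and v: "v \<in> Obj C"
    and p: "\<And>j. j \<in> Obj J \<Longrightarrow> p j = Comp C v v' (fobj D j) (p' j) k"
  shows "is_limit J C D v p"
proof -
  obtain k' where kk [simp]: "k \<in> Hom C v v'" "k' \<in> Hom C v' v" and e: "Comp C v v' v k' k = Id C v" "Comp C v' v v' k k' = Id C v'"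
    using k by (rule is_iso_inverse)
  have v'1 [simp]: "v' \<in> Obj C" "\<And>j. j \<in> Obj J \<Longrightarrow> p' j \<in> Hom C v' (fobj D j)"
    and p'c: "\<And>i j u. \<lbrakk>i \<in> Obj J; j \<in> Obj J; u \<in> Hom J i j\<rbrakk> \<Longrightarrow> Comp C v' (fobj D i) (fobj D j) (farr D i j u) (p' i) = p' j"
    and v'ex: "\<And>w q. is_cone J C D w q \<Longrightarrow> \<exists>!h. h \<in> Hom C w v' \<and> (\<forall>j\<in>Obj J. Comp C w v' (fobj D j) (p' j) h = q j)"
    using L unfolding is_limit_def is_cone_def by auto
  have ob [simp]: "fobj D j \<in> Obj C" if "j \<in> Obj J" for j using D that unfolding is_functor_def by blast
  have ar: "farr D i j u \<in> Hom C (fobj D i) (fobj D j)" if "i \<in> Obj J" "j \<in> Obj J" "u \<in> Hom J i j" for i j u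
    using D that unfolding is_functor_def by blast
  have pj: "p j \<in> Hom C v (fobj D j)" if "j \<in> Obj J" for j using p that v by simp
  have "is_cone J C D v p"
    unfolding is_cone_def
  proof (intro conjI ballI v pj)
    fix i j u assume i: "i \<in> Obj J" "j \<in> Obj J" "u \<in> Hom J i j"
    show "Comp C v (fobj D i) (fobj D j) (farr D i j u) (p i) = p j"
      unfolding p[OF i(1)] p[OF i(2)] by (rule slide1[OF p'c[OF i] kk(1) v'1(2)[OF i(1)] ar[OF i] v v'1(1) ob[OF i(1)] ob[OF i(2)]])
  qed
  moreover have "\<exists>!h. h \<in> Hom C w v \<and> (\<forall>j\<in>Obj J. Comp C w v (fobj D j) (p j) h = q j)" if c: "is_cone J C D w q" for w q
  proof -
    have w [simp]: "w \<in> Obj C" using c unfolding is_cone_def by blast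
    obtain h where h: "h \<in> Hom C w v'" "\<And>j. j \<in> Obj J \<Longrightarrow> Comp C w v' (fobj D j) (p' j) h = q j"
      and un: "\<And>h'. \<lbrakk>h' \<in> Hom C w v'; \<forall>j\<in>Obj J. Comp C w v' (fobj D j) (p' j) h' = q j\<rbrakk> \<Longrightarrow> h' = h" using v'ex[OF c] by blast
    have pk: "Comp C w v (fobj D j) (p j) g = Comp C w v' (fobj D j) (p' j) (Comp C w v v' k g)" if "j \<in> Obj J" "g \<in> Hom C w v" for j g
      unfolding p[OF that(1)] by (rule assoc[OF that(2) kk(1) v'1(2)[OF that(1)] w v v'1(1) ob[OF that(1)]])
    show ?thesis
    proof (rule ex1I[of _ "Comp C w v' v k' h"])
      have "Comp C w v v' k (Comp C w v' v k' h) = h" using slide1[OF e(2) h(1) kk(2,1) w v'1(1) v v'1(1)] h(1) by simp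
      then show "Comp C w v' v k' h \<in> Hom C w v \<and> (\<forall>j\<in>Obj J. Comp C w v (fobj D j) (p j) (Comp C w v' v k' h) = q j)"
        using pk h v by simp
      fix g assume g: "g \<in> Hom C w v \<and> (\<forall>j\<in>Obj J. Comp C w v (fobj D j) (p j) g = q j)"
      then have "Comp C w v v' k g = h" by (intro un) (use pk v in auto)
      then show "g = Comp C w v' v k' h" using slide1[OF e(1), of g w] g v by auto
    qed
  qed
  ultimately show ?thesis unfolding is_limit_def by blast
qed

lemma (in cat) weighted_colimit_iso:
  assumes X: "is_weighted_colimit K C \<phi> D X \<xi>" and Y: "is_weighted_colimit K C \<phi> D Y \<zeta>"
    and D: "\<And>k. k \<in> Obj K \<Longrightarrow> fobj D k \<in> Obj C"
  shows "\<exists>h. is_iso C X Y h"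
proof -
  have cX: "weighted_cocone K C \<phi> D X \<xi>" and cY: "weighted_cocone K C \<phi> D Y \<zeta>" using X Y unfolding is_weighted_colimit_def by blast+
  have o: "X \<in> Obj C" "Y \<in> Obj C" using cX cY unfolding weighted_cocone_def by blast+
  have i: "\<xi> k x \<in> Hom C (fobj D k) X" "\<zeta> k x \<in> Hom C (fobj D k) Y" if "k \<in> Obj K" "x \<in> fobj \<phi> k" for k x
    using cX cY that unfolding weighted_cocone_def by blast+
  obtain h where h: "h \<in> Hom C X Y" "\<And>k x. \<lbrakk>k \<in> Obj K; x \<in> fobj \<phi> k\<rbrakk> \<Longrightarrow> Comp C (fobj D k) X Y h (\<xi> k x) = \<zeta> k x"
    using X cY unfolding is_weighted_colimit_def by blast
  obtain g where g: "g \<in> Hom C Y X" "\<And>k x. \<lbrakk>k \<in> Obj K; x \<in> fobj \<phi> k\<rbrakk> \<Longrightarrow> Comp C (fobj D k) Y X g (\<zeta> k x) = \<xi> k x"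
    using Y cX unfolding is_weighted_colimit_def by blast
  have uX: "\<exists>!f. f \<in> Hom C X X \<and> (\<forall>k\<in>Obj K. \<forall>x\<in>fobj \<phi> k. Comp C (fobj D k) X X f (\<xi> k x) = \<xi> k x)"
    using X cX unfolding is_weighted_colimit_def by blast
  have uY: "\<exists>!f. f \<in> Hom C Y Y \<and> (\<forall>k\<in>Obj K. \<forall>x\<in>fobj \<phi> k. Comp C (fobj D k) Y Y f (\<zeta> k x) = \<zeta> k x)"
    using Y cY unfolding is_weighted_colimit_def by blast
  have "Comp C (fobj D k) X X (Comp C X Y X g h) (\<xi> k x) = \<xi> k x" if "k \<in> Obj K" "x \<in> fobj \<phi> k" for k x
    using assoc[OF i(1)[OF that] h(1) g(1) D[OF that(1)] o(1,2,1)] h(2)[OF that] g(2)[OF that] by simp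
  moreover have "Comp C (fobj D k) X X (Id C X) (\<xi> k x) = \<xi> k x" if "k \<in> Obj K" "x \<in> fobj \<phi> k" for k x
    using i(1)[OF that] D[OF that(1)] o by simp
  ultimately have 1: "Comp C X Y X g h = Id C X" using uX g(1) h(1) o by (metis (no_types, lifting) comp_in id_in)
  have "Comp C (fobj D k) Y Y (Comp C Y X Y h g) (\<zeta> k x) = \<zeta> k x" if "k \<in> Obj K" "x \<in> fobj \<phi> k" for k x
    using assoc[OF i(2)[OF that] g(1) h(1) D[OF that(1)] o(2,1,2)] h(2)[OF that] g(2)[OF that] by simp
  moreover have "Comp C (fobj D k) Y Y (Id C Y) (\<zeta> k x) = \<zeta> k x" if "k \<in> Obj K" "x \<in> fobj \<phi> k" for k x
    using i(2)[OF that] D[OF that(1)] o by simp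
  ultimately have 2: "Comp C Y X Y h g = Id C Y" using uY g(1) h(1) o by (metis (no_types, lifting) comp_in id_in)
  show ?thesis using 1 2 h(1) g(1) unfolding is_iso_def by blast
qed

section \<open>Exactness from stable pushouts\<close>

definition empty_psh :: "('o, 'u, 'u set, 'u \<Rightarrow> 'u) func" where
  "empty_psh = \<lparr>fobj = (\<lambda>_. {}), farr = (\<lambda>_ _ _ _. undefined)\<rparr>"

lemma fobj_empty_psh [simp]: "fobj empty_psh a = {}"
  by (simp add: empty_psh_def)

lemma presheaf_empty_psh:
  fixes C :: "('o, 'u) cat"
  assumes "universe TYPE('u)" "category C"
  shows "presheaf C empty_psh"
  using small_empty[OF small_singleton[OF assms(1)]] assms(2)
  by (intro presheafI) (auto simp: empty_psh_def)

locale universe_cat = locally_small_cat C for C :: "('o, 'u) cat" +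
  assumes univ: "universe TYPE('u)"
begin

abbreviation small_psh where "small_psh \<equiv> {P. small_presheaf C P}"

lemma small_presheaf_representable: "c \<in> Obj C \<Longrightarrow> small_presheaf C (representable C c)"
  unfolding small_presheaf_iff by (intro exI[of _ "{c}"] conjI lan_representable small_singleton[OF univ])

lemma presheaf_subcat_small: "presheaf_subcat C small_psh"
  by unfold_locales (simp add: small_presheaf_representable)

sublocale small_psh: presheaf_subcat C small_psh
  by (rule presheaf_subcat_small)

lemma small_presheaves_eq: "small_presheaves C = small_psh.A"
  by (simp add: small_presheaves_def)

lemma pnat_empty_psh: "(\<lambda>a\<in>Obj C. \<lambda>x\<in>{}. undefined) \<in> pnat C empty_psh G"
  using pnatI[of C empty_psh "\<lambda>_ _. undefined" G] presheaf_empty_psh[OF univ category] by simp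

lemma small_presheaf_empty_psh: "small_presheaf C empty_psh"
proof -
  have "small TYPE('u) ({} :: 'o set)"
    by (rule small_empty[OF small_singleton[OF univ]])
  moreover have "lan empty_psh {}"
    unfolding lan_def
  proof (intro conjI allI impI ballI)
    fix G and \<beta> :: "'o \<Rightarrow> 'u \<Rightarrow> 'u"
    have "\<alpha> = (\<lambda>a\<in>Obj C. \<lambda>x\<in>{}. undefined)" if "\<alpha> \<in> pnat C empty_psh G" for \<alpha>
      by (rule pnat_ext[OF that pnat_empty_psh[of G]]) simp
    then show "\<exists>!\<alpha>. \<alpha> \<in> pnat C empty_psh G \<and> (\<forall>a\<in>{}. \<forall>x\<in>fobj empty_psh a. \<alpha> a x = \<beta> a x)"
      using pnat_empty_psh by blast
  qed (use presheaf_empty_psh[OF univ category] in auto)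
  ultimately show ?thesis unfolding small_presheaf_iff by blast
qed

text \<open>The three index sets are joined into one that serves all three presheaves. The joint
  index set is small since the universe is infinite.\<close>

lemma small_presheaf_union:
  assumes mp: "mono_pair C R P1 P2 \<theta>1 \<theta>2" and s: "small_presheaf C P1" "small_presheaf C P2" "small_presheaf C P12"
    and p: "p \<in> pnat C P12 P1" and q: "q \<in> pnat C P12 P2"
    and e: "\<And>a z. \<lbrakk>a \<in> Obj C; z \<in> fobj P12 a\<rbrakk> \<Longrightarrow> \<theta>1 a (p a z) = \<theta>2 a (q a z)"
    and ex: "\<And>a x y. \<lbrakk>a \<in> Obj C; x \<in> fobj P1 a; y \<in> fobj P2 a; \<theta>1 a x = \<theta>2 a y\<rbrakk> \<Longrightarrow> \<exists>z\<in>fobj P12 a. p a z = x \<and> q a z = y"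
  shows "small_presheaf C (union_psh R P1 P2 \<theta>1 \<theta>2)"
proof -
  interpret M: mono_pair C R P1 P2 \<theta>1 \<theta>2 by (rule mp)
  obtain T1 T2 T3 where T: "small TYPE('u) T1" "lan P1 T1" "small TYPE('u) T2" "lan P2 T2" "small TYPE('u) T3" "lan P12 T3"
    using s unfolding small_presheaf_iff by blast
  have inf: "infinite (UNIV :: 'u set)"
  proof
    assume "finite (UNIV :: 'u set)"
    then have "|UNIV :: 'u set| <o |UNIV :: nat set|" by (intro finite_ordLess_infinite) (auto simp: card_of_well_order_on Field_card_of)
    then show False using univ unfolding universe_def using not_ordLess_ordLeq ordLess_imp_ordLeq by blast
  qed
  have sm: "small TYPE('u) (T1 \<union> T2 \<union> T3)"
    using T inf unfolding small_def by (intro card_of_Un_ordLess_infinite) auto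
  have "T1 \<union> T2 \<union> T3 \<subseteq> Obj C" using T unfolding lan_def by blast
  then have "lan P1 (T1 \<union> T2 \<union> T3)" "lan P2 (T1 \<union> T2 \<union> T3)" "lan P12 (T1 \<union> T2 \<union> T3)"
    using lan_mono[OF T(2), of "T1 \<union> T2 \<union> T3"] lan_mono[OF T(4), of "T1 \<union> T2 \<union> T3"] lan_mono[OF T(6), of "T1 \<union> T2 \<union> T3"] by auto
  then have "lan M.U (T1 \<union> T2 \<union> T3)" by (rule M.lan_U[OF _ _ _ p q e ex])
  then show ?thesis unfolding small_presheaf_iff using sm by blast
qed

text \<open>Being lex, \<open>D\<close> sends the two monomorphisms and their intersection in
  \<open>K\<close> to subpresheaves and their intersection. Both the smallness of the union and its
  identification with the weighted colimit rest on this.\<close>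

lemma binary_weighted_colimit:
  fixes K :: "('u, 'u) cat"
  assumes K: "small_cat K" "finitely_complete K" and o: "A0 \<in> Obj K" "B0 \<in> Obj K" "c0 \<in> Obj K"
    and a: "is_mono K A0 c0 a0" "is_mono K B0 c0 b0"
    and un: "is_union (presheaves K) (representable K c0)
       {(representable K A0, yoneda_arr K A0 c0 a0), (representable K B0, yoneda_arr K B0 c0 b0)} (\<phi>, \<iota>)"
    and D: "lex_functor K (small_presheaves C) D"
  shows "mono_pair C (fobj D c0) (fobj D A0) (fobj D B0) (farr D A0 c0 a0) (farr D B0 c0 b0)"
    and "small_presheaf C (union_psh (fobj D c0) (fobj D A0) (fobj D B0) (farr D A0 c0 a0) (farr D B0 c0 b0))"
    and "is_weighted_colimit K (small_presheaves C) \<phi> D (union_psh (fobj D c0) (fobj D A0) (fobj D B0) (farr D A0 c0 a0) (farr D B0 c0 b0))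
      (\<lambda>k x. farr D k c0 (\<iota> k x))"
proof -
  have Kl: "locally_small K" and Kc: "category K" using K unfolding small_cat_def locally_small_def by auto
  interpret K: finlim_cat K using Kc K by unfold_locales
  have D': "is_functor K small_psh.A D" "preserves_finite_limits K small_psh.A D" using D unfolding lex_functor_def small_presheaves_eq by auto
  have Dob: "fobj D k \<in> Obj small_psh.A" if "k \<in> Obj K" for k using D'(1) that unfolding is_functor_def by blast
  then have Dps: "presheaf C (fobj D k)" "small_presheaf C (fobj D k)" if "k \<in> Obj K" for k using that by simp_all
  have Dar: "farr D k l u \<in> pnat C (fobj D k) (fobj D l)" if "u \<in> Hom K k l" "k \<in> Obj K" "l \<in> Obj K" for k l u
    using D'(1) that unfolding is_functor_def by (metis full_subcat_simps(2) functor_cat_simps(2))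
  note ai = is_mono_in[OF a(1)] is_mono_in[OF a(2)]
  note ma = preserves_mono[OF D' Kc small_psh.category_A a(1) o(1,3)] preserves_mono[OF D' Kc small_psh.category_A a(2) o(2,3)]
  show mp: "mono_pair C (fobj D c0) (fobj D A0) (fobj D B0) (farr D A0 c0 a0) (farr D B0 c0 b0)"
  proof unfold_locales
    show "presheaf C (fobj D c0)" "presheaf C (fobj D A0)" "presheaf C (fobj D B0)" using Dps o by blast+
    show "farr D A0 c0 a0 \<in> pnat C (fobj D A0) (fobj D c0)" "farr D B0 c0 b0 \<in> pnat C (fobj D B0) (fobj D c0)"
      using Dar ai o by blast+
    show "x = x'" if "d \<in> Obj C" "x \<in> fobj (fobj D A0) d" "x' \<in> fobj (fobj D A0) d" "farr D A0 c0 a0 d x = farr D A0 c0 a0 d x'" for d x x'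
      by (rule small_psh.mono_pointwise[OF ma(1) Dob[OF o(1)] that])
    show "x = x'" if "d \<in> Obj C" "x \<in> fobj (fobj D B0) d" "x' \<in> fobj (fobj D B0) d" "farr D B0 c0 b0 d x = farr D B0 c0 b0 d x'" for d x x'
      by (rule small_psh.mono_pointwise[OF ma(2) Dob[OF o(2)] that])
  qed
  obtain M p q where P: "is_pullback K M A0 B0 c0 p q a0 b0"
    by (rule K.ex_pullback[OF ai o])
  note P1 = is_pullbackD[OF P]
  note DP = preserves_pullback[OF D' Kc small_psh.category_A P]
  have ex: "\<exists>z\<in>fobj (fobj D M) d. farr D M A0 p d z = x \<and> farr D M B0 q d z = y"
    if "d \<in> Obj C" "x \<in> fobj (fobj D A0) d" "y \<in> fobj (fobj D B0) d" "farr D A0 c0 a0 d x = farr D B0 c0 b0 d y" for d x y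
    by (rule small_psh.pullback_pointwise[OF DP that]) blast
  show U: "small_presheaf C (union_psh (fobj D c0) (fobj D A0) (fobj D B0) (farr D A0 c0 a0) (farr D B0 c0 b0))"
    by (rule small_presheaf_union[OF mp Dps(2)[OF o(1)] Dps(2)[OF o(2)] Dps(2)[OF P1(1)] Dar[OF P1(5,1,2)] Dar[OF P1(6,1,3)]
          small_psh.pullback_pointwise_commutes[OF DP] ex])
  show "is_weighted_colimit K (small_presheaves C) \<phi> D (union_psh (fobj D c0) (fobj D A0) (fobj D B0) (farr D A0 c0 a0) (farr D B0 c0 b0))
      (\<lambda>k x. farr D k c0 (\<iota> k x))"
    unfolding small_presheaves_eq
    by (rule small_psh.union_weighted_colimit[OF Kl a P un D'(1) mp ex]) (simp_all add: U)
qed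

lemma Phi_binaryE:
  assumes "(K, \<phi>) \<in> (Phi_binary :: 'u weight set)"
  obtains A0 B0 c0 a0 b0 \<iota> where "small_cat K" "finitely_complete K" "A0 \<in> Obj K" "B0 \<in> Obj K" "c0 \<in> Obj K"
    "is_mono K A0 c0 a0" "is_mono K B0 c0 b0"
    "is_union (presheaves K) (representable K c0)
       {(representable K A0, yoneda_arr K A0 c0 a0), (representable K B0, yoneda_arr K B0 c0 b0)} (\<phi>, \<iota>)"
proof -
  obtain A0 B0 c0 a0 b0 \<iota> where "is_free_lex_on_monos K (A0, B0, c0, a0, b0)" and
     un: "is_union (presheaves K) (representable K c0)
       {(representable K A0, yoneda_arr K A0 c0 a0), (representable K B0, yoneda_arr K B0 c0 b0)} (\<phi>, \<iota>)"
    using assms unfolding Phi_binary_def by auto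
  then have "small_cat K" "finitely_complete K" "(A0, B0, c0, a0, b0) \<in> Obj (mono_cospans K)" unfolding is_free_lex_on_monos_def by auto
  then show ?thesis using that un unfolding mono_cospans_simps by auto
qed

end

section \<open>Closure of the locally representable presheaves and the left adjoint\<close>

locale stable_universe_cat = universe_cat C + stable_pushouts C for C :: "('o, 'u) cat"
begin

sublocale stable_psh: stable_presheaf_subcat C small_psh ..

definition locally_rep where "locally_rep = {P. small_presheaf C P \<and> (\<exists>c \<eta>. stable_psh.local_iso P c \<eta>)}"

lemma stable_presheaf_subcat_locally_rep: "stable_presheaf_subcat C locally_rep"
  by unfold_locales (use stable_psh.local_iso_representable small_presheaf_representable in \<open>auto simp: locally_rep_def\<close>)

sublocale locally_rep: stable_presheaf_subcat C locally_rep
  by (rule stable_presheaf_subcat_locally_rep)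

definition refl_obj where "refl_obj P = fst (SOME c\<eta>. stable_psh.local_iso P (fst c\<eta>) (snd c\<eta>))"
definition refl_unit where "refl_unit P = snd (SOME c\<eta>. stable_psh.local_iso P (fst c\<eta>) (snd c\<eta>))"

lemma local_iso_refl_unit: "P \<in> locally_rep \<Longrightarrow> stable_psh.local_iso P (refl_obj P) (refl_unit P)"
  unfolding refl_obj_def refl_unit_def locally_rep_def by (rule someI_ex[of "\<lambda>c\<eta>. stable_psh.local_iso P (fst c\<eta>) (snd c\<eta>)"]) auto

lemma reflection_refl_obj: "P \<in> locally_rep \<Longrightarrow> small_psh.reflection P (refl_obj P) (refl_unit P)"
  by (rule stable_psh.local_iso_reflection[OF local_iso_refl_unit])

text \<open>The diagram is reflected and its limit taken in \<open>C\<close>. \<open>S\<close> is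
  variable because this serves twice: with \<open>locally_rep\<close> for closure under finite
  limits, and with the objects of \<open>Phi_l\<close> for their preservation by the left
  adjoint.\<close>

lemma limit_locally_rep:
  assumes J: "finite_cat J" and S: "S \<subseteq> locally_rep" "presheaf_subcat C S" and D: "is_functor J (full_subcat (presheaves C) S) D"
    and v: "presheaf C v" "small_psh.pointwise_limit J D v p"
  obtains v' p' \<eta>v where "is_limit J C (comp_func (presheaf_subcat.refl_func C S refl_obj refl_unit) D) v' p'" "stable_psh.local_iso v v' \<eta>v"
    "\<And>j x z. \<lbrakk>j \<in> Obj J; x \<in> Obj C; z \<in> fobj v x\<rbrakk> \<Longrightarrow> Comp C x v' (refl_obj (fobj D j)) (p' j) (\<eta>v x z) = refl_unit (fobj D j) x (p j x z)"
    "is_functor J C (comp_func (presheaf_subcat.refl_func C S refl_obj refl_unit) D)"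
proof -
  interpret S: presheaf_subcat C S by fact
  have refl: "small_psh.reflection P (refl_obj P) (refl_unit P)" if "P \<in> Obj S.A" for P using reflection_refl_obj that S(1) by auto
  let ?L = "S.refl_func refl_obj refl_unit"
  have Lf: "is_functor S.A C ?L" by (rule S.is_functor_refl_func[OF refl])
  have fob: "fobj ?L = refl_obj" by (rule S.fobj_refl_func[OF refl])
  have Dob: "fobj D j \<in> Obj S.A" if "j \<in> Obj J" for j using D that unfolding is_functor_def by blast
  have Dar: "farr D i j u \<in> pnat C (fobj D i) (fobj D j)" if "i \<in> Obj J" "j \<in> Obj J" "u \<in> Hom J i j" for i j u
    using D that unfolding is_functor_def by (metis full_subcat_simps(2) functor_cat_simps(2))
  have LD: "is_functor J C (comp_func ?L D)"
    using D Lf unfolding is_functor_def comp_func_def by simp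
  obtain v' p' where lim: "is_limit J C (comp_func ?L D) v' p'"
    using finitely_complete J LD unfolding finitely_complete_def by blast
  have ob: "fobj (comp_func ?L D) j = refl_obj (fobj D j)" for j by (simp add: comp_func_def fob)
  have "\<exists>\<eta>v. stable_psh.local_iso v v' \<eta>v \<and> (\<forall>j\<in>Obj J. \<forall>x\<in>Obj C. \<forall>z\<in>fobj v x. Comp C x v' (fobj (comp_func ?L D) j) (p' j) (\<eta>v x z) = refl_unit (fobj D j) x (p j x z))"
  proof (rule stable_psh.local_iso_limit[OF J _ Dar LD _ v lim])
    show "stable_psh.local_iso (fobj D j) (fobj (comp_func ?L D) j) (refl_unit (fobj D j))" if "j \<in> Obj J" for j
      unfolding ob using local_iso_refl_unit[of "fobj D j"] Dob[OF that] S(1) by auto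
    show "Comp C x (fobj (comp_func ?L D) i) (fobj (comp_func ?L D) j) (farr (comp_func ?L D) i j u) (refl_unit (fobj D i) x y) = refl_unit (fobj D j) x (farr D i j u x y)"
      if "i \<in> Obj J" "j \<in> Obj J" "u \<in> Hom J i j" "x \<in> Obj C" "y \<in> fobj (fobj D i) x" for i j u x y
      unfolding ob using S.farr_refl_func(2)[OF refl Dob[OF that(1)] Dob[OF that(2)] Dar[OF that(1-3)] that(4,5)] by (simp add: comp_func_def)
  qed
  then obtain \<eta>v where \<eta>v: "stable_psh.local_iso v v' \<eta>v"
    "\<And>j x z. \<lbrakk>j \<in> Obj J; x \<in> Obj C; z \<in> fobj v x\<rbrakk> \<Longrightarrow> Comp C x v' (refl_obj (fobj D j)) (p' j) (\<eta>v x z) = refl_unit (fobj D j) x (p j x z)"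
    unfolding ob by blast
  show ?thesis by (rule that[OF lim \<eta>v LD])
qed

lemma lex_closed_locally_rep: "lex_closed Phi_vee C locally_rep"
  unfolding lex_closed_def
proof (intro conjI)
  show "locally_rep \<subseteq> Obj (small_presheaves C)"
    using stable_psh.local_isoD(1) by (auto simp: locally_rep_def small_presheaves_eq)
  show "\<forall>c\<in>Obj C. representable C c \<in> locally_rep" using locally_rep.representable_S by blast
  have iso: "Q \<in> locally_rep" if P: "P \<in> locally_rep" and Q: "Q \<in> Obj (small_presheaves C)" and i: "is_iso (small_presheaves C) P Q \<theta>" for P Q \<theta>
  proof -
    obtain \<theta>' where th: "\<theta> \<in> Hom small_psh.A P Q" "\<theta>' \<in> Hom small_psh.A Q P" "Comp small_psh.A P Q P \<theta>' \<theta> = Id small_psh.A P" "Comp small_psh.A Q P Q \<theta> \<theta>' = Id small_psh.A Q"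
      using i unfolding small_presheaves_eq by (rule is_iso_inverse)
    have Q': "presheaf C Q" "small_presheaf C Q" using Q unfolding small_presheaves_eq by simp_all
    obtain c \<eta> where l: "stable_psh.local_iso P c \<eta>" using P unfolding locally_rep_def by blast
    have "stable_psh.local_iso Q c (Comp (presheaves C) Q P (representable C c) \<eta> \<theta>')"
    proof (rule stable_psh.local_iso_iso[OF l Q'(1)])
      show "\<theta>' \<in> pnat C Q P" "\<theta> \<in> pnat C P Q" using th by simp_all
      show "\<theta> x (\<theta>' x q) = q" if "x \<in> Obj C" "q \<in> fobj Q x" for x q
        using th(4)[THEN fun_cong, of x, THEN fun_cong, of q] that by simp
      show "\<theta>' x (\<theta> x q) = q" if "x \<in> Obj C" "q \<in> fobj P x" for x q
        using th(3)[THEN fun_cong, of x, THEN fun_cong, of q] that by simp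
    qed
    then show ?thesis using Q' unfolding locally_rep_def by blast
  qed
  then show "\<forall>P Q \<theta>. P \<in> locally_rep \<and> Q \<in> Obj (small_presheaves C) \<and> is_iso (small_presheaves C) P Q \<theta> \<longrightarrow> Q \<in> locally_rep" by blast
  show "\<forall>J D P p. finite_cat J \<and> is_functor J (small_presheaves C) D \<and> fobj D ` Obj J \<subseteq> locally_rep \<and> is_limit J (small_presheaves C) D P p \<longrightarrow> P \<in> locally_rep"
  proof (intro allI impI, elim conjE)
    fix J :: "(nat, nat) cat" and D P p
    assume J: "finite_cat J" and D: "is_functor J (small_presheaves C) D" and sub: "fobj D ` Obj J \<subseteq> locally_rep" and L: "is_limit J (small_presheaves C) D P p"
    have D1: "is_functor J small_psh.A D" using D unfolding small_presheaves_eq .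
    have P: "P \<in> Obj small_psh.A" "small_psh.pointwise_limit J D P p" using L unfolding small_presheaves_eq small_psh.is_limit_A_iff[OF D1] by blast+
    then have P': "presheaf C P" "small_presheaf C P" by simp_all
    have "is_functor J locally_rep.A D" using D1 sub unfolding is_functor_def by (simp add: image_subset_iff)
    then obtain v' p' \<eta>v where "stable_psh.local_iso P v' \<eta>v"
      by (rule limit_locally_rep[OF J subset_refl locally_rep.presheaf_subcat_axioms _ P'(1) P(2)])
    then show "P \<in> locally_rep" unfolding locally_rep_def using P' by blast
  qed
  have main: "P \<in> locally_rep" if w: "(K, \<phi>) \<in> Phi_vee" and D: "lex_functor K (small_presheaves C) D" and sub: "fobj D ` Obj K \<subseteq> locally_rep"
      and P: "is_weighted_colimit K (small_presheaves C) \<phi> D P \<xi>" for K :: "('u, 'u) cat" and \<phi> D P \<xi>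
  proof -
    have Pob: "P \<in> Obj small_psh.A" using P unfolding is_weighted_colimit_def weighted_cocone_def small_presheaves_eq by blast
    then have P': "presheaf C P" "small_presheaf C P" by simp_all
    from w consider "(K, \<phi>) \<in> Phi_empty" | "(K, \<phi>) \<in> Phi_binary" unfolding Phi_vee_def by blast
    then show "P \<in> locally_rep"
    proof cases
      case 1
      then have K: "is_terminal_cat K" and \<phi>: "is_initial (presheaves K) \<phi>" unfolding Phi_empty_def by auto
      have Kc: "category K" using K unfolding is_terminal_cat_def by blast
      \<comment> \<open>The initial presheaf maps to the empty one, so the weight
        \<open>\<phi>\<close> has no elements and cocones carry no data. The cocone with empty
        vertex then gives an arrow from \<open>P\<close> to the empty presheaf, so \<open>P\<close>
        is empty too.\<close>
      have "presheaf K empty_psh" by (rule presheaf_empty_psh[OF univ Kc])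
      then obtain f where f: "f \<in> pnat K \<phi> empty_psh" using \<phi> unfolding is_initial_def by auto
      have \<phi>e: "fobj \<phi> k = {}" if "k \<in> Obj K" for k using pnat_in[OF f _ that] by auto
      have e: "empty_psh \<in> Obj small_psh.A" using presheaf_empty_psh[OF univ category] small_presheaf_empty_psh by simp
      then have "weighted_cocone K small_psh.A \<phi> D empty_psh (\<lambda>_ _. undefined)" unfolding weighted_cocone_def using \<phi>e by simp
      then obtain g where "g \<in> Hom small_psh.A P empty_psh" using P unfolding is_weighted_colimit_def small_presheaves_eq by blast
      then have g: "g \<in> pnat C P empty_psh" by simp
      have Pe: "fobj P x = {}" if "x \<in> Obj C" for x using pnat_in[OF g _ that] by auto
      obtain z where z: "is_strict_initial C z" using strict_initial by blast
      then have z': "z \<in> Obj C" "is_initial C z" unfolding is_strict_initial_def is_initial_def by auto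
      have n: "(\<lambda>a\<in>Obj C. \<lambda>x\<in>fobj P a. undefined) \<in> pnat C P (representable C z)"
        by (rule pnatI[OF _ _ P'(1)]) (use Pe in auto)
      \<comment> \<open>Every object with an arrow to \<open>z\<close> is initial, so the empty
        family covers it and local surjectivity holds without elements.\<close>
      have "stable_psh.local_iso P z (\<lambda>a\<in>Obj C. \<lambda>x\<in>fobj P a. undefined)"
        unfolding stable_psh.local_iso_def using P'(1) z'(1) n Pe by (auto intro: locally.empty initial_over[OF z'(2)])
      then show ?thesis unfolding locally_rep_def using P' by blast
    next
      case 2
      then obtain A0 B0 c0 a0 b0 \<iota> where k: "small_cat K" "finitely_complete K" "A0 \<in> Obj K" "B0 \<in> Obj K" "c0 \<in> Obj K"
        "is_mono K A0 c0 a0" "is_mono K B0 c0 b0" "is_union (presheaves K) (representable K c0)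
         {(representable K A0, yoneda_arr K A0 c0 a0), (representable K B0, yoneda_arr K B0 c0 b0)} (\<phi>, \<iota>)"
        by (rule Phi_binaryE)
      note b = binary_weighted_colimit[OF k D]
      let ?U = "union_psh (fobj D c0) (fobj D A0) (fobj D B0) (farr D A0 c0 a0) (farr D B0 c0 b0)"
      have l: "stable_psh.local_iso (fobj D k) (refl_obj (fobj D k)) (refl_unit (fobj D k))" if "k \<in> Obj K" for k using local_iso_refl_unit sub that by blast
      obtain Q \<eta> where "stable_psh.local_iso ?U Q \<eta>" using stable_psh.union_local_iso[OF b(1) l[OF k(5)] l[OF k(3)] l[OF k(4)]] by blast
      then have U: "?U \<in> locally_rep" using b(2) unfolding locally_rep_def by blast
      have Dob: "fobj D k \<in> Obj small_psh.A" if "k \<in> Obj K" for k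
        using D that unfolding lex_functor_def is_functor_def small_presheaves_eq by blast
      \<comment> \<open>The given colimit \<open>P\<close> is known only up to isomorphism; the
        class is replete.\<close>
      obtain h where "is_iso small_psh.A ?U P h"
        using small_psh.A.weighted_colimit_iso[OF b(3)[unfolded small_presheaves_eq] P[unfolded small_presheaves_eq] Dob] by blast
      then show ?thesis using iso[OF U] Pob unfolding small_presheaves_eq by blast
    qed
  qed
  show "\<forall>(K, \<phi>)\<in>(Phi_vee :: 'u weight set). \<forall>D P \<xi>. lex_functor K (small_presheaves C) D \<and> fobj D ` Obj K \<subseteq> locally_rep \<and> is_weighted_colimit K (small_presheaves C) \<phi> D P \<xi> \<longrightarrow> P \<in> locally_rep"
    using main by blast
qed

text \<open>The value \<open>refl_obj v\<close> is a mere choice, while the limit \<open>w\<close>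
  of the reflected diagram is another reflection of \<open>v\<close>. The comparison of the two is
  invertible and compatible with the legs, so the left adjoint preserves the limit.\<close>

lemma lex_exact_Phi_vee: "lex_exact Phi_vee C"
proof -
  define S where "S = small_psh \<inter> \<Inter> {S. lex_closed Phi_vee C S}"
  have S: "S \<subseteq> locally_rep" unfolding S_def using lex_closed_locally_rep by blast
  have Phi: "Phi_l Phi_vee C = full_subcat (presheaves C) S"
    unfolding Phi_l_def small_presheaves_eq full_subcat_full_subcat S_def ..
  have "representable C c \<in> S" if "c \<in> Obj C" for c
    unfolding S_def using that small_presheaf_representable unfolding lex_closed_def by blast
  then interpret S: presheaf_subcat C S by unfold_locales
  have refl: "S.reflection P (refl_obj P) (refl_unit P)" if "P \<in> Obj S.A" for P using reflection_refl_obj that S by auto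
  let ?L = "S.refl_func refl_obj refl_unit"
  have fob: "fobj ?L = refl_obj" by (rule S.fobj_refl_func[OF refl])
  obtain \<epsilon> where adj: "adjunction S.A C ?L (yoneda C) (restrict refl_unit (Obj S.A)) \<epsilon>"
    using S.refl_adjunction[OF refl] by blast
  have "is_limit J C (comp_func ?L D) (fobj ?L v) (\<lambda>j. farr ?L v (fobj D j) (p j))"
    if J: "finite_cat J" and D: "is_functor J S.A D" and L: "is_limit J S.A D v p" for J :: "(nat, nat) cat" and D v p
  proof -
    have v: "v \<in> Obj S.A" "small_psh.pointwise_limit J D v p" using L unfolding S.is_limit_A_iff[OF D] by blast+
    then have v': "presheaf C v" "v \<in> locally_rep" using S by auto
    have pj: "p j \<in> pnat C v (fobj D j)" if "j \<in> Obj J" for j using v(2) that unfolding small_psh.pointwise_limit_def by blast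
    have Dob: "fobj D j \<in> Obj S.A" if "j \<in> Obj J" for j using D that unfolding is_functor_def by blast
    obtain w p' \<eta>v where lim: "is_limit J C (comp_func ?L D) w p'" and \<eta>v: "stable_psh.local_iso v w \<eta>v"
      "\<And>j x z. \<lbrakk>j \<in> Obj J; x \<in> Obj C; z \<in> fobj v x\<rbrakk> \<Longrightarrow> Comp C x w (refl_obj (fobj D j)) (p' j) (\<eta>v x z) = refl_unit (fobj D j) x (p j x z)"
      and LD: "is_functor J C (comp_func ?L D)"
      by (rule limit_locally_rep[OF J S S.presheaf_subcat_axioms D v'(1) v(2)]) blast
    have r1: "S.reflection v (refl_obj v) (refl_unit v)" by (rule refl[OF v(1)])
    have r2: "S.reflection v w \<eta>v" by (rule stable_psh.local_iso_reflection[OF \<eta>v(1)])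
    note d1 = S.reflectionD[OF r1] note d2 = S.reflectionD[OF r2]
    note k = S.mediator[OF r1 d2(1,2)] note k' = S.mediator[OF r2 d1(1,2)]
    let ?k = "S.mediator v (refl_obj v) (refl_unit v) w \<eta>v" and ?k' = "S.mediator v w \<eta>v (refl_obj v) (refl_unit v)"
    have "Comp C (refl_obj v) w (refl_obj v) ?k' ?k = Id C (refl_obj v)"
      by (rule S.reflection_ext[OF r1 d1(1) _ id_in[OF d1(1)] v'(1)])
        (use k k' d1 d2 assoc[OF d1(3) k(1) k'(1) _ d1(1) d2(1) d1(1)] in simp_all)
    moreover have "Comp C w (refl_obj v) w ?k ?k' = Id C w"
      by (rule S.reflection_ext[OF r2 d2(1) _ id_in[OF d2(1)] v'(1)])
        (use k k' d1 d2 assoc[OF d2(3) k'(1) k(1) _ d2(1) d1(1) d2(1)] in simp_all)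
    ultimately have iso: "is_iso C (refl_obj v) w ?k" using k(1) k'(1) unfolding is_iso_def by blast
    show ?thesis
      unfolding fob
    proof (rule is_limit_iso[OF lim iso LD d1(1)])
      fix j assume j: "j \<in> Obj J"
      have ob: "fobj (comp_func ?L D) j = refl_obj (fobj D j)" by (simp add: comp_func_def fob)
      have f1: "farr ?L v (fobj D j) (p j) \<in> Hom C (refl_obj v) (refl_obj (fobj D j))"
        by (rule S.farr_refl_func(1)[OF refl v(1) Dob[OF j] pj[OF j]])
      have f2: "Comp C x (refl_obj v) (refl_obj (fobj D j)) (farr ?L v (fobj D j) (p j)) (refl_unit v x z) = refl_unit (fobj D j) x (p j x z)"
        if "x \<in> Obj C" "z \<in> fobj v x" for x z
        by (rule S.farr_refl_func(2)[OF refl v(1) Dob[OF j] pj[OF j] that])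
      have dj: "refl_obj (fobj D j) \<in> Obj C" using S.reflectionD(1)[OF refl[OF Dob[OF j]]] .
      have p'j: "p' j \<in> Hom C w (refl_obj (fobj D j))" using lim j unfolding is_limit_def is_cone_def ob[symmetric] by blast
      show "farr ?L v (fobj D j) (p j) = Comp C (refl_obj v) w (fobj (comp_func ?L D) j) (p' j) ?k"
        unfolding ob
      proof (rule S.reflection_ext[OF r1 dj f1 _ v'(1)])
        show "Comp C (refl_obj v) w (refl_obj (fobj D j)) (p' j) ?k \<in> Hom C (refl_obj v) (refl_obj (fobj D j))"
          using p'j k(1) d1 d2 dj by simp
        fix x z assume x: "x \<in> Obj C" "z \<in> fobj v x"
        show "Comp C x (refl_obj v) (refl_obj (fobj D j)) (farr ?L v (fobj D j) (p j)) (refl_unit v x z) =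
          Comp C x (refl_obj v) (refl_obj (fobj D j)) (Comp C (refl_obj v) w (refl_obj (fobj D j)) (p' j) ?k) (refl_unit v x z)"
          using f2[OF x] assoc[OF d1(3)[OF x] k(1) p'j x(1) d1(1) d2(1) dj] k(2)[OF x] \<eta>v(2)[OF j x] by simp
      qed
    qed
  qed
  then have "preserves_finite_limits S.A C ?L" unfolding preserves_finite_limits_def by blast
  then show ?thesis
    unfolding lex_exact_def Phi using finitely_complete adj by blast
qed

end

section \<open>Stable pushouts from exactness\<close>

lemma (in cat) is_iso_pullback:
  assumes P: "is_pullback C P A B c p q a b" and a: "is_iso C A c a"
  shows "is_iso C P B q"
proof -
  note [simp] = is_pullbackD(1-8)[OF P]
  obtain a' where a' [simp]: "a' \<in> Hom C c A" and e: "Comp C A c A a' a = Id C A" "Comp C c A c a a' = Id C c"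
    using a by (rule is_iso_inverse)
  have "Comp C B A c a (Comp C B c A a' b) = Comp C B B c b (Id C B)"
    using slide1[OF e(2), of b B] by simp
  then obtain r where r: "r \<in> Hom C B P" "Comp C B P A p r = Comp C B c A a' b" "Comp C B P B q r = Id C B"
    by (rule is_pullback_lift[OF P, rotated 3]) auto
  note [simp] = r(1)
  have "Comp C P B P r q = Id C P"
  proof (rule is_pullback_unique[OF P])
    have "Comp C P c A a' (Comp C P A c a p) = p" using slide1[OF e(1), of p P] by simp
    then show "Comp C P P A p (Comp C P B P r q) = Comp C P P A p (Id C P)"
      using slide[OF r(2), of q P] is_pullbackD(9)[OF P] by simp
    show "Comp C P P B q (Comp C P B P r q) = Comp C P P B q (Id C P)"
      using slide1[OF r(3), of q P] by simp
  qed simp_all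
  then show ?thesis using r unfolding is_iso_def by auto
qed

lemma lex_functor_comp:
  assumes F: "lex_functor A B F" and G: "lex_functor B E G"
  shows "lex_functor A E (comp_func G F)"
proof -
  have fF: "is_functor A B F" and fG: "is_functor B E G" using F G unfolding lex_functor_def by auto
  have "is_functor A E (comp_func G F)" using fF fG unfolding is_functor_def comp_func_def by simp
  moreover have "preserves_finite_limits A E (comp_func G F)"
    unfolding preserves_finite_limits_def
  proof (intro allI impI, elim conjE)
    fix J :: "(nat, nat) cat" and D v p
    assume J: "finite_cat J" and D: "is_functor J A D" and L: "is_limit J A D v p"
    have FD: "is_functor J B (comp_func F D)" using D fF unfolding is_functor_def comp_func_def by simp
    have "is_limit J B (comp_func F D) (fobj F v) (\<lambda>j. farr F v (fobj D j) (p j))"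
      using F J D L unfolding lex_functor_def preserves_finite_limits_def by blast
    then have "is_limit J E (comp_func G (comp_func F D)) (fobj G (fobj F v)) (\<lambda>j. farr G (fobj F v) (fobj (comp_func F D) j) (farr F v (fobj D j) (p j)))"
      using G[unfolded lex_functor_def preserves_finite_limits_def, THEN conjunct2, rule_format, of J "comp_func F D" "fobj F v" "\<lambda>j. farr F v (fobj D j) (p j)"] J FD by blast
    then show "is_limit J E (comp_func (comp_func G F) D) (fobj (comp_func G F) v) (\<lambda>j. farr (comp_func G F) v (fobj D j) (p j))"
      by (simp add: comp_func_def)
  qed
  ultimately show ?thesis unfolding lex_functor_def by blast
qed

section \<open>Presheaves that lie in every closed class\<close>

context universe_cat
begin

text \<open>A lex functor on the terminal category must pick a terminal object, so the diagram is
  constant at the representable of a terminal object of \<open>C\<close>. It is lex because limits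
  of terminal objects are terminal. Since the weight is empty, its colimit is the initial
  presheaf.\<close>

lemma lex_closed_empty_psh:
  assumes T: "lex_closed Phi_vee C T" and fc: "finitely_complete C"
  shows "empty_psh \<in> T"
proof -
  interpret finlim_cat C by unfold_locales fact
  define K :: "('u, 'u) cat" where "K = \<lparr>Obj = {undefined}, Hom = (\<lambda>_ _. {undefined}), Id = (\<lambda>_. undefined), Comp = (\<lambda>_ _ _ _ _. undefined)\<rparr>"
  have K: "is_terminal_cat K" unfolding is_terminal_cat_def category_def K_def by simp
  then have Kc: "category K" unfolding is_terminal_cat_def by blast
  have "locally_small K" unfolding locally_small_def using Kc small_singleton[OF univ] by (simp add: K_def)
  then interpret K: universe_cat K using Kc univ by unfold_locales
  have "is_initial (presheaves K) empty_psh"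
    unfolding is_initial_def
  proof (intro conjI ballI)
    fix G
    have "f = (\<lambda>a\<in>Obj K. \<lambda>x\<in>{}. undefined)" if "f \<in> pnat K empty_psh G" for f
      by (rule pnat_ext[OF that K.pnat_empty_psh]) simp
    then show "\<exists>!f. f \<in> Hom (presheaves K) empty_psh G" using K.pnat_empty_psh[of G] unfolding functor_cat_simps by blast
  qed (use presheaf_empty_psh[OF univ Kc] in simp)
  then have w: "(K, empty_psh) \<in> Phi_vee" unfolding Phi_vee_def Phi_empty_def using K by blast
  obtain t where t: "t \<in> Obj C" "\<And>y. y \<in> Obj C \<Longrightarrow> \<exists>!f. f \<in> Hom C y t" using ex_terminal by blast
  have Yt: "representable C t \<in> Obj small_psh.A" by (rule small_psh.representable_A[OF t(1)])
  define D :: "('u, 'u, ('o, 'u, 'u set, 'u \<Rightarrow> 'u) func, 'o \<Rightarrow> 'u \<Rightarrow> 'u) func"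
    where "D = \<lparr>fobj = (\<lambda>_. representable C t), farr = (\<lambda>_ _ _. Id small_psh.A (representable C t))\<rparr>"
  have D: "fobj D k = representable C t" "farr D k l u = Id small_psh.A (representable C t)" for k l u unfolding D_def by simp_all
  have I: "Id small_psh.A (representable C t) \<in> pnat C (representable C t) (representable C t)" using presheaves_id_in[OF presheaf_representable[OF t(1)]] by simp
  have fD: "is_functor K small_psh.A D"
    unfolding is_functor_def D
    using Yt small_psh.A.id_in[OF Yt] small_psh.A.id_left[OF small_psh.A.id_in[OF Yt] Yt Yt] by (metis)
  have "is_limit J small_psh.A (comp_func D D') (fobj D v) (\<lambda>j. farr D v (fobj D' j) (p j))"
    if D': "is_functor J K D'" for J :: "(nat, nat) cat" and D' v p
  proof -
    have cD: "is_functor J small_psh.A (comp_func D D')" using D' fD unfolding is_functor_def comp_func_def by simp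
    show ?thesis
      unfolding small_psh.is_limit_A_iff[OF cD] small_psh.pointwise_limit_def
    proof (intro conjI ballI allI impI, goal_cases)
      case 1 then show ?case using Yt D by simp
    next
      case (2 j) then show ?case using I D by (simp add: comp_func_def)
    next
      case (3 i j u a x) then show ?case using t(1) D by (simp add: comp_func_def)
    next
      case (4 a y)
      have y: "y j \<in> Hom C a t" if "j \<in> Obj J" for j using 4 that by (auto simp: comp_func_def D)
      obtain f where f: "f \<in> Hom C a t" "\<And>g. g \<in> Hom C a t \<Longrightarrow> g = f" using t(2)[OF 4(1)] by blast
      have "y j = f" if "j \<in> Obj J" for j using f(2)[OF y[OF that]] .
      moreover have "f \<in> fobj (fobj D v) a" using f(1) 4(1) by (simp add: D)
      moreover have "z = f" if "z \<in> fobj (fobj D v) a" for z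
        using f(2)[of z] that 4(1) by (simp add: D)
      moreover have "farr D v (fobj D' j) (p j) a f = f" for j using f(1) 4(1) by (simp add: D)
      ultimately show ?case by blast
    qed
  qed
  then have lex: "lex_functor K (small_presheaves C) D" unfolding lex_functor_def preserves_finite_limits_def small_presheaves_eq using fD by blast
  have sub: "fobj D ` Obj K \<subseteq> T" using T t(1) unfolding lex_closed_def D by blast
  have e: "empty_psh \<in> Obj small_psh.A" using presheaf_empty_psh[OF univ category] small_presheaf_empty_psh by simp
  have "\<exists>!h. h \<in> Hom small_psh.A empty_psh Y" for Y
  proof -
    have "f = (\<lambda>a\<in>Obj C. \<lambda>x\<in>{}. undefined)" if "f \<in> pnat C empty_psh Y" for f
      by (rule pnat_ext[OF that pnat_empty_psh]) simp
    then show ?thesis using pnat_empty_psh[of Y] unfolding full_subcat_simps(2) functor_cat_simps(2) by blast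
  qed
  then have wc: "is_weighted_colimit K (small_presheaves C) empty_psh D empty_psh (\<lambda>_ _. undefined)"
    unfolding is_weighted_colimit_def weighted_cocone_def small_presheaves_eq using e by simp
  have all: "\<forall>(K, \<phi>)\<in>(Phi_vee :: 'u weight set). \<forall>D P \<xi>. lex_functor K (small_presheaves C) D \<and> fobj D ` Obj K \<subseteq> T \<and>
        is_weighted_colimit K (small_presheaves C) \<phi> D P \<xi> \<longrightarrow> P \<in> T"
    using T unfolding lex_closed_def by (elim conjE)
  show ?thesis using bspec[OF all w] lex sub wc by blast
qed

text \<open>The constructed free category has a lex functor to \<open>C\<close>, of whatever size,
  that picks out the given monomorphisms. Followed by the Yoneda embedding it is a lex diagram of
  representables, and its colimit is the union.\<close>

lemma lex_closed_union_rep: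
  assumes T: "lex_closed Phi_vee C T" and fc: "finitely_complete C"
    and a: "is_mono C A c a" "is_mono C B c b" and o: "A \<in> Obj C" "B \<in> Obj C" "c \<in> Obj C"
  shows "union_rep A B c a b \<in> T"
proof -
  obtain e1 :: "(bool \<times> bool) list \<Rightarrow> 'u" and d1 and e2 :: "nat list \<Rightarrow> 'u" and d2
    where enc: "struct_enc e1 d1 e2 d2" and free: "is_free_lex_on_monos (struct_enc.K e1 d1 e2 d2) (struct_enc.gX e1 e2)"
    using ex_free_lex_on_monos[OF univ] by blast
  interpret E: struct_enc e1 d1 e2 d2 by (rule enc)
  have K: "small_cat E.K" "finitely_complete E.K" using free unfolding is_free_lex_on_monos_def by auto
  interpret K: locally_small_cat E.K using K E.category_K unfolding small_cat_def by unfold_locales auto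
  note un = K.is_union_representables[OF E.is_mono_gens E.gens_in]
  let ?\<phi> = "K.union_rep E.gA E.gB E.gC (E.pt 0) (E.pt 0)"
  have w: "(E.K, ?\<phi>) \<in> Phi_vee"
    unfolding Phi_vee_def Phi_binary_def using free un by blast
  obtain F where F: "lex_functor E.K C F" "fobj F E.gA = A" "fobj F E.gB = B" "fobj F E.gC = c"
    "farr F E.gA E.gC (E.pt 0) = a" "farr F E.gB E.gC (E.pt 0) = b"
    by (rule E.ex_free_functor[OF category fc a o])
  let ?D = "comp_func (yoneda C) F"
  have "lex_functor C small_psh.A (yoneda C)" unfolding lex_functor_def using small_psh.is_functor_yoneda small_psh.preserves_finite_limits_yoneda by blast
  then have lex: "lex_functor E.K (small_presheaves C) ?D" unfolding small_presheaves_eq by (rule lex_functor_comp[OF F(1)])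
  have Fob: "fobj F k \<in> Obj C" if "k \<in> Obj E.K" for k using F(1) that unfolding lex_functor_def is_functor_def by blast
  have sub: "fobj ?D ` Obj E.K \<subseteq> T" using T Fob unfolding lex_closed_def by (auto simp: comp_func_def)
  have D: "fobj ?D E.gA = representable C A" "fobj ?D E.gB = representable C B" "fobj ?D E.gC = representable C c"
    "farr ?D E.gA E.gC (E.pt 0) = yoneda_arr C A c a" "farr ?D E.gB E.gC (E.pt 0) = yoneda_arr C B c b"
    by (simp_all add: comp_func_def F)
  note wc = binary_weighted_colimit(3)[OF K E.gens_in E.is_mono_gens un lex, unfolded D]
  have all: "\<forall>(K, \<phi>)\<in>(Phi_vee :: 'u weight set). \<forall>D P \<xi>. lex_functor K (small_presheaves C) D \<and> fobj D ` Obj K \<subseteq> T \<and>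
        is_weighted_colimit K (small_presheaves C) \<phi> D P \<xi> \<longrightarrow> P \<in> T"
    using T unfolding lex_closed_def by (elim conjE)
  show ?thesis using bspec[OF all w] lex sub wc by blast
qed

end

section \<open>Consequences of a left adjoint to the Yoneda embedding\<close>

context presheaf_subcat
begin

context
  fixes L \<eta> \<epsilon>
  assumes adj: "adjunction A C L (yoneda C) \<eta> \<epsilon>"
begin

lemma adjunctionD:
  shows "is_functor A C L"
    and "\<And>P. P \<in> Obj A \<Longrightarrow> fobj L P \<in> Obj C"
    and "\<And>P. P \<in> Obj A \<Longrightarrow> \<eta> P \<in> pnat C P (representable C (fobj L P))"
    and "\<And>P Q \<theta>. \<lbrakk>P \<in> Obj A; Q \<in> Obj A; \<theta> \<in> pnat C P Q\<rbrakk> \<Longrightarrow> farr L P Q \<theta> \<in> Hom C (fobj L P) (fobj L Q)"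
    and "\<And>d. d \<in> Obj C \<Longrightarrow> \<epsilon> d \<in> Hom C (fobj L (representable C d)) d"
proof -
  show f: "is_functor A C L" using adj unfolding adjunction_def by blast
  show "fobj L P \<in> Obj C" if "P \<in> Obj A" for P using f that unfolding is_functor_def by blast
  show "farr L P Q \<theta> \<in> Hom C (fobj L P) (fobj L Q)" if "P \<in> Obj A" "Q \<in> Obj A" "\<theta> \<in> pnat C P Q" for P Q \<theta>
    using f that unfolding is_functor_def by simp
  have n: "\<eta> \<in> nat_trans A A id_func (comp_func (yoneda C) L)" "\<epsilon> \<in> nat_trans C C (comp_func L (yoneda C)) id_func"
    using adj unfolding adjunction_def by blast+
  show "\<eta> P \<in> pnat C P (representable C (fobj L P))" if "P \<in> Obj A" for P
    using n(1) that unfolding nat_trans_def[of A] by (auto simp: id_func_def comp_func_def dest: PiE_mem)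
  show "\<epsilon> d \<in> Hom C (fobj L (representable C d)) d" if "d \<in> Obj C" for d
    using n(2) that unfolding nat_trans_def[of C C] by (auto simp: id_func_def comp_func_def dest: PiE_mem)
qed

lemma adj_unit_in: "\<lbrakk>P \<in> Obj A; x \<in> Obj C; p \<in> fobj P x\<rbrakk> \<Longrightarrow> \<eta> P x p \<in> Hom C x (fobj L P)"
  using pnat_in[OF adjunctionD(3)] by simp

lemma adj_unit_natural:
  assumes P: "P \<in> Obj A" "Q \<in> Obj A" and \<theta>: "\<theta> \<in> pnat C P Q" and x: "x \<in> Obj C" "p \<in> fobj P x"
  shows "Comp C x (fobj L P) (fobj L Q) (farr L P Q \<theta>) (\<eta> P x p) = \<eta> Q x (\<theta> x p)"
proof -
  have "\<eta> \<in> nat_trans A A id_func (comp_func (yoneda C) L)" using adj unfolding adjunction_def by blast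
  then have "Comp A P (representable C (fobj L P)) (representable C (fobj L Q)) (yoneda_arr C (fobj L P) (fobj L Q) (farr L P Q \<theta>)) (\<eta> P)
      = Comp A P Q (representable C (fobj L Q)) (\<eta> Q) \<theta>"
    using P \<theta> unfolding nat_trans_def[of A] by (auto simp: id_func_def comp_func_def)
  from this[THEN fun_cong, of x, THEN fun_cong, of p] show ?thesis
    using x adj_unit_in[OF P(1) x] by simp
qed

lemma adj_counit_natural:
  assumes b: "b \<in> Obj C" "b' \<in> Obj C" and f: "f \<in> Hom C b b'"
  shows "Comp C (fobj L (representable C b)) b b' f (\<epsilon> b) =
    Comp C (fobj L (representable C b)) (fobj L (representable C b')) b' (\<epsilon> b') (farr L (representable C b) (representable C b') (yoneda_arr C b b' f))"
proof -
  have "\<epsilon> \<in> nat_trans C C (comp_func L (yoneda C)) id_func" using adj unfolding adjunction_def by blast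
  then show ?thesis using b f unfolding nat_trans_def[of C C] by (auto simp: id_func_def comp_func_def)
qed

lemma adj_triangle1:
  assumes P: "P \<in> Obj A"
  shows "Comp C (fobj L P) (fobj L (representable C (fobj L P))) (fobj L P) (\<epsilon> (fobj L P)) (farr L P (representable C (fobj L P)) (\<eta> P)) = Id C (fobj L P)"
  using adj P unfolding adjunction_def Let_def yoneda_simps by blast

lemma adj_triangle2:
  assumes b: "b \<in> Obj C" and x: "x \<in> Obj C" "g \<in> Hom C x b"
  shows "Comp C x (fobj L (representable C b)) b (\<epsilon> b) (\<eta> (representable C b) x g) = g"
proof -
  have "Comp A (representable C b) (representable C (fobj L (representable C b))) (representable C b)
      (yoneda_arr C (fobj L (representable C b)) b (\<epsilon> b)) (\<eta> (representable C b)) = Id A (representable C b)"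
    using adj b unfolding adjunction_def Let_def yoneda_simps by blast
  from this[THEN fun_cong, of x, THEN fun_cong, of g] show ?thesis
    using x adj_unit_in[OF representable_A[OF b], of x g] by simp
qed

lemma adj_reflection:
  assumes P: "P \<in> Obj A"
  shows "reflection P (fobj L P) (\<eta> P)"
  unfolding reflection_def
proof (intro conjI ballI)
  have P': "presheaf C P" using P by simp
  note LP = adjunctionD(2)[OF P] and \<eta>P = adjunctionD(3)[OF P]
  show "fobj L P \<in> Obj C" "\<eta> P \<in> pnat C P (representable C (fobj L P))" by fact+
  fix d \<theta> assume d: "d \<in> Obj C" and \<theta>: "\<theta> \<in> pnat C P (representable C d)"
  let ?Y = "representable C"
  note Yd = representable_A[OF d] and YLP = representable_A[OF LP]
  note LYd = adjunctionD(2)[OF Yd] and LYLP = adjunctionD(2)[OF YLP]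
  note L\<theta> = adjunctionD(4)[OF P Yd \<theta>] and \<epsilon>d = adjunctionD(5)[OF d] and \<epsilon>LP = adjunctionD(5)[OF LP]
  note L\<eta> = adjunctionD(4)[OF P YLP \<eta>P]
  let ?k = "Comp C (fobj L P) (fobj L (?Y d)) d (\<epsilon> d) (farr L P (?Y d) \<theta>)"
  show "\<exists>!k. k \<in> Hom C (fobj L P) d \<and> (\<forall>x\<in>Obj C. \<forall>p\<in>fobj P x. Comp C x (fobj L P) d k (\<eta> P x p) = \<theta> x p)"
  proof (rule ex1I[of _ ?k])
    have "Comp C x (fobj L P) d ?k (\<eta> P x p) = \<theta> x p" if x: "x \<in> Obj C" "p \<in> fobj P x" for x p
      using assoc[OF adj_unit_in[OF P x] L\<theta> \<epsilon>d x(1) LP LYd d] adj_unit_natural[OF P Yd \<theta> x] adj_triangle2[OF d x(1), of "\<theta> x p"]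
        pnat_in[OF \<theta> x(2,1)] by simp
    then show "?k \<in> Hom C (fobj L P) d \<and> (\<forall>x\<in>Obj C. \<forall>p\<in>fobj P x. Comp C x (fobj L P) d ?k (\<eta> P x p) = \<theta> x p)"
      using L\<theta> \<epsilon>d LP LYd d by simp
    fix k assume k: "k \<in> Hom C (fobj L P) d \<and> (\<forall>x\<in>Obj C. \<forall>p\<in>fobj P x. Comp C x (fobj L P) d k (\<eta> P x p) = \<theta> x p)"
    then have kin: "k \<in> Hom C (fobj L P) d" by blast
    note Yk = yoneda_arr_in[OF kin LP d]
    note LYk = adjunctionD(4)[OF YLP Yd Yk]
    have \<theta>e: "Comp A P (?Y (fobj L P)) (?Y d) (yoneda_arr C (fobj L P) d k) (\<eta> P) = \<theta>"
      by (rule pnat_ext[OF A_comp_in[OF \<eta>P Yk P'] \<theta>]) (use k adj_unit_in[OF P] in simp)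
    have "\<eta> P \<in> Hom A P (?Y (fobj L P))" "yoneda_arr C (fobj L P) d k \<in> Hom A (?Y (fobj L P)) (?Y d)" using \<eta>P Yk by simp_all
    then have Lc: "farr L P (?Y d) \<theta> = Comp C (fobj L P) (fobj L (?Y (fobj L P))) (fobj L (?Y d)) (farr L (?Y (fobj L P)) (?Y d) (yoneda_arr C (fobj L P) d k)) (farr L P (?Y (fobj L P)) (\<eta> P))"
      using adjunctionD(1) P YLP Yd unfolding is_functor_def \<theta>e[symmetric] by blast
    have "?k = Comp C (fobj L P) (fobj L (?Y (fobj L P))) d (Comp C (fobj L (?Y (fobj L P))) (fobj L (?Y d)) d (\<epsilon> d) (farr L (?Y (fobj L P)) (?Y d) (yoneda_arr C (fobj L P) d k))) (farr L P (?Y (fobj L P)) (\<eta> P))"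
      unfolding Lc by (rule assoc[OF L\<eta> LYk \<epsilon>d LP LYLP LYd d, symmetric])
    also have "\<dots> = Comp C (fobj L P) (fobj L (?Y (fobj L P))) d (Comp C (fobj L (?Y (fobj L P))) (fobj L P) d k (\<epsilon> (fobj L P))) (farr L P (?Y (fobj L P)) (\<eta> P))"
      unfolding adj_counit_natural[OF LP d kin] ..
    also have "\<dots> = k"
      using assoc[OF L\<eta> \<epsilon>LP kin LP LYLP LP d] adj_triangle1[OF P] kin LP d by simp
    finally show "k = ?k" ..
  qed
qed

text \<open>By a triangle identity the counit is a left inverse. It is also a right inverse because
  the Yoneda embedding is full: the unit at a representable is composition with an arrow
  \<open>m\<close>, and \<open>m\<close> is the arrow in question since the two agree after the unit
  at \<open>P\<close>.\<close>

lemma adj_unit_inverted: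
  assumes P: "P \<in> Obj A"
  shows "is_iso C (fobj L P) (fobj L (representable C (fobj L P))) (farr L P (representable C (fobj L P)) (\<eta> P))"
proof -
  have P': "presheaf C P" using P by simp
  note LP = adjunctionD(2)[OF P] and \<eta>P = adjunctionD(3)[OF P]
  let ?Y = "representable C (fobj L P)"
  note YLP = representable_A[OF LP]
  have YLP': "presheaf C ?Y" by (rule presheaf_representable[OF LP])
  note LYLP = adjunctionD(2)[OF YLP] and \<epsilon>LP = adjunctionD(5)[OF LP]
  note L\<eta> = adjunctionD(4)[OF P YLP \<eta>P]
  define m where "m = \<eta> ?Y (fobj L P) (Id C (fobj L P))"
  have m: "m \<in> Hom C (fobj L P) (fobj L ?Y)" unfolding m_def using adj_unit_in[OF YLP LP] LP by simp
  have m\<eta>: "\<eta> ?Y x g = Comp C x (fobj L P) (fobj L ?Y) m g" if "x \<in> Obj C" "g \<in> Hom C x (fobj L P)" for x g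
    using pnat_representable_apply[OF adjunctionD(3)[OF YLP] LP that] m unfolding m_def by simp
  have mL: "m = farr L P ?Y (\<eta> P)"
  proof (rule reflection_ext[OF adj_reflection[OF P] LYLP m L\<eta> P'])
    fix x p assume x: "x \<in> Obj C" "p \<in> fobj P x"
    show "Comp C x (fobj L P) (fobj L ?Y) m (\<eta> P x p) = Comp C x (fobj L P) (fobj L ?Y) (farr L P ?Y (\<eta> P)) (\<eta> P x p)"
      using m\<eta>[OF x(1) adj_unit_in[OF P x]] adj_unit_natural[OF P YLP \<eta>P x] by simp
  qed
  have "Comp C (fobj L ?Y) (fobj L P) (fobj L ?Y) m (\<epsilon> (fobj L P)) = Id C (fobj L ?Y)"
  proof (rule reflection_ext[OF adj_reflection[OF YLP] LYLP _ id_in[OF LYLP] YLP'])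
    show "Comp C (fobj L ?Y) (fobj L P) (fobj L ?Y) m (\<epsilon> (fobj L P)) \<in> Hom C (fobj L ?Y) (fobj L ?Y)" using m \<epsilon>LP LP LYLP by simp
    fix x g assume x: "x \<in> Obj C" "g \<in> fobj ?Y x"
    then have g: "g \<in> Hom C x (fobj L P)" by simp
    show "Comp C x (fobj L ?Y) (fobj L ?Y) (Comp C (fobj L ?Y) (fobj L P) (fobj L ?Y) m (\<epsilon> (fobj L P))) (\<eta> ?Y x g) =
      Comp C x (fobj L ?Y) (fobj L ?Y) (Id C (fobj L ?Y)) (\<eta> ?Y x g)"
      using assoc[OF adj_unit_in[OF YLP x] \<epsilon>LP m x(1) LYLP LP LYLP] adj_triangle2[OF LP x(1) g] m\<eta>[OF x(1) g] adj_unit_in[OF YLP x] x LYLP by simp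
  qed
  then show ?thesis using adj_triangle1[OF P] L\<eta> \<epsilon>LP unfolding mL is_iso_def by blast
qed

text \<open>Under the adjunction, arrows from \<open>P\<close> and from the representable of
  \<open>X\<close> to a representable correspond to arrows out of their images under
  \<open>L\<close>. Hence they cannot tell the two apart once \<open>L\<close> inverts
  \<open>\<theta>\<close>.\<close>

lemma inverted_reflection:
  assumes P: "P \<in> Obj A" and X: "X \<in> Obj C" and \<theta>: "\<theta> \<in> pnat C P (representable C X)"
    and iso: "is_iso C (fobj L P) (fobj L (representable C X)) (farr L P (representable C X) \<theta>)"
  shows "reflection P X \<theta>"
  unfolding reflection_def
proof (intro conjI ballI X \<theta>)
  have P': "presheaf C P" using P by simp
  let ?Y = "representable C X" and ?t = "farr L P (representable C X) \<theta>"
  note YX = representable_A[OF X]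
  note LP = adjunctionD(2)[OF P] and LY = adjunctionD(2)[OF YX] and \<epsilon>X = adjunctionD(5)[OF X]
  obtain r where t: "?t \<in> Hom C (fobj L P) (fobj L ?Y)" and r: "r \<in> Hom C (fobj L ?Y) (fobj L P)"
    and e: "Comp C (fobj L P) (fobj L ?Y) (fobj L P) r ?t = Id C (fobj L P)" "Comp C (fobj L ?Y) (fobj L P) (fobj L ?Y) ?t r = Id C (fobj L ?Y)"
    using iso by (rule is_iso_inverse)
  define h where "h = \<eta> ?Y X (Id C X)"
  have h: "h \<in> Hom C X (fobj L ?Y)" unfolding h_def using adj_unit_in[OF YX X] X by simp
  have h\<eta>: "\<eta> ?Y x g = Comp C x X (fobj L ?Y) h g" if "x \<in> Obj C" "g \<in> Hom C x X" for x g
    using pnat_representable_apply[OF adjunctionD(3)[OF YX] X that] h unfolding h_def by simp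
  have \<epsilon>h: "Comp C X (fobj L ?Y) X (\<epsilon> X) h = Id C X" unfolding h_def by (rule adj_triangle2[OF X X id_in[OF X]])
  have \<theta>in: "\<theta> x p \<in> Hom C x X" if "x \<in> Obj C" "p \<in> fobj P x" for x p using pnat_in[OF \<theta> that(2,1)] by simp
  fix d \<alpha> assume d: "d \<in> Obj C" and \<alpha>: "\<alpha> \<in> pnat C P (representable C d)"
  note k = mediator[OF adj_reflection[OF P] d \<alpha>]
  let ?k = "mediator P (fobj L P) (\<eta> P) d \<alpha>"
  \<comment> \<open>From \<open>X\<close> one passes by the unit at its representable to
    \<open>fobj L ?Y\<close>, then by the inverse of the inverted arrow to \<open>fobj L P\<close>,
    where \<open>\<alpha>\<close> factors through the unit at \<open>P\<close>.\<close>
  let ?l = "Comp C X (fobj L P) d ?k (Comp C X (fobj L ?Y) (fobj L P) r h)"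
  show "\<exists>!l. l \<in> Hom C X d \<and> (\<forall>x\<in>Obj C. \<forall>p\<in>fobj P x. Comp C x X d l (\<theta> x p) = \<alpha> x p)"
  proof (rule ex1I[of _ ?l])
    have "Comp C x X d ?l (\<theta> x p) = \<alpha> x p" if x: "x \<in> Obj C" "p \<in> fobj P x" for x p
    proof -
      have 1: "Comp C x X (fobj L ?Y) h (\<theta> x p) = Comp C x (fobj L P) (fobj L ?Y) ?t (\<eta> P x p)"
        using h\<eta>[OF x(1) \<theta>in[OF x]] adj_unit_natural[OF P YX \<theta> x] by simp
      have "Comp C x X d ?l (\<theta> x p) = Comp C x (fobj L P) d ?k (Comp C x (fobj L ?Y) (fobj L P) r (Comp C x X (fobj L ?Y) h (\<theta> x p)))"
        using \<theta>in[OF x] h r k(1) x(1) X LP LY d by (simp add: assoc)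
      also have "\<dots> = Comp C x (fobj L P) d ?k (\<eta> P x p)"
        unfolding 1 slide1[OF e(1) adj_unit_in[OF P x] t r x(1) LP LY LP] using adj_unit_in[OF P x] x LP by simp
      finally show ?thesis using k(2)[OF x] by simp
    qed
    then show "?l \<in> Hom C X d \<and> (\<forall>x\<in>Obj C. \<forall>p\<in>fobj P x. Comp C x X d ?l (\<theta> x p) = \<alpha> x p)"
      using h r k(1) X LP LY d by simp
    fix l assume l: "l \<in> Hom C X d \<and> (\<forall>x\<in>Obj C. \<forall>p\<in>fobj P x. Comp C x X d l (\<theta> x p) = \<alpha> x p)"
    then have lin: "l \<in> Hom C X d" by blast
    have l\<epsilon>: "Comp C (fobj L ?Y) X d l (\<epsilon> X) \<in> Hom C (fobj L ?Y) d" using lin \<epsilon>X X LY d by simp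
    have "Comp C (fobj L P) (fobj L ?Y) d (Comp C (fobj L ?Y) X d l (\<epsilon> X)) ?t = ?k"
    proof (rule reflection_ext[OF adj_reflection[OF P] d _ k(1) P'])
      show "Comp C (fobj L P) (fobj L ?Y) d (Comp C (fobj L ?Y) X d l (\<epsilon> X)) ?t \<in> Hom C (fobj L P) d" using l\<epsilon> t LP LY d by simp
      fix x p assume x: "x \<in> Obj C" "p \<in> fobj P x"
      have "Comp C x (fobj L P) d (Comp C (fobj L P) (fobj L ?Y) d (Comp C (fobj L ?Y) X d l (\<epsilon> X)) ?t) (\<eta> P x p)
        = Comp C x X d l (Comp C x (fobj L ?Y) X (\<epsilon> X) (Comp C x (fobj L P) (fobj L ?Y) ?t (\<eta> P x p)))"
        using adj_unit_in[OF P x] t \<epsilon>X lin x(1) X LP LY d by (simp add: assoc)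
      also have "\<dots> = \<alpha> x p"
        unfolding adj_unit_natural[OF P YX \<theta> x] adj_triangle2[OF X x(1) \<theta>in[OF x]] using l x by blast
      finally show "Comp C x (fobj L P) d (Comp C (fobj L P) (fobj L ?Y) d (Comp C (fobj L ?Y) X d l (\<epsilon> X)) ?t) (\<eta> P x p) = Comp C x (fobj L P) d ?k (\<eta> P x p)"
        using k(2)[OF x] by simp
    qed
    then have "?l = Comp C X (fobj L P) d (Comp C (fobj L P) (fobj L ?Y) d (Comp C (fobj L ?Y) X d l (\<epsilon> X)) ?t) (Comp C X (fobj L ?Y) (fobj L P) r h)" by simp
    also have "\<dots> = Comp C X (fobj L ?Y) d (Comp C (fobj L ?Y) X d l (\<epsilon> X)) (Comp C X (fobj L P) (fobj L ?Y) ?t (Comp C X (fobj L ?Y) (fobj L P) r h))"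
      by (rule assoc[OF _ t l\<epsilon> X LP LY d]) (use h r X LP LY in simp)
    also have "\<dots> = Comp C X (fobj L ?Y) d (Comp C (fobj L ?Y) X d l (\<epsilon> X)) h"
      unfolding slide1[OF e(2) h r t X LY LP LY] using h X LY by simp
    also have "\<dots> = l" using assoc[OF h \<epsilon>X lin X LY X d] \<epsilon>h lin X d by simp
    finally show "l = ?l" ..
  qed
qed

text \<open>The hypotheses \<open>e\<close>, \<open>ex\<close> and \<open>inj\<close> say
  elementwise that \<open>Q\<close> is the pullback of the unit at \<open>P\<close> along
  \<open>f\<close>. So \<open>L\<close> sends \<open>\<theta>\<close> to a pullback of an
  isomorphism.\<close>

lemma pulled_back_reflection:
  assumes lexL: "preserves_finite_limits A C L" and P: "P \<in> Obj A" and Q: "Q \<in> Obj A" and X: "X \<in> Obj C"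
    and f: "f \<in> Hom C X (fobj L P)" and \<theta>: "\<theta> \<in> pnat C Q (representable C X)" and h: "h \<in> pnat C Q P"
    and e: "\<And>x q. \<lbrakk>x \<in> Obj C; q \<in> fobj Q x\<rbrakk> \<Longrightarrow> \<eta> P x (h x q) = Comp C x X (fobj L P) f (\<theta> x q)"
    and ex: "\<And>x p g. \<lbrakk>x \<in> Obj C; p \<in> fobj P x; g \<in> Hom C x X; \<eta> P x p = Comp C x X (fobj L P) f g\<rbrakk> \<Longrightarrow>
      \<exists>q\<in>fobj Q x. h x q = p \<and> \<theta> x q = g"
    and inj: "\<And>x q q'. \<lbrakk>x \<in> Obj C; q \<in> fobj Q x; q' \<in> fobj Q x; \<theta> x q = \<theta> x q'\<rbrakk> \<Longrightarrow> q = q'"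
  shows "reflection Q X \<theta>"
proof -
  note LP = adjunctionD(2)[OF P]
  have \<theta>in: "\<theta> x q \<in> Hom C x X" if "x \<in> Obj C" "q \<in> fobj Q x" for x q using pnat_in[OF \<theta> that(2,1)] by simp
  have "is_pullback A Q P (representable C X) (representable C (fobj L P)) h \<theta> (\<eta> P) (yoneda_arr C X (fobj L P) f)"
  proof (rule is_pullback_AI[OF _ h \<theta> adjunctionD(3)[OF P] yoneda_arr_in[OF f X LP]])
    show "{Q, P, representable C X, representable C (fobj L P)} \<subseteq> Obj A"
      using P Q representable_A[OF X] representable_A[OF LP] by blast
    show "\<eta> P x (h x q) = yoneda_arr C X (fobj L P) f x (\<theta> x q)" if "x \<in> Obj C" "q \<in> fobj Q x" for x q
      using e[OF that] \<theta>in[OF that] that(1) by simp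
    show "\<exists>q\<in>fobj Q x. h x q = p \<and> \<theta> x q = g" if "x \<in> Obj C" "p \<in> fobj P x" "g \<in> fobj (representable C X) x"
       "\<eta> P x p = yoneda_arr C X (fobj L P) f x g" for x p g
      using ex[OF that(1,2), of g] that by simp
    show "q = q'" if "x \<in> Obj C" "q \<in> fobj Q x" "q' \<in> fobj Q x" "h x q = h x q'" "\<theta> x q = \<theta> x q'" for x q q'
      using inj that by blast
  qed
  from is_iso_pullback[OF preserves_pullback[OF adjunctionD(1) lexL category_A category this] adj_unit_inverted[OF P]]
  show ?thesis by (rule inverted_reflection[OF Q X \<theta>])
qed

end

end

section \<open>A strict initial object and stable pushouts from exactness\<close>

lemma (in universe_cat) exact_imp_stable_pushouts:
  assumes "lex_exact Phi_vee C"
  shows "(\<exists>z. is_strict_initial C z) \<and> has_stable_pushouts_of_pullbacks_of_monos C"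
proof -
  have fc: "finitely_complete C" using assms unfolding lex_exact_def by blast
  interpret finlim_cat C by unfold_locales fact
  define S where "S = small_psh \<inter> \<Inter> {S. lex_closed Phi_vee C S}"
  have Phi: "Phi_l Phi_vee C = full_subcat (presheaves C) S"
    unfolding Phi_l_def small_presheaves_eq full_subcat_full_subcat S_def ..
  have "representable C c \<in> S" if "c \<in> Obj C" for c
    unfolding S_def using that small_presheaf_representable unfolding lex_closed_def by blast
  then interpret S: presheaf_subcat C S by unfold_locales
  have SI: "P \<in> S" if "\<And>T. lex_closed Phi_vee C T \<Longrightarrow> P \<in> T" "small_presheaf C P" for P
    unfolding S_def using that by blast
  obtain L \<eta> \<epsilon> where adj: "adjunction S.A C L (yoneda C) \<eta> \<epsilon>" and lexL: "preserves_finite_limits S.A C L"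
    using assms unfolding lex_exact_def Phi by blast
  note refl = S.adj_reflection[OF adj] note Lob = S.adjunctionD(2)[OF adj] note \<eta>in = S.adj_unit_in[OF adj]
  have e: "empty_psh \<in> Obj S.A"
    using presheaf_empty_psh[OF univ category] SI[OF lex_closed_empty_psh[OF _ fc] small_presheaf_empty_psh] by simp
  have initial: "is_initial C x" if r: "S.reflection empty_psh x \<theta>" for x \<theta>
    unfolding is_initial_def
  proof (intro conjI ballI S.reflectionD(1)[OF r])
    fix d assume d: "d \<in> Obj C"
    have "\<exists>!k. k \<in> Hom C x d \<and> (\<forall>y\<in>Obj C. \<forall>p\<in>fobj empty_psh y. Comp C y x d k (\<theta> y p) = (\<lambda>a\<in>Obj C. \<lambda>x\<in>{}. undefined) y p)"
      using r d pnat_empty_psh[of "representable C d"] unfolding S.reflection_def by blast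
    then show "\<exists>!f. f \<in> Hom C x d" by simp
  qed
  let ?z = "fobj L empty_psh"
  have z: "is_initial C ?z" by (rule initial[OF refl[OF e]])
  have "is_iso C x ?z f" if x: "x \<in> Obj C" "f \<in> Hom C x ?z" for x f
  proof -
    \<comment> \<open>Over any \<open>f\<close> the pullback of the empty presheaf is empty, so
      \<open>x\<close> reflects the empty presheaf as well and is initial.\<close>
    have "S.reflection empty_psh x (\<lambda>a\<in>Obj C. \<lambda>x\<in>{}. undefined)"
      by (rule S.pulled_back_reflection[OF adj lexL e e x pnat_empty_psh pnat_empty_psh]) simp_all
    then have x': "is_initial C x" by (rule initial)
    have "?z \<in> Obj C" by (rule Lob[OF e])
    then obtain g where g: "g \<in> Hom C ?z x" using z x(1) unfolding is_initial_def by blast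
    have "Comp C x ?z x g f = Id C x"
      by (rule is_initial_hom_eq[OF x', where y = x]) (use g x \<open>?z \<in> Obj C\<close> in auto)
    moreover have "Comp C ?z x ?z f g = Id C ?z"
      by (rule is_initial_hom_eq[OF z, where y = ?z]) (use g x \<open>?z \<in> Obj C\<close> in auto)
    ultimately show ?thesis using g x unfolding is_iso_def by blast
  qed
  then have "is_strict_initial C ?z" using z unfolding is_strict_initial_def by blast
  moreover have "has_stable_pushouts_of_pullbacks_of_monos C"
    unfolding has_stable_pushouts_of_pullbacks_of_monos_def
  proof (intro ballI allI impI, elim conjE)
    have US: "union_rep A B c a b \<in> Obj S.A"
      if a: "is_mono C A c a" "is_mono C B c b" and o: "A \<in> Obj C" "B \<in> Obj C" "c \<in> Obj C" for A B c a b
    proof -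
      interpret M: mono_pair C "representable C c" "representable C A" "representable C B" "yoneda_arr C A c a" "yoneda_arr C B c b"
        by (rule mono_pair_representable[OF a o])
      obtain P p q where P: "is_pullback C P A B c p q a b" by (rule ex_pullback[OF is_mono_in[OF a(1)] is_mono_in[OF a(2)] o])
      note P1 = is_pullbackD[OF P]
      have "small_presheaf C M.U"
      proof (rule small_presheaf_union[OF M.mono_pair_axioms])
        show "small_presheaf C (representable C A)" "small_presheaf C (representable C B)" "small_presheaf C (representable C P)"
          using small_presheaf_representable P1 by blast+
        show "yoneda_arr C P A p \<in> pnat C (representable C P) (representable C A)" "yoneda_arr C P B q \<in> pnat C (representable C P) (representable C B)"
          using yoneda_arr_in P1 by blast+
        show "yoneda_arr C A c a x (yoneda_arr C P A p x h) = yoneda_arr C B c b x (yoneda_arr C P B q x h)"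
          if "x \<in> Obj C" "h \<in> fobj (representable C P) x" for x h
          using slide[OF P1(9), of h x] that P1 by simp
        show "\<exists>h\<in>fobj (representable C P) x. yoneda_arr C P A p x h = g \<and> yoneda_arr C P B q x h = g'"
          if x: "x \<in> Obj C" "g \<in> fobj (representable C A) x" "g' \<in> fobj (representable C B) x" "yoneda_arr C A c a x g = yoneda_arr C B c b x g'" for x g g'
        proof -
          have "g \<in> Hom C x A" "g' \<in> Hom C x B" "Comp C x A c a g = Comp C x B c b g'" using x by simp_all
          then obtain h where "h \<in> Hom C x P" "Comp C x P A p h = g" "Comp C x P B q h = g'" by (rule is_pullback_lift[OF P x(1)])
          then show ?thesis using x(1) by (intro bexI[of _ h]) simp_all
        qed
      qed
      then show ?thesis using SI[OF lex_closed_union_rep[OF _ fc a o]] M.presheaf_U by simp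
    qed
    fix A B c a b P p q
    assume o: "A \<in> Obj C" "B \<in> Obj C" "c \<in> Obj C" and a: "is_mono C A c a" "is_mono C B c b" and P: "is_pullback C P A B c p q a b"
    note ab = is_mono_in[OF a(1)] is_mono_in[OF a(2)]
    note P1 = is_pullbackD[OF P]
    interpret M: mono_pair C "representable C c" "representable C A" "representable C B" "yoneda_arr C A c a" "yoneda_arr C B c b"
      by (rule mono_pair_representable[OF a o])
    note U = US[OF a o]
    let ?Q = "fobj L M.U"
    note Q = Lob[OF U]
    have UA: "Comp C x A c a h \<in> fobj M.U x" if "x \<in> Obj C" "h \<in> Hom C x A" for x h using M.U_I1[of h x] that by simp
    have UB: "Comp C x B c b h \<in> fobj M.U x" if "x \<in> Obj C" "h \<in> Hom C x B" for x h using M.U_I2[of h x] that by simp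
    have Ucases: "(\<exists>h\<in>Hom C x A. u = Comp C x A c a h) \<or> (\<exists>h\<in>Hom C x B. u = Comp C x B c b h)" if "x \<in> Obj C" "u \<in> fobj M.U x" for x u
      using that(2) by (cases rule: M.U_cases) (use that(1) in auto)
    have Uc: "u \<in> Hom C x c" if "x \<in> Obj C" "u \<in> fobj M.U x" for x u using M.U_sub[OF that(1)] that(2) unfolding M.fobj_U by auto
    have aU: "a \<in> fobj M.U A" "b \<in> fobj M.U B" using UA[OF o(1) id_in[OF o(1)]] UB[OF o(2) id_in[OF o(2)]] ab o by simp_all
    define i where "i = \<eta> M.U A a"
    define j where "j = \<eta> M.U B b"
    have i: "i \<in> Hom C A ?Q" and j: "j \<in> Hom C B ?Q" unfolding i_def j_def using \<eta>in[OF U] aU o by blast+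
    have \<eta>nat: "\<eta> M.U y (Comp C y x c u h) = Comp C y x ?Q (\<eta> M.U x u) h" if "x \<in> Obj C" "y \<in> Obj C" "u \<in> fobj M.U x" "h \<in> Hom C y x" for x y u h
      using pnat_natural[OF S.adjunctionD(3)[OF adj U] that(3,4,1,2)] \<eta>in[OF U that(1,3)] M.farr_U[OF that(3)] Uc[OF that(1,3)] by simp
    have \<eta>a: "\<eta> M.U x (Comp C x A c a h) = Comp C x A ?Q i h" if "x \<in> Obj C" "h \<in> Hom C x A" for x h
      unfolding i_def by (rule \<eta>nat[OF o(1) that(1) aU(1) that(2)])
    have \<eta>b: "\<eta> M.U x (Comp C x B c b h) = Comp C x B ?Q j h" if "x \<in> Obj C" "h \<in> Hom C x B" for x h
      unfolding j_def by (rule \<eta>nat[OF o(2) that(1) aU(2) that(2)])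
    \<comment> \<open>The comparison of \<open>?Q\<close> with \<open>c\<close>. It recovers an
      element of the union from its image under the unit, so the unit is injective here.\<close>
    define m where "m = S.mediator M.U ?Q (\<eta> M.U) c (incl C (fobj M.U))"
    have m\<eta>: "Comp C x ?Q c m (\<eta> M.U x u) = u" if "x \<in> Obj C" "u \<in> fobj M.U x" for x u
      using S.mediator[OF refl[OF U] o(3) M.incl_U] incl_apply[of x C u "fobj M.U"] that unfolding m_def by simp
    have m: "m \<in> Hom C ?Q c" using S.mediator(1)[OF refl[OF U] o(3) M.incl_U] unfolding m_def .
    have mi: "Comp C A ?Q c m i = a" "Comp C B ?Q c m j = b" unfolding i_def j_def by (rule m\<eta>; use aU o in simp)+
    have imono: "is_mono C A ?Q i" "is_mono C B ?Q j"
      using is_mono_cancel[of A c ?Q m i] is_mono_cancel[of B c ?Q m j] a mi m i j Q o by simp_all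
    have "Comp C P A ?Q i p = Comp C P B ?Q j q" using \<eta>a[OF P1(1,5)] \<eta>b[OF P1(1,6)] P1(9) by simp
    from is_pullback_cancel[OF _ Q m i j this] have PQ: "is_pullback C P A B ?Q p q i j" using P mi by simp
    \<comment> \<open>Stated for every \<open>f\<close>, since the identity of \<open>?Q\<close>
      then gives the original pushout and the other cases its stability. The union of
      \<open>A'\<close> and \<open>B'\<close> in the representable of \<open>X\<close> is the
      pullback of the unit along \<open>f\<close>, so \<open>X\<close> is its reflection.\<close>
    have key: "is_pushout C P' A' B' X p' q' i' j'"
      if X: "X \<in> Obj C" "f \<in> Hom C X ?Q" and A': "is_pullback C A' A X ?Q pA i' i f" and B': "is_pullback C B' B X ?Q pB j' j f"
        and P': "is_pullback C P' P X ?Q pP d (Comp C P A ?Q i p) f"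
        and p': "p' \<in> Hom C P' A'" "Comp C P' A' A pA p' = Comp C P' P A p pP" "Comp C P' A' X i' p' = d"
        and q': "q' \<in> Hom C P' B'" "Comp C P' B' B pB q' = Comp C P' P B q pP" "Comp C P' B' X j' q' = d"
      for X f P' A' B' pP pA pB d i' j' p' q'
    proof -
      have PX: "is_pullback C P' A' B' X p' q' i' j'" by (rule is_pullback_cube[OF PQ A' B' P' p' q'])
      have mono': "is_mono C A' X i'" "is_mono C B' X j'" using is_pullback_mono[OF A' imono(1)] is_pullback_mono[OF B' imono(2)] .
      note A1 = is_pullbackD[OF A'] note B1 = is_pullbackD[OF B']
      interpret N: mono_pair C "representable C X" "representable C A'" "representable C B'" "yoneda_arr C A' X i'" "yoneda_arr C B' X j'"
        by (rule mono_pair_representable[OF mono' A1(1) B1(1) X(1)])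
      note V = US[OF mono' A1(1) B1(1) X(1)]
      have VA: "Comp C x A' X i' h \<in> fobj N.U x" if "x \<in> Obj C" "h \<in> Hom C x A'" for x h using N.U_I1[of h x] that by simp
      have VB: "Comp C x B' X j' h \<in> fobj N.U x" if "x \<in> Obj C" "h \<in> Hom C x B'" for x h using N.U_I2[of h x] that by simp
      have VX: "u \<in> Hom C x X" if "x \<in> Obj C" "u \<in> fobj N.U x" for x u using N.U_sub[OF that(1)] that(2) unfolding N.fobj_U by auto
      have Vf: "\<exists>u\<in>fobj M.U x. \<eta> M.U x u = Comp C x X ?Q f g" if x: "x \<in> Obj C" and g: "g \<in> fobj N.U x" for x g
        using g
      proof (cases rule: N.U_cases)
        case (1 h)
        then have h: "h \<in> Hom C x A'" "g = Comp C x A' X i' h" using x by simp_all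
        have "\<eta> M.U x (Comp C x A c a (Comp C x A' A pA h)) = Comp C x X ?Q f g"
          using \<eta>a[OF x, of "Comp C x A' A pA h"] slide[OF A1(9) h(1) A1(5,7,6,8) x A1(1-4)] h x A1 by simp
        moreover have "Comp C x A c a (Comp C x A' A pA h) \<in> fobj M.U x" by (rule UA[OF x]) (use h x A1 in simp)
        ultimately show ?thesis by blast
      next
        case (2 h)
        then have h: "h \<in> Hom C x B'" "g = Comp C x B' X j' h" using x by simp_all
        have "\<eta> M.U x (Comp C x B c b (Comp C x B' B pB h)) = Comp C x X ?Q f g"
          using \<eta>b[OF x, of "Comp C x B' B pB h"] slide[OF B1(9) h(1) B1(5,7,6,8) x B1(1-4)] h x B1 by simp
        moreover have "Comp C x B c b (Comp C x B' B pB h) \<in> fobj M.U x" by (rule UB[OF x]) (use h x B1 in simp)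
        ultimately show ?thesis by blast
      qed
      have mf: "Comp C x ?Q c m (Comp C x X ?Q f g) \<in> fobj M.U x" "\<eta> M.U x (Comp C x ?Q c m (Comp C x X ?Q f g)) = Comp C x X ?Q f g"
        if x: "x \<in> Obj C" and g: "g \<in> fobj N.U x" for x g
      proof -
        obtain u where u: "u \<in> fobj M.U x" "\<eta> M.U x u = Comp C x X ?Q f g" using Vf[OF x g] by blast
        have "Comp C x ?Q c m (Comp C x X ?Q f g) = u" using m\<eta>[OF x u(1)] u(2) by simp
        then show "Comp C x ?Q c m (Comp C x X ?Q f g) \<in> fobj M.U x" "\<eta> M.U x (Comp C x ?Q c m (Comp C x X ?Q f g)) = Comp C x X ?Q f g"
          using u by simp_all
      qed
      \<comment> \<open>The projection of the pullback to the first union: an arrow \<open>g\<close>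
        lies over the element whose image under the unit is \<open>f g\<close>, and \<open>m\<close>
        computes that element.\<close>
      have hn: "(\<lambda>x\<in>Obj C. \<lambda>g\<in>fobj N.U x. Comp C x ?Q c m (Comp C x X ?Q f g)) \<in> pnat C N.U M.U" (is "?h \<in> _")
      proof (rule pnatI[OF mf(1) _ N.presheaf_U])
        fix x y u g assume x: "x \<in> Obj C" "y \<in> Obj C" "u \<in> Hom C y x" "g \<in> fobj N.U x"
        show "farr M.U x y u (Comp C x ?Q c m (Comp C x X ?Q f g)) = Comp C y ?Q c m (Comp C y X ?Q f (farr N.U x y u g))"
          using M.farr_U[OF mf(1)[OF x(1,4)]] N.farr_U[OF x(4)] VX[OF x(1,4)] X m Q o x by (simp add: assoc)
      qed
      have r: "S.reflection N.U X (incl C (fobj N.U))"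
      proof (rule S.pulled_back_reflection[OF adj lexL U V X N.incl_U hn])
        show "\<eta> M.U x (?h x g) = Comp C x X ?Q f (incl C (fobj N.U) x g)" if "x \<in> Obj C" "g \<in> fobj N.U x" for x g
          using mf(2)[OF that] incl_apply[where V = "fobj N.U", OF that] that by simp
        show "g = g'" if "x \<in> Obj C" "g \<in> fobj N.U x" "g' \<in> fobj N.U x" "incl C (fobj N.U) x g = incl C (fobj N.U) x g'" for x g g'
          using that incl_apply[where V = "fobj N.U", OF that(1,2)] incl_apply[where V = "fobj N.U", OF that(1,3)] by simp
        fix x u g assume x: "x \<in> Obj C" "u \<in> fobj M.U x" "g \<in> Hom C x X" "\<eta> M.U x u = Comp C x X ?Q f g"
        have gV: "g \<in> fobj N.U x"
          using Ucases[OF x(1,2)]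
        proof (elim disjE bexE)
          fix k assume k: "k \<in> Hom C x A" "u = Comp C x A c a k"
          then have "Comp C x A ?Q i k = Comp C x X ?Q f g" using \<eta>a[OF x(1) k(1)] x(4) by simp
          then obtain l where "l \<in> Hom C x A'" "Comp C x A' X i' l = g" by (rule is_pullback_lift[OF A' x(1) k(1) x(3)])
          then show ?thesis using VA[OF x(1), of l] by simp
        next
          fix k assume k: "k \<in> Hom C x B" "u = Comp C x B c b k"
          then have "Comp C x B ?Q j k = Comp C x X ?Q f g" using \<eta>b[OF x(1) k(1)] x(4) by simp
          then obtain l where "l \<in> Hom C x B'" "Comp C x B' X j' l = g" by (rule is_pullback_lift[OF B' x(1) k(1) x(3)])
          then show ?thesis using VB[OF x(1), of l] by simp
        qed
        have "?h x g = u" using m\<eta>[OF x(1,2)] x(1,4) gV by simp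
        then show "\<exists>q\<in>fobj N.U x. ?h x q = u \<and> incl C (fobj N.U) x q = g"
          using gV incl_apply[where V = "fobj N.U", OF x(1) gV] by blast
      qed
      \<comment> \<open>Arrows from \<open>A'\<close> and \<open>B'\<close> that agree on their
        intersection \<open>P'\<close> glue to a transformation from the union to the representable
        of \<open>t\<close>, which factors uniquely through the reflection \<open>X\<close>.\<close>
      have "\<exists>!k. k \<in> Hom C X t \<and> Comp C A' X t k i' = r1 \<and> Comp C B' X t k j' = r2"
        if t: "t \<in> Obj C" and r1: "r1 \<in> Hom C A' t" and r2: "r2 \<in> Hom C B' t" and rr: "Comp C P' A' t r1 p' = Comp C P' B' t r2 q'" for t r1 r2
      proof -
        have "\<exists>\<gamma>\<in>pnat C N.U (representable C t). (\<forall>x\<in>Obj C. \<forall>y\<in>fobj (representable C A') x. \<gamma> x (yoneda_arr C A' X i' x y) = yoneda_arr C A' t r1 x y) \<and>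
            (\<forall>x\<in>Obj C. \<forall>y\<in>fobj (representable C B') x. \<gamma> x (yoneda_arr C B' X j' x y) = yoneda_arr C B' t r2 x y)"
        proof (rule N.U_glue[OF yoneda_arr_in[OF r1 A1(1) t] yoneda_arr_in[OF r2 B1(1) t]])
          fix x y z assume x: "x \<in> Obj C" "y \<in> fobj (representable C A') x" "z \<in> fobj (representable C B') x" "yoneda_arr C A' X i' x y = yoneda_arr C B' X j' x z"
          then have y: "y \<in> Hom C x A'" "z \<in> Hom C x B'" "Comp C x A' X i' y = Comp C x B' X j' z" by simp_all
          obtain l where l: "l \<in> Hom C x P'" "Comp C x P' A' p' l = y" "Comp C x P' B' q' l = z"
            by (rule is_pullback_lift[OF PX x(1) y])
          show "yoneda_arr C A' t r1 x y = yoneda_arr C B' t r2 x z"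
            using slide[OF rr l(1) p'(1) r1 q'(1) r2 x(1) is_pullbackD(1)[OF P'] A1(1) B1(1) t] l x(1) y by simp
        qed
        then obtain \<gamma> where \<gamma>: "\<gamma> \<in> pnat C N.U (representable C t)"
          "\<And>x y. \<lbrakk>x \<in> Obj C; y \<in> Hom C x A'\<rbrakk> \<Longrightarrow> \<gamma> x (Comp C x A' X i' y) = Comp C x A' t r1 y"
          "\<And>x y. \<lbrakk>x \<in> Obj C; y \<in> Hom C x B'\<rbrakk> \<Longrightarrow> \<gamma> x (Comp C x B' X j' y) = Comp C x B' t r2 y" by auto
        note k = S.mediator[OF r t \<gamma>(1)]
        let ?k = "S.mediator N.U X (incl C (fobj N.U)) t \<gamma>"
        have k2: "Comp C x X t ?k g = \<gamma> x g" if "x \<in> Obj C" "g \<in> fobj N.U x" for x g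
          using k(2)[OF that] incl_apply[where V = "fobj N.U", OF that] by simp
        have ki: "Comp C A' X t ?k i' = r1" using k2[OF A1(1) VA[OF A1(1) id_in[OF A1(1)]]] \<gamma>(2)[OF A1(1) id_in[OF A1(1)]] r1 A1 X t by simp
        have kj: "Comp C B' X t ?k j' = r2" using k2[OF B1(1) VB[OF B1(1) id_in[OF B1(1)]]] \<gamma>(3)[OF B1(1) id_in[OF B1(1)]] r2 B1 X t by simp
        show ?thesis
        proof (rule ex1I[of _ ?k])
          show "?k \<in> Hom C X t \<and> Comp C A' X t ?k i' = r1 \<and> Comp C B' X t ?k j' = r2" using k(1) ki kj by blast
          fix l assume l: "l \<in> Hom C X t \<and> Comp C A' X t l i' = r1 \<and> Comp C B' X t l j' = r2"
          show "l = ?k"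
          proof (rule S.reflection_ext[OF r t _ k(1) N.presheaf_U])
            show "l \<in> Hom C X t" using l by blast
            fix x g assume x: "x \<in> Obj C" "g \<in> fobj N.U x"
            from x(2) have "Comp C x X t l g = Comp C x X t ?k g"
            proof (cases rule: N.U_cases)
              case (1 y)
              then have y: "y \<in> Hom C x A'" "g = Comp C x A' X i' y" using x(1) by simp_all
              show ?thesis
                using slide1[OF ki y(1) A1(6) k(1) x(1) A1(1) X(1) t] slide1[OF conjunct1[OF conjunct2[OF l]] y(1) A1(6) conjunct1[OF l] x(1) A1(1) X(1) t] y(2) by simp
            next
              case (2 y)
              then have y: "y \<in> Hom C x B'" "g = Comp C x B' X j' y" using x(1) by simp_all
              show ?thesis
                using slide1[OF kj y(1) B1(6) k(1) x(1) B1(1) X(1) t] slide1[OF conjunct2[OF conjunct2[OF l]] y(1) B1(6) conjunct1[OF l] x(1) B1(1) X(1) t] y(2) by simp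
            qed
            then show "Comp C x X t l (incl C (fobj N.U) x g) = Comp C x X t ?k (incl C (fobj N.U) x g)"
              using incl_apply[where V = "fobj N.U", OF x] by simp
          qed
        qed
      qed
      then show ?thesis unfolding is_pushout_iff using is_pullbackD[OF PX] by blast
    qed
    have po: "is_pushout C P A B ?Q p q i j"
    proof (rule key[OF Q id_in[OF Q] is_pullback_id[OF i o(1) Q] is_pullback_id[OF j o(2) Q] is_pullback_id[OF _ P1(1) Q]])
      show "Comp C P A ?Q i p \<in> Hom C P ?Q" "p \<in> Hom C P A" "q \<in> Hom C P B" using i P1 Q by simp_all
      show "Comp C P A A (Id C A) p = Comp C P P A p (Id C P)" "Comp C P B B (Id C B) q = Comp C P P B q (Id C P)" using P1 by simp_all
      show "Comp C P B ?Q j q = Comp C P A ?Q i p" using is_pullbackD(9)[OF PQ] by simp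
    qed simp
    show "\<exists>Q i j. is_stable_pushout C P A B Q p q i j"
      by (intro exI, rule is_stable_pushoutI[OF po]) (rule key)
  qed
  ultimately show ?thesis by blast
qed

theorem proposition5p5:
  fixes C :: "('o, 'u) cat"
  assumes "universe TYPE('u)"
    and "locally_small C"
    and "finitely_complete C"
  shows "(lex_exact Phi_vee C \<longleftrightarrow>
            (\<exists>z. is_strict_initial C z) \<and> has_stable_pushouts_of_pullbacks_of_monos C) \<and>
         ((\<exists>z. is_strict_initial C z) \<and> has_stable_pushouts_of_pullbacks_of_monos C \<longleftrightarrow>
            has_finite_unions C \<and> finite_unions_effective C \<and> finite_unions_stable C)"
proof -
  have c: "category C" using assms(2) unfolding locally_small_def by blast
  interpret universe_cat C using c assms by unfold_locales
  interpret finlim_cat C using c assms(3) by unfold_locales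
  have "lex_exact Phi_vee C"
    if "(\<exists>z. is_strict_initial C z) \<and> has_stable_pushouts_of_pullbacks_of_monos C"
  proof -
    interpret stable_universe_cat C using that by unfold_locales auto
    show ?thesis by (rule lex_exact_Phi_vee)
  qed
  then show ?thesis using exact_imp_stable_pushouts stable_pushouts_iff_unions by blast
qed

end
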